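(* Let $A,B\in\mathbb{Z}$ satisfy $-1\leq A\leq B$, $B\geq 2$ and $2A<B+3$, and let $T$ be the tile defined below. Then: (1) if $A\in\{-1,0,1\}$ and $B\geq 2$, or if $A=2$ and $B=2$, then $T$ is disk-like; (2) if $A\geq 2$ and $B\geq 3$, then $T$ is not disk-like.
   Context: Let $a(x,y)=(x+1,y)$ and $c(x,y)=(-x,-y)$. Let $g(\mathbf{x})=\begin{pmatrix}0&-B\\1&-A\end{pmatrix}\mathbf{x}+\left(\frac{B-1}{2},0\right)^T$, $\mathcal{D}=\{id,a,\dots,a^{B-2},c\}$ if $B\geq3$ and $\mathcal{D}=\{id,c\}$ if $B=2$, and let $T$ be the unique nonempty compact set with $g(T)=\bigcup_{\delta\in\mathcal{D}}\delta(T)$. Disk-like means homeomorphic to a closed disk. *)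

theory Defs
  imports "HOL-Analysis.Analysis"
begin

text \<open>Points of the plane are pairs of reals; the Euclidean norm on real \<times> real
  makes cball 0 1 the closed unit disk.\<close>

definition tr_a :: "real \<times> real \<Rightarrow> real \<times> real" where
  "tr_a p = (fst p + 1, snd p)"

definition rot_c :: "real \<times> real \<Rightarrow> real \<times> real" where
  "rot_c p = (- fst p, - snd p)"

text \<open>g(x) = M x + ((B-1)/2, 0) with M = [[0,-B],[1,-A]].\<close>
definition gmap :: "int \<Rightarrow> int \<Rightarrow> real \<times> real \<Rightarrow> real \<times> real" where
  "gmap A B p = (- of_int B * snd p + (of_int B - 1) / 2, fst p - of_int A * snd p)"

definition digits :: "int \<Rightarrow> (real \<times> real \<Rightarrow> real \<times> real) set" where
  "digits B = (if B \<ge> 3 then {tr_a ^^ k | k. k \<le> nat (B - 2)} \<union> {rot_c}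
               else {id, rot_c})"

definition tile :: "int \<Rightarrow> int \<Rightarrow> (real \<times> real) set" where
  "tile A B = (THE T. compact T \<and> T \<noteq> {} \<and>
                  gmap A B ` T = (\<Union>\<delta>\<in>digits B. \<delta> ` T))"

definition disk_like :: "(real \<times> real) set \<Rightarrow> bool" where
  "disk_like S \<longleftrightarrow> S homeomorphic cball (0 :: real \<times> real) 1"

end

theory Submission
  imports Defs "HOL-Complex_Analysis.Complex_Analysis"
begin

text \<open>
  The set \<open>S = T \<union> - T\<close> is a self-affine tile for the lattice \<open>\<int>\<^sup>2\<close>. A bound on integer recurrences determines which
  translates of \<open>S\<close> meet \<open>S\<close>, and from this all intersections among the lattice translates of \<open>T\<close> and \<open>- T\<close> can be
  computed through the map \<open>g\<close>.

  If \<open>A \<ge> 2\<close> and \<open>B \<ge> 3\<close>, then \<open>T \<inter> ((1, 0) - T)\<close> falls into two separated pieces. Were \<open>T\<close> a disk, the complement of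
  \<open>T \<union> ((1, 0) - T)\<close> would be connected, because the remaining tiles are disks linked to one another outside these two;
  by Janiszewski's theorem the intersection would then be connected.

  In the disk-like cases the intersections with neighbouring tiles, and \<open>T \<inter> - T\<close> itself, are chains of contracted
  copies of one another, hence arcs. They close up to a Jordan curve \<open>J \<subseteq> T\<close> with \<open>T - J\<close> open, so \<open>T\<close> is \<open>J\<close> together
  with its inside. That such a set is a closed disk is the theorem of Schoenflies, obtained here from the Riemann
  mapping theorem by extending the Riemann map to the boundary.
\<close>

section \<open>Boundary extension of the Riemann map\<close>

text \<open>Digit 0 and the half-turn together send \<open>T\<close> onto \<open>S\<close>, so
  \<open>g x\<close> in \<open>S\<close> acts as one digit of \<open>T\<close> beside 1, ..., B - 2;
  every contact between tiles then reduces to arithmetic with digits. For B = 2 no other digit is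
  left and g maps T homeomorphically onto S, which is why (2, 2) is disk-like although A = 2. The
  hypothesis 2A < B + 3 enters through the heights of neighbouring lattice vectors: maximal height 2
  or more is then impossible except for (A, B) = (2, 2) and (3, 4), and these fail one step later.
  Two places where measure theory is customary use other means. Distinct tiles share no open set
  because points with a single address are dense. The Riemann map has unique boundary limits, and is
  not constant on boundary arcs, by the maximum principle for h/(z - p)^n with a pole p just
  outside, instead of a length-area estimate. The matrix need not expand Euclidean lengths, so
  contraction is always measured in an adapted gauge N.\<close>

lemma fashoda_complex:
  fixes f g :: "real \<Rightarrow> complex"
  assumes "path f" "path g"
    and box: "\<And>z. z \<in> path_image f \<union> path_image g \<Longrightarrow> x0 \<le> Re z \<and> Re z \<le> x1 \<and> y0 \<le> Im z \<and> Im z \<le> y1"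
    and "Re (pathstart f) = x0" "Re (pathfinish f) = x1"
    and "Im (pathstart g) = y0" "Im (pathfinish g) = y1"
  shows "path_image f \<inter> path_image g \<noteq> {}"
proof -
  define V :: "complex \<Rightarrow> real^2" where "V = (\<lambda>z. vector [Re z, Im z])"
  have V1: "V z $ 1 = Re z" and V2: "V z $ 2 = Im z" for z by (simp_all add: V_def)
  have inj: "V z = V z' \<Longrightarrow> z = z'" for z z' by (metis V1 V2 complex_eqI)
  have "continuous_on UNIV (\<lambda>z. V z $ i)" for i
    using exhaust_2[of i] by (auto simp: V1 V2 intro!: linear_continuous_on bounded_linear_Re bounded_linear_Im)
  then have "continuous_on UNIV (\<lambda>z. \<chi> i. V z $ i)" by (rule continuous_on_vec_lambda)
  then have cont: "continuous_on A V" for A using continuous_on_subset[of UNIV V A] by simp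
  obtain z where z: "z \<in> path_image (V \<circ> f)" "z \<in> path_image (V \<circ> g)"
  proof (rule fashoda[of "V \<circ> f" "V \<circ> g" "vector [x0,y0]" "vector [x1,y1]"])
    show "path (V \<circ> f)" "path (V \<circ> g)" using assms cont by (auto intro: path_continuous_image)
    show "path_image (V \<circ> f) \<subseteq> cbox (vector [x0,y0]) (vector [x1,y1])"
         "path_image (V \<circ> g) \<subseteq> cbox (vector [x0,y0]) (vector [x1,y1])"
      using box by (auto simp: path_image_compose mem_box_cart forall_2 V1 V2)
  qed (use assms in \<open>auto simp: pathstart_def pathfinish_def V1 V2\<close>)
  then show ?thesis by (auto simp: path_image_compose dest!: inj)
qed

text \<open>Local connectedness of the inside up to its boundary, needed to join two points near w
  by a path that stays near w. Janiszewski's theorem splits the task into two connections, one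
  avoiding the curve and one avoiding a barrier around w.\<close>

lemma Jordan_inside_locally_connected:
  fixes c :: "real \<Rightarrow> complex"
  assumes c: "simple_path c" "pathfinish c = pathstart c" and w: "w \<in> path_image c" and e: "0 < e"
  obtains d where "0 < d"
    "\<And>z z'. z \<in> inside (path_image c) \<inter> ball w d \<Longrightarrow> z' \<in> inside (path_image c) \<inter> ball w d
       \<Longrightarrow> connected_component (inside (path_image c) \<inter> ball w e) z z'"
proof -
  define J where "J = path_image c"
  obtain t0 where t0: "t0 \<in> {0..1}" "w = c t0" using w by (auto simp: path_image_def)
  define k where "k = shiftpath t0 c"
  have k: "simple_path k" "path_image k = J" "k 0 = w" "k 1 = w"
    using t0 c simple_path_shiftpath[of c t0] path_image_shiftpath[of t0 c]
    by (simp_all add: k_def J_def) (auto simp: shiftpath_def pathstart_def pathfinish_def)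
  have pk: "continuous_on {0..1} k" using k(1) by (simp add: simple_path_def path_def)
  have "\<exists>\<eta>>0. \<forall>t\<in>{0..1}. dist t 0 < \<eta> \<longrightarrow> dist (k t) (k 0) < e"
    by (rule pk[unfolded continuous_on_iff, rule_format, OF _ e]) simp
  then obtain \<eta>1 where h1: "\<eta>1 > 0" "\<And>t. t \<in> {0..1} \<Longrightarrow> dist t 0 < \<eta>1 \<Longrightarrow> dist (k t) w < e"
    using k by auto
  have "\<exists>\<eta>>0. \<forall>t\<in>{0..1}. dist t 1 < \<eta> \<longrightarrow> dist (k t) (k 1) < e"
    by (rule pk[unfolded continuous_on_iff, rule_format, OF _ e]) simp
  then obtain \<eta>2 where h2: "\<eta>2 > 0" "\<And>t. t \<in> {0..1} \<Longrightarrow> dist t 1 < \<eta>2 \<Longrightarrow> dist (k t) w < e"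
    using k by auto
  define \<eta> where "\<eta> = min (1/4) (min \<eta>1 \<eta>2)"
  have eta: "0 < \<eta>" "\<eta> \<le> 1/4" "\<eta> \<le> \<eta>1" "\<eta> \<le> \<eta>2" using h1 h2 by (auto simp: \<eta>_def)
  \<comment> \<open>Cutting out the parameters near w at both ends leaves one connected arc: what is
    removed lies in \<open>ball w e\<close>, and what remains is compact and misses w.\<close>
  define J' where "J' = k ` {\<eta>..1-\<eta>}"
  have ck: "continuous_on {\<eta>..1-\<eta>} k" using pk by (rule continuous_on_subset) (use eta in auto)
  have J': "compact J'" "connected J'" unfolding J'_def
    using ck by (auto intro: compact_continuous_image connected_continuous_image)
  have sub: "J' \<subseteq> J" unfolding J'_def k(2)[symmetric] path_image_def using eta by auto
  have wJ': "w \<notin> J'"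
  proof
    assume "w \<in> J'"
    then obtain t where t: "t \<in> {\<eta>..1-\<eta>}" "k t = k 0" using k by (auto simp: J'_def)
    then show False using k(1) eta by (force simp: simple_path_def loop_free_def)
  qed
  have near: "J - J' \<subseteq> ball w e"
  proof
    fix x assume "x \<in> J - J'"
    then obtain t where t: "t \<in> {0..1}" "x = k t" "t \<notin> {\<eta>..1-\<eta>}" using k(2) unfolding path_image_def J'_def by blast
    then consider "t < \<eta>" | "t > 1-\<eta>" by force
    then show "x \<in> ball w e"
    proof cases
      case 1 then show ?thesis using h1(2)[of t] t eta by (auto simp: dist_commute)
    next
      case 2 then show ?thesis using h2(2)[of t] t eta by (auto simp: dist_commute dist_real_def)
    qed
  qed
  have "w \<in> - J'" "open (- J')" using wJ' J'(1) by (auto simp: compact_imp_closed)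
  then obtain d0 where d0: "d0 > 0" "ball w d0 \<subseteq> - J'" by (meson open_contains_ball)
  define d where "d = min d0 e"
  have d: "d > 0" "d \<le> d0" "d \<le> e" using d0 e by (auto simp: d_def)
  note JI = Jordan_inside_outside[OF c, folded J_def]
  show thesis
  proof (rule that[OF d(1)])
    fix z z' assume z: "z \<in> inside (path_image c) \<inter> ball w d" and z': "z' \<in> inside (path_image c) \<inter> ball w d"
    \<comment> \<open>The part of J outside \<open>ball w e\<close> belongs to J', so adding J' to
      the sphere makes the intersection with J exactly J', which is connected as Janiszewski's
      theorem demands.\<close>
    define Y where "Y = sphere w e \<union> J'"
    have "J \<inter> Y = J'" using sub near by (auto simp: Y_def)
    have "connected_component (- (J \<union> Y)) z z'"
    proof (rule Janiszewski)
      show "compact J" unfolding J_def using c(1) by (simp add: compact_path_image simple_path_imp_path)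
      show "closed Y" unfolding Y_def by (intro closed_Un closed_sphere compact_imp_closed J')
      show "connected (J \<inter> Y)" using \<open>J \<inter> Y = J'\<close> J' by simp
      show "connected_component (- J) z z'"
        unfolding connected_component_def
      proof (rule exI[of _ "inside J"], intro conjI)
        show "inside J \<subseteq> - J" using JI by blast
      qed (use JI z z' in \<open>auto simp: J_def\<close>)
      show "connected_component (- Y) z z'"
        unfolding connected_component_def
        by (rule exI[of _ "ball w d"]) (use d d0 z z' in \<open>auto simp: Y_def subset_iff\<close>)
    qed
    then obtain C where C: "connected C" "C \<subseteq> - (J \<union> Y)" "z \<in> C" "z' \<in> C"
      by (auto simp: connected_component_def)
    have "C \<subseteq> inside J"
    proof -
      have "connected C" "C \<subseteq> inside J \<union> outside J" "inside J \<inter> outside J \<inter> C = {}" using C JI by auto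
      moreover have "z \<in> inside J \<inter> C" using C(3) z by (simp add: J_def)
      ultimately have "outside J \<inter> C = {}" using JI connectedD[OF C(1), of "inside J" "outside J"] by blast
      then show ?thesis using \<open>C \<subseteq> inside J \<union> outside J\<close> by blast
    qed
    moreover have "C \<subseteq> ball w e"
    proof -
      have cov: "C \<subseteq> ball w e \<union> - cball w e" using C by (auto simp: Y_def)
      have "z \<in> ball w e \<inter> C" using C z d by auto
      then have "ball w e \<inter> C \<noteq> {}" by blast
      then have "- cball w e \<inter> C = {}"
        using connectedD[OF C(1), of "ball w e" "- cball w e"] cov by fastforce
      then show ?thesis using cov by blast
    qed
    ultimately show "connected_component (inside (path_image c) \<inter> ball w e) z z'"
      unfolding connected_component_def using C by (auto simp: J_def)
  qed
qed

text \<open>Dividing h by (z - p)^n with p = 1 + c/4 weighs the boundary by its distance to p: at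
  least 3c/4 on the circle of radius c about 1, at least c/4 on the crossing, exactly c/2 at 1 -
  c/4. This gives the bound (2/3)^n M + 2^n \<epsilon>, which vanishes when first \<epsilon> tends
  to 0 and then n to infinity.\<close>

lemma holomorphic_zero_behind_crossings:
  fixes h :: "complex \<Rightarrow> complex"
  assumes hol: "h holomorphic_on ball 0 1" and M: "\<And>z. z \<in> ball 0 1 \<Longrightarrow> norm (h z) \<le> M"
    and c: "0 < c" "c < 1"
    and cross: "\<And>\<epsilon>. 0 < \<epsilon> \<Longrightarrow> \<exists>\<gamma>. path \<gamma> \<and> path_image \<gamma> \<subseteq> ball 0 1 - cball 0 (1-\<epsilon>) \<and>
        Im (pathstart \<gamma>) = -c \<and> Im (pathfinish \<gamma>) = c \<and>
        (\<forall>z\<in>path_image \<gamma>. \<bar>Im z\<bar> \<le> c \<and> 0 < Re z \<and> norm (h z) \<le> \<epsilon>)"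
  shows "h (of_real (1 - c/4)) = 0"
proof -
  define w1 :: complex where "w1 = of_real (1 - c/4)"
  define p :: complex where "p = of_real (1 + c/4)"
  have M0: "0 \<le> M" using M[of 0] norm_ge_zero order_trans by (metis centre_in_ball zero_less_one)
  \<comment> \<open>The two bounds on \<epsilon> have separate purposes: \<epsilon> \<le> c (1 - c)
    forces the crossing into Re z \<ge> 1 - c, and \<epsilon> < c/4 keeps its modulus above that of
    \<open>w1\<close>.\<close>
  have main: "norm (h w1) \<le> (2/3)^n * M + 2^n * \<epsilon>" if eps: "0 < \<epsilon>" "\<epsilon> \<le> c * (1-c)" "\<epsilon> < c/4" for n \<epsilon>
  proof -
    obtain \<gamma> where g: "path \<gamma>" "path_image \<gamma> \<subseteq> ball 0 1 - cball 0 (1-\<epsilon>)"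
      "Im (pathstart \<gamma>) = -c" "Im (pathfinish \<gamma>) = c"
      and g': "\<And>z. z\<in>path_image \<gamma> \<Longrightarrow> \<bar>Im z\<bar> \<le> c \<and> 0 < Re z \<and> norm (h z) \<le> \<epsilon>"
      using cross[OF eps(1)] by blast
    have gre: "1 - c \<le> Re z" if z: "z \<in> path_image \<gamma>" for z
    proof (rule ccontr)
      assume "\<not> 1 - c \<le> Re z"
      then have "(Re z)^2 \<le> (1-c)^2" using g'[OF z] by (intro power_mono) auto
      moreover have "(Im z)^2 \<le> c^2" using g'[OF z] abs_le_square_iff[of "Im z" c] c by simp
      ultimately have "(norm z)^2 \<le> (1-c)^2 + c^2" by (simp add: cmod_power2)
      also have "\<dots> = 1 - 2 * (c*(1-c))" by (simp add: power2_eq_square algebra_simps)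
      also have "\<dots> \<le> 1 - 2 * \<epsilon>" using eps by simp
      also have "\<dots> \<le> (1-\<epsilon>)^2" using zero_le_power2[of \<epsilon>] by (simp add: power2_eq_square algebra_simps)
      finally have "norm z \<le> 1 - \<epsilon>" using eps c by (intro power2_le_imp_le[of "norm z" "1-\<epsilon>"]) auto
      then show False using z g(2) by auto
    qed
    define O' where "O' = ball 1 c \<inter> ball 0 1 - path_image \<gamma>"
    have oO: "open O'" unfolding O'_def using g(1) by (intro open_Diff open_Int) (auto intro: closed_path_image)
    have w1O: "w1 \<in> O'"
    proof -
      have "w1 \<notin> path_image \<gamma>"
      proof
        assume "w1 \<in> path_image \<gamma>"
        then have "norm w1 > 1 - \<epsilon>" using g(2) by auto
        then show False using eps c by (simp add: w1_def norm_of_real del: of_real_diff)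
      qed
      moreover have "1 - w1 = of_real (c/4)" by (simp add: w1_def)
      then have "norm (1 - w1) = c/4" using c by (simp only: norm_of_real; simp)
      moreover have "norm w1 = 1 - c/4" using c by (simp only: w1_def norm_of_real; simp)
      ultimately show ?thesis using c by (auto simp: O'_def dist_norm)
    qed
    define U where "U = connected_component_set O' w1"
    have oU: "open U" unfolding U_def using oO by (rule open_connected_component)
    have UO: "U \<subseteq> O'" unfolding U_def by (rule connected_component_subset)
    have w1U: "w1 \<in> U" unfolding U_def using w1O by simp
    obtain R where R: "R < 1" "\<And>z. z \<in> path_image \<gamma> \<Longrightarrow> norm z \<le> R"
    proof -
      have "compact (norm ` path_image \<gamma>)" using g(1)
        by (intro compact_continuous_image compact_path_image continuous_intros)
      moreover have "norm ` path_image \<gamma> \<noteq> {}" by simp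
      ultimately obtain m where "m \<in> norm ` path_image \<gamma>" "\<forall>t\<in>norm ` path_image \<gamma>. t \<le> m"
        using compact_attains_sup by blast
      then show thesis using that[of m] g(2) by auto
    qed
    \<comment> \<open>If the component escaped beyond the crossing, it could be prolonged to a path
      from left to right through the rectangle of width c and height 2c, and such a path must meet
      the crossing from bottom to top.\<close>
    have UR: "U \<subseteq> cball 0 R"
    proof (rule ccontr)
      assume "\<not> U \<subseteq> cball 0 R"
      then obtain y where y: "y \<in> U" "norm y > R" by force
      have "path_connected U" using oU connected_open_path_connected unfolding U_def by blast
      then obtain \<sigma> where s: "path \<sigma>" "path_image \<sigma> \<subseteq> U" "pathstart \<sigma> = w1" "pathfinish \<sigma> = y"
        using w1U y(1) unfolding path_connected_def by blast
      define y1 where "y1 = Complex 1 (Im y)"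
      define P where "P = linepath (of_real (1-c)) w1 +++ \<sigma> +++ linepath y y1"
      have inb: "1-c \<le> Re z \<and> Re z \<le> 1 \<and> -c \<le> Im z \<and> Im z \<le> c" if "z \<in> U" for z
      proof -
        have z: "norm (1 - z) < c" "norm z < 1" using that UO by (auto simp: O'_def dist_norm)
        then show ?thesis using abs_Re_le_cmod[of "1-z"] abs_Im_le_cmod[of "1-z"] complex_Re_le_cmod[of z] by auto
      qed
      have seg1: "Im z = 0 \<and> 1-c \<le> Re z \<and> Re z \<le> 1-c/4" if "z \<in> closed_segment (of_real (1-c)) w1" for z
        using that c unfolding w1_def closed_segment_of_real
        by (auto simp: closed_segment_eq_real_ivl simp del: of_real_diff split: if_splits)
      have seg2: "Im z = Im y \<and> Re y \<le> Re z \<and> Re z \<le> 1" if zs: "z \<in> closed_segment y y1" for z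
      proof -
        obtain u where u: "0 \<le> u" "u \<le> 1" "z = (1-u) *\<^sub>R y + u *\<^sub>R y1" using zs by (auto simp: in_segment)
        have "Re y \<le> 1" using inb y by auto
        then have "0 \<le> u * (1 - Re y)" "0 \<le> (1-u) * (1 - Re y)" using u by auto
        moreover have "Re z = (1-u) * Re y + u" "Im z = Im y" by (simp_all add: u(3) y1_def algebra_simps)
        ultimately show ?thesis by (auto simp: algebra_simps)
      qed
      have pim: "path_image P = closed_segment (of_real (1-c)) w1 \<union> path_image \<sigma> \<union> closed_segment y y1"
        using s by (simp add: P_def path_image_join Un_assoc)
      have "path_image P \<inter> path_image \<gamma> \<noteq> {}"
      proof (rule fashoda_complex[where ?x0.0="1-c" and ?x1.0=1 and ?y0.0="-c" and ?y1.0=c])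
        show "path P" using s by (simp add: P_def)
        show "Re (pathstart P) = 1-c" "Re (pathfinish P) = 1" by (simp_all add: P_def y1_def)
        fix z assume "z \<in> path_image P \<union> path_image \<gamma>"
        then consider "z \<in> closed_segment (of_real (1-c)) w1" | "z \<in> U" | "z \<in> closed_segment y y1" | "z \<in> path_image \<gamma>"
          using pim s by auto
        then show "1-c \<le> Re z \<and> Re z \<le> 1 \<and> -c \<le> Im z \<and> Im z \<le> c"
        proof cases
          case 1 then show ?thesis using seg1[of z] c by auto
        next
          case 2 then show ?thesis using inb by auto
        next
          case 3 then show ?thesis using seg2[of z] inb[OF y(1)] by auto
        next
          case 4
          have "norm z < 1" using 4 g(2) by auto
          then have "Re z \<le> 1" using complex_Re_le_cmod[of z] by linarith
          then show ?thesis using gre[OF 4] g'[OF 4] by auto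
        qed
      qed (use g in auto)
      then obtain z where z: "z \<in> path_image P" "z \<in> path_image \<gamma>" by auto
      have nz: "1 - \<epsilon> < norm z" "norm z \<le> R" using z g(2) R by auto
      from z(1) pim consider "z \<in> closed_segment (of_real (1-c)) w1" | "z \<in> path_image \<sigma>" | "z \<in> closed_segment y y1"
        by auto
      then show False
      proof cases
        case 1
        then have "Im z = 0" "0 \<le> Re z" "Re z \<le> 1 - c/4" using seg1[OF 1] c by auto
        then have "norm z \<le> 1-c/4" by (simp add: cmod_def)
        then show False using nz eps by auto
      next
        case 2 then show False using s UO z by (auto simp: O'_def)
      next
        case 3
        then have i: "Im z = Im y" "Re y \<le> Re z" "0 \<le> Re y" using seg2[OF 3] inb[OF y(1)] c by auto
        have "norm y \<le> norm z" unfolding cmod_def i using i by (intro real_sqrt_le_mono add_mono power_mono order_refl) auto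
        then show False using nz y by auto
      qed
    qed
    have clU: "closure U \<subseteq> cball 0 R" using UR by (simp add: closure_minimal)
    have fr: "z \<in> path_image \<gamma> \<or> dist 1 z = c" if z: "z \<in> frontier U" for z
    proof -
      have zc: "z \<in> closure U" using z by (simp add: frontier_def)
      have "z \<in> frontier O'" using z frontier_of_connected_component_subset unfolding U_def by blast
      then have "z \<notin> O'" using oO by (simp add: frontier_def interior_open)
      moreover have "norm z < 1" using zc clU R(1) by auto
      moreover have "closure U \<subseteq> cball 1 c"
        by (rule closure_minimal) (use UO in \<open>auto simp: O'_def\<close>)
      then have "dist 1 z \<le> c" using zc by auto
      ultimately show ?thesis by (auto simp: O'_def)
    qed
    have pz: "z \<noteq> p" if "norm z < 1" for z
      using that c by (auto simp: p_def norm_of_real simp del: of_real_add)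
    define k where "k = (\<lambda>z. h z / (z - p)^n)"
    have cl1: "closure U \<subseteq> ball 0 1" using clU R(1) by auto
    have holk: "k holomorphic_on ball 0 1" unfolding k_def
      using pz by (intro holomorphic_intros hol) auto
    have "norm (k w1) \<le> \<epsilon> / (c/4)^n + M / (3*c/4)^n"
    proof (rule maximum_modulus_frontier[where S=U and f=k and \<xi>=w1])
      show "k holomorphic_on interior U" using holk cl1 closure_subset interior_subset
        by (meson holomorphic_on_subset subset_trans)
      show "continuous_on (closure U) k" using holk cl1 holomorphic_on_imp_continuous_on continuous_on_subset by blast
      show "bounded U" using UR bounded_subset bounded_cball by blast
      show "w1 \<in> U" by (rule w1U)
      fix z assume z: "z \<in> frontier U"
      have z1: "norm z < 1" using z cl1 by (auto simp: frontier_def)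
      from fr[OF z] show "norm (k z) \<le> \<epsilon> / (c/4)^n + M / (3*c/4)^n"
      proof
        assume zg: "z \<in> path_image \<gamma>"
        have "c/4 \<le> norm (p - z)" using z1 norm_triangle_ineq2[of p z] c
          by (simp add: p_def norm_of_real del: of_real_add)
        then have "(c/4)^n \<le> norm (z-p)^n" using c by (intro power_mono) (auto simp: norm_minus_commute)
        then have "norm (k z) \<le> \<epsilon> / (c/4)^n" unfolding k_def norm_divide norm_power
          using g'[OF zg] c eps by (intro frac_le) auto
        also have "\<dots> \<le> \<epsilon> / (c/4)^n + M / (3*c/4)^n" using M0 c by simp
        finally show ?thesis .
      next
        assume d: "dist 1 z = c"
        have "norm (z - p) \<ge> norm (z - 1) - norm (p - 1)" using norm_triangle_ineq2[of "z-1" "p-1"] by simp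
        moreover have "norm (p - 1) = c/4" using c by (simp add: p_def)
        ultimately have "3*c/4 \<le> norm (z-p)" using d by (simp add: dist_norm norm_minus_commute)
        then have "(3*c/4)^n \<le> norm (z-p)^n" using c by (intro power_mono) auto
        then have "norm (k z) \<le> M / (3*c/4)^n" unfolding k_def norm_divide norm_power
          using M[of z] z1 c M0 by (intro frac_le) auto
        also have "\<dots> \<le> \<epsilon> / (c/4)^n + M / (3*c/4)^n" using eps c by simp
        finally show ?thesis .
      qed
    qed
    moreover have "norm (k w1) = norm (h w1) / (c/2)^n"
    proof -
      have "w1 - p = of_real (- (c/2))" by (simp add: w1_def p_def)
      then have "norm (w1-p) = c/2" using c by (simp only: norm_of_real; simp)
      then show ?thesis by (simp only: k_def norm_divide norm_power)
    qed
    ultimately have "norm (h w1) \<le> (\<epsilon> / (c/4)^n + M / (3*c/4)^n) * (c/2)^n"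
      using c by (simp add: pos_divide_le_eq)
    also have "\<dots> = \<epsilon> / (c/4)^n * (c/2)^n + M / (3*c/4)^n * (c/2)^n" by (rule distrib_right)
    also have "\<epsilon> / (c/4)^n * (c/2)^n = 2^n * \<epsilon>"
    proof -
      have "(c/2)^n = 2^n * (c/4)^n" by (simp flip: power_mult_distrib)
      then show ?thesis using c by simp
    qed
    also have "M / (3*c/4)^n * (c/2)^n = (2/3)^n * M"
    proof -
      have "(c/2)^n = (2/3)^n * (3*c/4)^n" by (simp flip: power_mult_distrib)
      then have "M / (3*c/4)^n * (c/2)^n = M * (2/3)^n * ((3*c/4)^n / (3*c/4)^n)" by simp
      also have "(3*c/4)^n / (3*c/4)^n = 1" using c by simp
      finally show ?thesis by simp
    qed
    also have "2^n * \<epsilon> + (2/3)^n * M = (2/3)^n * M + 2^n * \<epsilon>" by simp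
    finally show ?thesis .
  qed
  have "norm (h w1) \<le> (2/3)^n * M" for n
  proof (rule field_le_epsilon)
    fix e :: real assume e: "0 < e"
    define \<epsilon> where "\<epsilon> = min (e / 2^n) (min (c*(1-c)) (c/8))"
    have "0 < \<epsilon>" "\<epsilon> \<le> c*(1-c)" "\<epsilon> < c/4" "\<epsilon> \<le> e / 2^n" using c e by (auto simp: \<epsilon>_def min_less_iff_disj)
    moreover from this have "2^n * \<epsilon> \<le> e" by (simp add: field_simps)
    ultimately show "norm (h w1) \<le> (2/3)^n * M + e" using main[of \<epsilon> n] by linarith
  qed
  moreover have "(\<lambda>n. (2/3)^n * M) \<longlonglongrightarrow> 0 * M"
    by (intro tendsto_mult LIMSEQ_realpow_zero tendsto_const) auto
  ultimately have "norm (h w1) \<le> 0 * M" by (meson LIMSEQ_le_const)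
  then show ?thesis by (simp add: w1_def)
qed

text \<open>Stop when the height c is reached for the first time and start at the last earlier time
  of height -c; by the intermediate value theorem the path cannot leave the strip in
  between.\<close>

lemma crossing_subpath:
  fixes \<sigma> :: "real \<Rightarrow> complex"
  assumes \<sigma>: "path \<sigma>" and c: "0 < c" and ends: "Im (pathstart \<sigma>) < -c" "c < Im (pathfinish \<sigma>)"
  obtains \<gamma> where "path \<gamma>" "path_image \<gamma> \<subseteq> path_image \<sigma>" "Im (pathstart \<gamma>) = -c" "Im (pathfinish \<gamma>) = c"
    "\<And>z. z \<in> path_image \<gamma> \<Longrightarrow> \<bar>Im z\<bar> \<le> c"
proof -
  define u where "u = (\<lambda>t. Im (\<sigma> t))"
  have cu: "continuous_on {0..1} u" unfolding u_def using \<sigma> by (auto simp: path_def intro!: continuous_intros)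
  have cu': "continuous_on {a..b} u" if "0 \<le> a" "b \<le> 1" for a b
    using cu by (rule continuous_on_subset) (use that in auto)
  have u01: "u 0 < -c" "c < u 1" using ends by (auto simp: u_def pathstart_def pathfinish_def)
  define A where "A = {t\<in>{0..1}. u t = c}"
  have "compact A" unfolding A_def
    using continuous_closed_preimage_constant[OF cu, of c] by (auto simp: compact_eq_bounded_closed intro: bounded_subset[of "{0..1::real}"])
  moreover have "A \<noteq> {}" using IVT'[of u 0 c 1] u01 c cu by (auto simp: A_def)
  ultimately obtain t where t: "t \<in> A" "\<And>x. x \<in> A \<Longrightarrow> t \<le> x" using compact_attains_inf by metis
  have t': "0 \<le> t" "t \<le> 1" "u t = c" using t by (auto simp: A_def)
  define A' where "A' = {x\<in>{0..t}. u x = -c}"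
  have "compact A'" unfolding A'_def
    using continuous_closed_preimage_constant[OF cu', of 0 t "-c"] t' by (auto simp: compact_eq_bounded_closed intro: bounded_subset[of "{0..1::real}"])
  moreover have "A' \<noteq> {}" using IVT'[of u 0 "-c" t] u01 c cu'[of 0 t] t' by (auto simp: A'_def)
  ultimately obtain s where s: "s \<in> A'" "\<And>x. x \<in> A' \<Longrightarrow> x \<le> s" using compact_attains_sup by metis
  have s': "0 \<le> s" "s \<le> t" "u s = -c" using s by (auto simp: A'_def)
  have upper: "u x \<le> c" if x: "s \<le> x" "x \<le> t" for x
  proof (rule ccontr)
    assume n: "\<not> u x \<le> c"
    have "\<exists>y\<ge>0. y \<le> x \<and> u y = c" using n u01 c x s' t' by (intro IVT' cu') auto
    then obtain y where y: "0 \<le> y" "y \<le> x" "u y = c" by auto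
    then have "t \<le> y" using t(2)[of y] x t' by (auto simp: A_def)
    then have "x = t" using x y by auto
    then show False using n t' by auto
  qed
  have lower: "- c \<le> u x" if x: "s \<le> x" "x \<le> t" for x
  proof (rule ccontr)
    assume n: "\<not> - c \<le> u x"
    have "\<exists>y\<ge>x. y \<le> t \<and> u y = -c" using n c x s' t' by (intro IVT' cu') auto
    then obtain y where y: "x \<le> y" "y \<le> t" "u y = -c" by auto
    then have "y \<le> s" using s(2)[of y] x s' t' by (auto simp: A'_def)
    then have "x = s" using x y by auto
    then show False using n s' by auto
  qed
  define \<gamma> where "\<gamma> = subpath s t \<sigma>"
  have im: "path_image \<gamma> = \<sigma> ` {s..t}" using s' unfolding \<gamma>_def by (simp add: path_image_subpath)
  show thesis
  proof (rule that[of \<gamma>])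
    show "path \<gamma>" unfolding \<gamma>_def using \<sigma> s' t' by (intro path_subpath) auto
    show "path_image \<gamma> \<subseteq> path_image \<sigma>" using im s' t' by (auto simp: path_image_def)
    show "Im (pathstart \<gamma>) = -c" "Im (pathfinish \<gamma>) = c"
      using s' t' by (auto simp: \<gamma>_def u_def)
    show "\<And>z. z \<in> path_image \<gamma> \<Longrightarrow> \<bar>Im z\<bar> \<le> c"
      using im upper lower by (force simp: u_def abs_le_iff)
  qed
qed

lemma connected_sign:
  fixes u :: "'a::topological_space \<Rightarrow> real"
  assumes "connected C" "continuous_on C u" "\<And>z. z \<in> C \<Longrightarrow> u z \<noteq> 0"
  shows "(\<forall>z\<in>C. 0 < u z) \<or> (\<forall>z\<in>C. u z < 0)"
proof (rule ccontr)
  assume "\<not> ?thesis"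
  then obtain a b where "a \<in> C" "u a < 0" "b \<in> C" "0 < u b" using assms(3) by (meson linorder_neqE_linordered_idom)
  moreover have "connected (u ` C)" using assms by (intro connected_continuous_image)
  ultimately have "0 \<in> u ` C" by (meson connectedD_interval imageI less_imp_le)
  then show False using assms(3) by auto
qed

locale Jordan_domain_map =
  fixes c :: "real \<Rightarrow> complex" and \<Omega> J :: "complex set" and f \<phi> :: "complex \<Rightarrow> complex"
  assumes c: "simple_path c" "pathfinish c = pathstart c"
    and J: "J = path_image c" and \<Omega>: "\<Omega> = inside J"
    and holf: "f holomorphic_on \<Omega>" and holp: "\<phi> holomorphic_on ball 0 1"
    and fp: "\<And>z. z \<in> \<Omega> \<Longrightarrow> f z \<in> ball 0 1 \<and> \<phi> (f z) = z"
    and pf: "\<And>z. z \<in> ball 0 1 \<Longrightarrow> \<phi> z \<in> \<Omega> \<and> f (\<phi> z) = z"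
begin

lemma Om: "open \<Omega>" "connected \<Omega>" "bounded \<Omega>" "frontier \<Omega> = J" "closure \<Omega> = \<Omega> \<union> J" "\<Omega> \<inter> J = {}"
  using Jordan_inside_outside[OF c] closure_Un_frontier[of \<Omega>] inside_no_overlap[of J] by (auto simp: J \<Omega>)

lemma f_cont: "continuous_on \<Omega> f" and p_cont: "continuous_on (ball 0 1) \<phi>"
  using holf holp holomorphic_on_imp_continuous_on by auto

text \<open>A limit \<zeta> inside the disk would be sent by \<phi> to w, but w lies on the boundary
  and is no value of \<phi>.\<close>

lemma boundary_limit:
  assumes z: "\<And>n::nat. z n \<in> \<Omega>" and w: "z \<longlonglongrightarrow> w" "w \<in> J" and l: "(\<lambda>n. f (z n)) \<longlonglongrightarrow> \<zeta>"
  shows "norm \<zeta> = 1"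
proof -
  have "norm \<zeta> \<le> 1"
  proof (rule LIMSEQ_le_const2[OF tendsto_norm[OF l]])
    show "\<exists>N. \<forall>n\<ge>N. norm (f (z n)) \<le> 1" using fp z by (auto intro: less_imp_le)
  qed
  moreover have "\<not> norm \<zeta> < 1"
  proof
    assume "norm \<zeta> < 1"
    then have b: "\<zeta> \<in> ball 0 1" by simp
    have "(\<lambda>n. \<phi> (f (z n))) \<longlonglongrightarrow> \<phi> \<zeta>"
      by (rule continuous_on_tendsto_compose[OF p_cont l b]) (use fp z in auto)
    then have "z \<longlonglongrightarrow> \<phi> \<zeta>" using fp z by simp
    then have "w = \<phi> \<zeta>" using w LIMSEQ_unique by blast
    then show False using pf[OF b] w Om by auto
  qed
  ultimately show ?thesis by auto
qed

text \<open>If there were two limits, paths shrinking to w would have images crossing a fixed strip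
  ever closer to the unit circle. On these crossings \<phi> - w is small, so \<phi> - w vanishes at
  an inner point, although w is no value of \<phi>.\<close>

lemma boundary_limit_unique:
  assumes z: "\<And>n::nat. z n \<in> \<Omega>" "\<And>n. z' n \<in> \<Omega>" and w: "z \<longlonglongrightarrow> w" "z' \<longlonglongrightarrow> w" "w \<in> J"
    and l: "(\<lambda>n. f (z n)) \<longlonglongrightarrow> \<zeta>" "(\<lambda>n. f (z' n)) \<longlonglongrightarrow> \<zeta>'"
  shows "\<zeta> = \<zeta>'"
proof (rule ccontr)
  assume ne: "\<zeta> \<noteq> \<zeta>'"
  have n1: "norm \<zeta> = 1" "norm \<zeta>' = 1" using boundary_limit assms by blast+
  define d where "d = norm (\<zeta>' - \<zeta>)"
  have d: "0 < d" "d \<le> 2" using ne n1 norm_triangle_ineq4[of \<zeta>' \<zeta>] by (auto simp: d_def)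
  \<comment> \<open>Rotation by \<rho> makes the chord from \<zeta> to \<zeta>' vertical. Since both
    ends lie on the unit circle, their heights become -d/2 and d/2.\<close>
  define \<rho> where "\<rho> = \<i> * cnj (\<zeta>' - \<zeta>) / d"
  have r1: "norm \<rho> = 1" using d by (simp add: \<rho>_def norm_mult norm_divide d_def del: complex_cnj_diff)
  have "\<rho> * (\<zeta>' - \<zeta>) = \<i> * d"
  proof -
    have "cnj (\<zeta>' - \<zeta>) * (\<zeta>' - \<zeta>) = of_real (d^2)"
      unfolding d_def by (metis complex_norm_square mult.commute of_real_power)
    moreover have "\<rho> * (\<zeta>' - \<zeta>) = \<i> * (cnj (\<zeta>' - \<zeta>) * (\<zeta>' - \<zeta>)) / d"
      unfolding \<rho>_def by (simp only: times_divide_eq_left mult.assoc)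
    ultimately have "\<rho> * (\<zeta>' - \<zeta>) = \<i> * of_real (d^2) / d" by (simp only:)
    then show ?thesis using d by (simp add: power2_eq_square)
  qed
  then have diff: "Re (\<rho> * \<zeta>') = Re (\<rho> * \<zeta>)" "Im (\<rho> * \<zeta>') = Im (\<rho> * \<zeta>) + d"
    by (auto simp: algebra_simps complex_eq_iff)
  have sq: "(Re (\<rho>*\<zeta>))^2 + (Im (\<rho>*\<zeta>))^2 = 1" "(Re (\<rho>*\<zeta>'))^2 + (Im (\<rho>*\<zeta>'))^2 = 1"
    using n1 r1 by (simp_all add: norm_mult del: times_complex.simps flip: cmod_power2)
  have "(Im (\<rho>*\<zeta>))^2 = (Im (\<rho> * \<zeta>) + d)^2" using sq diff by simp
  then have "d * (2 * Im (\<rho>*\<zeta>) + d) = 0" by (simp add: power2_eq_square algebra_simps)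
  then have im: "Im (\<rho>*\<zeta>) = -(d/2)" "Im (\<rho>*\<zeta>') = d/2" using d diff by auto
  \<comment> \<open>With d \<le> 2 this gives k < 1, and k < d/2 makes late terms of the two
    sequences start below and end above the strip of height k.\<close>
  define k where "k = d/4"
  have k: "0 < k" "k < 1" "k < d/2" using d by (auto simp: k_def)
  define cross where "cross = (\<lambda>s \<epsilon> \<gamma>. path \<gamma> \<and> path_image \<gamma> \<subseteq> ball 0 1 - cball 0 (1-\<epsilon>) \<and>
        Im (pathstart \<gamma>) = -k \<and> Im (pathfinish \<gamma>) = k \<and>
        (\<forall>z\<in>path_image \<gamma>. \<bar>Im z\<bar> \<le> k \<and> 0 < Re z \<and> norm (\<phi> (z / (s * \<rho>)) - w) \<le> \<epsilon>))"
  have ex: "\<exists>s \<in> {1,-1::complex}. \<exists>\<gamma>. cross s \<epsilon> \<gamma>" if e: "0 < \<epsilon>" "\<epsilon> < 1 - k" for \<epsilon>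
  proof -
    have "compact (\<phi> ` cball 0 (1-\<epsilon>))"
      by (intro compact_continuous_image continuous_on_subset[OF p_cont]) (use e in auto)
    then have "open (- \<phi> ` cball 0 (1-\<epsilon>))" by (intro open_Compl compact_imp_closed)
    moreover have "w \<in> - \<phi> ` cball 0 (1-\<epsilon>)"
    proof
      assume "w \<in> \<phi> ` cball 0 (1-\<epsilon>)"
      then obtain y where "y \<in> cball 0 (1-\<epsilon>)" "w = \<phi> y" by blast
      then have "w \<in> \<Omega>" using pf[of y] e by simp
      then show False using w(3) Om(6) by blast
    qed
    ultimately obtain \<delta>0 where d0: "\<delta>0 > 0" "ball w \<delta>0 \<subseteq> - \<phi> ` cball 0 (1-\<epsilon>)"
      using open_contains_ball by metis
    define \<delta> where "\<delta> = min \<delta>0 \<epsilon>"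
    have "\<delta> > 0" using d0 e by (simp add: \<delta>_def)
    obtain \<eta> where eta: "0 < \<eta>" "\<And>z z'. z \<in> \<Omega> \<inter> ball w \<eta> \<Longrightarrow> z' \<in> \<Omega> \<inter> ball w \<eta> \<Longrightarrow> connected_component (\<Omega> \<inter> ball w \<delta>) z z'"
    proof -
      have "w \<in> path_image c" using w(3) J by simp
      from Jordan_inside_locally_connected[OF c this \<open>\<delta> > 0\<close>] that show thesis unfolding \<Omega> J by blast
    qed
    have "\<forall>\<^sub>F n in sequentially. dist (z n) w < \<eta>" "\<forall>\<^sub>F n in sequentially. dist (z' n) w < \<eta>"
      using w eta by (auto simp: tendsto_iff)
    moreover have "(\<lambda>n. Im (\<rho> * f (z n))) \<longlonglongrightarrow> -(d/2)" "(\<lambda>n. Im (\<rho> * f (z' n))) \<longlonglongrightarrow> d/2"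
      using tendsto_Im[OF tendsto_mult[OF tendsto_const[of \<rho>] l(1)]] tendsto_Im[OF tendsto_mult[OF tendsto_const[of \<rho>] l(2)]] im
      by (auto simp del: times_complex.simps)
    then have "\<forall>\<^sub>F n in sequentially. Im (\<rho> * f (z n)) < -k" "\<forall>\<^sub>F n in sequentially. k < Im (\<rho> * f (z' n))"
      using k by (auto intro!: order_tendstoD)
    ultimately have "\<forall>\<^sub>F n in sequentially. dist (z n) w < \<eta> \<and> dist (z' n) w < \<eta> \<and> Im (\<rho> * f (z n)) < -k \<and> k < Im (\<rho> * f (z' n))"
      by (auto simp: eventually_conj_iff)
    then obtain n where n: "dist (z n) w < \<eta>" "dist (z' n) w < \<eta>" "Im (\<rho> * f (z n)) < -k" "k < Im (\<rho> * f (z' n))"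
      using eventually_happens'[OF sequentially_bot] by blast
    have "connected_component (\<Omega> \<inter> ball w \<delta>) (z n) (z' n)"
      using eta(2) z n by (auto simp: dist_commute)
    then have "path_component (\<Omega> \<inter> ball w \<delta>) (z n) (z' n)"
      using open_path_connected_component[OF open_Int[OF Om(1) open_ball]] by simp
    then obtain p where p: "path p" "path_image p \<subseteq> \<Omega> \<inter> ball w \<delta>" "pathstart p = z n" "pathfinish p = z' n"
      by (auto simp: path_component_def)
    define \<sigma> where "\<sigma> = (\<lambda>x. \<rho> * f x) \<circ> p"
    have sig: "path \<sigma>" unfolding \<sigma>_def
      using p by (intro path_continuous_image continuous_intros continuous_on_subset[OF f_cont]) auto
    obtain \<gamma> where g: "path \<gamma>" "path_image \<gamma> \<subseteq> path_image \<sigma>" "Im (pathstart \<gamma>) = -k" "Im (pathfinish \<gamma>) = k"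
        "\<And>z. z \<in> path_image \<gamma> \<Longrightarrow> \<bar>Im z\<bar> \<le> k"
    proof (rule crossing_subpath[OF sig k(1)])
      show "Im (pathstart \<sigma>) < - k" "k < Im (pathfinish \<sigma>)" using n p by (auto simp: \<sigma>_def pathstart_def pathfinish_def)
    qed blast
    have gz: "norm y < 1 \<and> \<not> norm y \<le> 1-\<epsilon> \<and> norm (\<phi> (y / \<rho>) - w) \<le> \<epsilon>" if y: "y \<in> path_image \<gamma>" for y
    proof -
      obtain x where x: "x \<in> \<Omega>" "dist w x < \<delta>" "y = \<rho> * f x"
        using y g(2) p(2) by (force simp: \<sigma>_def path_image_compose)
      have ny: "norm y = norm (f x)" using r1 x by (simp add: norm_mult)
      have "y / \<rho> = f x" using x r1 by auto
      then have p: "\<phi> (y/\<rho>) = x" using fp x by auto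
      have "\<not> norm (f x) \<le> 1-\<epsilon>"
      proof
        assume "norm (f x) \<le> 1-\<epsilon>"
        then have "x \<in> \<phi> ` cball 0 (1-\<epsilon>)" using fp[OF x(1)] by (intro image_eqI[of _ _ "f x"]) auto
        then show False using d0 x by (auto simp: \<delta>_def subset_iff)
      qed
      then show ?thesis using ny fp[OF x(1)] p x by (auto simp: \<delta>_def dist_norm norm_minus_commute)
    qed
    \<comment> \<open>A point of modulus above 1 - \<epsilon> > k and height at most k cannot have
      real part 0, so each crossing stays in one half plane.\<close>
    have "(\<forall>y\<in>path_image \<gamma>. 0 < Re y) \<or> (\<forall>y\<in>path_image \<gamma>. Re y < 0)"
    proof (rule connected_sign)
      show "connected (path_image \<gamma>)" using g(1) by (rule connected_path_image)
      show "continuous_on (path_image \<gamma>) Re" by (intro linear_continuous_on bounded_linear_Re)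
      fix y assume y: "y \<in> path_image \<gamma>"
      show "Re y \<noteq> 0"
      proof
        assume "Re y = 0"
        then have "norm y = \<bar>Im y\<bar>" by (simp add: cmod_def)
        then show False using gz[OF y] g(5)[OF y] e by auto
      qed
    qed
    then show ?thesis
    proof
      assume "\<forall>y\<in>path_image \<gamma>. 0 < Re y"
      then have "cross 1 \<epsilon> \<gamma>" unfolding cross_def using g gz by auto
      then show ?thesis by blast
    next
      assume neg: "\<forall>y\<in>path_image \<gamma>. Re y < 0"
      define \<gamma>' where "\<gamma>' = reversepath (uminus \<circ> \<gamma>)"
      have im: "path_image \<gamma>' = uminus ` path_image \<gamma>" by (simp add: \<gamma>'_def path_image_compose)
      have "path \<gamma>'" unfolding \<gamma>'_def using g(1)
        by (simp only: path_reversepath, intro path_continuous_image continuous_intros)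
      moreover have "Im (pathstart \<gamma>') = -k" "Im (pathfinish \<gamma>') = k"
        using g by (auto simp: \<gamma>'_def pathstart_def pathfinish_def reversepath_def)
      ultimately have "cross (-1) \<epsilon> \<gamma>'" unfolding cross_def using gz g(5) neg by (auto simp: im)
      then show ?thesis by blast
    qed
  qed
  have mono: "cross s \<epsilon>' \<gamma>" if "cross s \<epsilon> \<gamma>" "\<epsilon> \<le> \<epsilon>'" for s \<epsilon> \<epsilon>' \<gamma>
    using that unfolding cross_def by fastforce
  \<comment> \<open>The half plane may depend on \<epsilon>, but a crossing for a small \<epsilon>
    also serves every larger one, so one of the two half planes works for all \<epsilon>.\<close>
  have "\<exists>s \<in> {1,-1::complex}. \<forall>\<epsilon>>0. \<exists>\<gamma>. cross s \<epsilon> \<gamma>"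
  proof (rule ccontr)
    assume "\<not> ?thesis"
    then obtain e1 e2 where e: "e1 > 0" "e2 > 0" "\<not> (\<exists>\<gamma>. cross 1 e1 \<gamma>)" "\<not> (\<exists>\<gamma>. cross (-1) e2 \<gamma>)" by auto
    define \<epsilon> where "\<epsilon> = min (min e1 e2) ((1-k)/2)"
    have "0 < \<epsilon>" "\<epsilon> < 1-k" "\<epsilon> \<le> e1" "\<epsilon> \<le> e2" using e k by (auto simp: \<epsilon>_def min_less_iff_disj)
    then show False using ex[of \<epsilon>] mono e by blast
  qed
  then obtain s :: complex where s: "s = 1 \<or> s = -1" "\<And>\<epsilon>. \<epsilon> > 0 \<Longrightarrow> \<exists>\<gamma>. cross s \<epsilon> \<gamma>" by blast
  have sr: "norm (s * \<rho>) = 1" using s(1) r1 by (auto simp: norm_mult)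
  define h where "h = (\<lambda>z. \<phi> (z / (s*\<rho>)) - w)"
  have im: "z / (s*\<rho>) \<in> ball 0 1" if "z \<in> ball 0 1" for z using that sr by (simp add: norm_divide)
  obtain M where M: "\<And>x. x \<in> \<Omega> \<Longrightarrow> norm x \<le> M" using Om(3) by (auto simp: bounded_iff)
  have "h (of_real (1 - k/4)) = 0"
  proof (rule holomorphic_zero_behind_crossings)
    show "h holomorphic_on ball 0 1" unfolding h_def
    proof (intro holomorphic_on_diff holomorphic_on_const)
      have "(\<lambda>z. z / (s*\<rho>)) holomorphic_on ball 0 1" using sr by (intro holomorphic_intros) auto
      moreover have "(\<lambda>z. z / (s*\<rho>)) ` ball 0 1 \<subseteq> ball 0 1" using im by blast
      ultimately show "(\<lambda>z. \<phi> (z / (s*\<rho>))) holomorphic_on ball 0 1"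
        using holomorphic_on_compose_gen[OF _ holp, of "\<lambda>z. z / (s*\<rho>)" "ball 0 1"] by (simp only: o_def)
    qed
    show "norm (h z) \<le> M + norm w" if "z \<in> ball 0 1" for z
      using M pf im[OF that] norm_triangle_ineq4[of "\<phi> (z / (s*\<rho>))" w] unfolding h_def by (smt (verit, best))
    show "0 < k" "k < 1" using k by auto
    show "\<exists>\<gamma>. path \<gamma> \<and> path_image \<gamma> \<subseteq> ball 0 1 - cball 0 (1-\<epsilon>) \<and>
        Im (pathstart \<gamma>) = -k \<and> Im (pathfinish \<gamma>) = k \<and>
        (\<forall>z\<in>path_image \<gamma>. \<bar>Im z\<bar> \<le> k \<and> 0 < Re z \<and> norm (h z) \<le> \<epsilon>)" if "0 < \<epsilon>" for \<epsilon>
      using s(2)[OF that] unfolding cross_def h_def by blast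
  qed
  then have "\<phi> (of_real (1-k/4) / (s*\<rho>)) = w" by (simp add: h_def)
  moreover have "(of_real (1-k/4) :: complex) \<in> ball 0 1" using k by (simp add: norm_of_real del: of_real_diff)
  ultimately show False using im pf w(3) Om by (metis disjoint_iff)
qed

text \<open>By compactness a failure yields two sequences with the same limit whose images have
  different limits. In the interior this contradicts continuity, on the boundary
  \<open>boundary_limit_unique\<close>.\<close>

lemma f_uniformly_continuous: "uniformly_continuous_on \<Omega> f"
proof (rule ccontr)
  assume "\<not> uniformly_continuous_on \<Omega> f"
  then obtain e where e: "e > 0" "\<forall>d>0. \<exists>x\<in>\<Omega>. \<exists>x'\<in>\<Omega>. dist x' x < d \<and> \<not> dist (f x') (f x) < e"
    unfolding uniformly_continuous_on_def by blast
  have "\<forall>n::nat. \<exists>x x'. x\<in>\<Omega> \<and> x'\<in>\<Omega> \<and> dist x' x < inverse (real (Suc n)) \<and> \<not> dist (f x') (f x) < e"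
  proof
    fix n :: nat
    show "\<exists>x x'. x\<in>\<Omega> \<and> x'\<in>\<Omega> \<and> dist x' x < inverse (real (Suc n)) \<and> \<not> dist (f x') (f x) < e"
      using e(2)[rule_format, of "inverse (real (Suc n))"] by auto
  qed
  then obtain x x' where x: "\<And>n. x n \<in> \<Omega>" "\<And>n. x' n \<in> \<Omega>" "\<And>n::nat. dist (x' n) (x n) < inverse (real (Suc n))" "\<And>n. \<not> dist (f (x' n)) (f (x n)) < e"
    by metis
  have comp: "compact (closure \<Omega> \<times> (cball (0::complex) 1 \<times> cball (0::complex) 1))"
    using Om(3) by (intro compact_Times compact_cball) (auto simp: compact_closure)
  define X where "X = (\<lambda>n. (x n, f (x n), f (x' n)))"
  have "\<forall>n. X n \<in> closure \<Omega> \<times> (cball 0 1 \<times> cball 0 1)"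
    using x(1,2) fp subsetD[OF closure_subset[of \<Omega>]] by (auto simp: X_def less_imp_le)
  then obtain l r where lr: "strict_mono (r::nat\<Rightarrow>nat)" "(X \<circ> r) \<longlonglongrightarrow> l" "l \<in> closure \<Omega> \<times> (cball 0 1 \<times> cball 0 1)"
    using comp by (meson compact_def)
  obtain w \<zeta> \<zeta>' where l: "l = (w, \<zeta>, \<zeta>')" by (metis prod.exhaust)
  have L: "(\<lambda>n. x (r n)) \<longlonglongrightarrow> w" "(\<lambda>n. f (x (r n))) \<longlonglongrightarrow> \<zeta>" "(\<lambda>n. f (x' (r n))) \<longlonglongrightarrow> \<zeta>'"
    using tendsto_fst[OF lr(2)] tendsto_fst[OF tendsto_snd[OF lr(2)]] tendsto_snd[OF tendsto_snd[OF lr(2)]]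
    by (auto simp: X_def l o_def)
  have "(\<lambda>n. dist (x' (r n)) (x (r n))) \<longlonglongrightarrow> 0"
  proof (rule Lim_null_comparison)
    show "\<forall>\<^sub>F n in sequentially. norm (dist (x' (r n)) (x (r n))) \<le> inverse (real (Suc (r n)))"
      using x(3) by (auto intro!: always_eventually less_imp_le)
    show "(\<lambda>n. inverse (real (Suc (r n)))) \<longlonglongrightarrow> 0"
      using LIMSEQ_subseq_LIMSEQ[OF LIMSEQ_inverse_real_of_nat lr(1)] by (simp add: o_def)
  qed
  then have L': "(\<lambda>n. x' (r n)) \<longlonglongrightarrow> w" 
  proof -
    assume "(\<lambda>n. dist (x' (r n)) (x (r n))) \<longlonglongrightarrow> 0"
    then have "(\<lambda>n. x' (r n) - x (r n)) \<longlonglongrightarrow> 0" unfolding dist_norm by (rule tendsto_norm_zero_cancel)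
    from tendsto_add[OF this L(1)] show ?thesis by simp
  qed
  have "dist \<zeta>' \<zeta> \<ge> e"
  proof (rule LIMSEQ_le_const[OF tendsto_dist[OF L(3) L(2)]])
    show "\<exists>N. \<forall>n\<ge>N. e \<le> dist (f (x' (r n))) (f (x (r n)))" using x(4) by (auto simp: not_less)
  qed
  then have ne: "\<zeta> \<noteq> \<zeta>'" using e by auto
  have "w \<in> \<Omega> \<union> J" using lr(3) Om(5) by (auto simp: l)
  then show False
  proof
    assume "w \<in> J" then show False using boundary_limit_unique[OF _ _ L(1) L' _ L(2,3)] x ne by blast
  next
    assume wO: "w \<in> \<Omega>"
    have "(\<lambda>n. f (x (r n))) \<longlonglongrightarrow> f w" "(\<lambda>n. f (x' (r n))) \<longlonglongrightarrow> f w"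
      using continuous_on_tendsto_compose[OF f_cont L(1) wO] continuous_on_tendsto_compose[OF f_cont L' wO] x by auto
    then show False using L ne LIMSEQ_unique by metis
  qed
qed

end

section \<open>Injectivity of the extended Riemann map\<close>

context Jordan_domain_map
begin

context
  fixes F
  assumes F: "continuous_on (closure \<Omega>) F" and Ff: "\<And>z. z \<in> \<Omega> \<Longrightarrow> F z = f z"
begin

lemma ext_cball: "z \<in> closure \<Omega> \<Longrightarrow> norm (F z) \<le> 1"
proof -
  have "F ` \<Omega> \<subseteq> cball 0 1" using fp Ff by (auto simp: less_imp_le)
  from image_closure_subset[OF F closed_cball this] show "z \<in> closure \<Omega> \<Longrightarrow> norm (F z) \<le> 1" by auto
qed

lemma ext_boundary:
  assumes "w \<in> J" shows "norm (F w) = 1"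
proof -
  have wc: "w \<in> closure \<Omega>" using assms Om(5) by blast
  then obtain z where z: "\<And>n. z n \<in> \<Omega>" "z \<longlonglongrightarrow> w" by (auto simp: closure_sequential)
  have "(\<lambda>n. F (z n)) \<longlonglongrightarrow> F w"
    using continuous_on_tendsto_compose[OF F z(2) wc] z(1) closure_subset by (auto intro!: always_eventually)
  then have "(\<lambda>n. f (z n)) \<longlonglongrightarrow> F w" using Ff z(1) by simp
  then show ?thesis using boundary_limit[OF z(1) z(2) assms] by blast
qed

text \<open>The pole argument again, with p on the outer side close to w0. The difference F -
  \<zeta> vanishes on the nearby part of J, the rest of the frontier keeps distance 3r/4 from p, and
  w1 is within r/2 of p. Letting n grow forces f w1 = \<zeta>, a value of modulus 1.\<close>

lemma ext_not_locally_constant: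
  assumes w0: "w0 \<in> J" and r: "0 < r" and const: "\<And>z. z \<in> J \<Longrightarrow> dist w0 z \<le> r \<Longrightarrow> F z = \<zeta>"
  shows False
proof -
  have "norm \<zeta> = 1" using ext_boundary[OF w0] const[OF w0] r by simp
  have "w0 \<in> closure \<Omega>" using w0 Om(5) by blast
  then obtain w1 where w1: "w1 \<in> \<Omega>" "dist w1 w0 < r/4" using r by (metis closure_approachable divide_pos_pos zero_less_numeral)
  have "w0 \<in> closure (outside J)" using w0 Jordan_inside_outside[OF c] by (auto simp: J frontier_def)
  then obtain p where p: "p \<in> outside J" "dist p w0 < r/4" using r by (metis closure_approachable divide_pos_pos zero_less_numeral)
  have pcl: "p \<notin> closure \<Omega>" 
  proof -
    have "inside J \<inter> outside J = {}" "inside J \<union> outside J = - J" using Jordan_inside_outside[OF c] unfolding J by blast+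
    then show ?thesis using p(1) unfolding Om(5) unfolding \<Omega> by blast
  qed
  have w1p: "norm (w1 - p) \<le> r/2" using w1 p dist_triangle_half_l[of w1 w0 "r/2" p] by (auto simp: dist_norm)
  define U where "U = \<Omega> \<inter> ball w0 r"
  have oU: "open U" using Om(1) by (auto simp: U_def)
  have cU: "closure U \<subseteq> closure \<Omega>" "closure U \<subseteq> cball w0 r"
  proof -
    show "closure U \<subseteq> closure \<Omega>" by (rule closure_mono) (simp add: U_def)
    show "closure U \<subseteq> cball w0 r" by (rule closure_minimal) (auto simp: U_def)
  qed
  have bd: "norm (f w1 - \<zeta>) \<le> 2 * (2/3)^n" for n
  proof -
    define k where "k = (\<lambda>z. (F z - \<zeta>) / (z - p)^n)"
    have "norm (k w1) \<le> 2 / (3*r/4)^n"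
    proof (rule maximum_modulus_frontier[where S=U and f=k and \<xi>=w1])
      have "f holomorphic_on U" using holf by (rule holomorphic_on_subset) (auto simp: U_def)
      then have "F holomorphic_on U" by (rule holomorphic_transform) (simp add: U_def Ff)
      then show "k holomorphic_on interior U" unfolding k_def interior_open[OF oU]
        using pcl closure_subset by (intro holomorphic_intros) (auto simp: U_def)
      show "continuous_on (closure U) k" unfolding k_def
        using pcl cU(1) by (intro continuous_intros continuous_on_subset[OF F]) auto
      show "bounded U" unfolding U_def by (simp add: bounded_Int)
      show "w1 \<in> U" using w1 r by (auto simp: U_def dist_commute)
      fix z assume z: "z \<in> frontier U"
      then have zc: "z \<in> closure U" "z \<notin> U" using oU by (auto simp: frontier_def interior_open)
      have zb: "dist w0 z \<le> r" "z \<in> \<Omega> \<union> J" using zc cU Om(5) by auto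
      show "norm (k z) \<le> 2 / (3*r/4)^n"
      proof (cases "z \<in> J")
        case True
        then have "k z = 0" using const zb by (simp add: k_def)
        then show ?thesis using r by simp
      next
        case False
        then have d: "dist w0 z = r" using zb zc by (auto simp: U_def)
        have "3*r/4 \<le> norm (z - p)" using d p dist_triangle[of w0 z p] by (simp add: dist_norm norm_minus_commute)
        then have 1: "(3*r/4)^n \<le> norm (z-p)^n" using r by (intro power_mono) auto
        have "norm (F z - \<zeta>) \<le> 2" using ext_cball[of z] zc cU \<open>norm \<zeta> = 1\<close> norm_triangle_ineq4[of "F z" \<zeta>] by auto
        then show ?thesis unfolding k_def norm_divide norm_power using r 1 by (intro frac_le) auto
      qed
    qed
    moreover have "norm (f w1 - \<zeta>) / (r/2)^n \<le> norm (k w1)"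
    proof -
      have "w1 \<noteq> p" using pcl w1 closure_subset by auto
      then have "norm (w1 - p)^n > 0" by simp
      moreover have "norm (w1-p)^n \<le> (r/2)^n" using w1p by (intro power_mono) auto
      ultimately show ?thesis unfolding k_def norm_divide norm_power Ff[OF w1(1)] by (intro divide_left_mono) (use r in auto)
    qed
    ultimately have "norm (f w1 - \<zeta>) / (r/2)^n \<le> 2 / (3*r/4)^n" by linarith
    then have "norm (f w1 - \<zeta>) \<le> 2 / (3*r/4)^n * (r/2)^n" using r by (simp add: pos_divide_le_eq)
    also have "(r/2)^n = (2/3)^n * (3*r/4)^n" by (simp flip: power_mult_distrib)
    also have "2 / (3*r/4)^n * ((2/3)^n * (3*r/4)^n) = 2 * (2/3)^n * ((3*r/4)^n / (3*r/4)^n)" by simp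
    also have "(3*r/4)^n / (3*r/4)^n = 1" using r by simp
    finally show ?thesis by simp
  qed
  have "(\<lambda>n. 2 * (2/3)^n) \<longlonglongrightarrow> 2 * (0::real)"
    by (intro tendsto_mult LIMSEQ_realpow_zero tendsto_const) auto
  then have "norm (f w1 - \<zeta>) \<le> 2 * 0" using bd by (meson LIMSEQ_le_const)
  then have "f w1 = \<zeta>" by simp
  then show False using fp[OF w1(1)] \<open>norm \<zeta> = 1\<close> by auto
qed

text \<open>If F left \<zeta> on both arcs, the boundary points with F near \<zeta> would break into
  a part around w and a part around w'. A short chord of the disk near \<zeta> pulls back to a
  connected set that meets the neighbourhoods of both.\<close>

lemma ext_constant_on_arc:
  assumes F2: "F w = \<zeta>" "F w' = \<zeta>"
    and u: "arc u" "pathstart u = w" "pathfinish u = w'" and d: "arc d" "pathstart d = w'" "pathfinish d = w"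
    and ud: "path_image u \<inter> path_image d = {w,w'}" "path_image u \<union> path_image d = J"
  shows "(\<forall>x\<in>path_image u. F x = \<zeta>) \<or> (\<forall>x\<in>path_image d. F x = \<zeta>)"
proof (rule ccontr)
  assume "\<not> ?thesis"
  then obtain s t where s: "s \<in> {0..1}" "F (u s) \<noteq> \<zeta>" and t: "t \<in> {0..1}" "F (d t) \<noteq> \<zeta>"
    by (auto simp: path_image_def)
  have ends: "u 0 = w" "u 1 = w'" "d 0 = w'" "d 1 = w" using u d by (auto simp: pathstart_def pathfinish_def)
  have st: "0 < s" "s < 1" "0 < t" "t < 1" using s t ends F2 by (auto simp: less_le)
  have inju: "x = y" if "u x = u y" "x \<in> {0..1}" "y \<in> {0..1}" for x y using u(1) that by (auto simp: arc_def inj_on_def)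
  have injd: "x = y" if "d x = d y" "x \<in> {0..1}" "y \<in> {0..1}" for x y using d(1) that by (auto simp: arc_def inj_on_def)
  have cu: "continuous_on {0..1} u" "continuous_on {0..1} d" using u d by (auto simp: arc_def path_def)
  define \<eta> where "\<eta> = min (dist (F (u s)) \<zeta>) (dist (F (d t)) \<zeta>) / 2"
  have eta: "0 < \<eta>" "\<eta> < dist (F (u s)) \<zeta>" "\<eta> < dist (F (d t)) \<zeta>" 
  proof -
    have "0 < dist (F (u s)) \<zeta>" "0 < dist (F (d t)) \<zeta>" using s t by auto
    then show "0 < \<eta>" "\<eta> < dist (F (u s)) \<zeta>" "\<eta> < dist (F (d t)) \<zeta>" unfolding \<eta>_def by linarith+
  qed
  define K where "K = {z \<in> closure \<Omega>. dist (F z) \<zeta> \<le> \<eta>}"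
  have cl: "compact (closure \<Omega>)" using Om(3) by (simp add: compact_closure)
  have "closed K"
  proof -
    have "K = closure \<Omega> \<inter> F -` cball \<zeta> \<eta>" by (auto simp: K_def dist_commute)
    then show ?thesis using continuous_closed_preimage[OF F closed_closure closed_cball, of \<zeta> \<eta>] by simp
  qed
  then have cK: "compact K" using cl by (metis (no_types, lifting) K_def compact_Int_closed inf.absorb_iff2 mem_Collect_eq subsetI)
  define A1 where "A1 = K \<inter> (u ` {0..s} \<union> d ` {t..1})"
  define A2 where "A2 = K \<inter> (u ` {s..1} \<union> d ` {0..t})"
  have comp: "compact (u ` {0..s})" "compact (d ` {t..1})" "compact (u ` {s..1})" "compact (d ` {0..t})"
    using st by (auto intro!: compact_continuous_image intro: continuous_on_subset[OF cu(1)] continuous_on_subset[OF cu(2)])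
  have A: "compact A1" "compact A2" unfolding A1_def A2_def
    using comp \<open>closed K\<close> by (auto intro!: closed_Int_compact compact_Un)
  have KJ: "K \<inter> J \<subseteq> A1 \<union> A2"
  proof
    fix x assume x: "x \<in> K \<inter> J"
    then consider a where "a \<in> {0..1}" "x = u a" | a where "a \<in> {0..1}" "x = d a"
      using ud(2) by (auto simp: path_image_def)
    then show "x \<in> A1 \<union> A2"
    proof cases
      case (1 a)
      then have "a \<in> {0..s} \<or> a \<in> {s..1}" by auto
      then show ?thesis using x 1 unfolding A1_def A2_def by blast
    next
      case (2 a)
      then have "a \<in> {t..1} \<or> a \<in> {0..t}" by auto
      then show ?thesis using x 2 unfolding A1_def A2_def by blast
    qed
  qed
  have us: "u s \<notin> K" "d t \<notin> K" using eta by (auto simp: K_def)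
  have mix: False if "u a = d b" "a \<in> {0..1}" "b \<in> {0..1}" "(a < 1 \<and> b < 1) \<or> (0 < a \<and> 0 < b)" for a b
  proof -
    have "u a \<in> path_image u" "d b \<in> path_image d" using that(2,3) unfolding path_image_def by blast+
    then have "u a \<in> {w,w'}" using ud(1) that(1) by auto
    then have "(a = 0 \<and> b = 1) \<or> (a = 1 \<and> b = 0)"
      using that inju[of a 0] inju[of a 1] injd[of b 0] injd[of b 1] ends by auto
    then show False using that by auto
  qed
  have "A1 \<inter> A2 = {}"
  proof (rule ccontr)
    assume "A1 \<inter> A2 \<noteq> {}"
    then obtain x where xK: "x \<in> K" and x: "x \<in> u ` {0..s} \<union> d ` {t..1}" "x \<in> u ` {s..1} \<union> d ` {0..t}"
      by (auto simp: A1_def A2_def)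
    from x consider a b where "x = u a" "x = u b" "a \<in> {0..s}" "b \<in> {s..1}"
      | a b where "x = u a" "x = d b" "a \<in> {0..s}" "b \<in> {0..t}"
      | a b where "x = d a" "x = u b" "a \<in> {t..1}" "b \<in> {s..1}"
      | a b where "x = d a" "x = d b" "a \<in> {t..1}" "b \<in> {0..t}" by blast
    then show False
    proof cases
      case (1 a b) then have "a = s" using inju[of a b] st by auto
      then show ?thesis using 1 us xK by auto
    next
      case (2 a b) then show ?thesis using mix[of a b] st by auto
    next
      case (3 a b) then show ?thesis using mix[of b a] st by auto
    next
      case (4 a b) then have "a = t" using injd[of a b] st by auto
      then show ?thesis using 4 us xK by auto
    qed
  qed
  then obtain V1 V2 where V: "open V1" "open V2" "A1 \<subseteq> V1" "A2 \<subseteq> V2" "V1 \<inter> V2 = {}"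
    using separation_normal[of A1 A2] A compact_imp_closed by metis
  \<comment> \<open>What lies in neither neighbourhood is a compact part of \<Omega>, on which f
    keeps away from the unit circle; a chord close enough to \<zeta> therefore avoids its
    image.\<close>
  define L where "L = K - (V1 \<union> V2)"
  have cL: "compact L" unfolding L_def using cK V by (intro compact_diff) auto
  have LO: "L \<subseteq> \<Omega>" using KJ V Om(5) by (auto simp: L_def K_def)
  obtain \<rho> where rho: "\<rho> < 1" "\<And>z. z \<in> L \<Longrightarrow> norm (f z) \<le> \<rho>"
  proof (cases "L = {}")
    case True then show ?thesis using that[of 0] by auto
  next
    case False
    have "compact ((\<lambda>z. norm (f z)) ` L)"
      by (intro compact_continuous_image cL continuous_intros continuous_on_subset[OF f_cont LO])
    then obtain m where m: "m \<in> (\<lambda>z. norm (f z)) ` L" "\<forall>y\<in>(\<lambda>z. norm (f z)) ` L. y \<le> m"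
      using False compact_attains_sup by (metis image_is_empty)
    then show ?thesis using that[of m] fp LO by auto
  qed
  define \<tau> where "\<tau> = min \<eta> (1-\<rho>)"
  have tau: "0 < \<tau>" "\<tau> \<le> \<eta>" "\<tau> \<le> 1-\<rho>" using eta rho by (auto simp: \<tau>_def)
  have approach: "\<exists>z\<in>\<Omega>. z \<in> V \<and> dist (f z) \<zeta> < \<tau>" if xJ: "x \<in> J" "F x = \<zeta>" "open V" "x \<in> V" for x V
  proof -
    have xc: "x \<in> closure \<Omega>" using that Om(5) by blast
    obtain e1 where e1: "e1 > 0" "\<And>z. z \<in> closure \<Omega> \<Longrightarrow> dist z x < e1 \<Longrightarrow> dist (F z) (F x) < \<tau>"
      using F xc tau(1) unfolding continuous_on_iff by metis
    obtain e2 where e2: "e2 > 0" "ball x e2 \<subseteq> V" using xJ(3,4) by (meson openE)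
    obtain z where "z \<in> \<Omega>" "dist z x < min e1 e2" using xc e1 e2 closure_approachable[of x \<Omega>] by (metis min_less_iff_conj)
    then show ?thesis using e1(2)[of z] e2 Ff that closure_subset by (force simp: dist_commute)
  qed
  have wJ: "w \<in> J" "w' \<in> J" using ud by auto
  have wc: "w \<in> closure \<Omega>" "w' \<in> closure \<Omega>" using wJ Om(5) by auto
  have "w \<in> A1" "w' \<in> A2" using ends F2 eta st wc by (auto simp: A1_def A2_def K_def image_iff intro: bexI[of _ 0] bexI[of _ 1])
  then obtain z z' where z: "z \<in> \<Omega>" "z \<in> V1" "dist (f z) \<zeta> < \<tau>" and z': "z' \<in> \<Omega>" "z' \<in> V2" "dist (f z') \<zeta> < \<tau>"
    using approach[OF wJ(1) F2(1) V(1)] approach[OF wJ(2) F2(2) V(2)] V(3,4) by blast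
  define C where "C = \<phi> ` closed_segment (f z) (f z')"
  have seg: "closed_segment (f z) (f z') \<subseteq> ball 0 1 \<inter> ball \<zeta> \<tau>"
    using z z' fp by (intro closed_segment_subset convex_Int convex_ball) (auto simp: dist_commute)
  have conC: "connected C" unfolding C_def
    using seg by (intro connected_continuous_image continuous_on_subset[OF p_cont]) auto
  have "z \<in> C" "z' \<in> C" unfolding C_def using fp z z' by (metis ends_in_segment image_eqI)+
  moreover have "C \<subseteq> V1 \<union> V2"
  proof
    fix x assume "x \<in> C"
    then obtain y where y0: "x = \<phi> y" "y \<in> closed_segment (f z) (f z')" unfolding C_def by blast
    then have "y \<in> ball 0 1 \<inter> ball \<zeta> \<tau>" using seg by blast
    then have y: "x = \<phi> y" "y \<in> ball 0 1" "dist \<zeta> y < \<tau>" using y0 by auto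
    have x: "x \<in> \<Omega>" "f x = y" using pf[OF y(2)] y by auto
    have n1: "norm \<zeta> = 1" using ext_boundary[OF wJ(1)] F2 by simp
    have "x \<in> K" using x y Ff tau closure_subset by (auto simp: K_def dist_commute)
    moreover have "x \<notin> L"
    proof
      assume "x \<in> L"
      then have "norm y \<le> \<rho>" using rho x by auto
      moreover have "norm \<zeta> - norm y < \<tau>" using y(3) norm_triangle_ineq2[of \<zeta> y] by (simp add: dist_norm)
      ultimately show False using n1 tau by auto
    qed
    ultimately show "x \<in> V1 \<union> V2" by (auto simp: L_def)
  qed
  ultimately show False using connectedD[OF conC V(1,2)] V(5) z z' by blast
qed

lemma ext_inj: "inj_on F (closure \<Omega>)"
proof (rule inj_onI)
  fix w w' assume w: "w \<in> closure \<Omega>" "w' \<in> closure \<Omega>" "F w = F w'"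
  have inO: "norm (F x) < 1 \<and> \<phi> (F x) = x" if "x \<in> \<Omega>" for x using fp Ff that by auto
  show "w = w'"
  proof (cases "w \<in> \<Omega> \<or> w' \<in> \<Omega>")
    case True
    then show ?thesis using inO[of w] inO[of w'] ext_boundary[of w] ext_boundary[of w'] w Om(5) by (metis UnE less_irrefl)
  next
    case False
    then have wJ: "w \<in> J" "w' \<in> J" using w Om(5) by auto
    show ?thesis
    proof (rule ccontr)
      assume "w \<noteq> w'"
      obtain u d where ud: "arc u" "arc d" "pathstart u = w" "pathfinish u = w'"
                    "pathstart d = w'" "pathfinish d = w"
                    "(path_image u) \<inter> (path_image d) = {w,w'}"
                    "(path_image u) \<union> (path_image d) = J"
        using exists_double_arc[OF c, of w w'] wJ \<open>w \<noteq> w'\<close> unfolding J by metis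
      have half: False if a: "arc p" "path_image p \<inter> path_image q = {pathstart p, pathfinish p}"
          "path_image p \<union> path_image q = J" "arc q" "\<forall>x\<in>path_image p. F x = F w" for p q :: "real \<Rightarrow> complex"
      proof -
        have "p (1/2) \<noteq> p 0" "p (1/2) \<noteq> p 1" using a(1) inj_onD[of p "{0..1}" "1/2" 0] inj_onD[of p "{0..1}" "1/2" 1] by (auto simp: arc_def)
        moreover have pp: "p (1/2) \<in> path_image p" by (auto simp: path_image_def)
        ultimately have "p (1/2) \<in> - path_image q" using a(2) by (auto simp: pathstart_def pathfinish_def)
        moreover have "open (- path_image q)" using a(4) by (simp add: closed_arc_image open_Compl)
        ultimately obtain r where r: "r > 0" "ball (p (1/2)) r \<subseteq> - path_image q" by (metis openE)
        show False
        proof (rule ext_not_locally_constant[of "p (1/2)" "r/2" "F w"])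
          show "p (1/2) \<in> J" using pp a(3) by auto
          show "0 < r/2" using r by auto
          fix z assume z: "z \<in> J" "dist (p (1/2)) z \<le> r/2"
          then have "z \<in> ball (p (1/2)) r" using r by auto
          then show "F z = F w" using r z a(3,5) by blast
        qed
      qed
      have "(\<forall>x\<in>path_image u. F x = F w) \<or> (\<forall>x\<in>path_image d. F x = F w)"
        by (rule ext_constant_on_arc[of w _ w']) (use ud w in auto)
      then show False
      proof
        assume "\<forall>x\<in>path_image u. F x = F w" then show False using half[of u d] ud by auto
      next
        assume "\<forall>x\<in>path_image d. F x = F w" then show False using half[of d u] ud by auto
      qed
    qed
  qed
qed

end

lemma closed_Jordan_domain_homeomorphic: "closure \<Omega> homeomorphic cball (0::complex) 1"
proof -
  obtain F where F: "uniformly_continuous_on (closure \<Omega>) F" "\<And>x. x \<in> \<Omega> \<Longrightarrow> f x = F x"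
  proof (rule uniformly_continuous_on_extension_on_closure[OF f_uniformly_continuous])
    fix g assume "uniformly_continuous_on (closure \<Omega>) g" "\<And>x. x \<in> \<Omega> \<Longrightarrow> f x = g x"
    then show thesis by (rule that)
  qed
  have cF: "continuous_on (closure \<Omega>) F" using F(1) by (rule uniformly_continuous_imp_continuous)
  have Ff: "\<And>z. z \<in> \<Omega> \<Longrightarrow> F z = f z" using F(2) by simp
  have cl: "compact (closure \<Omega>)" using Om(3) by (simp add: compact_closure)
  have "F ` closure \<Omega> = cball 0 1"
  proof
    show "F ` closure \<Omega> \<subseteq> cball 0 1" using ext_cball[OF cF Ff] by auto
    have "ball 0 1 \<subseteq> F ` closure \<Omega>"
    proof
      fix z :: complex assume "z \<in> ball 0 1"
      then have "\<phi> z \<in> closure \<Omega>" "F (\<phi> z) = z" using pf[of z] Ff closure_subset by auto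
      then show "z \<in> F ` closure \<Omega>" by (metis image_eqI)
    qed
    moreover have "closed (F ` closure \<Omega>)" by (intro compact_imp_closed compact_continuous_image cF cl)
    ultimately have "closure (ball 0 1) \<subseteq> F ` closure \<Omega>" by (rule closure_minimal)
    then show "cball 0 1 \<subseteq> F ` closure \<Omega>" by simp
  qed
  then show ?thesis using homeomorphic_compact[OF cl cF _ ext_inj[OF cF Ff]] by blast
qed

end

theorem Jordan_curve_closed_disk:
  fixes c :: "real \<Rightarrow> complex"
  assumes c: "simple_path c" "pathfinish c = pathstart c"
  shows "(path_image c \<union> inside (path_image c)) homeomorphic cball (0::complex) 1"
proof -
  define \<Omega> where "\<Omega> = inside (path_image c)"
  note JI = Jordan_inside_outside[OF c]
  have "open \<Omega>" "simply_connected \<Omega>" "\<Omega> \<noteq> {}" "\<Omega> \<noteq> UNIV"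
    using JI simply_connected_inside_simple_path[OF c(1)] not_bounded_UNIV by (auto simp: \<Omega>_def)
  then obtain f g where fg: "f holomorphic_on \<Omega>" "g holomorphic_on ball 0 1"
      "\<And>z. z \<in> \<Omega> \<Longrightarrow> f z \<in> ball 0 1 \<and> g(f z) = z" "\<And>z. z \<in> ball 0 1 \<Longrightarrow> g z \<in> \<Omega> \<and> f(g z) = z"
    using Riemann_mapping_theorem[of \<Omega>] by blast
  interpret Jordan_domain_map c \<Omega> "path_image c" f g
    by unfold_locales (use c fg in \<open>auto simp: \<Omega>_def\<close>)
  have "closure \<Omega> = path_image c \<union> inside (path_image c)" using Om(5) unfolding \<Omega>_def by (simp only: Un_commute)
  then show ?thesis using closed_Jordan_domain_homeomorphic by (simp only:)
qed

section \<open>Arcs from chains of contractions\<close>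

text \<open>Pieces with index in \<open>I\<close> are contracted copies of K run in the same
  direction, the others are arcs already at hand. The arc is obtained as the fixed point of the
  corresponding substitution on paths, as for curves of de Rham type.\<close>

locale arc_chain =
  fixes K :: "'a::euclidean_space set" and P :: "nat \<Rightarrow> 'a set" and x :: "nat \<Rightarrow> 'a"
    and h :: "nat \<Rightarrow> 'a \<Rightarrow> 'a" and \<gamma> :: "nat \<Rightarrow> real \<Rightarrow> 'a" and I :: "nat set" and m :: nat
    and N :: "'a \<Rightarrow> real" and lam c0 c1 :: real
  assumes m: "2 \<le> m" and K: "compact K" "K \<noteq> {}" "K = (\<Union>i<m. P i)"
    and copy: "\<And>i. i < m \<Longrightarrow> i \<in> I \<Longrightarrow> P i = h i ` K \<and> h i (x 0) = x i \<and> h i (x m) = x (Suc i) \<and> inj (h i)"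
    and contr: "\<And>i p q. i < m \<Longrightarrow> i \<in> I \<Longrightarrow> N (h i p - h i q) \<le> lam * N (p - q)"
    and arcs: "\<And>i. i < m \<Longrightarrow> i \<notin> I \<Longrightarrow> arc (\<gamma> i) \<and> path_image (\<gamma> i) = P i \<and> \<gamma> i 0 = x i \<and> \<gamma> i 1 = x (Suc i)"
    and lam: "0 \<le> lam" "lam < 1" and N: "0 < c0" "0 < c1" "\<And>v. c0 * norm v \<le> N v" "\<And>v. N v \<le> c1 * norm v"
    and disj: "\<And>i j. i < m \<Longrightarrow> j < m \<Longrightarrow> Suc i < j \<Longrightarrow> P i \<inter> P j = {}"
    and adj: "\<And>i. Suc i < m \<Longrightarrow> P i \<inter> P (Suc i) \<subseteq> {x (Suc i)}"
    and ends: "\<And>i. 0 < i \<Longrightarrow> i < m \<Longrightarrow> x 0 \<notin> P i" "\<And>i. Suc i < m \<Longrightarrow> x m \<notin> P i"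
begin

definition pc where "pc i q s = (if i \<in> I then h i (q s) else \<gamma> i s)"
text \<open>Capping at m - 1 places t = 1 at the end of the last piece instead of the start of a
  further one.\<close>

definition idx where "idx t = min (m-1) (nat \<lfloor>real m * t\<rfloor>)"
definition step where "step q t = pc (idx t) q (real m * t - real (idx t))"
definition admissible where "admissible q \<longleftrightarrow> continuous_on {0..1::real} q \<and> q 0 = x 0 \<and> q 1 = x m"

lemma idx: assumes "t \<in> {0..1}" shows "idx t < m" "real m * t - real (idx t) \<in> {0..1}"
proof -
  have m0: "0 < real m" using m by simp
  have f: "0 \<le> real m * t" "real m * t \<le> real m" using assms m0 by (auto simp: mult_left_le)
  show "idx t < m" using m by (simp add: idx_def)
  show "real m * t - real (idx t) \<in> {0..1}"
  proof (cases "nat \<lfloor>real m * t\<rfloor> \<le> m - 1")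
    case True
    then have "idx t = nat \<lfloor>real m * t\<rfloor>" by (simp add: idx_def)
    then have "real (idx t) = of_int \<lfloor>real m * t\<rfloor>" using f by simp
    then show ?thesis by (auto simp: less_imp_le) linarith
  next
    case False
    then have "idx t = m-1" "\<lfloor>real m * t\<rfloor> \<ge> int m" by (auto simp: idx_def)
    then have "real m * t = real m" using f by linarith
    then show ?thesis using \<open>idx t = m-1\<close> m by (simp add: of_nat_diff)
  qed
qed

lemma arc_inj: "i < m \<Longrightarrow> i \<notin> I \<Longrightarrow> \<gamma> i s = \<gamma> i t \<Longrightarrow> s \<in> {0..1} \<Longrightarrow> t \<in> {0..1} \<Longrightarrow> s = t"
  using arcs[of i] inj_onD[of "\<gamma> i" "{0..1}" s t] by (simp add: arc_def)

lemma pc_ends: assumes "q 0 = x 0" "q 1 = x m" "i < m" shows "pc i q 0 = x i" "pc i q 1 = x (Suc i)"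
  using assms copy[of i] arcs[of i] by (auto simp: pc_def)

text \<open>At a common end of two subintervals \<open>idx\<close> selects the right one; the two
  formulas agree there because consecutive pieces share a vertex.\<close>

lemma step_piece:
  assumes q: "q 0 = x 0" "q 1 = x m" and i: "i < m" and t: "real i / m \<le> t" "t \<le> (real i + 1) / m"
  shows "step q t = pc i q (real m * t - real i)"
proof -
  have m0: "0 < real m" using m by simp
  have t': "real i \<le> real m * t" "real m * t \<le> real i + 1" using t m0 by (auto simp: field_simps)
  show ?thesis
  proof (cases "real m * t < real i + 1 \<or> Suc i = m")
    case True
    have "idx t = i"
    proof (cases "real m * t < real i + 1")
      case True
      then have "\<lfloor>real m * t\<rfloor> = int i" using t' by linarith
      then show ?thesis using i by (simp add: idx_def)
    next
      case False
      then have "real m * t = real i + 1" "Suc i = m" using t' True by auto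
      then have "\<lfloor>real m * t\<rfloor> = int i + 1" by linarith
      then show ?thesis using \<open>Suc i = m\<close> by (simp add: idx_def)
    qed
    then show ?thesis by (simp add: step_def)
  next
    case False
    then have e: "real m * t = real i + 1" "Suc i < m" using t' i by auto
    then have "\<lfloor>real m * t\<rfloor> = int i + 1" by linarith
    then have "idx t = Suc i" using e by (simp add: idx_def nat_add_distrib)
    then show ?thesis using e pc_ends[OF q, of "Suc i"] pc_ends[OF q, of i] by (simp add: step_def)
  qed
qed

lemma h_cont: assumes "i < m" "i \<in> I" shows "continuous_on A (h i)"
proof (rule continuous_on_subset[OF _ subset_UNIV])
  have "norm (h i p - h i q) \<le> (lam * c1 / c0) * norm (p - q)" for p q
  proof -
    have "c0 * norm (h i p - h i q) \<le> lam * N (p - q)" using N(3) contr[OF assms] order_trans by blast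
    also have "\<dots> \<le> lam * (c1 * norm (p - q))" using N(4) lam by (intro mult_left_mono) auto
    finally show ?thesis using N(1) by (simp add: field_simps)
  qed
  then have "(lam * c1 / c0)-lipschitz_on UNIV (h i)" using lam N by (intro lipschitz_onI) (auto simp: dist_norm)
  then show "continuous_on UNIV (h i)" by (rule lipschitz_on_continuous_on)
qed

lemma pc_cont: assumes "continuous_on {0..1} q" "i < m" shows "continuous_on {0..1} (pc i q)"
proof (cases "i \<in> I")
  case True
  have "continuous_on {0..1} (\<lambda>s. h i (q s))"
    by (rule continuous_on_compose2[OF h_cont[OF assms(2) True, of UNIV] assms(1)]) auto
  then show ?thesis using True by (simp add: pc_def[abs_def])
next
  case False
  then show ?thesis using arcs[OF assms(2)] by (simp add: pc_def[abs_def] arc_def path_def)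
qed

lemma unit_interval_pieces: "{0..1::real} = (\<Union>i<m. {real i / m .. (real i + 1) / m})"
proof
  have m0: "0 < real m" using m by simp
  show "{0..1} \<subseteq> (\<Union>i<m. {real i / m .. (real i + 1) / m})"
  proof
    fix t :: real assume t: "t \<in> {0..1}"
    have "real (idx t) / m \<le> t" "t \<le> (real (idx t) + 1) / m" using idx(2)[OF t] m0 by (auto simp: field_simps)
    then show "t \<in> (\<Union>i<m. {real i / m .. (real i + 1) / m})" using idx(1)[OF t] by auto
  qed
  show "(\<Union>i<m. {real i / m .. (real i + 1) / m}) \<subseteq> {0..1}"
  proof
    fix t assume "t \<in> (\<Union>i<m. {real i / m .. (real i + 1) / m})"
    then obtain i where i: "i < m" "real i / m \<le> t" "t \<le> (real i + 1) / m" by auto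
    have "(real i + 1) / m \<le> 1" using i m0 by (simp add: field_simps)
    moreover have "0 \<le> real i / m" by simp
    ultimately show "t \<in> {0..1}" unfolding atLeastAtMost_iff using i by linarith
  qed
qed

lemma step_admissible: assumes "admissible q" shows "admissible (step q)"
proof -
  have m0: "0 < real m" using m by simp
  have q: "q 0 = x 0" "q 1 = x m" "continuous_on {0..1} q" using assms by (auto simp: admissible_def)
  have "continuous_on (\<Union>i<m. {real i / m .. (real i + 1) / m}) (step q)"
  proof (rule continuous_on_closed_Union)
    fix i assume "i \<in> {..<m}"
    then have i: "i < m" by simp
    have "continuous_on {real i / m .. (real i + 1) / m} (\<lambda>t. pc i q (real m * t - real i))"
      by (rule continuous_on_compose2[OF pc_cont[OF q(3) i]]) (use m0 in \<open>auto intro!: continuous_intros simp: field_simps\<close>)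
    then show "continuous_on {real i / m .. (real i + 1) / m} (step q)"
      by (rule continuous_on_eq) (use step_piece[OF q(1,2) i] in auto)
  qed auto
  moreover have "step q 0 = x 0" using step_piece[OF q(1,2), of 0 0] pc_ends[OF q(1,2), of 0] m by simp
  moreover have "step q 1 = x m"
  proof -
    have "step q 1 = pc (m-1) q 1" using step_piece[OF q(1,2), of "m-1" 1] m by (simp add: of_nat_diff)
    then show ?thesis using pc_ends(2)[OF q(1,2), of "m-1"] m by simp
  qed
  ultimately show ?thesis by (simp add: admissible_def flip: unit_interval_pieces)
qed

lemma N0: "N 0 = 0" using N(3)[of 0] N(4)[of 0] by simp
lemma Npos: "0 \<le> N v" using N(3)[of v] N(1) by (meson mult_nonneg_nonneg norm_ge_zero order_less_imp_le order_trans)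

lemma pc_contr: assumes "i < m" shows "N (pc i q s - pc i q' s) \<le> lam * N (q s - q' s)"
  using contr[OF assms] Npos lam by (auto simp: pc_def N0)

primrec iter where "iter 0 = (\<lambda>t. (1-t) *\<^sub>R x 0 + t *\<^sub>R x m)" | "iter (Suc n) = step (iter n)"

lemma iter_admissible: "admissible (iter n)"
proof (induction n)
  case 0 show ?case by (auto simp: admissible_def intro!: continuous_intros)
qed (simp add: step_admissible)

lemma iter_bound: "\<exists>D. \<forall>n. \<forall>t\<in>{0..1}. norm (iter (Suc n) t - iter n t) \<le> D * lam ^ n"
proof -
  have "compact ((\<lambda>t. iter 1 t - iter 0 t) ` {0..1::real})"
    using iter_admissible[of 1] iter_admissible[of 0]
    by (intro compact_continuous_image continuous_on_diff) (auto simp: admissible_def)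
  then obtain D0 where D0: "\<And>t. t \<in> {0..1} \<Longrightarrow> norm (iter 1 t - iter 0 t) \<le> D0"
    by (meson compact_imp_bounded bounded_iff imageI)
  have *: "N (iter (Suc n) t - iter n t) \<le> lam ^ n * (c1 * D0)" if "t \<in> {0..1}" for n t using that
  proof (induction n arbitrary: t)
    case 0
    have "N (iter (Suc 0) t - iter 0 t) \<le> c1 * norm (iter (Suc 0) t - iter 0 t)" by (rule N)
    also have "\<dots> \<le> c1 * D0" using D0[OF 0] N(2) by (intro mult_left_mono) auto
    finally show ?case by simp
  next
    case (Suc n)
    define s where "s = real m * t - real (idx t)"
    have "N (iter (Suc (Suc n)) t - iter (Suc n) t) \<le> lam * N (iter (Suc n) s - iter n s)"
    proof -
      have "iter (Suc k) t = pc (idx t) (iter k) s" for k by (simp add: step_def s_def)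
      then show ?thesis using pc_contr[OF idx(1)[OF Suc.prems], of "iter (Suc n)" s "iter n"] by (simp only:)
    qed
    also have "\<dots> \<le> lam * (lam ^ n * (c1 * D0))"
      using Suc.IH[of s] idx(2)[OF Suc.prems] lam by (intro mult_left_mono) (auto simp: s_def)
    finally show ?case by (simp add: mult.assoc)
  qed
  have "norm (iter (Suc n) t - iter n t) \<le> (c1 * D0 / c0) * lam ^ n" if "t \<in> {0..1}" for n t
  proof -
    have "c0 * norm (iter (Suc n) t - iter n t) \<le> lam ^ n * (c1 * D0)" using *[OF that] N(3) order_trans by blast
    then show ?thesis using N(1) by (simp add: field_simps)
  qed
  then show ?thesis by blast
qed

text \<open>Successive iterates differ by a multiple of \<open>lam ^ n\<close>, so the telescoping
  series converges uniformly, and continuity of the maps \<open>h i\<close> makes its sum a fixed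
  point of \<open>step\<close>.\<close>

lemma limit_path:
  obtains p where "admissible p" "\<And>i t. i < m \<Longrightarrow> real i / m \<le> t \<Longrightarrow> t \<le> (real i + 1) / m \<Longrightarrow> p t = pc i p (real m * t - real i)"
proof -
  obtain D where D: "\<And>n t. t\<in>{0..1} \<Longrightarrow> norm (iter (Suc n) t - iter n t) \<le> D * lam ^ n" using iter_bound by blast
  define f where "f = (\<lambda>n t. iter (Suc n) t - iter n t)"
  have "uniform_limit {0..1} (\<lambda>n t. \<Sum>i<n. f i t) (\<lambda>t. suminf (\<lambda>i. f i t)) sequentially"
    by (rule Weierstrass_m_test[of _ _ "\<lambda>n. D * lam ^ n"]) (use D lam in \<open>auto simp: f_def intro!: summable_mult summable_geometric\<close>)
  then have ul0: "uniform_limit {0..1} (\<lambda>n t. iter 0 t + (\<Sum>i<n. f i t)) (\<lambda>t. iter 0 t + suminf (\<lambda>i. f i t)) sequentially"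
    by (intro uniform_limit_add uniform_limit_const)
  define p where "p = (\<lambda>t. iter 0 t + suminf (\<lambda>i. f i t))"
  have tele: "iter 0 t + (\<Sum>i<n. f i t) = iter n t" for n t
    unfolding f_def by (subst sum_lessThan_telescope) simp
  have ul: "uniform_limit {0..1} iter p sequentially" using ul0 unfolding tele p_def .
  have lim: "(\<lambda>n. iter n t) \<longlonglongrightarrow> p t" if "t \<in> {0..1}" for t
    using tendsto_uniform_limitI[OF ul that] .
  have "continuous_on {0..1} p"
    by (rule uniform_limit_theorem[OF _ ul]) (use iter_admissible in \<open>auto simp: admissible_def intro!: always_eventually\<close>)
  moreover have "p 0 = x 0" using lim[of 0] iter_admissible by (auto simp: admissible_def LIMSEQ_const_iff)
  moreover have "p 1 = x m" using lim[of 1] iter_admissible by (auto simp: admissible_def LIMSEQ_const_iff)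
  ultimately have adm: "admissible p" by (simp add: admissible_def)
  show thesis
  proof (rule that[OF adm])
    fix i t assume i: "i < m" and t: "real i / m \<le> t" "t \<le> (real i + 1) / m"
    have m0: "0 < real m" using m by simp
    have t01: "t \<in> {0..1}" using unit_interval_pieces i t by auto
    define s where "s = real m * t - real i"
    have s: "s \<in> {0..1}" using t m0 by (auto simp: s_def field_simps)
    have "(\<lambda>n. pc i (iter n) s) \<longlonglongrightarrow> pc i p s"
    proof (cases "i \<in> I")
      case True
      have "(\<lambda>n. h i (iter n s)) \<longlonglongrightarrow> h i (p s)"
        by (rule continuous_on_tendsto_compose[OF h_cont[OF i True, of UNIV] lim[OF s]]) auto
      then show ?thesis using True by (simp add: pc_def)
    qed (simp add: pc_def)
    moreover have "iter (Suc n) t = pc i (iter n) s" for n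
      using step_piece[OF _ _ i t] iter_admissible[of n] by (simp add: admissible_def s_def)
    then have "(\<lambda>n. pc i (iter n) s) \<longlonglongrightarrow> p t" using LIMSEQ_Suc[OF lim[OF t01]] by simp
    ultimately show "p t = pc i p (real m * t - real i)" using LIMSEQ_unique s_def by blast
  qed
qed

lemma small_imp_closed_mem:
  assumes "closed A" "\<And>n::nat. \<exists>k\<in>A. N (y - k) \<le> lam ^ n * E"
  shows "y \<in> A"
proof -
  have "\<exists>k\<in>A. dist k y < e" if e: "0 < e" for e
  proof -
    have "(\<lambda>n. lam ^ n * E) \<longlonglongrightarrow> 0 * E" using lam by (intro tendsto_mult LIMSEQ_realpow_zero tendsto_const) auto
    then have "\<forall>\<^sub>F n in sequentially. lam ^ n * E < c0 * e" using e N(1) by (intro order_tendstoD) auto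
    then obtain n where "lam ^ n * E < c0 * e" by (auto simp: eventually_sequentially)
    moreover obtain k where "k \<in> A" "N (y - k) \<le> lam ^ n * E" using assms(2) by blast
    ultimately have "c0 * norm (y - k) < c0 * e" using N(3)[of "y-k"] by linarith
    then show ?thesis using N(1) \<open>k \<in> A\<close> by (auto simp: dist_norm norm_minus_commute)
  qed
  then show ?thesis using assms(1) by (metis closed_approachable)
qed

text \<open>The image of the fixed path is K because each of the two sets lies within
  \<open>lam ^ n * E\<close> of the other for every n. Injectivity is a descent: parameters with
  equal value lie in the same piece, where their distance can be magnified by m, or in adjacent
  pieces, where both are the shared vertex.\<close>

theorem arc_exists:
  obtains p where "arc p" "path_image p = K" "pathstart p = x 0" "pathfinish p = x m"
    "\<And>i. i < m \<Longrightarrow> p ` {real i / m .. (real i + 1) / m} = P i" "\<And>i. i \<le> m \<Longrightarrow> p (real i / m) = x i"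
proof -
  obtain p where adm: "admissible p" and
    p: "\<And>i t. i < m \<Longrightarrow> real i / m \<le> t \<Longrightarrow> t \<le> (real i + 1) / m \<Longrightarrow> p t = pc i p (real m * t - real i)"
    using limit_path by blast
  have m0: "0 < real m" using m by simp
  have p01: "p 0 = x 0" "p 1 = x m" "continuous_on {0..1} p" using adm by (auto simp: admissible_def)
  have piece: "\<exists>i<m. real i / m \<le> t \<and> t \<le> (real i + 1) / m \<and> real m * t - real i \<in> {0..1}" if t01: "t \<in> {0..1}" for t
  proof -
    obtain i where "i < m" "t \<in> {real i / m .. (real i + 1) / m}" using t01 unfolding unit_interval_pieces by blast
    then show ?thesis using m0 by (intro exI[of _ i]) (auto simp: field_simps)
  qed
  define L where "L = p ` {0..1}"
  have cL: "compact L" unfolding L_def using p01 by (intro compact_continuous_image) auto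
  have "bounded ((\<lambda>(y,k). y - k) ` (L \<times> K))"
    by (intro compact_imp_bounded compact_continuous_image compact_Times cL K) (auto simp: case_prod_unfold intro!: continuous_intros)
  then obtain E0 where E0: "\<And>y k. y \<in> L \<Longrightarrow> k \<in> K \<Longrightarrow> norm (y - k) \<le> E0" by (force simp: bounded_iff)
  define E where "E = c1 * E0"
  have E: "N (y - k) \<le> E" "N (k - y) \<le> E" if "y \<in> L" "k \<in> K" for y k
  proof -
    have "c1 * norm (y-k) \<le> E" unfolding E_def using E0[OF that] N(2) by (intro mult_left_mono) auto
    then show "N (y - k) \<le> E" "N (k - y) \<le> E"
      using N(4)[of "y-k"] N(4)[of "k-y"] by (simp_all add: norm_minus_commute)
  qed
  obtain k0 where k0: "k0 \<in> K" using K by blast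
  have L0: "p 0 \<in> L" by (auto simp: L_def)
  have Epos: "0 \<le> lam ^ n * E" for n using E(1)[OF L0 k0] Npos[of "p 0 - k0"] lam by auto
  have toK: "\<exists>k\<in>K. N (p t - k) \<le> lam ^ n * E" if "t \<in> {0..1}" for n t using that
  proof (induction n arbitrary: t)
    case 0 then show ?case using E k0 by (auto simp: L_def)
  next
    case (Suc n)
    obtain i where i: "i < m" "real i / m \<le> t" "t \<le> (real i + 1) / m" "real m * t - real i \<in> {0..1}" using piece[OF Suc.prems] by blast
    define s where "s = real m * t - real i"
    have pt: "p t = pc i p s" using p[OF i(1-3)] by (simp add: s_def)
    show ?case
    proof (cases "i \<in> I")
      case True
      obtain k where k: "k \<in> K" "N (p s - k) \<le> lam ^ n * E" using Suc.IH[of s] i(4) by (auto simp: s_def)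
      have "h i k \<in> K" using K(3) copy[OF i(1) True] k(1) i(1) by blast
      moreover have "N (p t - h i k) \<le> lam * N (p s - k)" using contr[OF i(1) True] pt True by (simp add: pc_def)
      moreover have "lam * N (p s - k) \<le> lam * (lam ^ n * E)" using k(2) lam(1) by (rule mult_left_mono)
      ultimately show ?thesis by (auto simp: mult.assoc intro!: bexI[of _ "h i k"])
    next
      case False
      have "p t \<in> P i" using pt False arcs[OF i(1) False] i(4) by (auto simp: pc_def path_image_def s_def)
      then have "p t \<in> K" using K(3) i(1) by blast
      then show ?thesis using Epos[of "Suc n"] N0 by (intro bexI[of _ "p t"]) auto
    qed
  qed
  have toL: "\<exists>y\<in>L. N (k - y) \<le> lam ^ n * E" if "k \<in> K" for n k using that
  proof (induction n arbitrary: k)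
    case 0 then show ?case using E L0 by auto
  next
    case (Suc n)
    obtain i where i: "i < m" "k \<in> P i" using Suc.prems K(3) by blast
    have in_L: "pc i p s \<in> L" if "s \<in> {0..1}" for s
    proof -
      define t where "t = (real i + s) / m"
      have t: "real i / m \<le> t" "t \<le> (real i + 1) / m" using that m0 by (auto simp: t_def divide_right_mono)
      have "real m * t - real i = s" using m0 by (simp add: t_def)
      then have "p t = pc i p s" using p[OF i(1) t] by simp
      moreover have "t \<in> {0..1}" using t i(1) unit_interval_pieces by auto
      ultimately show ?thesis unfolding L_def by (metis image_eqI)
    qed
    show ?case
    proof (cases "i \<in> I")
      case True
      then obtain k' where k': "k' \<in> K" "k = h i k'" using i copy[OF i(1) True] by blast
      obtain y where y: "y \<in> L" "N (k' - y) \<le> lam ^ n * E" using Suc.IH[OF k'(1)] by blast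
      obtain s where s: "s \<in> {0..1}" "y = p s" using y(1) by (auto simp: L_def)
      have "h i y \<in> L" using in_L[OF s(1)] True s by (simp add: pc_def)
      moreover have "N (k - h i y) \<le> lam * N (k' - y)" using contr[OF i(1) True] k' by simp
      moreover have "lam * N (k' - y) \<le> lam * (lam ^ n * E)" using y(2) lam(1) by (rule mult_left_mono)
      ultimately show ?thesis by (auto simp: mult.assoc intro!: bexI[of _ "h i y"])
    next
      case False
      then obtain s where s: "s \<in> {0..1}" "k = \<gamma> i s" using arcs[OF i(1) False] i(2) unfolding path_image_def by (metis imageE)
      then have "k \<in> L" using in_L[OF s(1)] False by (simp add: pc_def)
      then show ?thesis using Epos[of "Suc n"] N0 by (intro bexI[of _ k]) auto
    qed
  qed
  have LK: "L = K"
  proof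
    show "L \<subseteq> K"
    proof
      fix y assume "y \<in> L"
      then obtain t where t: "t \<in> {0..1}" "y = p t" by (auto simp: L_def)
      show "y \<in> K" using small_imp_closed_mem[OF compact_imp_closed[OF K(1)], of y E] toK[OF t(1)] t(2) by blast
    qed
    show "K \<subseteq> L" using small_imp_closed_mem[OF compact_imp_closed[OF cL], of _ E] toL by blast
  qed
  have pim: "pc i p ` {0..1} = P i" if "i < m" for i
  proof (cases "i \<in> I")
    case True
    then have "pc i p ` {0..1} = h i ` L" by (auto simp: pc_def L_def)
    then show ?thesis using LK copy[OF that True] by simp
  next
    case False
    then show ?thesis using arcs[OF that False] by (simp add: pc_def path_image_def)
  qed
  have mem: "p t \<in> P i" if "i < m" "real i / m \<le> t" "t \<le> (real i + 1) / m" "real m * t - real i \<in> {0..1}" for i t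
    using p[OF that(1-3)] pim[OF that(1)] that(4) by auto
  \<comment> \<open>Before injectivity the ends have to be settled: x m lies in the last piece
    alone, but that piece may again be a copy of K, so uniqueness of its parameter also needs the
    magnification.\<close>
  have last: "1 - s \<le> (1 / real m) ^ n" if "s \<in> {0..1}" "p s = x m" for n s using that
  proof (induction n arbitrary: s)
    case 0 then show ?case by auto
  next
    case (Suc n)
    obtain i where i: "i < m" "real i / m \<le> s" "s \<le> (real i + 1) / m" "real m * s - real i \<in> {0..1}" using piece[OF Suc.prems(1)] by blast
    have "Suc i = m" using mem[OF i] ends(2)[of i] Suc.prems i(1) by (cases "Suc i < m") auto
    define s' where "s' = real m * s - real i"
    have ss: "1 - s = (1 - s') / m" using m0 \<open>Suc i = m\<close> by (auto simp: s'_def field_simps)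
    have e: "pc i p s' = pc i p 1" using p[OF i(1-3)] Suc.prems(2) pc_ends(2)[OF p01(1,2) i(1)] \<open>Suc i = m\<close> by (simp add: s'_def)
    have "1 - s' \<le> (1 / real m)^n"
    proof (cases "i \<in> I")
      case True
      then have "p s' = x m" using e copy[OF i(1) True] p01 by (auto simp: pc_def inj_def)
      then show ?thesis using Suc.IH[of s'] i(4) by (simp add: s'_def)
    next
      case False
      then have "s' = 1" using e arc_inj[OF i(1) False, of s' 1] i(4) by (simp add: pc_def s'_def)
      then show ?thesis by simp
    qed
    then have "(1 - s') / m \<le> (1 / real m)^n / m" using m0 by (simp add: divide_right_mono)
    then show ?case using ss by simp
  qed
  have first: "s \<le> (1 / real m) ^ n" if "s \<in> {0..1}" "p s = x 0" for n s using that
  proof (induction n arbitrary: s)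
    case 0 then show ?case by auto
  next
    case (Suc n)
    obtain i where i: "i < m" "real i / m \<le> s" "s \<le> (real i + 1) / m" "real m * s - real i \<in> {0..1}" using piece[OF Suc.prems(1)] by blast
    have i0: "i = 0" using mem[OF i] ends(1)[of i] Suc.prems i(1) by (cases "0 < i") auto
    define s' where "s' = real m * s - real i"
    have ss: "s = s' / m" using m0 i0 by (auto simp: s'_def field_simps)
    have e: "pc i p s' = pc i p 0" using p[OF i(1-3)] Suc.prems(2) pc_ends(1)[OF p01(1,2) i(1)] i0 by (simp add: s'_def)
    have "s' \<le> (1 / real m)^n"
    proof (cases "i \<in> I")
      case True
      then have "p s' = x 0" using e copy[OF i(1) True] p01 by (auto simp: pc_def inj_def)
      then show ?thesis using Suc.IH[of s'] i(4) by (simp add: s'_def)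
    next
      case False
      then have "s' = 0" using e arc_inj[OF i(1) False, of s' 0] i(4) by (simp add: pc_def s'_def)
      then show ?thesis by simp
    qed
    then have "s' / m \<le> (1 / real m)^n / m" using m0 by (simp add: divide_right_mono)
    then show ?case using ss by simp
  qed
  have pow0: "y \<le> 0" if "\<And>n. y \<le> (1 / real m) ^ n" for y
  proof -
    have "(\<lambda>n. (1 / real m) ^ n) \<longlonglongrightarrow> 0" using m by (intro LIMSEQ_realpow_zero) auto
    then show ?thesis using that by (meson LIMSEQ_le_const)
  qed
  have lastE: "s = 1" if "s \<in> {0..1}" "p s = x m" for s using pow0[OF last[OF that]] that by auto
  have firstE: "s = 0" if "s \<in> {0..1}" "p s = x 0" for s using pow0[OF first[OF that]] that by auto
  have pc1: "s = 1" if "s \<in> {0..1}" "pc i p s = x (Suc i)" "i < m" for i s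
  proof (cases "i \<in> I")
    case True
    then have "p s = x m" using that(2) copy[OF that(3) True] by (auto simp: pc_def inj_def)
    then show ?thesis using lastE that(1) by blast
  next
    case False
    then show ?thesis using that arcs[OF that(3) False] by (auto simp: pc_def arc_def inj_on_def)
  qed
  have pc0: "s = 0" if "s \<in> {0..1}" "pc i p s = x i" "i < m" for i s
  proof (cases "i \<in> I")
    case True
    then have "p s = x 0" using that(2) copy[OF that(3) True] by (auto simp: pc_def inj_def)
    then show ?thesis using firstE that(1) by blast
  next
    case False
    then show ?thesis using that arcs[OF that(3) False] by (auto simp: pc_def arc_def inj_on_def)
  qed
  have injn: "\<bar>s - t\<bar> \<le> (1 / real m) ^ n" if "s \<in> {0..1}" "t \<in> {0..1}" "p s = p t" for n s t using that
  proof (induction n arbitrary: s t)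
    case 0 then show ?case by auto
  next
    case (Suc n)
    obtain i where i: "i < m" "real i / m \<le> s" "s \<le> (real i + 1) / m" "real m * s - real i \<in> {0..1}" using piece[OF Suc.prems(1)] by blast
    obtain j where j: "j < m" "real j / m \<le> t" "t \<le> (real j + 1) / m" "real m * t - real j \<in> {0..1}" using piece[OF Suc.prems(2)] by blast
    have both: "p s \<in> P i" "p s \<in> P j" using mem[OF i] mem[OF j] Suc.prems(3) by auto
    have nxt: "u = v" if "i' < m" "Suc i' < m" "real i' / m \<le> u" "u \<le> (real i' + 1) / m" "real m * u - real i' \<in> {0..1}"
      "real (Suc i') / m \<le> v" "v \<le> (real (Suc i') + 1) / m" "real m * v - real (Suc i') \<in> {0..1}" "p u = p v" for i' u v
    proof -
      have "p u \<in> P i' \<inter> P (Suc i')" using mem[of i' u] mem[of "Suc i'" v] that by auto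
      then have e: "p u = x (Suc i')" using adj[OF that(2)] by blast
      have "real m * u - real i' = 1" using pc1[of "real m * u - real i'" i'] that e p[of i' u] by auto
      moreover have "real m * v - real (Suc i') = 0" using pc0[of "real m * v - real (Suc i')" "Suc i'"] that e p[of "Suc i'" v] by auto
      ultimately have "real m * u = real m * v" by simp
      then show "u = v" using m0 by simp
    qed
    consider "i = j" | "j = Suc i" | "i = Suc j" | "Suc i < j" | "Suc j < i" by linarith
    then show ?case
    proof cases
      case 1
      define s' where "s' = real m * s - real i"
      define t' where "t' = real m * t - real i"
      have e: "pc i p s' = pc i p t'" using p[OF i(1-3)] p[OF j(1-3)] 1 Suc.prems(3) by (simp add: s'_def t'_def)
      have st: "s' \<in> {0..1}" "t' \<in> {0..1}" using i(4) j(4) 1 by (auto simp: s'_def t'_def)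
      have "\<bar>s' - t'\<bar> \<le> (1 / real m)^n"
      proof (cases "i \<in> I")
        case True
        then have "p s' = p t'" using e copy[OF i(1) True] by (auto simp: pc_def inj_def)
        then show ?thesis using Suc.IH st by blast
      next
        case False
        then have "s' = t'" using e arc_inj[OF i(1) False, of s' t'] st by (simp add: pc_def)
        then show ?thesis by simp
      qed
      moreover have "\<bar>s' - t'\<bar> = real m * \<bar>s - t\<bar>" unfolding s'_def t'_def using m0 by (simp flip: abs_mult_pos right_diff_distrib add: abs_mult)
      ultimately show ?thesis using m0 by (simp add: field_simps)
    next
      case 2 then have "s = t" using nxt[of i s t] i j Suc.prems(3) by auto
      then show ?thesis by simp
    next
      case 3 then have "t = s" using nxt[of j t s] i j Suc.prems(3) by auto
      then show ?thesis by simp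
    next
      case 4 then show ?thesis using disj[OF i(1) j(1)] both by auto
    next
      case 5 then show ?thesis using disj[OF j(1) i(1)] both by auto
    qed
  qed
  have "inj_on p {0..1}"
  proof (rule inj_onI)
    fix s t assume "s \<in> {0..1}" "t \<in> {0..1}" "p s = p t"
    then have "\<bar>s - t\<bar> \<le> 0" using pow0[OF injn] by blast
    then show "s = t" by simp
  qed
  then have "arc p" using p01 by (simp add: arc_def path_def)
  moreover have "p ` {real i / m .. (real i + 1) / m} = P i" if i: "i < m" for i
  proof -
    have "p ` {real i / m .. (real i + 1) / m} = (\<lambda>t. pc i p (real m * t - real i)) ` {real i / m .. (real i + 1) / m}"
      using p[OF i] by (intro image_cong) auto
    also have "\<dots> = pc i p ` (\<lambda>t. real m * t - real i) ` {real i / m .. (real i + 1) / m}" by (simp add: image_image)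
    also have "(\<lambda>t. real m * t - real i) ` {real i / m .. (real i + 1) / m} = {0..1}"
    proof -
      have "s \<in> (\<lambda>t. real m * t - real i) ` {real i / m .. (real i + 1) / m}" if "s \<in> {0..1}" for s
        using that m0 by (intro image_eqI[of _ _ "(real i + s) / m"]) (auto simp: field_simps)
      then show ?thesis using m0 by (auto simp: field_simps)
    qed
    finally show ?thesis using pim[OF i] by simp
  qed
  moreover have "p (real i / m) = x i" if "i \<le> m" for i
  proof (cases "i < m")
    case True
    then show ?thesis using p[of i "real i / m"] m0 pc_ends(1)[OF p01(1,2) True] by (simp add: divide_right_mono)
  next
    case False
    then show ?thesis using that p01 m0 by auto
  qed
  ultimately show thesis using that[of p] LK p01 by (simp add: path_image_def L_def pathstart_def pathfinish_def)
qed

end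

section \<open>The tile as an attractor\<close>

text \<open>A substitute for a norm adapted to the matrix: comparison with the Euclidean norm,
  subadditivity and symmetry are all that the contraction arguments consume.\<close>

locale gauge =
  fixes N :: "'a::euclidean_space \<Rightarrow> real" and lam c0 c1 :: real
  assumes lam: "0 \<le> lam" "lam < 1" and c01: "0 < c0" "0 < c1"
    and N_lower: "\<And>v. c0 * norm v \<le> N v" and N_upper: "\<And>v. N v \<le> c1 * norm v"
    and N_add: "\<And>v w. N (v + w) \<le> N v + N w" and N_minus: "\<And>v. N (- v) = N v"
begin

lemma N_zero: "N 0 = 0" using N_lower[of 0] N_upper[of 0] by simp

lemma N_nonneg: "0 \<le> N v"
  using N_lower[of v] c01 by (meson mult_nonneg_nonneg norm_ge_zero order_less_imp_le order_trans)

lemma N_diff_le: "\<bar>N v - N w\<bar> \<le> N (v - w)"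
  using N_add[of "v - w" w] N_add[of "w - v" v] N_minus[of "v - w"] by simp

lemma N_continuous: "continuous_on A N"
proof -
  have "c1-lipschitz_on UNIV N"
    using c01 N_diff_le N_upper by (intro lipschitz_onI) (auto simp: dist_norm intro: order_trans)
  then show ?thesis using lipschitz_on_continuous_on continuous_on_subset by blast
qed

lemma closed_mem_if_gauge_small:
  assumes "closed K" "\<And>n::nat. \<exists>k\<in>K. N (y - k) \<le> lam ^ n * E"
  shows "y \<in> K"
proof -
  have "\<exists>k\<in>K. dist k y < e" if e: "0 < e" for e
  proof -
    have "(\<lambda>n. lam ^ n * E) \<longlonglongrightarrow> 0 * E" using lam by (intro tendsto_mult LIMSEQ_realpow_zero tendsto_const) auto
    then have "\<forall>\<^sub>F n in sequentially. lam ^ n * E < c0 * e" using e c01 by (intro order_tendstoD) auto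
    then obtain n where "lam ^ n * E < c0 * e" by (auto simp: eventually_sequentially)
    moreover obtain k where "k \<in> K" "N (y - k) \<le> lam ^ n * E" using assms(2) by blast
    ultimately have "c0 * norm (y - k) < c0 * e" using N_lower[of "y-k"] by linarith
    then show ?thesis using c01 \<open>k \<in> K\<close> by (auto simp: dist_norm norm_minus_commute)
  qed
  then show ?thesis using assms(1) by (metis closed_approachable)
qed

lemma gauge_bounded:
  assumes "bounded X" "bounded Y"
  obtains E where "0 \<le> E" "\<And>x y. x \<in> X \<Longrightarrow> y \<in> Y \<Longrightarrow> N (x - y) \<le> E"
proof -
  obtain a b where ab: "\<And>x. x \<in> X \<Longrightarrow> norm x \<le> a" "\<And>y. y \<in> Y \<Longrightarrow> norm y \<le> b"
    using assms by (auto simp: bounded_iff)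
  show thesis
  proof (rule that[of "c1 * \<bar>a + b\<bar>"])
    show "N (x - y) \<le> c1 * \<bar>a + b\<bar>" if "x \<in> X" "y \<in> Y" for x y
    proof -
      have "norm (x - y) \<le> \<bar>a + b\<bar>" using ab(1)[OF that(1)] ab(2)[OF that(2)] norm_triangle_ineq4[of x y] by linarith
      then have "c1 * norm (x-y) \<le> c1 * \<bar>a + b\<bar>" using c01 by (intro mult_left_mono) auto
      then show ?thesis using N_upper[of "x-y"] by linarith
    qed
  qed (use c01 in auto)
qed

lemma contraction_continuous:
  assumes "\<And>p q. N (f p - f q) \<le> lam * N (p - q)"
  shows "continuous_on A f"
proof -
  have "norm (f p - f q) \<le> (lam * c1 / c0) * norm (p - q)" for p q
  proof -
    have "c0 * norm (f p - f q) \<le> lam * N (p - q)" using N_lower assms order_trans by blast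
    also have "\<dots> \<le> lam * (c1 * norm (p - q))" using N_upper lam by (intro mult_left_mono) auto
    finally show ?thesis using c01 by (simp add: field_simps)
  qed
  then have "(lam * c1 / c0)-lipschitz_on UNIV f" using lam c01 by (intro lipschitz_onI) (auto simp: dist_norm)
  then show ?thesis using lipschitz_on_continuous_on continuous_on_subset by blast
qed

text \<open>Pull a point of X back n times inside X, exchange it for a point of Y and push forward
  again: the error shrinks like \<open>lam ^ n\<close>. Used in both directions this gives
  uniqueness of the attractor.\<close>

lemma attractor_subset:
  assumes contr: "\<And>f p q. f \<in> fs \<Longrightarrow> N (f p - f q) \<le> lam * N (p - q)"
    and X: "bounded X" "X \<subseteq> (\<Union>f\<in>fs. f ` X)"
    and Y: "compact Y" "Y \<noteq> {}" "(\<Union>f\<in>fs. f ` Y) \<subseteq> Y"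
  shows "X \<subseteq> Y"
proof
  fix x0 assume x0: "x0 \<in> X"
  obtain E where E: "\<And>x y. x \<in> X \<Longrightarrow> y \<in> Y \<Longrightarrow> N (x - y) \<le> E"
    using gauge_bounded[OF X(1) compact_imp_bounded[OF Y(1)]] by metis
  have "\<exists>y\<in>Y. N (x - y) \<le> lam ^ n * E" if "x \<in> X" for n x using that
  proof (induction n arbitrary: x)
    case 0 then show ?case using E Y(2) by auto
  next
    case (Suc n)
    obtain f x' where f: "f \<in> fs" "x' \<in> X" "x = f x'" using Suc.prems X(2) by blast
    obtain y where y: "y \<in> Y" "N (x' - y) \<le> lam ^ n * E" using Suc.IH[OF f(2)] by blast
    have "N (x - f y) \<le> lam * N (x' - y)" using contr f by auto
    also have "\<dots> \<le> lam * (lam ^ n * E)" using y(2) lam(1) by (rule mult_left_mono)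
    finally show ?case using Y(3) f(1) y(1) by (auto simp: mult.assoc)
  qed
  then show "x0 \<in> Y" using closed_mem_if_gauge_small[OF compact_imp_closed[OF Y(1)]] x0 by blast
qed

text \<open>For existence, the gauge ball of radius R is mapped into itself as soon as N (f 0) \<le>
  (1 - lam) R for all maps, and the attractor is the intersection of its decreasing images.\<close>

lemma attractor_ex1:
  assumes fs: "finite fs" "fs \<noteq> {}"
    and contr: "\<And>f p q. f \<in> fs \<Longrightarrow> N (f p - f q) \<le> lam * N (p - q)" and inj: "\<And>f. f \<in> fs \<Longrightarrow> inj f"
  shows "\<exists>!X. compact X \<and> X \<noteq> {} \<and> X = (\<Union>f\<in>fs. f ` X)"
proof (rule ex_ex1I)
  show "X = Y" if "compact X \<and> X \<noteq> {} \<and> X = (\<Union>f\<in>fs. f ` X)" "compact Y \<and> Y \<noteq> {} \<and> Y = (\<Union>f\<in>fs. f ` Y)" for X Y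
  proof (rule equalityI)
    show "X \<subseteq> Y" by (rule attractor_subset[of fs]) (use that contr compact_imp_bounded in auto)
    show "Y \<subseteq> X" by (rule attractor_subset[of fs]) (use that contr compact_imp_bounded in auto)
  qed
next
  define R where "R = Max ((\<lambda>f. N (f 0)) ` fs) / (1 - lam)"
  have R: "N (f 0) \<le> (1 - lam) * R" if "f \<in> fs" for f
  proof -
    have "N (f 0) \<le> Max ((\<lambda>f. N (f 0)) ` fs)" using fs that by (intro Max_ge) auto
    then show ?thesis using lam by (simp add: R_def)
  qed
  have R0: "0 \<le> R"
  proof -
    obtain f where "f \<in> fs" using fs by blast
    then have "0 \<le> (1 - lam) * R" using R[of f] N_nonneg[of "f 0"] by linarith
    then show ?thesis using lam by (simp add: zero_le_mult_iff)
  qed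
  define K where "K = rec_nat {p. N p \<le> R} (\<lambda>_ X. \<Union>f\<in>fs. f ` X)"
  have K0: "K 0 = {p. N p \<le> R}" and KS: "K (Suc n) = (\<Union>f\<in>fs. f ` K n)" for n by (simp_all add: K_def)
  have "compact (K 0)"
  proof -
    have "closed (K 0)" unfolding K0 by (intro closed_Collect_le N_continuous continuous_on_const)
    moreover have "bounded (K 0)"
    proof -
      have "norm p \<le> R / c0" if "p \<in> K 0" for p using that N_lower[of p] c01 by (simp add: K0 field_simps)
      then show ?thesis by (auto simp: bounded_iff)
    qed
    ultimately show ?thesis by (simp add: compact_eq_bounded_closed)
  qed
  then have cK: "compact (K n)" for n
  proof (induction n)
    case (Suc n)
    show ?case unfolding KS using fs(1) Suc contr
      by (intro compact_UN) (auto intro!: compact_continuous_image contraction_continuous)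
  qed
  have "0 \<in> K 0" using R0 by (simp add: K0 N_zero)
  then have neK: "K n \<noteq> {}" for n by (induction n) (use fs in \<open>auto simp: KS\<close>)
  have "K 1 \<subseteq> K 0"
  proof
    fix x assume "x \<in> K 1"
    then obtain f p where f: "f \<in> fs" "N p \<le> R" "x = f p" by (auto simp: KS K0)
    have "N x \<le> N (f p - f 0) + N (f 0)" using N_add[of "f p - f 0" "f 0"] f by simp
    also have "\<dots> \<le> lam * N p + (1-lam) * R" using contr[OF f(1), of p 0] R[OF f(1)] by simp
    also have "\<dots> \<le> lam * R + (1-lam) * R" using f(2) lam by (intro add_mono mult_left_mono) auto
    finally show "x \<in> K 0" by (simp add: K0 algebra_simps)
  qed
  then have dec: "K (Suc n) \<subseteq> K n" for n
    by (induction n) (auto simp: KS, metis One_nat_def KS UN_I image_eqI subsetD)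
  then have dec': "n \<le> k \<Longrightarrow> K k \<subseteq> K n" for n k by (rule lift_Suc_antimono_le)
  define X where "X = (\<Inter>n. K n)"
  have cX: "compact X" unfolding X_def using cK by (intro compact_Inter) auto
  have neX: "X \<noteq> {}" unfolding X_def
    by (rule compact_nest) (use cK neK dec' in auto)
  have "X = (\<Union>f\<in>fs. f ` X)"
  proof
    show "(\<Union>f\<in>fs. f ` X) \<subseteq> X"
    proof
      fix x assume "x \<in> (\<Union>f\<in>fs. f ` X)"
      then obtain f p where f: "f \<in> fs" "p \<in> X" "x = f p" by blast
      then have "x \<in> K (Suc n)" for n by (auto simp: KS X_def)
      then show "x \<in> X" using dec unfolding X_def by blast
    qed
    show "X \<subseteq> (\<Union>f\<in>fs. f ` X)"
    proof
      fix x assume x: "x \<in> X"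
      \<comment> \<open>The map through which x is reached may change with n. One of finitely many
        maps recurs, and its injectivity makes the preimage of x the same at every level.\<close>
      have "\<forall>n. \<exists>f\<in>fs. x \<in> f ` K n" using x KS unfolding X_def by blast
      then obtain F where F: "\<And>n. F n \<in> fs" "\<And>n. x \<in> F n ` K n" by metis
      have "finite (range F)" using F(1) fs(1) by (meson finite_subset image_subsetI)
      then obtain f where f: "infinite {n. F n = f}" using inf_img_fin_dom[of F UNIV] by (auto simp: vimage_def)
      then have "f \<in> fs" using F(1) by (metis (mono_tags, lifting) Collect_empty_eq finite.emptyI)
      have inf: "\<exists>k\<ge>n. F k = f" for n using f by (metis (mono_tags, lifting) finite_nat_set_iff_bounded_le mem_Collect_eq nat_le_linear)
      obtain p where p: "x = f p" using inf[of 0] F(2) by blast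
      have "p \<in> K n" for n
      proof -
        obtain k where k: "k \<ge> n" "F k = f" using inf by blast
        then obtain p' where "p' \<in> K k" "x = f p'" using F(2)[of k] by blast
        then show ?thesis using p inj[OF \<open>f \<in> fs\<close>] dec'[OF k(1)] by (auto dest: injD)
      qed
      then show "x \<in> (\<Union>f\<in>fs. f ` X)" using \<open>f \<in> fs\<close> p by (auto simp: X_def)
    qed
  qed
  then show "\<exists>X. compact X \<and> X \<noteq> {} \<and> X = (\<Union>f\<in>fs. f ` X)" using cX neX by blast
qed

end

definition ginv :: "int \<Rightarrow> int \<Rightarrow> real \<times> real \<Rightarrow> real \<times> real" where
  "ginv A B p = (snd p + of_int A * (((of_int B - 1) / 2 - fst p) / of_int B), ((of_int B - 1) / 2 - fst p) / of_int B)"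

lemma gmap_ginv: "B \<noteq> 0 \<Longrightarrow> gmap A B (ginv A B p) = p"
  by (cases p) (simp add: gmap_def ginv_def)

lemma ginv_gmap: "B \<noteq> 0 \<Longrightarrow> ginv A B (gmap A B p) = p"
  by (cases p) (simp add: gmap_def ginv_def)

locale tile_gauge = gauge N lam c0 c1 for N :: "real \<times> real \<Rightarrow> real" and lam c0 c1 +
  fixes A B :: int
  assumes B2: "2 \<le> B" and contr: "\<And>p q. N (ginv A B p - ginv A B q) \<le> lam * N (p - q)"

text \<open>For small A a weighted sum of absolute values contracts if the weight of the second
  coordinate lies between 1 and 2, whence 3/2. If A^2 < 4B, the eigenvalues \<lambda> of the matrix
  are complex of modulus sqrt B, and the coordinate fst v + \<lambda> snd v turns the linear part of
  g into multiplication by \<lambda>; its absolute value is the gauge and the inverse contracts by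
  exactly 1 / sqrt B.\<close>

lemma tile_gauge_exists:
  assumes "2 \<le> B" "\<bar>A\<bar> \<le> B - 2 \<or> A * A < 4 * B"
  shows "\<exists>N lam c0 c1. tile_gauge N lam c0 c1 A B"
proof -
  define a b where "a = real_of_int A" and "b = real_of_int B"
  have b: "2 \<le> b" using assms(1) by (simp add: b_def)
  have lin: "ginv A B p - ginv A B q = (snd (p - q) - a * fst (p - q) / b, - fst (p - q) / b)" for p q
    using b by (simp add: ginv_def a_def b_def field_simps prod_eq_iff)
  from assms(2) show ?thesis
  proof
    assume A: "\<bar>A\<bar> \<le> B - 2"
    then have ab: "\<bar>a\<bar> \<le> b - 2" by (simp add: a_def b_def flip: of_int_abs)
    define N :: "real \<times> real \<Rightarrow> real" where "N = (\<lambda>v. \<bar>fst v\<bar> + 3/2 * \<bar>snd v\<bar>)"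
    define lam where "lam = 1 - 1 / (2*b)"
    have "tile_gauge N lam 1 (5/2) A B"
    proof
      show "0 \<le> lam" "lam < 1" using b by (auto simp: lam_def field_simps)
      show "1 * norm v \<le> N v" for v
      proof -
        have "norm v \<le> \<bar>fst v\<bar> + \<bar>snd v\<bar>" using norm_Pair_le[of "fst v" "snd v"] by simp
        then show ?thesis by (simp add: N_def)
      qed
      show "N v \<le> 5/2 * norm v" for v
      proof -
        have "\<bar>fst v\<bar> \<le> norm v" "\<bar>snd v\<bar> \<le> norm v" using norm_fst_le[of "fst v" "snd v"] norm_snd_le[of "snd v" "fst v"] by auto
        then show ?thesis unfolding N_def by linarith
      qed
      show "N (v + w) \<le> N v + N w" for v w 
        using abs_triangle_ineq[of "fst v" "fst w"] abs_triangle_ineq[of "snd v" "snd w"] unfolding N_def fst_add snd_add by linarith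
      show "N (- v) = N v" for v by (simp add: N_def)
      show "2 \<le> B" by fact
      show "N (ginv A B p - ginv A B q) \<le> lam * N (p - q)" for p q
      proof -
        define u v where "u = fst (p - q)" and "v = snd (p - q)"
        have "N (ginv A B p - ginv A B q) = \<bar>v - a * u / b\<bar> + 3/2 * (\<bar>u\<bar> / b)"
          unfolding lin N_def u_def v_def using b by (simp add: abs_divide)
        also have "\<bar>v - a * u / b\<bar> \<le> \<bar>v\<bar> + \<bar>a\<bar> * \<bar>u\<bar> / b"
          using abs_triangle_ineq4[of v "a*u/b"] b by (simp add: abs_mult abs_divide)
        also have "\<bar>a\<bar> * \<bar>u\<bar> / b \<le> (b-2) * \<bar>u\<bar> / b" using ab b by (intro divide_right_mono mult_right_mono) auto
        finally have "N (ginv A B p - ginv A B q) \<le> \<bar>v\<bar> + ((b-2) * \<bar>u\<bar> / b + 3/2 * (\<bar>u\<bar> / b))" by simp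
        also have "(b-2) * \<bar>u\<bar> / b + 3/2 * (\<bar>u\<bar> / b) = lam * \<bar>u\<bar>" using b by (simp add: lam_def field_simps)
        also have "\<bar>v\<bar> + lam * \<bar>u\<bar> \<le> lam * N (p - q)"
        proof -
          have "2/3 \<le> lam" using b by (simp add: lam_def field_simps)
          then have "1 * \<bar>v\<bar> \<le> (3/2 * lam) * \<bar>v\<bar>" by (intro mult_right_mono) auto
          then show ?thesis by (simp add: N_def u_def v_def algebra_simps)
        qed
        finally show ?thesis .
      qed
    qed auto
    then show ?thesis by blast
  next
    assume "A * A < 4 * B"
    then have D: "a^2 < 4 * b" unfolding a_def b_def power2_eq_square by (metis of_int_less_iff of_int_mult of_int_numeral)
    define d where "d = sqrt (4*b - a^2)"
    have d: "0 < d" "d^2 = 4*b - a^2" using D by (auto simp: d_def)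
    define L where "L = (\<lambda>v::real\<times>real. Complex (fst v - a/2 * snd v) (d/2 * snd v))"
    define N where "N = (\<lambda>v. cmod (L v))"
    have sq: "(N v)^2 = (fst v - a/2 * snd v)^2 + (d/2 * snd v)^2" for v by (simp add: N_def L_def cmod_power2)
    have "tile_gauge N (1 / sqrt b) (1 / (1 + \<bar>a\<bar> / d + 2/d)) (1 + \<bar>a\<bar> + d) A B"
    proof
      show "0 \<le> 1 / sqrt b" "1 / sqrt b < 1" using b by auto
      show "0 < 1 / (1 + \<bar>a\<bar> / d + 2/d)" using d by (simp add: add_pos_nonneg)
      show "0 < 1 + \<bar>a\<bar> + d" using d by simp
      show "2 \<le> B" by fact
      show "1 / (1 + \<bar>a\<bar> / d + 2/d) * norm v \<le> N v" for v
      proof -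
        have 1: "d/2 * \<bar>snd v\<bar> \<le> N v" using abs_Im_le_cmod[of "L v"] d by (simp add: N_def L_def abs_mult)
        have 2: "\<bar>fst v - a/2 * snd v\<bar> \<le> N v" using abs_Re_le_cmod[of "L v"] by (simp add: N_def L_def)
        have s: "\<bar>snd v\<bar> \<le> 2/d * N v" using 1 d by (simp add: field_simps)
        have "\<bar>fst v\<bar> \<le> \<bar>fst v - a/2 * snd v\<bar> + \<bar>a/2 * snd v\<bar>" by linarith
        also have "\<bar>a/2 * snd v\<bar> \<le> \<bar>a\<bar>/2 * (2/d * N v)" using s by (simp only: abs_mult) (intro mult_mono, auto)
        finally have "\<bar>fst v\<bar> \<le> N v + \<bar>a\<bar>/d * N v" using 2 by simp
        moreover have "norm v \<le> \<bar>fst v\<bar> + \<bar>snd v\<bar>" using norm_Pair_le[of "fst v" "snd v"] by simp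
        ultimately have "norm v \<le> (1 + \<bar>a\<bar> / d + 2/d) * N v" using s by (simp add: algebra_simps)
        moreover have "0 < 1 + \<bar>a\<bar> / d + 2/d" using d by (simp add: add_pos_nonneg)
        ultimately show ?thesis by (simp add: pos_divide_le_eq mult.commute)
      qed
      show "N v \<le> (1 + \<bar>a\<bar> + d) * norm v" for v
      proof -
        have f: "\<bar>fst v\<bar> \<le> norm v" "\<bar>snd v\<bar> \<le> norm v" using norm_fst_le[of "fst v" "snd v"] norm_snd_le[of "snd v" "fst v"] by auto
        have "N v \<le> \<bar>fst v - a/2 * snd v\<bar> + \<bar>d/2 * snd v\<bar>" using cmod_le[of "L v"] by (simp add: N_def L_def)
        also have "\<dots> \<le> \<bar>fst v\<bar> + \<bar>a\<bar>/2 * \<bar>snd v\<bar> + d/2 * \<bar>snd v\<bar>" using d abs_triangle_ineq4[of "fst v" "a/2 * snd v"] by (simp add: abs_mult)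
        also have "\<dots> \<le> norm v + \<bar>a\<bar> * norm v + d * norm v" using f d by (intro add_mono mult_mono) auto
        finally show ?thesis by (simp add: algebra_simps)
      qed
      show "N (v + w) \<le> N v + N w" for v w
      proof -
        have "L (v + w) = L v + L w" by (simp add: L_def complex_eq_iff algebra_simps)
        then show ?thesis unfolding N_def by (metis norm_triangle_ineq)
      qed
      show "N (- v) = N v" for v
      proof -
        have "L (- v) = - L v" by (simp add: L_def complex_eq_iff)
        then show ?thesis by (simp add: N_def)
      qed
      show "N (ginv A B p - ginv A B q) \<le> 1 / sqrt b * N (p - q)" for p q
      proof -
        define u v where "u = fst (p - q)" and "v = snd (p - q)"
        have "(N (ginv A B p - ginv A B q))^2 = (v - a*u/b - a/2 * (- u/b))^2 + (d/2 * (- u/b))^2"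
          unfolding sq lin u_def v_def by simp
        also have "\<dots> = (v - a*u/(2*b))^2 + d^2 * (u/(2*b))^2"
          using b by (simp add: power2_eq_square field_simps)
        also have "\<dots> = (b * v^2 - a * u * v + u^2) / b" unfolding d(2) using b by (simp add: power2_eq_square field_simps)
        also have "\<dots> = ((u - a/2 * v)^2 + (d/2 * v)^2) / b"
        proof -
          have "(d/2 * v)^2 = (4*b - a^2) * v^2 / 4" unfolding d(2)[symmetric] by (simp add: power2_eq_square)
          then show ?thesis by (simp add: power2_eq_square algebra_simps)
        qed
        also have "\<dots> = (N (p-q))^2 / b" unfolding sq u_def v_def by simp
        also have "\<dots> = (1 / sqrt b * N (p - q))^2" using b by (simp add: power_mult_distrib power_divide)
        finally show ?thesis using b by (simp add: power2_eq_iff_nonneg N_def)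
      qed
    qed
    then show ?thesis by blast
  qed
qed

section \<open>The lattice tile and its neighbours\<close>

text \<open>The numbers x, y, z, w are successive second coordinates along a chain of neighbours,
  and Q bounds them. If x = Q \<ge> 2, then y is negative; the equation for z bounds z from above
  and the equation for w bounds A z from below, and under 2A < B + 3 both can hold only in two
  exceptional patterns.\<close>

lemma int_recurrence_bound:
  fixes A B Q x y z w k k' :: int
  assumes A: "1 \<le> A" "A \<le> B" "2 \<le> B" "2 * A < B + 3"
    and bnd: "\<bar>x\<bar> \<le> Q" "\<bar>y\<bar> \<le> Q" "\<bar>z\<bar> \<le> Q" "\<bar>w\<bar> \<le> Q"
    and k: "\<bar>k\<bar> \<le> B - 1" "\<bar>k'\<bar> \<le> B - 1"
    and rec: "z = k - A * y - B * x" "w = k' - A * z - B * y" and x: "x = Q" and Q: "2 \<le> Q"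
  shows "(A = 2 \<and> B = 2) \<or> (A = 3 \<and> B = 4 \<and> Q = 2 \<and> y = -2 \<and> z = 1 \<and> w = 2)"
proof -
  have 1: "A * y \<le> B - 1 - B * Q + Q" using rec(1) bnd(3) k(1) unfolding x abs_le_iff by linarith
  have Bq: "B * Q \<ge> 2 * B + (Q - 2) * 2"
  proof -
    have "0 \<le> (B - 2) * (Q - 2)" using A Q by simp
    then show ?thesis by (simp add: algebra_simps)
  qed
  have "A * y \<le> -1"
  proof -
    have "0 \<le> (B - 1) * (Q - 2)" using A Q by simp
    then show ?thesis using 1 A by (simp add: algebra_simps)
  qed
  have y: "y \<le> -1"
  proof (rule ccontr)
    assume "\<not> y \<le> -1"
    then have "0 \<le> A * y" using A by simp
    then show False using \<open>A * y \<le> -1\<close> by simp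
  qed
  define m where "m = - y"
  have m: "1 \<le> m" "m \<le> Q" "y = - m" using y bnd(2) by (auto simp: m_def)
  have 2: "z \<le> B - 1 - B * Q + A * m" using rec(1) k(1) unfolding x m(3) abs_le_iff mult_minus_right by linarith
  have 3: "B * m - (B - 1) - Q \<le> A * z" using rec(2) k(2) bnd(4) unfolding m(3) abs_le_iff mult_minus_right by linarith
  have 4: "A * z \<le> A * (B - 1 - B * Q + A * m)" using 2 A by (intro mult_left_mono) auto
  have 5: "Q * (A * B - 1) \<le> (A + 1) * (B - 1) + (A * A - B) * m"
    using 3 4 by (simp add: algebra_simps)
  show ?thesis
  \<comment> \<open>The sign of A^2 - B decides whether the inequality is weakest at m = 1 or at m =
    Q.\<close>
  proof (cases "A * A \<le> B")
    case True
    have t: "(B - A * A) * 1 \<le> (B - A * A) * m" using True m by (intro mult_left_mono) auto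
    have "1 * 1 \<le> A * B" using A by (intro mult_mono) auto
    then have "2 * (A * B - 1) \<le> Q * (A * B - 1)" using Q by (intro mult_right_mono) auto
    then have "2 * (A * B - 1) \<le> (A + 1) * (B - 1) - (B - A * A)" using 5 t by (simp add: algebra_simps)
    then have "A * B + A \<le> A * A + 1" by (simp add: algebra_simps)
    then have "A * (B + 1 - A) \<le> 1" by (simp add: algebra_simps)
    moreover have "1 * 1 \<le> A * (B + 1 - A)" using A by (intro mult_mono) auto
    ultimately have "A * (B + 1 - A) = 1" by simp
    then have "A = 1" "B + 1 - A = 1" using A by (auto simp: zmult_eq_1_iff)
    then show ?thesis using A by auto
  next
    case False
    then have "(A * A - B) * m \<le> (A * A - B) * Q" using m by (intro mult_left_mono) auto
    then have 6: "Q * ((A + 1) * (B - A + 1) - 2) \<le> (A + 1) * (B - 1)" using 5 by (simp add: algebra_simps)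
    have pos: "0 \<le> (A + 1) * (B - A + 1) - 2"
    proof -
      have "2 * 1 \<le> (A + 1) * (B - A + 1)" using A by (intro mult_mono) auto
      then show ?thesis by simp
    qed
    have "2 * ((A + 1) * (B - A + 1) - 2) \<le> Q * ((A + 1) * (B - A + 1) - 2)" using Q pos by (intro mult_right_mono) auto
    then have 7: "(A + 1) * (B - 2 * A + 3) \<le> 4" using 6 by (simp add: algebra_simps)
    have A2: "2 \<le> A"
    proof (rule ccontr)
      assume "\<not> 2 \<le> A" then have "A = 1" using A by simp
      then show False using False A by simp
    qed
    have e1: "1 \<le> B - 2 * A + 3" using A by simp
    have "(A + 1) * 1 \<le> (A + 1) * (B - 2 * A + 3)" using e1 A by (intro mult_left_mono) auto
    from order_trans[OF this 7] have A3: "A = 2 \<or> A = 3" using A2 by auto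
    then show ?thesis
    proof
      assume "A = 2" then show ?thesis using 7 False A by auto
    next
      assume a3: "A = 3"
      then have b4: "B = 4" using 7 A by auto
      have "Q = 2" using 6 a3 b4 Q by simp
      moreover have "m = 2" using 5 a3 b4 \<open>Q = 2\<close> m by simp
      ultimately have "z \<le> 1" "6 \<le> 3 * z + 3" using 2 3 a3 b4 by auto
      then have "z = 1" by simp
      moreover have "w \<ge> 2" using rec(2) k a3 b4 \<open>z = 1\<close> m \<open>m = 2\<close> by (simp add: abs_le_iff)
      ultimately show ?thesis using a3 b4 \<open>Q = 2\<close> \<open>m = 2\<close> m bnd by auto
    qed
  qed
qed

text \<open>For A = B = 2 the polynomial t^2 + 2 t + 2 of the recurrence divides t^4 + 4, so three
  consecutive relations combine into one between v, the digits and 4 Q. It gives 4 Q \<le> Q +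
  5.\<close>

lemma int_recurrence_bound_22:
  fixes Q x y z w v k k' k'' :: int
  assumes bnd: "\<bar>x\<bar> \<le> Q" "\<bar>y\<bar> \<le> Q" "\<bar>z\<bar> \<le> Q" "\<bar>w\<bar> \<le> Q" "\<bar>v\<bar> \<le> Q"
    and k: "\<bar>k\<bar> \<le> 1" "\<bar>k'\<bar> \<le> 1" "\<bar>k''\<bar> \<le> 1"
    and rec: "z = k - 2 * y - 2 * x" "w = k' - 2 * z - 2 * y" "v = k'' - 2 * w - 2 * z" and x: "x = Q"
  shows "Q \<le> 1"
proof -
  have "v = k'' - 2 * k' + 2 * k - 4 * Q" using rec x by simp
  then show ?thesis using bnd(5) k unfolding abs_le_iff by linarith
qed

definition neighbour_vec :: "int \<Rightarrow> int \<times> int \<Rightarrow> bool" where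
  "neighbour_vec A v \<longleftrightarrow> v \<in> {(0,0), (1,0), (-1,0), (A,1), (-A,-1), (A-1,1), (1-A,-1)}"

text \<open>V stands for the lattice vectors whose translates of S meet S, and k for a difference of
  two digits. Once all heights are at most 1, two consecutive heights q and r give back the first
  coordinate as p = r + A q.\<close>

lemma neighbour_set_bound:
  fixes A B :: int and V :: "(int \<times> int) set"
  assumes A: "1 \<le> A" "A \<le> B" "2 \<le> B" "2 * A < B + 3"
    and V: "finite V" "\<And>p q. (p, q) \<in> V \<Longrightarrow> (-p, -q) \<in> V"
      "\<And>p q. (p, q) \<in> V \<Longrightarrow> \<exists>k. \<bar>k\<bar> \<le> B - 1 \<and> (k - B * q, p - A * q) \<in> V"
    and v: "v \<in> V"
  shows "neighbour_vec A v"
proof -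
  define Q where "Q = Max ((\<lambda>v. \<bar>snd v\<bar>) ` V)"
  have Qb: "\<bar>q\<bar> \<le> Q" if "(p, q) \<in> V" for p q
    unfolding Q_def using V(1) that by (intro Max_ge) force+
  have "Q \<in> (\<lambda>v. \<bar>snd v\<bar>) ` V" unfolding Q_def using V(1) v by (intro Max_in) auto
  then obtain p0 where p0: "(p0, Q) \<in> V"
  proof -
    assume "Q \<in> (\<lambda>v. \<bar>snd v\<bar>) ` V"
    then obtain p q where "(p, q) \<in> V" "Q = \<bar>q\<bar>" by force
    then have "(p, Q) \<in> V \<or> (-p, Q) \<in> V" using V(2)[of p q] by (cases "0 \<le> q") auto
    then show thesis using that by blast
  qed
  have Q1: "Q \<le> 1"
  proof (rule ccontr)
    assume "\<not> Q \<le> 1"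
    then have Q2: "2 \<le> Q" by simp
    obtain k1 where k1: "\<bar>k1\<bar> \<le> B - 1" "(k1 - B * Q, p0 - A * Q) \<in> V" using V(3)[OF p0] by blast
    define y where "y = p0 - A * Q"
    obtain k2 where k2: "\<bar>k2\<bar> \<le> B - 1" "(k2 - B * y, k1 - B * Q - A * y) \<in> V" using V(3)[OF k1(2)] by (auto simp: y_def)
    define z where "z = k1 - B * Q - A * y"
    obtain k3 where k3: "\<bar>k3\<bar> \<le> B - 1" "(k3 - B * z, k2 - B * y - A * z) \<in> V" using V(3)[OF k2(2)] by (auto simp: z_def)
    define w where "w = k2 - B * y - A * z"
    obtain k4 where k4: "\<bar>k4\<bar> \<le> B - 1" "(k4 - B * w, k3 - B * z - A * w) \<in> V" using V(3)[OF k3(2)] by (auto simp: w_def)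
    define u where "u = k3 - B * z - A * w"
    have bs: "\<bar>y\<bar> \<le> Q" "\<bar>z\<bar> \<le> Q" "\<bar>w\<bar> \<le> Q" "\<bar>u\<bar> \<le> Q"
      using Qb[OF k1(2)] Qb[OF k2(2)] Qb[OF k3(2)] Qb[OF k4(2)] by (auto simp: y_def z_def w_def u_def)
    have "(A = 2 \<and> B = 2) \<or> (A = 3 \<and> B = 4 \<and> Q = 2 \<and> y = -2 \<and> z = 1 \<and> w = 2)"
    proof (rule int_recurrence_bound[OF A _ bs(1-3) k1(1) k2(1) _ _ refl Q2])
      show "\<bar>Q\<bar> \<le> Q" using Q2 by simp
      show "z = k1 - A * y - B * Q" "w = k2 - A * z - B * y" by (simp_all add: z_def w_def)
    qed
    then show False
    proof
      assume "A = 2 \<and> B = 2"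
      then have ab: "A = 2" "B = 2" by auto
      have "Q \<le> 1"
      proof (rule int_recurrence_bound_22[OF _ bs])
        show "\<bar>Q\<bar> \<le> Q" using Q2 by simp
        show "\<bar>k1\<bar> \<le> 1" "\<bar>k2\<bar> \<le> 1" "\<bar>k3\<bar> \<le> 1" using k1(1) k2(1) k3(1) ab by auto
        show "z = k1 - 2 * y - 2 * Q" "w = k2 - 2 * z - 2 * y" "u = k3 - 2 * w - 2 * z"
          unfolding z_def w_def u_def ab by simp_all
      qed simp
      then show False using Q2 by simp
    next
      assume "A = 3 \<and> B = 4 \<and> Q = 2 \<and> y = -2 \<and> z = 1 \<and> w = 2"
      \<comment> \<open>The exceptional pattern for A = 3, B = 4 determines the next height up to
        its digit, and that height is too large.\<close>
      then have "u = k3 - 10" "\<bar>k3\<bar> \<le> 3" "\<bar>u\<bar> \<le> 2" using bs(4) k3(1) by (simp_all add: u_def)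
      then show False by linarith
    qed
  qed
  obtain p q where pq: "v = (p, q)" by (cases v)
  obtain k where k: "\<bar>k\<bar> \<le> B - 1" "(k - B * q, p - A * q) \<in> V" using V(3) v pq by blast
  obtain k' where k': "(k' - B * (p - A * q), k - B * q - A * (p - A * q)) \<in> V" using V(3)[OF k(2)] by blast
  define r where "r = p - A * q"
  have b: "\<bar>q\<bar> \<le> 1" "\<bar>r\<bar> \<le> 1" "\<bar>k - B * q - A * r\<bar> \<le> 1"
    using Qb[of p q] Qb[OF k(2)] Qb[OF k'] v pq Q1 by (auto simp: r_def)
  have qs: "q = -1 \<or> q = 0 \<or> q = 1" "r = -1 \<or> r = 0 \<or> r = 1" using b by auto
  have "\<not> (q = 1 \<and> r = 1)"
  proof
    assume "q = 1 \<and> r = 1"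
    then have "\<bar>k - B - A\<bar> \<le> 1" using b(3) by simp
    then show False using k(1) A by linarith
  qed
  moreover have "\<not> (q = -1 \<and> r = -1)"
  proof
    assume "q = -1 \<and> r = -1"
    then have "\<bar>k + B + A\<bar> \<le> 1" using b(3) by simp
    then show False using k(1) A by linarith
  qed
  moreover have "p = r + A * q" by (simp add: r_def)
  ultimately show ?thesis using qs pq unfolding neighbour_vec_def by (elim disjE) simp_all
qed

definition lv :: "int \<Rightarrow> int \<Rightarrow> real \<times> real" where "lv p q = (of_int p, of_int q)"

lemma lv_simps [simp]: "lv 0 0 = 0" "fst (lv p q) = of_int p" "snd (lv p q) = of_int q"
  by (simp_all add: lv_def zero_prod_def)

lemma lv_add: "lv (p + p') (q + q') = lv p q + lv p' q'" and lv_diff: "lv (p - p') (q - q') = lv p q - lv p' q'"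
  and lv_minus: "lv (- p) (- q) = - lv p q"
  by (simp_all add: lv_def)

lemma gmap_diff_lv: "gmap A B (x - lv p q) = gmap A B x - lv (- B * q) (p - A * q)"
  by (simp add: gmap_def lv_def prod_eq_iff algebra_simps)

lemma gmap_minus: "gmap A B (- x) = lv (B - 1) 0 - gmap A B x"
  by (simp add: gmap_def lv_def prod_eq_iff field_simps)

text \<open>By \<open>S_rec\<close> the set g S is the union of the B translates of S by (0, 0),
  ..., (B - 1, 0). These digits form a complete residue system, so S is a self-affine lattice
  tile.\<close>

locale lattice_tile = tile_gauge +
  fixes S :: "(real \<times> real) set"
  assumes S_compact: "compact S" and S_ne: "S \<noteq> {}" and S_sym: "\<And>x. x \<in> S \<Longrightarrow> - x \<in> S"
    and S_rec: "\<And>x. x \<in> S \<longleftrightarrow> (\<exists>k\<in>{0..B-1}. gmap A B x - lv k 0 \<in> S)"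
begin

abbreviation "g \<equiv> gmap A B"
abbreviation "gi \<equiv> ginv A B"

lemma g_gi [simp]: "g (gi x) = x" and gi_g [simp]: "gi (g x) = x"
  using B2 by (auto simp: gmap_ginv ginv_gmap)

lemma g_inj: "g x = g y \<Longrightarrow> x = y" by (metis gi_g)

lemma inj_gi: "gi x = gi y \<Longrightarrow> x = y" by (metis g_gi)

definition inS :: "real \<times> real \<Rightarrow> int \<Rightarrow> int \<Rightarrow> bool" where "inS x p q \<longleftrightarrow> x - lv p q \<in> S"

lemma inS_00 [simp]: "inS x 0 0 \<longleftrightarrow> x \<in> S" by (simp add: inS_def)

text \<open>The rule behind all later computations: membership in a translate is passed on to g x at
  a position shifted by a digit, so that impossible contacts show up as integer
  inequalities.\<close>

lemma inS_rec: "inS x p q \<longleftrightarrow> (\<exists>k\<in>{0..B-1}. inS (g x) (k - B * q) (p - A * q))"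
proof -
  have "g (x - lv p q) - lv k 0 = g x - lv (k - B * q) (p - A * q)" for k
    unfolding gmap_diff_lv by (simp add: lv_def prod_eq_iff)
  then show ?thesis unfolding inS_def by (subst S_rec) simp
qed

lemma inS_shift: "inS (x - lv a b) p q \<longleftrightarrow> inS x (p + a) (q + b)"
  by (simp add: inS_def lv_add algebra_simps)

lemma inS_minus: "inS (- x) p q \<longleftrightarrow> inS x (- p) (- q)"
proof -
  have "- x - lv p q = - (x - lv (-p) (-q))" by (simp add: lv_minus)
  then show ?thesis unfolding inS_def using S_sym[of "x - lv (-p) (-q)"] S_sym[of "- (x - lv (-p) (-q))"] by (simp only: minus_minus) blast
qed

lemma inS_bounded: obtains R where "0 < R" "\<And>x p q. inS x p q \<Longrightarrow> norm (x - lv p q) \<le> R"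
proof -
  obtain R where R: "R > 0" "\<forall>x\<in>S. norm x \<le> R" using S_compact compact_imp_bounded bounded_pos by metis
  then show thesis using that[of R] by (auto simp: inS_def)
qed

lemma finite_lattice_ball: "finite {(p,q). norm (x - lv p q) \<le> R}"
proof (rule finite_subset)
  show "{(p,q). norm (x - lv p q) \<le> R} \<subseteq> {\<lfloor>fst x - R\<rfloor>..\<lceil>fst x + R\<rceil>} \<times> {\<lfloor>snd x - R\<rfloor>..\<lceil>snd x + R\<rceil>}"
  proof clarify
    fix p q assume "norm (x - lv p q) \<le> R"
    moreover have "\<bar>fst x - of_int p\<bar> \<le> norm (x - lv p q)" "\<bar>snd x - of_int q\<bar> \<le> norm (x - lv p q)"
      using norm_fst_le[of "fst (x - lv p q)" "snd (x - lv p q)"] norm_snd_le[of "snd (x - lv p q)" "fst (x - lv p q)"]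
      unfolding prod.collapse by (simp_all add: fst_diff snd_diff)
    ultimately have "fst x - R \<le> p" "p \<le> fst x + R" "snd x - R \<le> q" "q \<le> snd x + R" by (simp_all add: abs_le_iff)
    then show "p \<in> {\<lfloor>fst x - R\<rfloor>..\<lceil>fst x + R\<rceil>} \<and> q \<in> {\<lfloor>snd x - R\<rfloor>..\<lceil>snd x + R\<rceil>}"
      by (auto simp: floor_le_iff le_ceiling_iff)
  qed
qed simp

text \<open>Local finiteness: near a point only finitely many lattice positions matter, and each
  carries finitely many of the sets.\<close>

lemma closed_lattice_union:
  assumes X: "\<And>i. i \<in> I \<Longrightarrow> compact (X i)" and near: "\<And>i x. i \<in> I \<Longrightarrow> x \<in> X i \<Longrightarrow> inS x (fst (v i)) (snd (v i))"
    and fin: "\<And>w. finite {i \<in> I. v i = w}"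
  shows "closed (\<Union>i\<in>I. X i)"
proof -
  obtain R where R: "\<And>x p q. inS x p q \<Longrightarrow> norm (x - lv p q) \<le> R" using inS_bounded by metis
  note [simp del] = split_paired_Ex split_paired_All
  show ?thesis unfolding closed_limpt islimpt_approachable
  proof (intro allI impI)
    fix y assume y: "\<forall>e>0. \<exists>x\<in>\<Union>i\<in>I. X i. x \<noteq> y \<and> dist x y < e"
    define I' where "I' = {i\<in>I. norm (y - lv (fst (v i)) (snd (v i))) \<le> R + 1}"
    have "I' \<subseteq> (\<Union>w\<in>{(p,q). norm (y - lv p q) \<le> R + 1}. {i \<in> I. v i = w})" by (auto simp: I'_def)
    then have "finite I'" using finite_lattice_ball[of y "R+1"] fin by (meson finite_UN_I finite_subset)
    then have cl: "closed (\<Union>i\<in>I'. X i)" using X compact_imp_closed by (intro closed_UN) (auto simp: I'_def)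
    have "y \<in> (\<Union>i\<in>I'. X i)"
    proof (rule closed_approachable[THEN iffD1, OF cl], intro allI impI)
      fix e :: real assume "0 < e"
      then obtain x i where x: "i \<in> I" "x \<in> X i" "dist x y < min e 1" using y[rule_format, of "min e 1"] by auto
      have "norm (y - lv (fst (v i)) (snd (v i))) \<le> norm (y - x) + norm (x - lv (fst (v i)) (snd (v i)))"
        using norm_triangle_ineq[of "y - x" "x - lv (fst (v i)) (snd (v i))"] by simp
      then have "i \<in> I'" using x R[OF near[OF x(1,2)]] by (auto simp: I'_def dist_norm norm_minus_commute)
      then show "\<exists>x\<in>\<Union>i\<in>I'. X i. dist x y < e" using x by auto
    qed
    then show "y \<in> (\<Union>i\<in>I. X i)" by (auto simp: I'_def)
  qed
qed

lemma compact_translate: "compact X \<Longrightarrow> compact {x. x - w \<in> X}" for X :: "(real \<times> real) set"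
proof -
  assume "compact X"
  then have "compact ((\<lambda>x. x + w) ` X)" by (intro compact_continuous_image continuous_intros)
  moreover have "(\<lambda>x. x + w) ` X = {x. x - w \<in> X}" by (auto simp: image_iff) (metis diff_add_cancel)
  ultimately show ?thesis by simp
qed

text \<open>The union W of all translates is closed, and gi maps it into itself because the digits
  represent all residues modulo B. Every point of the plane is within a fixed gauge distance of W,
  and n applications of gi reduce this distance by \<open>lam ^ n\<close>.\<close>

lemma covering: "\<exists>p q. inS x p q"
proof -
  define W where "W = (\<Union>i\<in>UNIV. {x. inS x (fst i) (snd i)})"
  have cW: "closed W" unfolding W_def
  proof (rule closed_lattice_union[of _ _ id])
    show "compact {x. inS x (fst i) (snd i)}" for i unfolding inS_def by (rule compact_translate[OF S_compact])
  qed (auto intro: finite_subset[of _ "{w}" for w])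
  have pull: "gi w \<in> W" if w: "w \<in> W" for w
  proof -
    obtain p q where pq: "inS w p q" using w by (auto simp: W_def)
    define q' where "q' = - (p div B)"
    have "p = p mod B - B * q'" using B2 by (simp add: q'_def)
    moreover have "p mod B \<in> {0..B-1}" using B2 by (simp add: pos_mod_bound pos_mod_sign le_diff_iff)
    ultimately have "inS (g (gi w)) (p mod B - B * q') (q + A * q' - A * q')" "p mod B \<in> {0..B-1}" using pq by auto
    then have "inS (gi w) (q + A * q') q'" by (subst inS_rec) blast
    then show ?thesis by (force simp: W_def)
  qed
  obtain s0 where s0: "s0 \<in> S" using S_ne by blast
  obtain E where E: "\<And>a b. a \<in> cball 0 2 \<Longrightarrow> b \<in> S \<Longrightarrow> N (a - b) \<le> E"
    using gauge_bounded[OF bounded_cball compact_imp_bounded[OF S_compact]] by metis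
  have "\<exists>w\<in>W. N (y - w) \<le> lam ^ n * E" for n y
  proof (induction n arbitrary: y)
    case 0
    define p q where "p = \<lfloor>fst y\<rfloor>" and "q = \<lfloor>snd y\<rfloor>"
    have "norm (y - lv p q) \<le> \<bar>fst y - p\<bar> + \<bar>snd y - q\<bar>" using norm_Pair_le[of "fst (y - lv p q)" "snd (y - lv p q)"] unfolding prod.collapse by (simp add: fst_diff snd_diff)
    also have "\<dots> \<le> 2" unfolding p_def q_def by linarith
    finally have "N ((y - lv p q) - s0) \<le> E" using s0 by (intro E) auto
    moreover have "inS (s0 + lv p q) p q" using s0 by (simp add: inS_def)
    then have "s0 + lv p q \<in> W" unfolding W_def by (intro UN_I[of "(p,q)"]) auto
    ultimately show ?case by (auto simp: algebra_simps intro!: bexI[of _ "s0 + lv p q"])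
  next
    case (Suc n)
    obtain w where w: "w \<in> W" "N (g y - w) \<le> lam ^ n * E" using Suc[of "g y"] by blast
    have "N (y - gi w) \<le> lam * N (g y - w)" using contr[of "g y" w] by simp
    also have "\<dots> \<le> lam * (lam ^ n * E)" using w(2) lam(1) by (rule mult_left_mono)
    finally show ?case using pull[OF w(1)] by (auto simp: mult.assoc)
  qed
  then have "x \<in> W" using closed_mem_if_gauge_small[OF cW] by blast
  then show ?thesis by (auto simp: W_def)
qed

text \<open>Pulling any point of S back along the digits of a bounded orbit approaches the start of
  the orbit geometrically. Periodic orbits thereby exhibit explicit common points of several
  tiles.\<close>

lemma orbit_mem:
  assumes bdd: "bounded (range z)" and orb: "\<And>n::nat. \<exists>k\<in>{0..B-1}. g (z n) - lv k 0 = z (Suc n)"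
  shows "z 0 \<in> S"
proof -
  obtain s0 where s0: "s0 \<in> S" using S_ne by blast
  obtain E where E: "\<And>a b. a \<in> range z \<Longrightarrow> b \<in> S \<Longrightarrow> N (a - b) \<le> E"
    using gauge_bounded[OF bdd compact_imp_bounded[OF S_compact]] by metis
  have "\<exists>s\<in>S. N (z m - s) \<le> lam ^ n * E" for n m
  proof (induction n arbitrary: m)
    case 0 then show ?case using E[of "z m" s0] s0 by (metis mult_1 power_0 rangeI)
  next
    case (Suc n)
    obtain s where s: "s \<in> S" "N (z (Suc m) - s) \<le> lam ^ n * E" using Suc by blast
    obtain k where k: "k \<in> {0..B-1}" "g (z m) - lv k 0 = z (Suc m)" using orb by blast
    define s' where "s' = gi (s + lv k 0)"
    have "g s' - lv k 0 \<in> S" using s(1) by (simp add: s'_def)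
    then have "s' \<in> S" using k(1) by (subst S_rec) blast
    have "N (z m - s') \<le> lam * N (g (z m) - (s + lv k 0))" unfolding s'_def using contr[of "g (z m)" "s + lv k 0"] by simp
    also have "g (z m) - (s + lv k 0) = z (Suc m) - s" using k(2) by (simp add: algebra_simps)
    also have "lam * N (z (Suc m) - s) \<le> lam * (lam ^ n * E)" using s(2) lam(1) by (rule mult_left_mono)
    finally show ?case using \<open>s' \<in> S\<close> by (auto simp: mult.assoc)
  qed
  then show ?thesis using closed_mem_if_gauge_small[OF compact_imp_closed[OF S_compact]] by blast
qed

lemma cycle3_mem:
  assumes "g z0 - lv k0 0 = z1" "g z1 - lv k1 0 = z2" "g z2 - lv k2 0 = z0" "k0 \<in> {0..B-1}" "k1 \<in> {0..B-1}" "k2 \<in> {0..B-1}"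
  shows "z0 \<in> S" "z1 \<in> S" "z2 \<in> S"
proof -
  have gen: "y0 \<in> S" if "g y0 - lv l0 0 = y1" "g y1 - lv l1 0 = y2" "g y2 - lv l2 0 = y0" "l0 \<in> {0..B-1}" "l1 \<in> {0..B-1}" "l2 \<in> {0..B-1}"
    for y0 y1 y2 l0 l1 l2
  proof -
    define z where "z = (\<lambda>n::nat. if n mod 3 = 0 then y0 else if n mod 3 = 1 then y1 else y2)"
    have "z 0 \<in> S"
    proof (rule orbit_mem)
      have "range z \<subseteq> {y0,y1,y2}" by (auto simp: z_def)
      then show "bounded (range z)" by (meson bounded_subset finite.emptyI finite_imp_bounded finite_insert)
      fix n
      have "n mod 3 = 0 \<and> Suc n mod 3 = 1 \<or> n mod 3 = 1 \<and> Suc n mod 3 = 2 \<or> n mod 3 = 2 \<and> Suc n mod 3 = 0" by presburger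
      then show "\<exists>k\<in>{0..B-1}. g (z n) - lv k 0 = z (Suc n)" using that by (auto simp: z_def)
    qed
    then show ?thesis by (simp add: z_def)
  qed
  show "z0 \<in> S" by (rule gen[OF assms])
  show "z1 \<in> S" by (rule gen[OF assms(2,3,1) assms(5,6,4)])
  show "z2 \<in> S" by (rule gen[OF assms(3,1,2) assms(6,4,5)])
qed

definition nbrs :: "(int \<times> int) set" where "nbrs = {(p,q). \<exists>x. x \<in> S \<and> inS x p q}"

lemma nbrs_finite: "finite nbrs"
proof -
  obtain R where R: "R > 0" "\<And>x p q. inS x p q \<Longrightarrow> norm (x - lv p q) \<le> R" using inS_bounded by blast
  have "nbrs \<subseteq> {(p,q). norm (0 - lv p q) \<le> 2 * R}"
  proof clarify
    fix p q assume "(p, q) \<in> nbrs"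
    then obtain x where x: "x \<in> S" "inS x p q" by (auto simp: nbrs_def)
    have "norm x \<le> R" using R(2)[of x 0 0] x by simp
    moreover have "norm (lv p q) \<le> norm x + norm (x - lv p q)" using norm_triangle_ineq4[of x "x - lv p q"] by simp
    ultimately show "norm (0 - lv p q) \<le> 2 * R" using R(2)[OF x(2)] by simp
  qed
  then show ?thesis using finite_lattice_ball finite_subset by blast
qed

lemma nbrs_minus: assumes "(p,q) \<in> nbrs" shows "(-p,-q) \<in> nbrs"
proof -
  obtain x where x: "x \<in> S" "inS x p q" using assms by (auto simp: nbrs_def)
  then have "x - lv p q \<in> S" "inS (x - lv p q) (-p) (-q)" unfolding inS_shift by (simp_all add: inS_def)
  then show ?thesis unfolding nbrs_def by blast
qed

text \<open>A common point of S and S + (p, q) lies in a subtile of each; these two subtiles touch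
  again, and k is the difference of their digits.\<close>

lemma nbrs_step: assumes "(p,q) \<in> nbrs" shows "\<exists>k. \<bar>k\<bar> \<le> B - 1 \<and> (k - B * q, p - A * q) \<in> nbrs"
proof -
  obtain x where x: "inS x 0 0" "inS x p q" using assms by (auto simp: nbrs_def)
  obtain j where j: "j \<in> {0..B-1}" "inS (g x) j 0" using x(1)[unfolded inS_rec[of x 0 0]] by auto
  obtain k where k: "k \<in> {0..B-1}" "inS (g x) (k - B * q) (p - A * q)" using x(2)[unfolded inS_rec[of x p q]] by auto
  define y where "y = g x - lv j 0"
  have "inS y 0 0" "inS y (k - j - B * q) (p - A * q)" unfolding y_def inS_shift using j k by (auto simp: algebra_simps)
  then have "(k - j - B * q, p - A * q) \<in> nbrs" unfolding nbrs_def inS_00 by blast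
  then show ?thesis using j k by (intro exI[of _ "k - j"]) auto
qed

lemma inS_nbrs: assumes "inS x p q" "inS x p' q'" shows "(p' - p, q' - q) \<in> nbrs"
proof -
  have "inS (x - lv p q) 0 0" "inS (x - lv p q) (p' - p) (q' - q)" unfolding inS_shift using assms by simp_all
  then show ?thesis unfolding nbrs_def inS_00 by blast
qed

end

section \<open>The crystallographic tile as half of the lattice tile\<close>

locale half_tile = lattice_tile +
  fixes T :: "(real \<times> real) set"
  assumes T_compact: "compact T" and S_T: "\<And>x. x \<in> S \<longleftrightarrow> x \<in> T \<or> - x \<in> T"
begin

text \<open>\<open>inT\<close> and \<open>inU\<close> describe the tiles T + (p, q) and (p, q) - T,
  that is, all images of T under the group generated by the lattice translations and the
  half-turn.\<close>

definition inT :: "real \<times> real \<Rightarrow> int \<Rightarrow> int \<Rightarrow> bool" where "inT x p q \<longleftrightarrow> x - lv p q \<in> T"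
definition inU :: "real \<times> real \<Rightarrow> int \<Rightarrow> int \<Rightarrow> bool" where "inU x p q \<longleftrightarrow> lv p q - x \<in> T"

lemma inT_00 [simp]: "inT x 0 0 \<longleftrightarrow> x \<in> T" and inU_00 [simp]: "inU x 0 0 \<longleftrightarrow> - x \<in> T"
  by (simp_all add: inT_def inU_def)

lemma inS_iff: "inS x p q \<longleftrightarrow> inT x p q \<or> inU x p q"
  unfolding inS_def inT_def inU_def S_T by (simp only: minus_diff_eq)

lemma inT_inS: "inT x p q \<Longrightarrow> inS x p q" and inU_inS: "inU x p q \<Longrightarrow> inS x p q" by (auto simp: inS_iff)

lemma inT_shift: "inT (x - lv a b) p q \<longleftrightarrow> inT x (p + a) (q + b)"
  and inU_shift: "inU (x - lv a b) p q \<longleftrightarrow> inU x (p + a) (q + b)"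
  by (simp_all add: inT_def inU_def lv_add algebra_simps)

lemma inT_minus: "inT (- x) p q \<longleftrightarrow> inU x (- p) (- q)" and inU_minus: "inU (- x) p q \<longleftrightarrow> inT x (- p) (- q)"
proof -
  have "- x - lv p q = lv (-p) (-q) - x" by (simp add: lv_minus)
  then show "inT (- x) p q \<longleftrightarrow> inU x (- p) (- q)" by (simp only: inT_def inU_def)
  have "lv p q - - x = x - lv (-p) (-q)" by (simp add: lv_minus)
  then show "inU (- x) p q \<longleftrightarrow> inT x (- p) (- q)" by (simp only: inT_def inU_def)
qed

lemma inT_reflect: "inT (lv a b - x) p q \<longleftrightarrow> inU x (a - p) (b - q)"
  and inU_reflect: "inU (lv a b - x) p q \<longleftrightarrow> inT x (a - p) (b - q)"
  and inS_reflect: "inS (lv a b - x) p q \<longleftrightarrow> inS x (a - p) (b - q)"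
proof -
  have e: "lv a b - x = - x - lv (-a) (-b)" by (simp add: lv_minus)
  show "inT (lv a b - x) p q \<longleftrightarrow> inU x (a - p) (b - q)" "inU (lv a b - x) p q \<longleftrightarrow> inT x (a - p) (b - q)"
    "inS (lv a b - x) p q \<longleftrightarrow> inS x (a - p) (b - q)"
    unfolding e inT_shift inU_shift inS_shift inT_minus inU_minus inS_minus by (simp_all add: algebra_simps)
qed

lemma inS_plus: "inS (x + lv a b) p q \<longleftrightarrow> inS x (p - a) (q - b)"
  and inT_plus: "inT (x + lv a b) p q \<longleftrightarrow> inT x (p - a) (q - b)"
  and inU_plus: "inU (x + lv a b) p q \<longleftrightarrow> inU x (p - a) (q - b)"
proof -
  have e: "x + lv a b = x - lv (-a) (-b)" by (simp add: lv_minus)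
  show "inS (x + lv a b) p q \<longleftrightarrow> inS x (p - a) (q - b)" "inT (x + lv a b) p q \<longleftrightarrow> inT x (p - a) (q - b)"
    "inU (x + lv a b) p q \<longleftrightarrow> inU x (p - a) (q - b)"
    unfolding e inT_shift inU_shift inS_shift by simp_all
qed

end

text \<open>Digit 0 and the half-turn of the defining equation are merged into the single
  alternative \<open>gmap A B x\<close> in S, because T together with -T is S.\<close>

locale crystile = half_tile +
  assumes T_rec: "\<And>x. x \<in> T \<longleftrightarrow> gmap A B x \<in> S \<or> (\<exists>k\<in>{1..B-2}. gmap A B x - lv k 0 \<in> T)"
begin

lemma inT_rec: "inT x p q \<longleftrightarrow> inS (g x) (- B * q) (p - A * q) \<or> (\<exists>k\<in>{1..B-2}. inT (g x) (k - B * q) (p - A * q))"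
proof -
  have e: "g (x - lv p q) - lv k 0 = g x - lv (k - B * q) (p - A * q)" for k
    unfolding gmap_diff_lv by (simp add: lv_def prod_eq_iff)
  show ?thesis unfolding inT_def inS_def T_rec[of "x - lv p q"] e unfolding gmap_diff_lv ..
qed

text \<open>The half-turn reverses the order of the digits, k becoming B - 1 - k, so the S-piece
  moves to the other end.\<close>

lemma inU_rec: "inU x p q \<longleftrightarrow> inS (g x) (B - 1 - B * q) (p - A * q) \<or> (\<exists>k\<in>{1..B-2}. inU (g x) (k - B * q) (p - A * q))"
proof -
  have g: "g (- x) = lv (B-1) 0 - g x" by (rule gmap_minus)
  have "inU x p q \<longleftrightarrow> inT (- x) (-p) (-q)" by (simp add: inT_minus)
  also have "\<dots> \<longleftrightarrow> inS (g (-x)) (B * q) (A * q - p) \<or> (\<exists>k\<in>{1..B-2}. inT (g (-x)) (k + B * q) (A * q - p))"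
    by (subst inT_rec) simp
  also have "\<dots> \<longleftrightarrow> inS (g x) (B - 1 - B * q) (p - A * q) \<or> (\<exists>k\<in>{1..B-2}. inU (g x) (B - 1 - (k + B * q)) (p - A * q))"
    unfolding g inS_reflect inT_reflect by simp
  also have "(\<exists>k\<in>{1..B-2}. inU (g x) (B - 1 - (k + B * q)) (p - A * q)) \<longleftrightarrow> (\<exists>k\<in>{1..B-2}. inU (g x) (k - B * q) (p - A * q))"
    (is "?l \<longleftrightarrow> ?r")
  proof
    assume ?l then obtain k where "k \<in> {1..B-2}" "inU (g x) (B - 1 - (k + B * q)) (p - A * q)" by blast
    then show ?r by (intro bexI[of _ "B - 1 - k"]) (auto simp: algebra_simps)
  next
    assume ?r then obtain k where "k \<in> {1..B-2}" "inU (g x) (k - B * q) (p - A * q)" by blast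
    then show ?l by (intro bexI[of _ "B - 1 - k"]) (auto simp: algebra_simps)
  qed
  finally show ?thesis .
qed

end

lemma mem_uminus_image: "x \<in> uminus ` X \<longleftrightarrow> - x \<in> X" for X :: "'a::group_add set"
proof
  assume "x \<in> uminus ` X"
  then obtain y where "y \<in> X" "x = - y" by blast
  then show "- x \<in> X" by simp
next
  assume "- x \<in> X"
  then show "x \<in> uminus ` X" by (intro image_eqI[of _ _ "- x"]) auto
qed

lemma tr_a_pow: "(tr_a ^^ k) p = p + lv (int k) 0"
  by (induction k arbitrary: p) (auto simp: tr_a_def lv_def prod_eq_iff)

lemma digits_eq: assumes "2 \<le> B" shows "digits B = (\<lambda>k p. p + lv k 0) ` {0..B-2} \<union> {uminus}"
proof -
  have c: "rot_c = uminus" by (auto simp: rot_c_def fun_eq_iff prod_eq_iff)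
  have t: "tr_a ^^ k = (\<lambda>p. p + lv (int k) 0)" for k by (simp add: tr_a_pow fun_eq_iff)
  show ?thesis
  proof (cases "3 \<le> B")
    case True
    have "{tr_a ^^ k | k. k \<le> nat (B - 2)} = (\<lambda>k p. p + lv k 0) ` {0..B-2}"
    proof
      show "{tr_a ^^ k | k. k \<le> nat (B - 2)} \<subseteq> (\<lambda>k p. p + lv k 0) ` {0..B-2}"
        using True by (force simp: t)
      show "(\<lambda>k p. p + lv k 0) ` {0..B-2} \<subseteq> {tr_a ^^ k | k. k \<le> nat (B - 2)}"
      proof
        fix f assume "f \<in> (\<lambda>k p. p + lv k 0) ` {0..B-2}"
        then obtain k where k: "0 \<le> k" "k \<le> B - 2" "f = (\<lambda>p. p + lv k 0)" by auto
        then have "f = tr_a ^^ nat k" "nat k \<le> nat (B-2)" by (auto simp: t)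
        then show "f \<in> {tr_a ^^ k | k. k \<le> nat (B - 2)}" by blast
      qed
    qed
    then show ?thesis using True by (simp add: digits_def c)
  next
    case False
    then have "B = 2" using assms by simp
    then show ?thesis by (auto simp: digits_def c fun_eq_iff id_def)
  qed
qed

text \<open>After applying \<open>ginv\<close> the defining equation is the attractor equation for
  the contractions \<open>ginv\<close> composed with the digits, so the definite description in
  \<open>tile\<close> denotes the attractor.\<close>

lemma tile_crystile:
  assumes "tile_gauge N lam c0 c1 A B"
  shows "crystile N lam c0 c1 A B (tile A B \<union> uminus ` tile A B) (tile A B)" "tile A B \<noteq> {}"
proof -
  interpret tile_gauge N lam c0 c1 A B by fact
  have Bn: "B \<noteq> 0" using B2 by simp
  note [simp] = gmap_ginv[OF Bn] ginv_gmap[OF Bn]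
  define fs where "fs = (\<lambda>\<delta>. ginv A B \<circ> \<delta>) ` digits B"
  have inj: "inj \<delta>" if "\<delta> \<in> digits B" for \<delta> using that by (auto simp: digits_eq[OF B2] inj_def)
  have iso: "N (\<delta> p - \<delta> q) = N (p - q)" if "\<delta> \<in> digits B" for \<delta> p q
    using that N_minus[of "p - q"] by (auto simp: digits_eq[OF B2])
  have ex: "\<exists>!X. compact X \<and> X \<noteq> {} \<and> X = (\<Union>f\<in>fs. f ` X)"
  proof (rule attractor_ex1)
    show "finite fs" "fs \<noteq> {}" unfolding fs_def digits_eq[OF B2] using B2 by auto
    show "N (f p - f q) \<le> lam * N (p - q)" if "f \<in> fs" for f p q
    proof -
      obtain \<delta> where d: "\<delta> \<in> digits B" "f = ginv A B \<circ> \<delta>" using \<open>f \<in> fs\<close> by (auto simp: fs_def)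
      then show ?thesis using contr[of "\<delta> p" "\<delta> q"] iso[OF d(1)] by simp
    qed
    show "inj f" if "f \<in> fs" for f
    proof -
      obtain \<delta> where d: "\<delta> \<in> digits B" "f = ginv A B \<circ> \<delta>" using \<open>f \<in> fs\<close> by (auto simp: fs_def)
      have "inj (ginv A B)" by (rule inj_on_inverseI[of _ "gmap A B"]) simp
      then show ?thesis using inj[OF d(1)] d(2) by (simp add: inj_compose)
    qed
  qed
  have eq: "gmap A B ` X = (\<Union>\<delta>\<in>digits B. \<delta> ` X) \<longleftrightarrow> X = (\<Union>f\<in>fs. f ` X)" for X
  proof -
    have "(\<Union>f\<in>fs. f ` X) = ginv A B ` (\<Union>\<delta>\<in>digits B. \<delta> ` X)" unfolding fs_def by (simp add: image_UN image_comp)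
    moreover have e: "ginv A B ` gmap A B ` X = X" by (simp add: image_image)
    moreover have "gmap A B ` ginv A B ` Y = Y" for Y by (simp add: image_image)
    ultimately show ?thesis by (metis (no_types))
  qed
  have "compact (tile A B) \<and> tile A B \<noteq> {} \<and> gmap A B ` tile A B = (\<Union>\<delta>\<in>digits B. \<delta> ` tile A B)"
    unfolding tile_def by (rule theI') (simp only: eq ex)
  then have T: "compact (tile A B)" "tile A B \<noteq> {}" "gmap A B ` tile A B = (\<Union>\<delta>\<in>digits B. \<delta> ` tile A B)" by auto
  define T where "T = tile A B"
  define S where "S = T \<union> uminus ` T"
  have S_T: "x \<in> S \<longleftrightarrow> x \<in> T \<or> - x \<in> T" for x unfolding S_def Un_iff mem_uminus_image ..
  have rec0: "x \<in> T \<longleftrightarrow> (\<exists>k\<in>{0..B-2}. gmap A B x - lv k 0 \<in> T) \<or> - gmap A B x \<in> T" for x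
  proof -
    have "x \<in> T \<longleftrightarrow> gmap A B x \<in> gmap A B ` T"
    proof
      assume "gmap A B x \<in> gmap A B ` T"
      then obtain y where y: "y \<in> T" "gmap A B x = gmap A B y" by blast
      then have "ginv A B (gmap A B x) = ginv A B (gmap A B y)" by simp
      then show "x \<in> T" using y(1) by simp
    qed simp
    also have "\<dots> \<longleftrightarrow> gmap A B x \<in> (\<Union>\<delta>\<in>digits B. \<delta> ` T)" using T(3) by (simp add: T_def)
    also have "\<dots> \<longleftrightarrow> (\<exists>k\<in>{0..B-2}. gmap A B x \<in> (\<lambda>p. p + lv k 0) ` T) \<or> gmap A B x \<in> uminus ` T"
      unfolding digits_eq[OF B2] by auto
    finally have 1: "x \<in> T \<longleftrightarrow> (\<exists>k\<in>{0..B-2}. gmap A B x \<in> (\<lambda>p. p + lv k 0) ` T) \<or> - gmap A B x \<in> T"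
      unfolding mem_uminus_image .
    have "gmap A B x \<in> (\<lambda>p. p + lv k 0) ` T \<longleftrightarrow> gmap A B x - lv k 0 \<in> T" for k
    proof
      assume "gmap A B x \<in> (\<lambda>p. p + lv k 0) ` T"
      then obtain y where "y \<in> T" "gmap A B x = y + lv k 0" by blast
      then show "gmap A B x - lv k 0 \<in> T" by simp
    next
      assume "gmap A B x - lv k 0 \<in> T"
      then show "gmap A B x \<in> (\<lambda>p. p + lv k 0) ` T" by (intro image_eqI[of _ _ "gmap A B x - lv k 0"]) auto
    qed
    then show ?thesis using 1 by simp
  qed
  have T_rec: "x \<in> T \<longleftrightarrow> gmap A B x \<in> S \<or> (\<exists>k\<in>{1..B-2}. gmap A B x - lv k 0 \<in> T)" for x
  proof -
    have "{0..B-2} = insert 0 {1..B-2}" using B2 by auto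
    then show ?thesis unfolding rec0[of x] S_T by auto
  qed
  have T_rec': "- x \<in> T \<longleftrightarrow> gmap A B x - lv (B-1) 0 \<in> S \<or> (\<exists>k\<in>{1..B-2}. - (gmap A B x - lv k 0) \<in> T)" for x
  proof -
    have "- x \<in> T \<longleftrightarrow> lv (B-1) 0 - gmap A B x \<in> S \<or> (\<exists>k\<in>{1..B-2}. lv (B-1) 0 - gmap A B x - lv k 0 \<in> T)"
      unfolding T_rec[of "-x"] gmap_minus ..
    also have "lv (B-1) 0 - gmap A B x \<in> S \<longleftrightarrow> gmap A B x - lv (B-1) 0 \<in> S" unfolding S_T by (auto simp: minus_diff_eq)
    also have "(\<exists>k\<in>{1..B-2}. lv (B-1) 0 - gmap A B x - lv k 0 \<in> T) \<longleftrightarrow> (\<exists>k\<in>{1..B-2}. - (gmap A B x - lv (B-1-k) 0) \<in> T)"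
    proof -
      have "lv (B-1) 0 - gmap A B x - lv k 0 = - (gmap A B x - lv (B-1-k) 0)" for k by (simp add: lv_def prod_eq_iff)
      then show ?thesis by (simp only:)
    qed
    also have "(\<exists>k\<in>{1..B-2}. - (gmap A B x - lv (B-1-k) 0) \<in> T) \<longleftrightarrow> (\<exists>k\<in>{1..B-2}. - (gmap A B x - lv k 0) \<in> T)"
      (is "?l \<longleftrightarrow> ?r")
    proof
      assume ?l then obtain k where "k \<in> {1..B-2}" "- (gmap A B x - lv (B-1-k) 0) \<in> T" by blast
      then show ?r by (intro bexI[of _ "B - 1 - k"]) auto
    next
      assume ?r then obtain k where "k \<in> {1..B-2}" "- (gmap A B x - lv k 0) \<in> T" by blast
      then show ?l by (intro bexI[of _ "B - 1 - k"]) auto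
    qed
    finally show ?thesis .
  qed
  have "crystile N lam c0 c1 A B S T"
  proof (unfold_locales)
    show "compact S" unfolding S_def using T(1) by (intro compact_Un) (auto simp: T_def intro!: compact_continuous_image continuous_intros)
    show "S \<noteq> {}" using T(2) by (simp add: S_def T_def)
    show "- x \<in> S" if "x \<in> S" for x using that unfolding S_T by auto
    show "x \<in> S \<longleftrightarrow> (\<exists>k\<in>{0..B-1}. gmap A B x - lv k 0 \<in> S)" for x
    proof
      assume "x \<in> S"
      then consider "x \<in> T" | "- x \<in> T" unfolding S_T by blast
      then show "\<exists>k\<in>{0..B-1}. gmap A B x - lv k 0 \<in> S"
      proof cases
        case 1
        then show ?thesis unfolding T_rec[of x]
        proof
          assume "gmap A B x \<in> S" then show ?thesis using B2 by (intro bexI[of _ 0]) auto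
        next
          assume "\<exists>k\<in>{1..B-2}. gmap A B x - lv k 0 \<in> T"
          then obtain k where "k \<in> {1..B-2}" "gmap A B x - lv k 0 \<in> T" by blast
          then show ?thesis unfolding S_T by (intro bexI[of _ k]) auto
        qed
      next
        case 2
        then show ?thesis unfolding T_rec'[of x]
        proof
          assume "gmap A B x - lv (B-1) 0 \<in> S" then show ?thesis using B2 by (intro bexI[of _ "B-1"]) auto
        next
          assume "\<exists>k\<in>{1..B-2}. - (gmap A B x - lv k 0) \<in> T"
          then obtain k where "k \<in> {1..B-2}" "- (gmap A B x - lv k 0) \<in> T" by blast
          then show ?thesis unfolding S_T by (intro bexI[of _ k]) auto
        qed
      qed
    next
      assume "\<exists>k\<in>{0..B-1}. gmap A B x - lv k 0 \<in> S"
      then obtain k where k: "k \<in> {0..B-1}" "gmap A B x - lv k 0 \<in> S" by blast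
      consider "k = 0" | "k = B - 1" | "k \<in> {1..B-2}" using k(1) by force
      then show "x \<in> S"
      proof cases
        case 1 then have "x \<in> T" using k(2) unfolding T_rec[of x] by simp
        then show ?thesis unfolding S_T by blast
      next
        case 2 then have "- x \<in> T" using k(2) unfolding T_rec'[of x] by blast
        then show ?thesis unfolding S_T by blast
      next
        case 3
        from k(2) have "gmap A B x - lv k 0 \<in> T \<or> - (gmap A B x - lv k 0) \<in> T" unfolding S_T .
        then have "x \<in> T \<or> - x \<in> T" unfolding T_rec[of x] T_rec'[of x] using 3 by blast
        then show ?thesis unfolding S_T .
      qed
    qed
    show "compact T" using T(1) by (simp add: T_def)
    show "x \<in> S \<longleftrightarrow> x \<in> T \<or> - x \<in> T" for x by (rule S_T)
    show "x \<in> T \<longleftrightarrow> gmap A B x \<in> S \<or> (\<exists>k\<in>{1..B-2}. gmap A B x - lv k 0 \<in> T)" for x by (rule T_rec)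
  qed
  then show "crystile N lam c0 c1 A B (tile A B \<union> uminus ` tile A B) (tile A B)" unfolding S_def T_def .
  show "tile A B \<noteq> {}" by (rule T(2))
qed

definition toC :: "real \<times> real \<Rightarrow> complex" where "toC p = Complex (fst p) (snd p)"

lemma toC_bij: "bij toC"
proof (rule bijI')
  show "toC x = toC y \<longleftrightarrow> x = y" for x y by (auto simp: toC_def prod_eq_iff)
  show "\<exists>x. y = toC x" for y by (rule exI[of _ "(Re y, Im y)"]) (simp add: toC_def)
qed

lemma toC_homeomorphism: "homeomorphism UNIV UNIV toC (\<lambda>z. (Re z, Im z))"
proof
  show "continuous_on UNIV toC" unfolding toC_def[abs_def] by (intro continuous_intros)
  show "continuous_on UNIV (\<lambda>z. (Re z, Im z))" by (intro continuous_intros)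
qed (auto simp: toC_def)

lemma toC_homeomorphic: "X homeomorphic toC ` X"
  using homeomorphism_of_subsets[OF toC_homeomorphism, of X] unfolding homeomorphic_def by blast

lemma toC_continuous: "continuous_on X toC"
  using toC_homeomorphism by (auto simp: homeomorphism_def intro: continuous_on_subset)

lemma toC_connected: "connected (toC ` X) \<longleftrightarrow> connected X"
  using toC_homeomorphic homeomorphic_connectedness by blast

section \<open>The tiles that are not disk-like\<close>

lemma neighbour_vec_cases:
  assumes "neighbour_vec A (p, q)"
  shows "(q = 0 \<and> (p = 0 \<or> p = 1 \<or> p = -1)) \<or> (q = 1 \<and> (p = A \<or> p = A - 1)) \<or> (q = -1 \<and> (p = -A \<or> p = 1 - A))"
  using assms by (auto simp: neighbour_vec_def)

lemma Janiszewski_dual_prod: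
  fixes X Y :: "(real \<times> real) set"
  assumes "compact X" "compact Y" "connected X" "connected Y" "connected (- (X \<union> Y))"
  shows "connected (X \<inter> Y)"
proof -
  have inj: "inj toC" using toC_bij by (rule bij_is_inj)
  have "connected (toC ` X \<inter> toC ` Y)"
  proof (rule Janiszewski_dual)
    show "compact (toC ` X)" "compact (toC ` Y)" using assms by (auto intro!: compact_continuous_image toC_continuous)
    show "connected (toC ` X)" "connected (toC ` Y)" using assms by (simp_all add: toC_connected)
    have "- (toC ` X \<union> toC ` Y) = toC ` (- (X \<union> Y))" unfolding image_Un[symmetric] by (rule bij_image_Compl_eq[OF toC_bij, symmetric])
    then show "connected (- (toC ` X \<union> toC ` Y))" using assms by (simp add: toC_connected)
  qed
  then show ?thesis using inj by (simp add: toC_connected flip: image_Int)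
qed

text \<open>By invariance of domain the image of the open disk is open. It is connected and dense in
  X, and the interior of X lies between it and its closure.\<close>

lemma disk_like_interior:
  assumes "disk_like X"
  shows "connected X" "connected (interior X)" "X \<subseteq> closure (interior X)" "interior X \<noteq> {}"
proof -
  obtain f h where fh: "homeomorphism (cball (0::real\<times>real) 1) X f h"
    using assms homeomorphic_sym unfolding disk_like_def homeomorphic_def by blast
  have cf: "continuous_on (cball 0 1) f" and fX: "f ` cball 0 1 = X" and hf: "\<And>x. x \<in> cball 0 1 \<Longrightarrow> h (f x) = x"
    using fh unfolding homeomorphism_def by blast+
  have inj: "inj_on f (cball 0 1)" by (rule inj_on_inverseI[of _ h]) (rule hf)
  show "connected X" unfolding fX[symmetric] by (intro connected_continuous_image cf) simp
  define W where "W = f ` ball 0 1"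
  have oW: "open W" unfolding W_def
    by (rule invariance_of_domain) (use cf inj in \<open>auto intro: continuous_on_subset inj_on_subset\<close>)
  have conW: "connected W" unfolding W_def
    by (intro connected_continuous_image continuous_on_subset[OF cf]) auto
  have WX: "W \<subseteq> interior X" using oW fX by (intro interior_maximal) (auto simp: W_def)
  have "f ` closure (ball 0 1) \<subseteq> closure W"
    by (rule image_closure_subset) (use cf in \<open>simp_all add: closure_subset flip: W_def\<close>)
  then have XW: "X \<subseteq> closure W" using fX by simp
  then show "connected (interior X)" using connected_intermediate_closure[OF conW WX] interior_subset by blast
  show "X \<subseteq> closure (interior X)" using XW closure_mono[OF WX] by blast
  show "interior X \<noteq> {}" using WX by (auto simp: W_def)
qed

locale nondisk_tile = crystile +
  assumes A2: "2 \<le> A" and B3: "3 \<le> B" and AB: "2 * A < B + 3"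
begin

lemma AB1: "A \<le> B - 1" using A2 B3 AB by linarith

lemma nb: assumes "inS x p q" "inS x p' q'"
  shows "(q' - q = 0 \<and> (p' - p = 0 \<or> p' - p = 1 \<or> p' - p = -1)) \<or> (q' - q = 1 \<and> (p' - p = A \<or> p' - p = A - 1)) \<or>
    (q' - q = -1 \<and> (p' - p = -A \<or> p' - p = 1 - A))"
proof (rule neighbour_vec_cases, rule neighbour_set_bound[OF _ _ _ AB nbrs_finite])
  show "(p' - p, q' - q) \<in> nbrs" using inS_nbrs[OF assms] .
qed (use A2 AB1 B2 nbrs_minus nbrs_step in auto)

text \<open>The fixed point of x \<mapsto> g x + (1, 0). Its translates form a 3-cycle under the
  digits 0, A - 1 and B - 1, which makes it a common point of S, S + (1, 0) and S + (A, 1).\<close>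

definition zp :: "real \<times> real" where "zp = (of_int (A + 1) * (of_int (B + 1) / (2 * of_int (A + B + 1))), of_int (B + 1) / (2 * of_int (A + B + 1)))"

lemma g_zp: "g zp = zp - lv 1 0"
proof -
  define a b where "a = real_of_int A" and "b = real_of_int B"
  define y where "y = (b + 1) / (2 * (a + b + 1))"
  have "0 < a + b + 1" using A2 B2 by (simp add: a_def b_def add_pos_pos)
  then have "y * (2 * (a + b + 1)) = b + 1" by (simp add: y_def)
  then have 1: "2 * (a * y) + 2 * (b * y) + 2 * y = b + 1" by (simp add: algebra_simps)
  have z: "zp = ((a + 1) * y, y)" by (simp add: zp_def a_def b_def y_def)
  have "- b * y + (b - 1) / 2 = (a + 1) * y - 1" 
  proof -
    have "2 * P + 2 * R + 2 * y = b + 1 \<Longrightarrow> - R + (b - 1) / 2 = P + y - 1" for P R :: real by (simp add: field_simps)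
    from this[OF 1] show ?thesis by (simp add: distrib_right)
  qed
  moreover have "(a + 1) * y - a * y = y" by (simp add: algebra_simps)
  ultimately show ?thesis unfolding z by (simp add: gmap_def lv_def prod_eq_iff flip: a_def b_def)
qed

lemma zp_mem: "inS zp 0 0" "inS zp 1 0" "inS zp A 1"
proof -
  have 1: "g zp - lv 0 0 = zp - lv 1 0" using g_zp by simp
  have 2: "g (zp - lv 1 0) - lv (A-1) 0 = zp - lv A 1" unfolding gmap_diff_lv g_zp by (simp add: lv_def prod_eq_iff)
  have 3: "g (zp - lv A 1) - lv (B-1) 0 = zp" unfolding gmap_diff_lv g_zp by (simp add: lv_def prod_eq_iff)
  show "inS zp 0 0" "inS zp 1 0" "inS zp A 1" unfolding inS_00 unfolding inS_def
    by (rule cycle3_mem[OF 1 2 3]; use A2 AB1 B2 in simp)+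
qed

text \<open>Contact with the neighbour at -(A, 1) would need the digit B - 1, while T has only the
  digits 0, ..., B - 2.\<close>

lemma T_lower: "\<not> (inT x p q \<and> inS x (p - A) (q - 1))"
proof
  assume a: "inT x p q \<and> inS x (p - A) (q - 1)"
  obtain n where n: "n \<in> {0..B-1}" "inS (g x) (n - B * (q - 1)) (p - A - A * (q - 1))"
    using a inS_rec[of x "p - A" "q - 1"] by blast
  obtain k where k: "0 \<le> k" "k \<le> B - 2" "inS (g x) (k - B * q) (p - A * q)"
  proof -
    from a have "inS (g x) (- B * q) (p - A * q) \<or> (\<exists>k\<in>{1..B-2}. inT (g x) (k - B * q) (p - A * q))"
      using inT_rec by blast
    then show thesis
    proof
      assume "inS (g x) (- B * q) (p - A * q)" then show thesis using that[of 0] B3 by simp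
    next
      assume "\<exists>k\<in>{1..B-2}. inT (g x) (k - B * q) (p - A * q)"
      then obtain k where "k \<in> {1..B-2}" "inT (g x) (k - B * q) (p - A * q)" by blast
      then show thesis using that[of k] inT_inS by auto
    qed
  qed
  show False using nb[OF k(3) n(2)] n(1) k(1,2) by (auto simp: algebra_simps)
qed

lemma U_upper: "\<not> (inU x p q \<and> inS x (p + A) (q + 1))"
  using T_lower[of "-x" "-p" "-q"] by (simp add: inT_minus inS_minus add.commute)

lemma zpT: "inT zp 0 0" "inU zp A 1"
  using zp_mem U_upper[of zp 0 0] T_lower[of zp A 1] inS_iff[of zp 0 0] inS_iff[of zp A 1] by auto

definition PP where "PP = {x. inT x 0 0}"
definition QQ where "QQ = {x. inU x 1 0}"

lemma compact_inT: "compact {x. inT x p q}" unfolding inT_def by (rule compact_translate[OF T_compact])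
lemma compact_inU: "compact {x. inU x p q}"
proof -
  have "{x. inU x p q} = (\<lambda>x. lv p q - x) ` T"
  proof (intro equalityI subsetI)
    fix x assume "x \<in> {x. inU x p q}"
    then show "x \<in> (\<lambda>x. lv p q - x) ` T" unfolding inU_def by (intro image_eqI[of _ _ "lv p q - x"]) auto
  next
    fix x assume "x \<in> (\<lambda>x. lv p q - x) ` T"
    then obtain y where "y \<in> T" "x = lv p q - y" by blast
    then show "x \<in> {x. inU x p q}" by (simp add: inU_def)
  qed
  then show ?thesis using T_compact by (auto intro!: compact_continuous_image continuous_intros)
qed

lemma g_cont: "continuous_on X g"
  unfolding gmap_def[abs_def] by (intro continuous_intros)

lemma closed_g_preimage: "closed Y \<Longrightarrow> closed {x. g x \<in> Y}"
  using continuous_closed_preimage[OF g_cont[of UNIV] closed_UNIV] by (simp add: vimage_def)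

text \<open>The intersection is split by the digit of T: in K1 the point g x lies in S, in K2 it
  lies in some T + (k, 0) with k \<ge> 1. A point of both would have g x in S, T + (1, 0) and S +
  (A, 1), and following it once more contradicts \<open>T_lower\<close>. Preimages of translates of
  the triple point \<open>zp\<close> show that both parts are nonempty.\<close>

lemma PQ_disconnected: "\<not> connected (PP \<inter> QQ)"
proof -
  define K1 where "K1 = PP \<inter> QQ \<inter> {x. g x \<in> S}"
  define K2 where "K2 = PP \<inter> QQ \<inter> {x. g x \<in> (\<Union>k\<in>{1..B-2}. {y. inT y k 0})}"
  have cPQ: "closed (PP \<inter> QQ)" unfolding PP_def QQ_def by (intro closed_Int compact_imp_closed[OF compact_inT] compact_imp_closed[OF compact_inU])
  have c1: "closed K1" unfolding K1_def
    by (intro closed_Int[OF cPQ] closed_g_preimage compact_imp_closed[OF S_compact])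
  have c2: "closed K2" unfolding K2_def
    by (intro closed_Int[OF cPQ] closed_g_preimage closed_UN compact_imp_closed[OF compact_inT] ballI) auto
  have un: "PP \<inter> QQ = K1 \<union> K2"
  proof
    show "PP \<inter> QQ \<subseteq> K1 \<union> K2"
    proof
      fix x assume x: "x \<in> PP \<inter> QQ"
      then have "inS (g x) 0 0 \<or> (\<exists>k\<in>{1..B-2}. inT (g x) k 0)" using inT_rec[of x 0 0] by (simp add: PP_def)
      then show "x \<in> K1 \<union> K2" using x unfolding K1_def K2_def inS_00 by blast
    qed
  qed (auto simp: K1_def K2_def)
  have disj: "K1 \<inter> K2 = {}"
  proof (rule ccontr)
    assume "K1 \<inter> K2 \<noteq> {}"
    then obtain x where x: "x \<in> QQ" "inS (g x) 0 0" "x \<in> K2" by (auto simp: K1_def)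
    then obtain k where k: "k \<in> {1..B-2}" "inT (g x) k 0" by (auto simp: K2_def)
    have k1: "k = 1" using nb[OF x(2) inT_inS[OF k(2)]] k(1) by auto
    from x(1) have "inS (g x) (B - 1) 1 \<or> (\<exists>j\<in>{1..B-2}. inU (g x) j 1)" using inU_rec[of x 1 0] by (simp add: QQ_def)
    then obtain j where j: "inS (g x) j 1" using inU_inS by blast
    have jA: "j = A" using nb[OF x(2) j] nb[OF inT_inS[OF k(2)] j] k1 by auto
    define y where "y = g x - lv 1 0"
    have y: "inS y (-1) 0" "inT y 0 0" "inS y (A - 1) 1" unfolding y_def inS_shift inT_shift using x(2) k(2) j k1 jA by auto
    obtain m where m: "m \<in> {0..B-1}" "inS (g y) m (-1)" using y(1) inS_rec[of y "-1" 0] by auto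
    obtain n where n: "n \<in> {0..B-1}" "inS (g y) (n - B) (-1)" using y(3) inS_rec[of y "A-1" 1] by auto
    have mn: "m = 0" "n - B = -1" using nb[OF m(2) n(2)] m(1) n(1) by auto
    from y(2) have "inS (g y) 0 0 \<or> (\<exists>k\<in>{1..B-2}. inT (g y) k 0)" using inT_rec[of y 0 0] by simp
    then show False
    proof
      assume "inS (g y) 0 0"
      from nb[OF this m(2)] show False using mn A2 by auto
    next
      assume "\<exists>k\<in>{1..B-2}. inT (g y) k 0"
      then obtain l where l: "inT (g y) l 0" by blast
      have "l = A - 1" using nb[OF inT_inS[OF l] m(2)] nb[OF inT_inS[OF l] n(2)] mn by auto
      then show False using T_lower[of "g y" l 0] l n(2) mn by auto
    qed
  qed
  have ne1: "gi zp \<in> K1"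
  proof -
    have "inT (gi zp) 0 0" using inT_rec[of "gi zp" 0 0] zp_mem by simp
    moreover have "inU (gi zp) 1 0"
    proof (cases "A = B - 1")
      case True
      have "inS zp (B - 1) 1" by (simp only: True[symmetric] zp_mem)
      then show ?thesis using inU_rec[of "gi zp" 1 0] by simp
    next
      case False
      then have "A \<in> {1..B-2}" using AB1 A2 by auto
      then show ?thesis using inU_rec[of "gi zp" 1 0] zpT by auto
    qed
    ultimately show ?thesis using zp_mem by (simp add: K1_def PP_def QQ_def)
  qed
  have ne2: "K2 \<noteq> {}"
  proof -
    \<comment> \<open>The point is found backwards: gi y needs the T-digit B - A and has to lie in
      the S-piece B - 1 of (1, 0) - T. That B - A is among 1, ..., B - 2 uses 2 \<le> A \<le> B -
      1.\<close>
    define w where "w = zp - lv A 1"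
    define y' where "y' = gi w"
    define y where "y = y' + lv (B - A) 0"
    have w: "inS w 0 0" "inS w (-A) (-1)" unfolding w_def inS_shift using zp_mem by simp_all
    have "inT y' 0 0" using inT_rec[of y' 0 0] w by (simp add: y'_def)
    then have 1: "inT y (B - A) 0" unfolding y_def inT_plus by simp
    have "inS y' (A - 1) 1"
    proof -
      have "B - A \<in> {0..B-1}" "inS (g y') (B - A - B * 1) (A - 1 - A * 1)" using w(2) AB1 A2 by (auto simp: y'_def)
      then show ?thesis using inS_rec[of y' "A-1" 1] by blast
    qed
    then have 2: "inS y (B - 1) 1" unfolding y_def inS_plus by simp
    have BA: "B - A \<in> {1..B-2}" using AB1 A2 by auto
    have "inT (gi y) 0 0" using inT_rec[of "gi y" 0 0] 1 BA by auto
    moreover have "inU (gi y) 1 0" using inU_rec[of "gi y" 1 0] 2 by simp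
    ultimately have "gi y \<in> K2" using 1 BA by (auto simp: K2_def PP_def QQ_def)
    then show ?thesis by blast
  qed
  show ?thesis
  proof
    assume "connected (PP \<inter> QQ)"
    from connected_closedD[OF this _ _ c1 c2] have "K1 \<inter> (PP \<inter> QQ) = {} \<or> K2 \<inter> (PP \<inter> QQ) = {}"
      using un disj by simp
    then show False unfolding un using ne1 ne2 by blast
  qed
qed

section \<open>Addresses and disjointness of interiors\<close>

definition XX where "XX s p q = (if s then {x. inT x p q} else {x. inU x p q})"

lemma XX_inS: "x \<in> XX s p q \<Longrightarrow> inS x p q"
  by (auto simp: XX_def inT_inS inU_inS split: if_splits)

lemma inS_XX: "inS x p q \<Longrightarrow> \<exists>s. x \<in> XX s p q"
  using inS_iff[of x p q] by (metis XX_def mem_Collect_eq)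

text \<open>The last equivalence makes addresses unique: kind and digit of a subtile determine the
  kind of its parent. Rotated subtiles at digit 0 belong to T, unrotated ones at digit B - 1 to -T,
  and all others to the parent of their own kind.\<close>

lemma XX_child:
  assumes "x \<in> XX s p q"
  obtains s' k where "g x \<in> XX s' (k - B * q) (p - A * q)" "0 \<le> k" "k \<le> B - 1" "s \<longleftrightarrow> (if s' then k \<le> B - 2 else k = 0)"
proof (cases s)
  case True
  then have "inS (g x) (0 - B * q) (p - A * q) \<or> (\<exists>k\<in>{1..B-2}. inT (g x) (k - B * q) (p - A * q))"
    using assms inT_rec[of x p q] by (simp add: XX_def)
  then show thesis
  proof
    assume "inS (g x) (0 - B * q) (p - A * q)"
    then obtain s' where "g x \<in> XX s' (0 - B * q) (p - A * q)" using inS_XX by blast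
    then show thesis using that[of s' 0] True B3 by auto
  next
    assume "\<exists>k\<in>{1..B-2}. inT (g x) (k - B * q) (p - A * q)"
    then obtain k where "k\<in>{1..B-2}" "g x \<in> XX True (k - B * q) (p - A * q)" by (auto simp: XX_def)
    then show thesis using that[of True k] True by auto
  qed
next
  case False
  then have "inS (g x) (B - 1 - B * q) (p - A * q) \<or> (\<exists>k\<in>{1..B-2}. inU (g x) (k - B * q) (p - A * q))"
    using assms inU_rec[of x p q] by (simp add: XX_def)
  then show thesis
  proof
    assume "inS (g x) (B - 1 - B * q) (p - A * q)"
    then obtain s' where "g x \<in> XX s' (B - 1 - B * q) (p - A * q)" using inS_XX by blast
    then show thesis using that[of s' "B - 1"] False B3 by auto
  next
    assume "\<exists>k\<in>{1..B-2}. inU (g x) (k - B * q) (p - A * q)"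
    then obtain k where "k\<in>{1..B-2}" "g x \<in> XX False (k - B * q) (p - A * q)" by (auto simp: XX_def)
    then show thesis using that[of False k] False by auto
  qed
qed

lemma div_unique: assumes "k - B * q = k' - B * q'" "0 \<le> k" "k \<le> B - 1" "0 \<le> k'" "k' \<le> B - 1" shows "q = q'" "k = k'"
proof -
  have e: "k - k' = B * (q - q')" using assms(1) by (simp add: algebra_simps)
  show "k = k'"
  proof (rule ccontr)
    assume "k \<noteq> k'"
    then have "B dvd k - k'" "k - k' \<noteq> 0" using e by auto
    then have "\<bar>B\<bar> \<le> \<bar>k - k'\<bar>" using dvd_imp_le_int by blast
    then show False using assms B2 by auto
  qed
  then show "q = q'" using assms B2 by simp
qed

text \<open>If 0 lies in S + v, then by symmetry also in S - v, so 2 v is a neighbour vector; every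
  neighbour vector except 0 has an odd coordinate.\<close>

lemma zero_only: assumes "inS 0 p q" shows "p = 0 \<and> q = 0"
proof -
  have "inS 0 (-p) (-q)" using assms inS_minus[of 0 p q] by simp
  from nb[OF this assms] show ?thesis by presburger
qed

text \<open>The origin lies in T and in -T. One step back this ambiguity is gone, since both halves
  of S at digit 0 belong to T, and the point has a single address.\<close>

definition w0 where "w0 = gi 0"

lemma w0_only: assumes "w0 \<in> XX s p q" shows "s \<and> p = 0 \<and> q = 0"
proof -
  obtain s' k where k: "g w0 \<in> XX s' (k - B * q) (p - A * q)" "0 \<le> k" "k \<le> B - 1" "s \<longleftrightarrow> (if s' then k \<le> B - 2 else k = 0)"
    using XX_child[OF assms] by blast
  have "g w0 = 0" by (simp add: w0_def)
  then have z: "k - B * q = 0 \<and> p - A * q = 0" using zero_only[of "k - B * q" "p - A * q"] XX_inS[OF k(1)] by (simp only:)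
  then have "q = 0" "k = 0" using div_unique[of k q 0 0] k B2 by auto
  then show ?thesis using z k(4) B3 by auto
qed

lemma w0_shift_only: assumes "w0 + lv a b \<in> XX s p q" shows "s \<and> p = a \<and> q = b"
proof -
  have "w0 \<in> XX s (p - a) (q - b)" using assms by (auto simp: XX_def inT_plus inU_plus split: if_splits)
  from w0_only[OF this] show ?thesis by simp
qed

text \<open>Uniqueness of the address is inherited under g backwards: the position of the subtile
  determines digit and row by division with remainder, and \<open>XX_child\<close> determines the
  kind.\<close>

lemma chain_unique:
  assumes "(g ^^ n) u = w0 + lv a b" "u \<in> XX s p q" "u \<in> XX s' p' q'"
  shows "s = s' \<and> p = p' \<and> q = q'"
  using assms
proof (induction n arbitrary: u s p q s' p' q')
  case 0
  then have "u = w0 + lv a b" by simp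
  then show ?case using w0_shift_only[of a b s p q] w0_shift_only[of a b s' p' q'] 0 by auto
next
  case (Suc n)
  obtain r k where k: "g u \<in> XX r (k - B * q) (p - A * q)" "0 \<le> k" "k \<le> B - 1" "s \<longleftrightarrow> (if r then k \<le> B - 2 else k = 0)"
    using XX_child[OF Suc.prems(2)] by blast
  obtain r' k' where k': "g u \<in> XX r' (k' - B * q') (p' - A * q')" "0 \<le> k'" "k' \<le> B - 1" "s' \<longleftrightarrow> (if r' then k' \<le> B - 2 else k' = 0)"
    using XX_child[OF Suc.prems(3)] by blast
  have "(g ^^ n) (g u) = w0 + lv a b" using Suc.prems(1) by (simp add: funpow_Suc_right del: funpow.simps)
  from Suc.IH[OF this k(1) k'(1)] have e: "r = r'" "k - B * q = k' - B * q'" "p - A * q = p' - A * q'" by auto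
  have "q = q'" "k = k'" using div_unique[OF e(2)] k k' by auto
  then show ?case using e k(4) k'(4) by auto
qed

text \<open>The argument of \<open>covering\<close> with the lattice translates of w0 in place of S:
  their n-fold preimages come within \<open>lam ^ n * E\<close> of every point.\<close>

lemma dense_w0:
  assumes "open U" "U \<noteq> {}"
  shows "\<exists>n u a b. u \<in> U \<and> (g ^^ n) u = w0 + lv a b"
proof -
  obtain x where x: "x \<in> U" using assms by blast
  obtain e where e: "e > 0" "ball x e \<subseteq> U" using assms(1) x by (meson openE)
  define D where "D n = {u. \<exists>a b. (g ^^ n) u = w0 + lv a b}" for n
  define E where "E = c1 * 2"
  have step: "\<exists>u\<in>D n. N (y - u) \<le> lam ^ n * E" for n y
  proof (induction n arbitrary: y)
    case 0
    define p q where "p = \<lfloor>fst (y - w0)\<rfloor>" and "q = \<lfloor>snd (y - w0)\<rfloor>"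
    define v where "v = y - (w0 + lv p q)"
    have fs: "fst v = fst (y - w0) - p" "snd v = snd (y - w0) - q" by (simp_all add: v_def algebra_simps)
    have "norm v \<le> \<bar>fst v\<bar> + \<bar>snd v\<bar>" using norm_Pair_le[of "fst v" "snd v"] by simp
    also have "\<dots> \<le> 2" unfolding fs p_def q_def by linarith
    finally have "c1 * norm v \<le> E" unfolding E_def using c01 by (intro mult_left_mono) auto
    then have "N v \<le> E" using N_upper[of v] by linarith
    moreover have "w0 + lv p q \<in> D 0" unfolding D_def by (simp, blast)
    ultimately show ?case by (intro bexI[of _ "w0 + lv p q"]) (simp_all add: v_def)
  next
    case (Suc n)
    obtain u where u: "u \<in> D n" "N (g y - u) \<le> lam ^ n * E" using Suc[of "g y"] by blast
    have "N (y - gi u) \<le> lam * N (g y - u)" using contr[of "g y" u] by simp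
    also have "\<dots> \<le> lam * (lam ^ n * E)" using u(2) lam(1) by (rule mult_left_mono)
    finally have 1: "N (y - gi u) \<le> lam ^ Suc n * E" by (simp add: mult.assoc)
    have "(g ^^ Suc n) (gi u) = (g ^^ n) u" by (simp add: funpow_Suc_right del: funpow.simps)
    then have "gi u \<in> D (Suc n)" using u(1) unfolding D_def by (simp only: mem_Collect_eq)
    then show ?case using 1 by blast
  qed
  have "x \<in> closure (\<Union>n. D n)"
  proof (rule closed_mem_if_gauge_small[of _ x E])
    show "closed (closure (\<Union>n. D n))" by simp
    show "\<exists>k\<in>closure (\<Union>n. D n). N (x - k) \<le> lam ^ n * E" for n
      using step[of n x] subsetD[OF closure_subset[of "\<Union>n. D n"]] by blast
  qed
  then obtain u where u: "u \<in> (\<Union>n. D n)" "dist u x < e" using e(1) closure_approachable by blast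
  then have "u \<in> U" using e(2) by (auto simp: dist_commute)
  then show ?thesis using u(1) unfolding D_def by blast
qed

text \<open>An open set contains a point with a single address; this replaces a comparison of
  areas.\<close>

lemma nonoverlap:
  assumes "open U" "U \<noteq> {}" "U \<subseteq> XX s p q" "U \<subseteq> XX s' p' q'"
  shows "s = s' \<and> p = p' \<and> q = q'"
proof -
  obtain n u a b where u: "u \<in> U" "(g ^^ n) u = w0 + lv a b" using dense_w0[OF assms(1,2)] by blast
  show ?thesis by (rule chain_unique[OF u(2) subsetD[OF assms(3) u(1)] subsetD[OF assms(4) u(1)]])
qed

lemma XX_image: "XX s p q = (\<lambda>x. (if s then 1 else -1) *\<^sub>R x + lv p q) ` T"
proof (intro equalityI subsetI)
  fix x assume "x \<in> XX s p q"
  then show "x \<in> (\<lambda>x. (if s then 1 else -1) *\<^sub>R x + lv p q) ` T"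
    by (cases s) (auto simp: XX_def inT_def inU_def intro: image_eqI[of _ _ "x - lv p q"] image_eqI[of _ _ "lv p q - x"])
next
  fix x assume "x \<in> (\<lambda>x. (if s then 1 else -1) *\<^sub>R x + lv p q) ` T"
  then obtain y where "y \<in> T" "x = (if s then 1 else -1) *\<^sub>R y + lv p q" by blast
  then show "x \<in> XX s p q" by (cases s) (simp_all add: XX_def inT_def inU_def)
qed

lemma XX_homeo:
  obtains h where "homeomorphism (UNIV :: (real \<times> real) set) UNIV (\<lambda>x. (if s then 1 else -1) *\<^sub>R x + lv p q) h"
proof
  show "homeomorphism UNIV UNIV (\<lambda>x. (if s then 1 else -1) *\<^sub>R x + lv p q) (\<lambda>x. (if s then 1 else -1) *\<^sub>R (x - lv p q))"
  proof
    show "(\<lambda>x. (if s then 1 else -1) *\<^sub>R x + lv p q) ` UNIV \<subseteq> UNIV" "(\<lambda>x. (if s then 1 else -1) *\<^sub>R (x - lv p q)) ` UNIV \<subseteq> UNIV" by auto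
    show "continuous_on UNIV (\<lambda>x. (if s then 1 else -1) *\<^sub>R x + lv p q)"
      "continuous_on UNIV (\<lambda>x. (if s then 1 else -1) *\<^sub>R (x - lv p q))" by (cases s; auto intro!: continuous_intros)+
  qed (cases s; simp)+
qed

lemma homeomorphism_UNIV_interior:
  fixes f :: "'a::topological_space \<Rightarrow> 'b::topological_space"
  assumes "homeomorphism UNIV UNIV f h"
  shows "interior (f ` X) = f ` interior X" "closure (f ` X) = f ` closure X"
proof -
  have fh: "continuous_on UNIV f" "continuous_on UNIV h" "\<And>x. h (f x) = x" "\<And>y. f (h y) = y"
    using assms by (auto simp: homeomorphism_def)
  have im: "f ` Y = h -` Y" for Y
  proof (intro equalityI subsetI)
    fix y assume "y \<in> f ` Y" then show "y \<in> h -` Y" using fh(3) by auto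
  next
    fix y assume "y \<in> h -` Y" then show "y \<in> f ` Y" using fh(4)[of y] by (metis image_eqI vimageD)
  qed
  have im': "h ` Z = f -` Z" for Z
  proof (intro equalityI subsetI)
    fix y assume "y \<in> h ` Z" then show "y \<in> f -` Z" using fh(4) by auto
  next
    fix y assume "y \<in> f -` Z" then show "y \<in> h ` Z" using fh(3)[of y] by (metis image_eqI vimageD)
  qed
  have op: "open Y \<Longrightarrow> open (f ` Y)" for Y unfolding im using fh(2) by (simp add: open_vimage)
  have op': "open Z \<Longrightarrow> open (h ` Z)" for Z unfolding im' using fh(1) by (simp add: open_vimage)
  show "interior (f ` X) = f ` interior X"
  proof
    show "f ` interior X \<subseteq> interior (f ` X)" by (intro interior_maximal image_mono interior_subset op open_interior)
    have "h ` interior (f ` X) \<subseteq> X"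
    proof
      fix x assume "x \<in> h ` interior (f ` X)"
      then obtain y where "y \<in> f ` X" "x = h y" using interior_subset by blast
      then show "x \<in> X" using fh(3) by auto
    qed
    then have "h ` interior (f ` X) \<subseteq> interior X" by (intro interior_maximal op' open_interior)
    then have "f ` h ` interior (f ` X) \<subseteq> f ` interior X" by (rule image_mono)
    moreover have "f ` h ` interior (f ` X) = interior (f ` X)" using fh(4) by (simp add: image_image)
    ultimately show "interior (f ` X) \<subseteq> f ` interior X" by simp
  qed
  show "closure (f ` X) = f ` closure X"
  proof
    have "closed (f ` closure X)" unfolding im using fh(2) by (simp add: closed_vimage)
    then show "closure (f ` X) \<subseteq> f ` closure X" by (intro closure_minimal image_mono closure_subset)
    show "f ` closure X \<subseteq> closure (f ` X)"
      by (rule image_closure_subset[OF continuous_on_subset[OF fh(1) subset_UNIV] closed_closure closure_subset])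
  qed
qed

section \<open>Linking the remaining tiles around the pair\<close>

context
  assumes disk: "disk_like T"
begin

lemma XX_disk: "connected (XX s p q)" "connected (interior (XX s p q))" "XX s p q \<subseteq> closure (interior (XX s p q))" "interior (XX s p q) \<noteq> {}"
proof -
  obtain h where h: "homeomorphism (UNIV :: (real \<times> real) set) UNIV (\<lambda>x. (if s then 1 else -1) *\<^sub>R x + lv p q) h" using XX_homeo by blast
  note i = homeomorphism_UNIV_interior[OF h]
  have ch: "continuous_on X (\<lambda>x. (if s then 1 else -1) *\<^sub>R x + lv p q)" for X :: "(real \<times> real) set" by (intro continuous_intros)
  note d = disk_like_interior[OF disk]
  show "connected (XX s p q)" unfolding XX_image by (rule connected_continuous_image[OF ch d(1)])
  show "connected (interior (XX s p q))" unfolding XX_image i by (rule connected_continuous_image[OF ch d(2)])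
  show "XX s p q \<subseteq> closure (interior (XX s p q))" unfolding XX_image i by (rule image_mono[OF d(3)])
  show "interior (XX s p q) \<noteq> {}" unfolding XX_image i using d(4) by simp
qed

lemma interior_disjoint:
  assumes "\<not> (s = s' \<and> p = p' \<and> q = q')"
  shows "interior (XX s p q) \<inter> XX s' p' q' = {}"
proof (rule ccontr)
  assume "interior (XX s p q) \<inter> XX s' p' q' \<noteq> {}"
  then have "interior (XX s p q) \<inter> closure (interior (XX s' p' q')) \<noteq> {}" using XX_disk(3) by blast
  then have "interior (XX s p q) \<inter> interior (XX s' p' q') \<noteq> {}" by (simp add: open_Int_closure_eq_empty)
  from nonoverlap[OF _ this, of s p q s' p' q'] show False
    using assms interior_subset[of "XX s p q"] interior_subset[of "XX s' p' q'"] by auto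
qed

definition CC where "CC = - (PP \<union> QQ)"
definition ok where "ok s p q \<longleftrightarrow> (s, p, q) \<noteq> (True, 0, 0) \<and> (s, p, q) \<noteq> (False, 1, 0)"

lemma PQ_XX: "PP = XX True 0 0" "QQ = XX False 1 0" by (simp_all add: PP_def QQ_def XX_def)

lemma PQ_inS: "x \<in> PP \<union> QQ \<Longrightarrow> inS x 0 0 \<or> inS x 1 0" unfolding PQ_XX using XX_inS by blast

text \<open>The interior of another tile misses the pair, is connected and dense in its tile, so
  everything between it and its closure is connected.\<close>

lemma piece_connected: assumes "ok s p q" shows "connected (XX s p q \<inter> CC)" "XX s p q \<inter> CC \<noteq> {}"
proof -
  have i: "interior (XX s p q) \<inter> XX True 0 0 = {}" "interior (XX s p q) \<inter> XX False 1 0 = {}"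
    using assms interior_disjoint unfolding ok_def by auto
  then have sub: "interior (XX s p q) \<subseteq> XX s p q \<inter> CC" unfolding CC_def PQ_XX using interior_subset by blast
  show "connected (XX s p q \<inter> CC)" by (rule connected_intermediate_closure[OF XX_disk(2) sub]) (use XX_disk(3) in blast)
  show "XX s p q \<inter> CC \<noteq> {}" using sub XX_disk(4) by blast
qed

definition lk where "lk s p q s' p' q' \<longleftrightarrow> (\<forall>x\<in>XX s p q \<inter> CC. \<forall>y\<in>XX s' p' q' \<inter> CC. connected_component CC x y)"

lemma lk_refl: "ok s p q \<Longrightarrow> lk s p q s p q"
proof -
  assume o: "ok s p q"
  show ?thesis unfolding lk_def connected_component_def
    by (intro ballI exI[of _ "XX s p q \<inter> CC"] conjI piece_connected(1)[OF o] Int_lower2)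
qed

lemma lk_sym: "lk s p q s' p' q' \<Longrightarrow> lk s' p' q' s p q"
  unfolding lk_def by (intro ballI, rule connected_component_sym) simp

lemma lk_trans: "lk s p q s' p' q' \<Longrightarrow> lk s' p' q' s'' p'' q'' \<Longrightarrow> ok s' p' q' \<Longrightarrow> lk s p q s'' p'' q''"
proof -
  assume a: "lk s p q s' p' q'" "lk s' p' q' s'' p'' q''" "ok s' p' q'"
  obtain m where m: "m \<in> XX s' p' q' \<inter> CC" using piece_connected(2)[OF a(3)] by blast
  show ?thesis unfolding lk_def
  proof (intro ballI)
    fix x y assume xy: "x \<in> XX s p q \<inter> CC" "y \<in> XX s'' p'' q'' \<inter> CC"
    have "connected_component CC x m" using a(1)[unfolded lk_def, rule_format, OF xy(1) m] .
    moreover have "connected_component CC m y" using a(2)[unfolded lk_def, rule_format, OF m xy(2)] .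
    ultimately show "connected_component CC x y" by (rule connected_component_trans)
  qed
qed

lemma lk_point: assumes "x \<in> XX s p q" "x \<in> XX s' p' q'" "x \<in> CC" "ok s p q" "ok s' p' q'"
  shows "lk s p q s' p' q'"
proof -
  have "connected_component CC y x" if "y \<in> XX s p q \<inter> CC" for y
    using lk_refl[OF assms(4), unfolded lk_def, rule_format, OF that, of x] assms(1,3) by blast
  moreover have "connected_component CC x y" if "y \<in> XX s' p' q' \<inter> CC" for y
    using lk_refl[OF assms(5), unfolded lk_def, rule_format, of x, OF _ that] assms(2,3) by blast
  ultimately show ?thesis unfolding lk_def by (intro ballI) (rule connected_component_trans[of CC _ x])
qed

definition far where "far p q \<longleftrightarrow> (p, q) \<noteq> (0, 0) \<and> (p, q) \<noteq> (1::int, 0::int)"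

lemma far_ok: "far p q \<Longrightarrow> ok s p q" by (auto simp: far_def ok_def)

lemma CC_I: "\<not> inS x 0 0 \<Longrightarrow> \<not> inS x 1 0 \<Longrightarrow> x \<in> CC" unfolding CC_def using PQ_inS by blast

lemma center_point: obtains x where "inT x 0 0" "inU x 0 0" "\<not> inS x 1 0" "\<not> inS x A 1" "\<not> inS x (A - 1) 1"
proof -
  have PQ: "inT (gi zp) 0 0" "inU (gi zp) 1 0 \<or> inS (gi zp) 1 0"
  proof -
    show "inT (gi zp) 0 0" using inT_rec[of "gi zp" 0 0] zp_mem by simp
    have "inS (g (gi zp)) (A - B * 0) (1 - A * 0)" "A \<in> {0..B-1}" using zp_mem AB1 A2 by auto
    then have "inS (gi zp) 1 0" using inS_rec[of "gi zp" 1 0] by blast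
    then show "inU (gi zp) 1 0 \<or> inS (gi zp) 1 0" by blast
  qed
  then have PQ': "inT (gi zp) 0 0" "inS (gi zp) 1 0" using inU_inS by blast+
  define y where "y = gi zp + lv (B - 2) 0"
  have y: "inT y (B - 2) 0" "inS y (B - 1) 0" unfolding y_def inT_plus inS_plus using PQ' by simp_all
  have k: "B - 2 \<in> {1..B-2}" using B3 by auto
  show thesis
  proof (rule that[of "gi y"])
    show "inT (gi y) 0 0" using inT_rec[of "gi y" 0 0] y k by auto
    show "inU (gi y) 0 0" using inU_rec[of "gi y" 0 0] y by simp
    show "\<not> inS (gi y) 1 0"
    proof
      assume "inS (gi y) 1 0"
      then obtain j where "j \<in> {0..B-1}" "inS y j 1" using inS_rec[of "gi y" 1 0] by auto
      then show False using nb[OF y(2), of j 1] A2 by auto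
    qed
    show "\<not> inS (gi y) A 1"
    proof
      assume "inS (gi y) A 1"
      then obtain j where "j \<in> {0..B-1}" "inS y (j - B) 0" using inS_rec[of "gi y" A 1] by auto
      then show False using nb[OF y(2), of "j - B" 0] B3 by auto
    qed
    show "\<not> inS (gi y) (A - 1) 1"
    proof
      assume "inS (gi y) (A - 1) 1"
      then obtain j where "j \<in> {0..B-1}" "inS y (j - B) (-1)" using inS_rec[of "gi y" "A - 1" 1] by auto
      then show False using nb[OF y(2), of "j - B" "-1"] AB1 by auto
    qed
  qed
qed

lemma halves_linked: assumes "far p q" shows "lk True p q False p q"
proof -
  obtain x where x: "inT x 0 0" "inU x 0 0" "\<not> inS x 1 0" "\<not> inS x A 1" "\<not> inS x (A - 1) 1" by (rule center_point)
  have x0: "inS x 0 0" using x(1) inT_inS by blast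
  have xm: "inS (-x) 0 0" using x0 inS_minus[of x 0 0] by simp
  have n: "\<not> inS (-x) (-1) 0" "\<not> inS (-x) (-A) (-1)" "\<not> inS (-x) (1-A) (-1)" using x(3-5) by (simp_all add: inS_minus)
  define y where "y = (if q < 0 \<or> (q = 0 \<and> p \<le> -1) then x else - x)"
  have "inT y 0 0" "inU y 0 0" using x(1,2) by (auto simp: y_def)
  then have 1: "y + lv p q \<in> XX True p q" "y + lv p q \<in> XX False p q" by (simp_all add: XX_def inT_plus inU_plus)
  have 2: "\<not> inS y (-p) (-q) \<and> \<not> inS y (1 - p) (- q)"
  proof (cases "q < 0 \<or> (q = 0 \<and> p \<le> -1)")
    case False
    then have y: "y = -x" by (auto simp: y_def)
    show ?thesis
    proof (intro conjI notI)
      assume i: "inS y (-p) (-q)"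
      show False using nb[OF xm i[unfolded y]] n i False assms unfolding y far_def by auto
    next
      assume i: "inS y (1-p) (-q)"
      show False using nb[OF xm i[unfolded y]] n i False assms unfolding y far_def by auto
    qed
  next
    case True
    then have y: "y = x" by (auto simp: y_def)
    show ?thesis
    proof (intro conjI notI)
      assume i: "inS y (-p) (-q)"
      show False using nb[OF x0 i[unfolded y]] x(3-5) i True assms unfolding y far_def by auto
    next
      assume i: "inS y (1-p) (-q)"
      show False using nb[OF x0 i[unfolded y]] x(3-5) i True assms unfolding y far_def by auto
    qed
  qed
  have "y + lv p q \<in> CC"
  proof (rule CC_I)
    show "\<not> inS (y + lv p q) 0 0" "\<not> inS (y + lv p q) 1 0" unfolding inS_plus using 2 by simp_all
  qed
  then show ?thesis by (rule lk_point[OF 1 _ far_ok[OF assms] far_ok[OF assms]])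
qed

text \<open>Since the two halves at a far position are linked, positions can be treated as blocks
  from here on.\<close>

definition blk where "blk p q p' q' \<longleftrightarrow> (\<forall>s s'. lk s p q s' p' q')"

lemma halves: assumes "far p q" shows "lk s p q s' p q"
proof -
  have a: "lk True p q False p q" "lk False p q True p q" "lk True p q True p q" "lk False p q False p q"
    using halves_linked[OF assms] lk_sym lk_refl[OF far_ok[OF assms]] by blast+
  then show ?thesis by (cases s; cases s'; simp)
qed

lemma blk_I: assumes "far p q" "far p' q'" "lk s p q s' p' q'" shows "blk p q p' q'"
  unfolding blk_def
proof (intro allI)
  fix r r'
  have "lk r p q s' p' q'" by (rule lk_trans[OF halves[OF assms(1)] assms(3) far_ok[OF assms(1)]])
  then show "lk r p q r' p' q'" by (rule lk_trans[OF _ halves[OF assms(2)] far_ok[OF assms(2)]])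
qed

lemma blk_refl: "far p q \<Longrightarrow> blk p q p q" unfolding blk_def using halves by blast
lemma blk_sym: "blk p q p' q' \<Longrightarrow> blk p' q' p q" unfolding blk_def by (intro allI) (rule lk_sym, simp)
lemma blk_trans: "blk p q p' q' \<Longrightarrow> blk p' q' p'' q'' \<Longrightarrow> far p' q' \<Longrightarrow> blk p q p'' q''"
  unfolding blk_def by (intro allI) (rule lk_trans[OF _ _ far_ok], simp_all)

lemma blk_point: assumes "inS x p q" "inS x p' q'" "\<not> inS x 0 0" "\<not> inS x 1 0" "far p q" "far p' q'"
  shows "blk p q p' q'"
proof -
  obtain s s' where "x \<in> XX s p q" "x \<in> XX s' p' q'" using inS_XX assms(1,2) by blast
  then have "lk s p q s' p' q'" by (rule lk_point[OF _ _ CC_I[OF assms(3,4)] far_ok[OF assms(5)] far_ok[OF assms(6)]])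
  then show ?thesis using blk_I assms(5,6) by blast
qed

text \<open>A point of the side between S and S + (1, 0) off their common upper neighbour S + (A,
  1). The half-turn about (1/2, 0) yields one off the common lower neighbour, and in each row one of
  the two avoids the pair.\<close>

lemma side_point: obtains x where "inS x 0 0" "inS x 1 0" "\<not> inS x A 1"
proof -
  define y where "y = zp + lv (B - A - 1) 0"
  have y: "inS y (B - A) 0" "inS y (B - 1) 1" unfolding y_def inS_plus using zp_mem by simp_all
  have BA: "B - A \<in> {0..B-1}" "B - 1 \<in> {0..B-1}" using AB1 A2 by auto
  show thesis
  proof (rule that[of "gi y"])
    show "inS (gi y) 0 0" using inS_rec[of "gi y" 0 0] y(1) BA(1) by auto
    show "inS (gi y) 1 0" using inS_rec[of "gi y" 1 0] y(2) BA(2) by auto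
    show "\<not> inS (gi y) A 1"
    proof
      assume "inS (gi y) A 1"
      then obtain j where "j \<in> {0..B-1}" "inS y (j - B) 0" using inS_rec[of "gi y" A 1] by auto
      then show False using nb[OF y(1), of "j - B" 0] AB1 by auto
    qed
  qed
qed

lemma row_step: assumes "far p q" "far (p + 1) q" shows "blk p q (p + 1) q"
proof -
  obtain x where x: "inS x 0 0" "inS x 1 0" "\<not> inS x A 1" by (rule side_point)
  have x': "inS (lv 1 0 - x) 0 0" "inS (lv 1 0 - x) 1 0" "\<not> inS (lv 1 0 - x) (1 - A) (-1)"
    unfolding inS_reflect using x by simp_all
  define y where "y = (if q < 0 then x else lv 1 0 - x)"
  have y: "inS y 0 0" "inS y 1 0" using x x' by (auto simp: y_def)
  have y3: "q < 0 \<Longrightarrow> \<not> inS y A 1" "\<not> q < 0 \<Longrightarrow> \<not> inS y (1 - A) (-1)" using x x' by (auto simp: y_def)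
  have no: False if i: "inS y a b" "b = - q" "a = - p \<or> a = 1 - p" for a b
  proof -
    have c: "(a = 0 \<and> b = 0) \<or> (a = 1 \<and> b = 0) \<or> (a = A \<and> b = 1) \<or> (a = 1 - A \<and> b = -1)"
      using nb[OF y(1) i(1)] nb[OF y(2) i(1)] A2 by presburger
    show False
    proof (cases "q < 0")
      case True
      then have "a = A \<and> b = 1" using c i(2) by auto
      then show False using y3(1)[OF True] i(1) by simp
    next
      case False
      then have "b = 0 \<or> (a = 1 - A \<and> b = -1)" using c i(2) by auto
      then have "b = 0" using y3(2)[OF False] i(1) by blast
      then have "q = 0" "a = 0 \<or> a = 1" using c i(2) by auto
      then show False using assms i(3) unfolding far_def by auto
    qed
  qed
  show ?thesis
  proof (rule blk_point[OF _ _ _ _ assms])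
    show "inS (y + lv p q) p q" "inS (y + lv p q) (p + 1) q" unfolding inS_plus using y by simp_all
    show "\<not> inS (y + lv p q) 0 0" "\<not> inS (y + lv p q) 1 0" using no[of "-p" "-q"] no[of "1-p" "-q"] unfolding inS_plus by auto
  qed
qed

lemma row_right: assumes "\<And>i::nat. far (p + int i) q" shows "blk p q (p + int n) q"
proof (induction n)
  case 0 show ?case using blk_refl[OF assms[of 0]] by simp
next
  case (Suc n)
  have "blk (p + int n) q (p + int n + 1) q" using row_step[of "p + int n" q] assms[of n] assms[of "Suc n"] by (simp add: algebra_simps)
  then show ?case using blk_trans[OF Suc _ assms[of n]] by (simp add: algebra_simps)
qed

lemma row_any: assumes "q \<noteq> 0" shows "blk p q p' q"
proof -
  have f: "far a q" for a using assms by (simp add: far_def)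
  show ?thesis
  proof (cases "p \<le> p'")
    case True then show ?thesis using row_right[of p q "nat (p' - p)"] f by simp
  next
    case False then show ?thesis using blk_sym[OF row_right[of p' q "nat (p - p')"]] f by simp
  qed
qed

text \<open>Neighbouring positions differ by at most A in the first coordinate, and the pair sits at
  0 and 1; from distance A + 2 on, the triple point \<open>zp\<close> is out of its reach and joins
  consecutive rows.\<close>

lemma vert: assumes "A + 2 \<le> \<bar>p\<bar>" shows "blk p q (p + A) (q + 1)"
proof (rule blk_point)
  show "inS (zp + lv p q) p q" "inS (zp + lv p q) (p + A) (q + 1)" unfolding inS_plus using zp_mem by simp_all
  show "\<not> inS (zp + lv p q) 0 0"
  proof
    assume "inS (zp + lv p q) 0 0"
    then have "inS zp (-p) (-q)" unfolding inS_plus by simp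
    from nb[OF zp_mem(1) this] show False using assms A2 by auto
  qed
  show "\<not> inS (zp + lv p q) 1 0"
  proof
    assume "inS (zp + lv p q) 1 0"
    then have "inS zp (1-p) (-q)" unfolding inS_plus by simp
    from nb[OF zp_mem(1) this] show False using assms A2 by auto
  qed
  show "far p q" "far (p + A) (q + 1)" using assms A2 by (auto simp: far_def)
qed

text \<open>Rows other than 0 are uninterrupted and are joined far from the pair. Row 0 is cut
  between -1 and 2, and its left part reaches the right part by a detour through row 1.\<close>

lemma all_blk: assumes "far p q" shows "blk p q (A + 2) 0"
proof -
  define R where "R = A + 2"
  have R: "4 \<le> R" "A + 2 \<le> \<bar>R\<bar>" "A + 2 \<le> \<bar>- R\<bar>" using A2 by (auto simp: R_def)
  have right: "blk p 0 R 0" if "2 \<le> p" for p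
  proof (cases "p \<le> R")
    case True then show ?thesis using row_right[of p 0 "nat (R - p)"] that by (auto simp: far_def)
  next
    case False then show ?thesis using blk_sym[OF row_right[of R 0 "nat (p - R)"]] R by (auto simp: far_def)
  qed
  have up: "blk p (int (Suc n)) R 0" for n p
  proof (induction n arbitrary: p)
    case 0
    have "blk p 1 (R + A) 1" by (rule row_any) simp
    moreover have "blk (R + A) 1 R 0" using blk_sym[OF vert[OF R(2), of 0]] by simp
    ultimately show ?case using blk_trans[of p 1 "R + A" 1 R 0] by (simp add: far_def)
  next
    case (Suc n)
    define q where "q = int (Suc n)"
    have q: "q + 1 \<noteq> 0" "q \<noteq> 0" "int (Suc (Suc n)) = q + 1" by (auto simp: q_def)
    have "blk p (q+1) (R + A) (q+1)" using q by (intro row_any)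
    moreover have "blk (R + A) (q+1) R q" using blk_sym[OF vert[OF R(2), of q]] by simp
    ultimately have "blk p (q+1) R q" using blk_trans[of p "q+1" "R+A" "q+1" R q] q by (simp add: far_def)
    then show ?case using blk_trans[of p "q+1" R q R 0] Suc[of R] q by (simp add: far_def q_def)
  qed
  have down: "blk p (- int (Suc n)) R 0" for n p
  proof (induction n arbitrary: p)
    case 0
    have "blk p (-1) R (-1)" by (rule row_any) simp
    moreover have "blk R (-1) (R + A) 0" using vert[OF R(2), of "-1"] by simp
    moreover have "blk (R + A) 0 R 0" using right[of "R + A"] R A2 by simp
    ultimately show ?case using blk_trans[of p "-1" R "-1" "R + A" 0] blk_trans[of p "-1" "R + A" 0 R 0] R A2 by (simp add: far_def)
  next
    case (Suc n)
    define q where "q = - int (Suc (Suc n))"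
    have q: "q \<noteq> 0" "q + 1 \<noteq> 0" "- int (Suc n) = q + 1" by (auto simp: q_def)
    have "blk p q R q" using q by (intro row_any)
    moreover have "blk R q (R + A) (q + 1)" by (rule vert[OF R(2)])
    ultimately have "blk p q (R + A) (q + 1)" using blk_trans[of p q R q] q by (simp add: far_def)
    moreover have "blk (R + A) (q + 1) R 0" using Suc[of "R + A"] unfolding q(3) .
    ultimately show ?case using blk_trans[of p q "R + A" "q + 1" R 0] q by (simp add: far_def q_def)
  qed
  consider "q > 0" | "q < 0" | "q = 0" "p \<ge> 2" | "q = 0" "p \<le> -1" using assms by (force simp: far_def)
  then have "blk p q R 0"
  proof cases
    case 1 then show ?thesis using up[of p "nat (q - 1)"] by simp
  next
    case 2 then show ?thesis using down[of p "nat (- q - 1)"] by simp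
  next
    case 3 then show ?thesis using right by simp
  next
    case 4
    have l: "blk a 0 (a + int n) 0" if "a + int n \<le> -1" for a n
    proof -
      have "blk a 0 (a + int k) 0" if "k \<le> n" for k using that
      proof (induction k)
        case 0 then show ?case using blk_refl[of a 0] \<open>a + int n \<le> -1\<close> by (simp add: far_def)
      next
        case (Suc k)
        have "blk (a + int k) 0 (a + int k + 1) 0" by (rule row_step) (use Suc.prems \<open>a + int n \<le> -1\<close> in \<open>auto simp: far_def\<close>)
        then show ?case using blk_trans[of a 0 "a + int k" 0 "a + int k + 1" 0] Suc \<open>a + int n \<le> -1\<close> by (simp add: far_def algebra_simps)
      qed
      then show ?thesis by simp
    qed
    have "blk p 0 (- R) 0"
    proof (cases "p \<le> - R")
      case True then show ?thesis using l[of p "nat (- R - p)"] R by simp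
    next
      case False then show ?thesis using blk_sym[OF l[of "-R" "nat (p + R)"]] 4 by simp
    qed
    moreover have "blk (-R) 0 (-R + A) 1" using vert[OF R(3), of 0] by simp
    moreover have "blk (-R + A) 1 R 0" using up[of "-R + A" 0] by simp
    ultimately show ?thesis using blk_trans[of p 0 "-R" 0 "-R+A" 1] blk_trans[of p 0 "-R+A" 1 R 0] 4 R by (simp add: far_def)
  qed
  then show ?thesis by (simp add: R_def)
qed

text \<open>What is left are the partners of the removed halves, -T and T + (1, 0). They are tied to
  the outside at the triple points -zp and (1, 0) + zp.\<close>

lemma all_linked: assumes "ok s p q" shows "lk s p q True (A + 2) 0"
proof (cases "far p q")
  case True then show ?thesis using all_blk unfolding blk_def by blast
next
  case False
  define x where "x = - zp"
  have x: "inU x 0 0" "inS x (-A) (-1)" unfolding x_def using zpT zp_mem by (simp_all add: inU_minus inS_minus)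
  have nT: "\<not> inT x 0 0" using T_lower[of x 0 0] x(2) by simp
  have nU: "\<not> inU x 1 0" using nb[OF inU_inS[of x 1 0] x(2)] A2 by auto
  from False have "(s = False \<and> p = 0 \<and> q = 0) \<or> (s = True \<and> p = 1 \<and> q = 0)"
    using assms by (cases s) (auto simp: far_def ok_def)
  then show ?thesis
  proof
    assume a: "s = False \<and> p = 0 \<and> q = 0"
    have f: "far (-A) (-1)" by (simp add: far_def)
    obtain s' where s': "x \<in> XX s' (-A) (-1)" using inS_XX[OF x(2)] by blast
    have "x \<in> CC" using nT nU by (simp add: CC_def PP_def QQ_def)
    moreover have "x \<in> XX False 0 0" using x(1) by (simp add: XX_def)
    ultimately have "lk False 0 0 s' (-A) (-1)" using lk_point[OF _ s'] far_ok[OF f] assms a by blast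
    then show ?thesis using lk_trans[OF _ _ far_ok[OF f]] all_blk[OF f] a unfolding blk_def by blast
  next
    assume a: "s = True \<and> p = 1 \<and> q = 0"
    define y where "y = lv 1 0 - x"
    have f: "far (A + 1) 1" by (simp add: far_def)
    have "inS y (A + 1) 1" unfolding y_def inS_reflect using x(2) by simp
    then obtain s' where s': "y \<in> XX s' (A + 1) 1" using inS_XX by blast
    have "\<not> inT y 0 0" "\<not> inU y 1 0" unfolding y_def inT_reflect inU_reflect using nT nU by simp_all
    then have "y \<in> CC" by (simp add: CC_def PP_def QQ_def)
    moreover have "y \<in> XX True 1 0" using x(1) unfolding XX_def y_def by (simp add: inT_reflect)
    ultimately have "lk True 1 0 s' (A + 1) 1" using lk_point[OF _ s'] far_ok[OF f] assms a by blast
    then show ?thesis using lk_trans[OF _ _ far_ok[OF f]] all_blk[OF f] a unfolding blk_def by blast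
  qed
qed

lemma CC_connected: "connected CC"
proof -
  have far0: "far (A + 2) 0" using A2 by (simp add: far_def)
  obtain b where b: "b \<in> XX True (A + 2) 0 \<inter> CC" using piece_connected(2)[OF far_ok[OF far0]] by blast
  have "connected_component CC x b" if x: "x \<in> CC" for x
  proof -
    obtain p q where "inS x p q" using covering by blast
    then obtain s where s: "x \<in> XX s p q" using inS_XX by blast
    have "ok s p q" using s x unfolding CC_def PQ_XX ok_def by auto
    from all_linked[OF this, unfolded lk_def, rule_format, of x b] show ?thesis using s x b by blast
  qed
  then show ?thesis unfolding connected_iff_connected_component
    by (intro ballI) (rule connected_component_trans[OF _ connected_component_sym])
qed

lemma disk_like_contradiction: False
proof -
  have "connected (PP \<inter> QQ)"
  proof (rule Janiszewski_dual_prod)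
    show "compact PP" "compact QQ" unfolding PP_def QQ_def by (rule compact_inT, rule compact_inU)
    show "connected PP" "connected QQ" unfolding PQ_XX by (rule XX_disk(1))+
    show "connected (- (PP \<union> QQ))" using CC_connected unfolding CC_def .
  qed
  then show False using PQ_disconnected by blast
qed

end

lemma not_disk_like: "\<not> disk_like T" using disk_like_contradiction by blast

end

section \<open>A Jordan curve bounding the tile\<close>

lemma arc_continuous_inj_image:
  assumes "arc p" "continuous_on (path_image p) h" "inj_on h (path_image p)"
  shows "arc (h \<circ> p)"
proof -
  have "path (h \<circ> p)" using assms by (intro path_continuous_image) (auto simp: arc_def)
  moreover have "inj_on (h \<circ> p) {0..1}" using assms by (intro comp_inj_on) (auto simp: arc_def path_image_def)
  ultimately show ?thesis by (simp add: arc_def)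
qed

lemma disk_like_homeomorphic: "X homeomorphic Y \<Longrightarrow> disk_like Y \<Longrightarrow> disk_like X"
  unfolding disk_like_def using homeomorphic_trans by blast

text \<open>In the complement of the curve the rest of X is open and closed, so the connected inside
  and outside are each contained in X or disjoint from it. Boundedness of X excludes the outside,
  and since X is more than the curve, the inside is contained.\<close>

lemma disk_like_of_Jordan_curve:
  fixes X :: "(real \<times> real) set"
  assumes X: "compact X" and c: "simple_path c" "pathfinish c = pathstart c" "path_image c \<subseteq> X"
    and op: "open (X - path_image c)" and ne: "X - path_image c \<noteq> {}"
  shows "disk_like X"
proof -
  define k where "k = toC \<circ> c"
  define J where "J = path_image k"
  define Y where "Y = toC ` X"
  have bij: "bij toC" by (rule toC_bij)
  have inj: "inj toC" using bij by (rule bij_is_inj)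
  have pc: "path c" using c(1) by (rule simple_path_imp_path)
  have k: "simple_path k" "pathfinish k = pathstart k"
  proof -
    have "path k" unfolding k_def by (intro path_continuous_image pc toC_continuous)
    then show "simple_path k" using c(1) inj by (auto simp: simple_path_def loop_free_def k_def inj_eq)
    show "pathfinish k = pathstart k" using c(2) by (simp add: k_def pathfinish_def pathstart_def)
  qed
  have J: "J = toC ` path_image c" by (simp add: J_def k_def path_image_compose)
  have YJ: "Y - J = toC ` (X - path_image c)" unfolding Y_def J by (rule image_set_diff[OF inj, symmetric])
  have oYJ: "open (Y - J)" unfolding YJ
    using op homeomorphism_imp_open_map[OF toC_homeomorphism, of "X - path_image c"] by simp
  have cY: "compact Y" unfolding Y_def by (intro compact_continuous_image X toC_continuous)
  note JI = Jordan_inside_outside[OF k, folded J_def]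
  have clopen: "V \<subseteq> Y \<or> V \<inter> Y = {}" if V: "connected V" "V \<inter> J = {}" for V
  proof -
    have "V \<subseteq> (Y - J) \<union> - Y" "(Y - J) \<inter> (- Y) \<inter> V = {}" using V(2) by auto
    then have "(Y - J) \<inter> V = {} \<or> (- Y) \<inter> V = {}"
      using connectedD[OF V(1) oYJ, of "- Y"] cY compact_imp_closed by blast
    then show ?thesis using V(2) by blast
  qed
  have inJ: "inside J \<inter> J = {}" "outside J \<inter> J = {}" using JI by blast+
  have "outside J \<inter> Y = {}"
  proof (rule ccontr)
    assume "outside J \<inter> Y \<noteq> {}"
    then have "outside J \<subseteq> Y" using clopen[of "outside J"] JI inJ by blast
    then show False using JI compact_imp_bounded[OF cY] bounded_subset by blast
  qed
  then have sub: "Y \<subseteq> J \<union> inside J" using JI by blast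
  have "Y - J \<noteq> {}" using ne unfolding YJ by simp
  then have "inside J \<inter> Y \<noteq> {}" using sub by blast
  then have "inside J \<subseteq> Y" using clopen[of "inside J"] JI inJ by blast
  moreover have "J \<subseteq> Y" unfolding J Y_def using c(3) by (rule image_mono)
  ultimately have "Y = J \<union> inside J" using sub by blast
  then have "Y homeomorphic cball (0::complex) 1" using Jordan_curve_closed_disk[OF k] by (simp add: J_def)
  moreover have "cball (0::real\<times>real) 1 homeomorphic cball (0::complex) 1"
  proof -
    have n: "norm (toC p) = norm p" for p by (simp add: toC_def cmod_def norm_prod_def)
    have "toC ` cball 0 1 = cball 0 1"
    proof (intro equalityI subsetI)
      fix z assume "z \<in> toC ` cball 0 1" then show "z \<in> cball 0 1" using n by auto
    next
      fix z :: complex assume z: "z \<in> cball 0 1"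
      obtain p where p: "z = toC p" using bij by (metis bij_pointE)
      then show "z \<in> toC ` cball 0 1" using z n[of p] by auto
    qed
    then show ?thesis using toC_homeomorphic[of "cball 0 1"] by simp
  qed
  moreover have "X homeomorphic Y" unfolding Y_def by (rule toC_homeomorphic)
  ultimately show ?thesis unfolding disk_like_def by (meson homeomorphic_sym homeomorphic_trans)
qed

context half_tile
begin

lemma compact_inS: "compact {x. inS x p q}" unfolding inS_def by (rule compact_translate[OF S_compact])

lemma closed_uminus_T: "closed {x. - x \<in> T}"
proof -
  have "{x. - x \<in> T} = uminus ` T" using mem_uminus_image[of _ T] by auto
  moreover have "compact (uminus ` T)" using T_compact by (intro compact_continuous_image continuous_intros)
  ultimately show ?thesis using compact_imp_closed by simp
qed

lemma closed_other_S: "closed {x. \<exists>p q. (p, q) \<noteq> (0, 0) \<and> inS x p q}"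
proof -
  have "closed (\<Union>i\<in>- {(0,0)}. {x. inS x (fst i) (snd i)})"
    by (rule closed_lattice_union[of _ _ id]) (auto simp: compact_inS intro: finite_subset[of _ "{w}" for w])
  moreover have "(\<Union>i\<in>- {(0,0)}. {x. inS x (fst i) (snd i)}) = {x. \<exists>p q. (p, q) \<noteq> (0, 0) \<and> inS x p q}" by force
  ultimately show ?thesis by simp
qed

end

text \<open>In \<open>krec\<close> the image under \<open>g\<close> of \<open>T \<inter> - T\<close> is read as a chain of translates of itself and of the three parts
  \<open>\<gamma>0\<close>, \<open>\<gamma>1\<close>, \<open>\<gamma>2\<close> of the side \<open>S \<inter> (S + (1, 0))\<close>; the sign \<open>eps\<close> records its orientation. The boundary of \<open>T\<close> is
  then \<open>T \<inter> - T\<close> followed by \<open>\<gamma>1\<close>, \<open>\<gamma>0\<close>, \<open>\<gamma>U\<close> and a translate of \<open>\<gamma>0\<close>.\<close>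

locale kappa_tile = half_tile +
  fixes a u w :: "real \<times> real" and \<gamma>0 \<gamma>1 \<gamma>U :: "real \<Rightarrow> real \<times> real" and eps :: real
  assumes eps: "eps = 1 \<or> eps = -1"
    and row_nb: "\<And>x p. x \<in> S \<Longrightarrow> inS x p 0 \<Longrightarrow> \<bar>p\<bar> \<le> 1"
    and zero_only: "\<And>p q. inS 0 p q \<Longrightarrow> p = 0 \<and> q = 0"
    and never: "\<And>x. \<not> (inU x 0 0 \<and> inT x 1 0)"
    and g0: "arc \<gamma>0" "path_image \<gamma>0 = {x. inT x 0 0 \<and> inT x 1 0}" "\<gamma>0 0 = a" "\<gamma>0 1 = u"
    and g1: "arc \<gamma>1" "path_image \<gamma>1 = {x. inT x 0 0 \<and> inU x 1 0}" "\<gamma>1 0 = u" "\<gamma>1 1 = w"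
    and gU: "arc \<gamma>U" "path_image \<gamma>U = {x. x \<in> T \<and> (\<exists>p q. q \<noteq> 0 \<and> inS x p q)}" "\<gamma>U 0 = a" "\<gamma>U 1 = a - lv 1 0"
    and F01: "\<And>x. inT x 0 0 \<Longrightarrow> inT x 1 0 \<Longrightarrow> inU x 1 0 \<Longrightarrow> x = u"
    and uw: "u + w = lv 1 0"
    and UF: "\<And>x p q. x \<in> T \<Longrightarrow> q \<noteq> 0 \<Longrightarrow> inS x p q \<Longrightarrow> inS x 1 0 \<Longrightarrow> x = a"
    and UF': "\<And>x p q. x \<in> T \<Longrightarrow> q \<noteq> 0 \<Longrightarrow> inS x p q \<Longrightarrow> inS x (-1) 0 \<Longrightarrow> x = a - lv 1 0"
    and UU: "\<And>x p q. x \<in> T \<Longrightarrow> q \<noteq> 0 \<Longrightarrow> inS x p q \<Longrightarrow> - x \<notin> T"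
    and krec: "\<And>x. x \<in> T \<and> - x \<in> T \<longleftrightarrow> (\<exists>k\<in>{0..B-2}. inT (gmap A B x) k 0 \<and> inU (gmap A B x) (k+1) 0) \<or>
      (\<exists>k\<in>{1..B-2}. inT (gmap A B x) k 0 \<and> inU (gmap A B x) k 0) \<or> (inU (gmap A B x) 0 0 \<and> inU (gmap A B x) 1 0) \<or>
      (inT (gmap A B x) (B-2) 0 \<and> inT (gmap A B x) (B-1) 0)"
    and gw: "gmap A B (- eps *\<^sub>R w) = lv 1 0 - a"
begin

section \<open>The seam between T and -T as an arc\<close>

definition kap where "kap = {x. x \<in> T \<and> - x \<in> T}"

lemma row: assumes "inS x p 0" "inS x p' 0" shows "\<bar>p' - p\<bar> \<le> 1"
  using row_nb[of "x - lv p 0" "p' - p"] assms inS_shift[of x p 0 "p' - p" 0] by (simp add: inS_def)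

lemma row2: "inS x p 0 \<Longrightarrow> inS x p' 0 \<Longrightarrow> p + 1 < p' \<Longrightarrow> False"
  using row[of x p p'] by auto

lemma nev: "inU x p 0 \<Longrightarrow> inT x (p + 1) 0 \<Longrightarrow> False"
  using never[of "x - lv p 0"] unfolding inT_shift inU_shift by (simp add: add.commute)

lemma F01': "inT x p 0 \<Longrightarrow> inT x (p + 1) 0 \<Longrightarrow> inU x (p + 1) 0 \<Longrightarrow> x = u + lv p 0"
  using F01[of "x - lv p 0"] unfolding inT_shift inU_shift by (simp add: add.commute algebra_simps)

text \<open>The half-turn exchanging the positions p and p + 1 reduces this to \<open>F01'\<close>
  and takes u to w.\<close>

lemma F12': assumes "inT x p 0" "inU x p 0" "inU x (p + 1) 0" shows "x = w + lv p 0"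
proof -
  have "lv (2*p + 1) 0 - x = u + lv p 0"
    by (rule F01') (unfold inT_reflect inU_reflect, use assms in \<open>simp_all add: algebra_simps\<close>)
  then have "x = lv (2*p + 1) 0 - (u + lv p 0)" by (simp add: algebra_simps)
  also have "\<dots> = (lv 1 0 - u) + lv p 0" by (simp add: lv_def prod_eq_iff)
  also have "lv 1 0 - u = w" using uw by (simp add: algebra_simps)
  finally show ?thesis .
qed

definition \<gamma>2 where "\<gamma>2 = (\<lambda>t. lv 1 0 - \<gamma>0 t)"

lemma g2: "arc \<gamma>2" "path_image \<gamma>2 = {x. inU x 0 0 \<and> inU x 1 0}" "\<gamma>2 0 = lv 1 0 - a" "\<gamma>2 1 = w"
proof -
  have e: "\<gamma>2 = (\<lambda>x. lv 1 0 - x) \<circ> \<gamma>0" by (simp add: \<gamma>2_def fun_eq_iff)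
  show "arc \<gamma>2" unfolding e by (rule arc_continuous_inj_image[OF g0(1)]) (auto intro!: continuous_intros inj_onI)
  show "path_image \<gamma>2 = {x. inU x 0 0 \<and> inU x 1 0}"
  proof -
    have "x \<in> (\<lambda>x. lv 1 0 - x) ` Y \<longleftrightarrow> lv 1 0 - x \<in> Y" for x Y
    proof
      assume "lv 1 0 - x \<in> Y" then show "x \<in> (\<lambda>x. lv 1 0 - x) ` Y" by (intro image_eqI[of _ _ "lv 1 0 - x"]) auto
    qed auto
    then have "x \<in> path_image \<gamma>2 \<longleftrightarrow> inT (lv 1 0 - x) 0 0 \<and> inT (lv 1 0 - x) 1 0" for x
      unfolding e path_image_compose g0(2) by simp
    then show ?thesis unfolding inT_reflect by auto
  qed
  show "\<gamma>2 0 = lv 1 0 - a" "\<gamma>2 1 = w" using g0(3,4) uw by (auto simp: \<gamma>2_def algebra_simps)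
qed

definition m where "m = nat (2 * B - 1)"
text \<open>The 2 B - 1 pieces in their order along the chain: \<gamma>2 first, a translate of
  \<gamma>0 last, in between translates of \<gamma>1 at odd and of the seam itself at even
  places.\<close>

definition Pg :: "nat \<Rightarrow> (real \<times> real) set" where
  "Pg i = (if i = 0 then {y. inU y 0 0 \<and> inU y 1 0}
     else if i = m - 1 then {y. inT y (B-2) 0 \<and> inT y (B-1) 0}
     else if odd i then {y. inT y (int (i div 2)) 0 \<and> inU y (int (i div 2) + 1) 0}
     else {y. inT y (int (i div 2)) 0 \<and> inU y (int (i div 2)) 0})"
definition Xg :: "nat \<Rightarrow> real \<times> real" where
  "Xg i = (if i = 0 then lv 1 0 - a else if i = m then a + lv (B-2) 0
     else if odd i then w + lv (int (i div 2)) 0 else u + lv (int (i div 2) - 1) 0)"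
definition \<gamma>g :: "nat \<Rightarrow> real \<Rightarrow> real \<times> real" where
  "\<gamma>g i = (if i = 0 then \<gamma>2 else if i = m - 1 then (\<lambda>t. reversepath \<gamma>0 t + lv (B-2) 0)
     else (\<lambda>t. reversepath \<gamma>1 t + lv (int (i div 2)) 0))"
text \<open>For eps = -1 the chain starts at w instead of -w. The seam is invariant under the
  half-turn, so the factor eps restores the direction of each copy.\<close>

definition hk :: "nat \<Rightarrow> real \<times> real \<Rightarrow> real \<times> real" where
  "hk i x = gi (eps *\<^sub>R x + lv (int (i div 2)) 0)"

lemma m: "3 \<le> m" "int m = 2 * B - 1" "odd m" using B2 by (auto simp: m_def even_nat_iff)

lemma m_neq: "Suc 0 \<noteq> m - Suc 0" "m - Suc 0 \<noteq> m" "m - Suc 0 \<noteq> 0" using m by auto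

lemma mem_shift_image: "y \<in> (\<lambda>x. x + v) ` Y \<longleftrightarrow> y - v \<in> Y" for y v :: "real \<times> real"
proof
  assume "y - v \<in> Y" then show "y \<in> (\<lambda>x. x + v) ` Y" by (intro image_eqI[of _ _ "y - v"]) auto
qed auto

lemma arc_shift:
  fixes v :: "real \<times> real"
  assumes "arc p" shows "arc (\<lambda>t. p t + v)" "path_image (\<lambda>t. p t + v) = {y. y - v \<in> path_image p}"
proof -
  have e: "(\<lambda>t. p t + v) = (\<lambda>x. x + v) \<circ> p" by (simp add: fun_eq_iff)
  show "arc (\<lambda>t. p t + v)" unfolding e by (rule arc_continuous_inj_image[OF assms]) (auto intro!: continuous_intros inj_onI)
  show "path_image (\<lambda>t. p t + v) = {y. y - v \<in> path_image p}"
    unfolding e path_image_compose using mem_shift_image by blast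
qed

lemma gg: assumes "i < m" "i = 0 \<or> i = m - 1 \<or> odd i"
  shows "arc (\<gamma>g i)" "path_image (\<gamma>g i) = Pg i" "\<gamma>g i 0 = Xg i" "\<gamma>g i 1 = Xg (Suc i)"
proof -
  have em: "even (m - 1)" "m - 1 \<noteq> 0" using m by auto
  have d: "int ((m - 1) div 2) = B - 1" using m by linarith
  consider "i = 0" | "i = m - 1" | "odd i" "i \<noteq> 0" "i \<noteq> m - 1" using assms by blast
  then have "arc (\<gamma>g i) \<and> path_image (\<gamma>g i) = Pg i \<and> \<gamma>g i 0 = Xg i \<and> \<gamma>g i 1 = Xg (Suc i)"
  proof cases
    case 1
    then show ?thesis using g2 m by (simp add: \<gamma>g_def Pg_def Xg_def)
  next
    case 2
    have r: "arc (reversepath \<gamma>0)" using g0(1) by (simp add: arc_reversepath)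
    have "path_image (\<gamma>g i) = Pg i"
      using 2 em arc_shift(2)[OF r, of "lv (B-2) 0"] unfolding \<gamma>g_def Pg_def path_image_reversepath g0(2) mem_Collect_eq inT_shift by simp
    then show ?thesis using 2 em arc_shift(1)[OF r] g0(3,4) m m_neq d by (simp add: \<gamma>g_def Xg_def reversepath_def)
  next
    case 3
    have r: "arc (reversepath \<gamma>1)" using g1(1) by (simp add: arc_reversepath)
    have s: "Suc i \<noteq> m" "even (Suc i)" "int (Suc i div 2) = int (i div 2) + 1" using 3 assms(1) m by auto
    have "path_image (\<gamma>g i) = Pg i"
      using 3 arc_shift(2)[OF r, of "lv (int (i div 2)) 0"] unfolding \<gamma>g_def Pg_def path_image_reversepath g1(2) mem_Collect_eq inT_shift inU_shift
      by (simp add: add.commute)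
    then show ?thesis using 3 s arc_shift(1)[OF r] g1(3,4) assms(1) by (simp add: \<gamma>g_def Xg_def reversepath_def)
  qed
  then show "arc (\<gamma>g i)" "path_image (\<gamma>g i) = Pg i" "\<gamma>g i 0 = Xg i" "\<gamma>g i 1 = Xg (Suc i)" by auto
qed

lemma Pg_cases: assumes "i < m" "y \<in> Pg i"
  obtains (first) "i = 0" "inU y 0 0" "inU y 1 0" | (last) "i = m - 1" "inT y (B-2) 0" "inT y (B-1) 0"
  | (odd) k where "i = 2 * k + 1" "0 \<le> int k" "int k \<le> B - 2" "inT y (int k) 0" "inU y (int k + 1) 0"
  | (even) k where "i = 2 * k" "1 \<le> int k" "int k \<le> B - 2" "inT y (int k) 0" "inU y (int k) 0"
proof -
  consider "i = 0" | "i = m - 1" "i \<noteq> 0" | "odd i" "i \<noteq> 0" "i \<noteq> m - 1" | "even i" "i \<noteq> 0" "i \<noteq> m - 1" by blast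
  then show thesis
  proof cases
    case 1 then show thesis using first assms(2) by (simp add: Pg_def)
  next
    case 2 then show thesis using last assms(2) by (simp add: Pg_def)
  next
    case 3
    then have "i = 2 * (i div 2) + 1" by simp
    moreover have "int (i div 2) \<le> B - 2" using 3 assms(1) m by linarith
    ultimately show thesis using odd[of "i div 2"] assms(2) 3 by (simp add: Pg_def)
  next
    case 4
    then have i: "i = 2 * (i div 2)" by simp
    moreover have "1 \<le> int (i div 2)" "int (i div 2) \<le> B - 2" using 4 i assms(1) m by linarith+
    ultimately show thesis using even[of "i div 2"] assms(2) 4 by (simp add: Pg_def)
  qed
qed

lemma Pg_adj: assumes "Suc i < m" "y \<in> Pg i" "y \<in> Pg (Suc i)" shows "y = Xg (Suc i)"
proof -
  have i: "i < m" using assms(1) by simp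
  from i assms(2) show ?thesis
  proof (cases rule: Pg_cases)
    case first
    have "y \<in> {y. inT y 0 0 \<and> inU y 1 0}" using assms(3) first(1) m_neq by (simp add: Pg_def)
    then have "y = w + lv 0 0" using F12'[of y 0] first by simp
    then show ?thesis using first m by (simp add: Xg_def)
  next
    case last then show ?thesis using assms(1) by simp
  next
    case (odd k)
    show ?thesis
    proof (cases "Suc i = m - 1")
      case True
      then have k: "int k = B - 2" using odd m by linarith
      have "inT y (int k + 1) 0" using assms(3) True k m by (simp add: Pg_def)
      then have "y = u + lv (int k) 0" using F01' odd by blast
      then show ?thesis using odd m assms(1) by (simp add: Xg_def)
    next
      case False
      then have "inT y (int k + 1) 0" using assms(3) odd by (simp add: Pg_def algebra_simps)
      then have "y = u + lv (int k) 0" using F01' odd by blast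
      then show ?thesis using odd m assms(1) by (simp add: Xg_def)
    qed
  next
    case (even k)
    have "Suc i \<noteq> m - 1" using even m by presburger
    then have "inU y (int k + 1) 0" using assms(3) even by (simp add: Pg_def)
    then have "y = w + lv (int k) 0" using F12' even by blast
    then show ?thesis using even m assms(1) by (simp add: Xg_def)
  qed
qed

text \<open>Pieces that are not adjacent involve two tiles at least 2 apart in the row, or else a
  rotated tile and the unrotated one next to it on the right, which \<open>never\<close>
  excludes.\<close>

lemma Pg_disj: assumes "j < m" "Suc i < j" "y \<in> Pg i" "y \<in> Pg j" shows False
proof -
  have i: "i < m" using assms by simp
  from i assms(3) show False
  proof (cases rule: Pg_cases)
    case first
    from assms(1,4) show False
    proof (cases rule: Pg_cases)
      case first then show False using assms(2) by simp
    next
      case last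
      show False
      proof (cases "B = 2")
        case True
        then have "inT y 0 0" "inT y 1 0" using last by auto
        then show False using never[of y] \<open>inU y 0 0\<close> by blast
      next
        case False then show False using row2[OF inU_inS[OF \<open>inU y 0 0\<close>] inT_inS[OF last(3)]] B2 by simp
      qed
    next
      case (odd k) then show False using row2[OF inU_inS[OF \<open>inU y 0 0\<close>] inU_inS[OF odd(5)]] \<open>i = 0\<close> assms(2) by simp
    next
      case (even k)
      show False
      proof (cases "k = 1")
        case True then show False using nev[of y 0] \<open>inU y 0 0\<close> even(4) by simp
      next
        case False then show False using row2[OF inU_inS[OF \<open>inU y 0 0\<close>] inT_inS[OF even(4)]] even(2) by simp
      qed
    qed
  next
    case last then show False using assms by simp
  next
    case o: (odd k)
    from assms(1,4) show False
    proof (cases rule: Pg_cases)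
      case first then show False using assms(2) by simp
    next
      case last
      have "int k \<le> B - 3" using last o assms(2) m by linarith
      then show False using row2[OF inT_inS[OF o(4)] inT_inS[OF last(3)]] by simp
    next
      case (odd l) then show False using row2[OF inT_inS[OF o(4)] inU_inS[OF odd(5)]] o(1) assms(2) by simp
    next
      case (even l) then show False using row2[OF inT_inS[OF o(4)] inT_inS[OF even(4)]] o(1) assms(2) by simp
    qed
  next
    case e: (even k)
    from assms(1,4) show False
    proof (cases rule: Pg_cases)
      case first then show False using assms(2) by simp
    next
      case last
      show False
      proof (cases "int k = B - 2")
        case True then show False using nev[of y "B-2"] e(5) last(3) by simp
      next
        case False
        then show False using row2[OF inT_inS[OF e(4)] inT_inS[OF last(3)]] e(3) by simp
      qed
    next
      case (odd l) then show False using row2[OF inT_inS[OF e(4)] inU_inS[OF odd(5)]] e(1) assms(2) by simp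
    next
      case (even l)
      show False
      proof (cases "l = k + 1")
        case True then show False using nev[of y "int k"] e(5) even(4) by (simp add: add.commute)
      next
        case False then show False using row2[OF inT_inS[OF e(4)] inT_inS[OF even(4)]] e(1) even(1) assms(2) by simp
      qed
    qed
  qed
qed

lemma kap_compact: "compact kap"
proof -
  have "kap = T \<inter> {x. - x \<in> T}" by (auto simp: kap_def)
  then show ?thesis using T_compact closed_uminus_T by (simp add: compact_Int_closed)
qed

lemma kap_minus: "x \<in> kap \<Longrightarrow> - x \<in> kap" by (simp add: kap_def)

lemma kap_rec: "x \<in> kap \<longleftrightarrow> (\<exists>i<m. g x \<in> Pg i)"
proof
  assume "x \<in> kap"
  then consider k where "k\<in>{0..B-2}" "inT (g x) k 0" "inU (g x) (k+1) 0" | k where "k\<in>{1..B-2}" "inT (g x) k 0" "inU (g x) k 0"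
    | "inU (g x) 0 0" "inU (g x) 1 0" | "inT (g x) (B-2) 0" "inT (g x) (B-1) 0"
    unfolding kap_def mem_Collect_eq krec by blast
  then show "\<exists>i<m. g x \<in> Pg i"
  proof cases
    case (1 k)
    define i where "i = 2 * nat k + 1"
    have i: "odd i" "i \<noteq> 0" "i < m" "int (i div 2) = k" "i \<noteq> m - 1" using 1 m by (auto simp: i_def)
    then have "g x \<in> Pg i" using 1 unfolding Pg_def by simp
    then show ?thesis using i by blast
  next
    case (2 k)
    define i where "i = 2 * nat k"
    have i: "even i" "i \<noteq> 0" "i < m" "int (i div 2) = k" "i \<noteq> m - 1" using 2 m by (auto simp: i_def)
    then have "g x \<in> Pg i" using 2 unfolding Pg_def by simp
    then show ?thesis using i by blast
  next
    case 3 then show ?thesis using m by (intro exI[of _ 0]) (simp add: Pg_def)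
  next
    case 4 then show ?thesis using m by (intro exI[of _ "m-1"]) (simp add: Pg_def)
  qed
next
  assume "\<exists>i<m. g x \<in> Pg i"
  then obtain i where i: "i < m" "g x \<in> Pg i" by blast
  from i show "x \<in> kap"
  proof (cases rule: Pg_cases)
    case first then show ?thesis unfolding kap_def mem_Collect_eq krec by blast
  next
    case last then show ?thesis unfolding kap_def mem_Collect_eq krec by blast
  next
    case (odd k)
    then have "int k \<in> {0..B-2}" by simp
    then show ?thesis using odd(4,5) unfolding kap_def mem_Collect_eq krec by blast
  next
    case (even k)
    then have "int k \<in> {1..B-2}" by simp
    then show ?thesis using even(4,5) unfolding kap_def mem_Collect_eq krec by blast
  qed
qed

lemma kap_arc: obtains p where "arc p" "path_image p = kap" "pathstart p = - w" "pathfinish p = w"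
proof -
  define I where "I = {i. i \<noteq> 0 \<and> i \<noteq> m - 1 \<and> even i}"
  have c0: "gi (Xg 0) = - eps *\<^sub>R w" using gw m by (simp add: Xg_def flip: gw)
  have cm: "gi (Xg m) = eps *\<^sub>R w"
  proof -
    have "g (eps *\<^sub>R w) = lv (B-1) 0 - g (- eps *\<^sub>R w)" using gmap_minus[of A B "- eps *\<^sub>R w"] by simp
    also have "\<dots> = a + lv (B-2) 0" unfolding gw by (simp add: lv_def prod_eq_iff)
    finally have "g (eps *\<^sub>R w) = Xg m" using m by (simp add: Xg_def)
    then show ?thesis by (metis gi_g)
  qed
  interpret AC: arc_chain kap "\<lambda>i. gi ` Pg i" "\<lambda>i. gi (Xg i)" hk "\<lambda>i. gi \<circ> \<gamma>g i" I m N lam c0 c1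
  proof
    show "2 \<le> m" using m by simp
    show "compact kap" by (rule kap_compact)
    have im: "x \<in> gi ` Y \<longleftrightarrow> g x \<in> Y" for x Y
    proof
      assume "g x \<in> Y" then show "x \<in> gi ` Y" by (intro image_eqI[of _ _ "g x"]) simp_all
    next
      assume "x \<in> gi ` Y"
      then obtain y where "y \<in> Y" "x = gi y" by blast
      then show "g x \<in> Y" by simp
    qed
    show K: "kap = (\<Union>i<m. gi ` Pg i)"
    proof (rule set_eqI)
      fix x show "x \<in> kap \<longleftrightarrow> x \<in> (\<Union>i<m. gi ` Pg i)" unfolding kap_rec[of x] UN_iff im by blast
    qed
    have "Xg (Suc 0) \<in> Pg 0" using pathfinish_in_path_image[of "\<gamma>g 0"] gg[of 0] m by (simp add: pathfinish_def)
    then show "kap \<noteq> {}" unfolding K using m by force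
    show "gi ` Pg i = hk i ` kap \<and> hk i (gi (Xg 0)) = gi (Xg i) \<and> hk i (gi (Xg m)) = gi (Xg (Suc i)) \<and> inj (hk i)" if i: "i < m" "i \<in> I" for i
    proof (intro conjI)
      define k where "k = int (i div 2)"
      have ii: "i \<noteq> 0" "i \<noteq> m - 1" "even i" using i(2) by (auto simp: I_def)
      have P: "y \<in> Pg i \<longleftrightarrow> y - lv k 0 \<in> kap" for y using ii by (simp add: Pg_def kap_def inT_def inU_def k_def)
      have sk: "eps *\<^sub>R x \<in> kap \<longleftrightarrow> x \<in> kap" for x using eps kap_minus[of x] kap_minus[of "- x"] by auto
      have ee: "eps *\<^sub>R eps *\<^sub>R x = x" for x :: "real \<times> real" using eps by auto
      show "gi ` Pg i = hk i ` kap"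
      proof (intro equalityI subsetI)
        fix x assume "x \<in> gi ` Pg i"
        then have "eps *\<^sub>R (g x - lv k 0) \<in> kap" unfolding im P sk .
        moreover have "x = hk i (eps *\<^sub>R (g x - lv k 0))" unfolding hk_def ee by (simp add: k_def)
        ultimately show "x \<in> hk i ` kap" by blast
      next
        fix x assume "x \<in> hk i ` kap"
        then obtain y where "y \<in> kap" "x = hk i y" by blast
        then show "x \<in> gi ` Pg i" unfolding im P by (simp add: hk_def sk k_def)
      qed
      show "hk i (gi (Xg 0)) = gi (Xg i)"
      proof -
        have "eps *\<^sub>R (- eps *\<^sub>R w) + lv k 0 = u + lv (k - 1) 0"
        proof -
          have "u = lv 1 0 - w" using uw by (simp add: algebra_simps)
          then show ?thesis using eps by (auto simp: lv_def prod_eq_iff)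
        qed
        then show ?thesis using ii i(1) unfolding c0 hk_def by (simp add: Xg_def k_def)
      qed
      show "hk i (gi (Xg m)) = gi (Xg (Suc i))"
        using ii i(1) ee[of w] unfolding cm hk_def by (auto simp: Xg_def)
      show "inj (hk i)"
      proof (rule injI)
        fix x y assume "hk i x = hk i y"
        then have "g (hk i x) = g (hk i y)" by simp
        then show "x = y" using eps unfolding hk_def by auto
      qed
    qed
    show "N (hk i p - hk i q) \<le> lam * N (p - q)" if "i < m" "i \<in> I" for i p q
    proof -
      have "N (eps *\<^sub>R p - eps *\<^sub>R q) = N (p - q)" using eps N_minus[of "p - q"] by auto
      then show ?thesis using contr[of "eps *\<^sub>R p + lv (int (i div 2)) 0" "eps *\<^sub>R q + lv (int (i div 2)) 0"] by (simp add: hk_def)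
    qed
    show "arc (gi \<circ> \<gamma>g i) \<and> path_image (gi \<circ> \<gamma>g i) = gi ` Pg i \<and> (gi \<circ> \<gamma>g i) 0 = gi (Xg i) \<and> (gi \<circ> \<gamma>g i) 1 = gi (Xg (Suc i))"
      if i: "i < m" "i \<notin> I" for i
    proof -
      have ii: "i = 0 \<or> i = m - 1 \<or> odd i" using i(2) by (auto simp: I_def)
      note G = gg[OF i(1) ii]
      have "inj gi" by (rule inj_on_inverseI[of _ g]) simp
      then have "arc (gi \<circ> \<gamma>g i)" by (intro arc_continuous_inj_image[OF G(1)] contraction_continuous contr) (auto intro: inj_on_subset)
      then show ?thesis using G by (simp add: path_image_compose)
    qed
    show "0 \<le> lam" "lam < 1" "0 < c0" "0 < c1" "c0 * norm v \<le> N v" "N v \<le> c1 * norm v" for v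
      by (rule lam c01 N_lower N_upper)+
    show "gi ` Pg i \<inter> gi ` Pg j = {}" if "i < m" "j < m" "Suc i < j" for i j
      using Pg_disj[OF that(2,3)] im by blast
    show "gi ` Pg i \<inter> gi ` Pg (Suc i) \<subseteq> {gi (Xg (Suc i))}" if "Suc i < m" for i
    proof
      fix x assume "x \<in> gi ` Pg i \<inter> gi ` Pg (Suc i)"
      then have "g x = Xg (Suc i)" using Pg_adj[OF that] im by blast
      then show "x \<in> {gi (Xg (Suc i))}" by (metis gi_g singletonI)
    qed
    have X0: "Xg 0 \<in> Pg 0" "Xg m \<in> Pg (m-1)" "Xg 0 \<noteq> Xg (Suc 0)" "Xg m \<noteq> Xg (m - 1)"
    proof -
      have m1: "m - 1 < m" "0 < m" "Suc (m-1) = m" using m by auto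
      have G0: "arc (\<gamma>g 0)" "path_image (\<gamma>g 0) = Pg 0" "\<gamma>g 0 0 = Xg 0" "\<gamma>g 0 1 = Xg (Suc 0)" using gg[OF m1(2)] by auto
      have Gm: "arc (\<gamma>g (m-1))" "path_image (\<gamma>g (m-1)) = Pg (m-1)" "\<gamma>g (m-1) 0 = Xg (m-1)" "\<gamma>g (m-1) 1 = Xg m"
        using gg[OF m1(1)] m1(3) by auto
      show "Xg 0 \<in> Pg 0" using pathstart_in_path_image[of "\<gamma>g 0"] G0 by (simp add: pathstart_def)
      show "Xg m \<in> Pg (m-1)" using pathfinish_in_path_image[of "\<gamma>g (m-1)"] Gm by (simp add: pathfinish_def)
      show "Xg 0 \<noteq> Xg (Suc 0)" using arc_distinct_ends[OF G0(1)] G0 by (simp add: pathstart_def pathfinish_def)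
      show "Xg m \<noteq> Xg (m - 1)" using arc_distinct_ends[OF Gm(1)] Gm by (simp add: pathstart_def pathfinish_def)
    qed
    show "gi (Xg 0) \<notin> gi ` Pg i" if "0 < i" "i < m" for i
    proof
      assume "gi (Xg 0) \<in> gi ` Pg i"
      then have y: "Xg 0 \<in> Pg i" by (simp add: im)
      show False
      proof (cases "i = Suc 0")
        case True then show False using Pg_adj[of 0 "Xg 0"] X0 y that by auto
      next
        case False then show False using Pg_disj[OF that(2) _ X0(1) y] that by auto
      qed
    qed
    show "gi (Xg m) \<notin> gi ` Pg i" if "Suc i < m" for i
    proof
      assume "gi (Xg m) \<in> gi ` Pg i"
      then have y: "Xg m \<in> Pg i" by (simp add: im)
      show False
      proof (cases "Suc i = m - 1")
        case True then show False using Pg_adj[of i "Xg m"] X0 y that by auto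
      next
        case False
        then have "Suc i < m - 1" "m - 1 < m" using that by linarith+
        then show False using Pg_disj[OF _ _ y X0(2)] by blast
      qed
    qed
  qed
  obtain p where p: "arc p" "path_image p = kap" "pathstart p = gi (Xg 0)" "pathfinish p = gi (Xg m)"
  proof (rule AC.arc_exists)
    fix p assume "arc p" "path_image p = kap" "pathstart p = gi (Xg 0)" "pathfinish p = gi (Xg m)"
    then show thesis by (rule that)
  qed
  from eps show thesis
  proof
    assume "eps = 1" then show thesis using that[of p] p c0 cm by simp
  next
    assume "eps = -1"
    then show thesis using that[of "reversepath p"] p c0 cm by (simp add: arc_reversepath)
  qed
qed

text \<open>W is the union of all tiles other than T, and the curve is the part of T lying in W. By
  \<open>covering\<close> the rest of T is the complement of W, which is open because W is
  closed.\<close>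

lemma disk_like_T: "disk_like T"
proof -
  obtain pk where pk: "arc pk" "path_image pk = kap" "pathstart pk = - w" "pathfinish pk = w" by (rule kap_arc)
  define F0 F1 UU' where "F0 = {x. inT x 0 0 \<and> inT x 1 0}" and "F1 = {x. inT x 0 0 \<and> inU x 1 0}"
    and "UU' = {x. x \<in> T \<and> (\<exists>p q. q \<noteq> 0 \<and> inS x p q)}"
  define F0' where "F0' = {x. x + lv 1 0 \<in> F0}"
  define q where "q = (\<lambda>t. \<gamma>0 t + (- lv 1 0))"
  have q: "arc q" "path_image q = F0'" "pathstart q = a - lv 1 0" "pathfinish q = - w"
  proof -
    show "arc q" unfolding q_def by (rule arc_shift(1)[OF g0(1)])
    show "path_image q = F0'" unfolding q_def arc_shift(2)[OF g0(1)] g0(2) F0'_def F0_def by simp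
    have "u = lv 1 0 - w" using uw by (simp add: algebra_simps)
    then show "pathstart q = a - lv 1 0" "pathfinish q = - w" using g0(3,4) by (simp_all add: q_def pathstart_def pathfinish_def)
  qed
  have F0'_iff: "x \<in> F0' \<longleftrightarrow> inT x (-1) 0 \<and> inT x 0 0" for x unfolding F0'_def F0_def mem_Collect_eq inT_plus by simp
  have ends: "pathstart \<gamma>0 = a" "pathfinish \<gamma>0 = u" "pathstart \<gamma>1 = u" "pathfinish \<gamma>1 = w" "pathstart \<gamma>U = a" "pathfinish \<gamma>U = a - lv 1 0"
    using g0 g1 gU by (auto simp: pathstart_def pathfinish_def)
  have im: "path_image \<gamma>0 = F0" "path_image \<gamma>1 = F1" "path_image \<gamma>U = UU'" using g0 g1 gU by (simp_all add: F0_def F1_def UU'_def)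
  have aF0: "a \<in> F0" using im(1) ends(1) pathstart_in_path_image by metis
  have kF1: "kap \<inter> F1 \<subseteq> {w}"
  proof
    fix x assume "x \<in> kap \<inter> F1"
    then have "inT x 0 0" "inU x 0 0" "inU x (0 + 1) 0" by (auto simp: kap_def F1_def)
    then show "x \<in> {w}" using F12'[of x 0] by simp
  qed
  have kF0: "kap \<inter> F0 = {}" using never unfolding kap_def F0_def inU_00 by blast
  have kU: "kap \<inter> UU' = {}" using UU unfolding kap_def UU'_def by blast
  have kF0': "kap \<inter> F0' \<subseteq> {- w}"
  proof
    fix x assume x: "x \<in> kap \<inter> F0'"
    then have "inT (-x) 0 0" "inU (-x) 0 0" "inU (-x) (0 + 1) 0" using F0'_iff[of x] by (auto simp: kap_def inU_minus)
    then have "-x = w" using F12'[of "-x" 0] by simp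
    then show "x \<in> {- w}" by (metis minus_minus singletonI)
  qed
  have F1F0: "F1 \<inter> F0 \<subseteq> {u}" using F01 unfolding F0_def F1_def by blast
  have FU: "F1 \<inter> UU' = {}" "F0 \<inter> UU' \<subseteq> {a}"
  proof -
    have *: "x = a" if "x \<in> F0 \<union> F1" "x \<in> UU'" for x
    proof -
      have "inS x 1 0" using that(1) inT_inS[of x 1 0] inU_inS[of x 1 0] by (auto simp: F0_def F1_def)
      then show ?thesis using that(2) UF[of x] by (auto simp: UU'_def)
    qed
    then show "F0 \<inter> UU' \<subseteq> {a}" by blast
    have "a \<notin> F1" using F1F0 aF0 arc_distinct_ends[OF g0(1)] ends by auto
    then show "F1 \<inter> UU' = {}" using * by blast
  qed
  have FF': "(F0 \<union> F1) \<inter> F0' = {}"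
  proof (rule ccontr)
    assume "(F0 \<union> F1) \<inter> F0' \<noteq> {}"
    then obtain x where x: "x \<in> F0 \<union> F1" "x \<in> F0'" by blast
    have "inS x 1 0" "inS x (-1) 0" using x F0'_iff[of x] inT_inS[of x] inU_inS[of x] by (auto simp: F0_def F1_def)
    then show False using row2[of x "-1" 1] by simp
  qed
  have UF0': "UU' \<inter> F0' \<subseteq> {a - lv 1 0}"
  proof
    fix x assume x: "x \<in> UU' \<inter> F0'"
    then have "inS x (-1) 0" using F0'_iff inT_inS by blast
    then show "x \<in> {a - lv 1 0}" using x UF'[of x] by (auto simp: UU'_def)
  qed
  define r0 where "r0 = reversepath \<gamma>0 +++ \<gamma>U"
  have r0: "arc r0" "path_image r0 = F0 \<union> UU'" "pathstart r0 = u" "pathfinish r0 = a - lv 1 0"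
  proof -
    show "arc r0" unfolding r0_def
      by (rule arc_join) (use g0(1) gU(1) ends im FU in \<open>auto simp: arc_reversepath\<close>)
    show "path_image r0 = F0 \<union> UU'" unfolding r0_def using ends im by (subst path_image_join) auto
    show "pathstart r0 = u" "pathfinish r0 = a - lv 1 0" using ends by (simp_all add: r0_def)
  qed
  define r1 where "r1 = reversepath \<gamma>1 +++ r0"
  have r1: "arc r1" "path_image r1 = F1 \<union> F0 \<union> UU'" "pathstart r1 = w" "pathfinish r1 = a - lv 1 0"
  proof -
    have "path_image (reversepath \<gamma>1) \<inter> path_image r0 \<subseteq> {pathstart r0}" using FU F1F0 im r0 by auto
    then show "arc r1" unfolding r1_def using g1(1) r0 ends by (intro arc_join) (auto simp: arc_reversepath)
    show "path_image r1 = F1 \<union> F0 \<union> UU'" unfolding r1_def using ends im r0 by (subst path_image_join) auto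
    show "pathstart r1 = w" "pathfinish r1 = a - lv 1 0" using ends r0 by (simp_all add: r1_def)
  qed
  define r2 where "r2 = pk +++ r1"
  have r2: "arc r2" "path_image r2 = kap \<union> F1 \<union> F0 \<union> UU'" "pathstart r2 = - w" "pathfinish r2 = a - lv 1 0"
  proof -
    have "path_image pk \<inter> path_image r1 \<subseteq> {pathstart r1}" using kF1 kF0 kU pk r1 by auto
    then show "arc r2" unfolding r2_def using pk r1 by (intro arc_join) auto
    show "path_image r2 = kap \<union> F1 \<union> F0 \<union> UU'" unfolding r2_def using pk r1 by (subst path_image_join) auto
    show "pathstart r2 = - w" "pathfinish r2 = a - lv 1 0" using pk r1 by (simp_all add: r2_def)
  qed
  define c where "c = r2 +++ q"
  have c: "simple_path c" "pathfinish c = pathstart c"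
  proof -
    have "path_image r2 \<inter> path_image q \<subseteq> {pathstart r2, pathstart q}"
      unfolding r2 q using kF0' FF' UF0' by blast
    then show "simple_path c" unfolding c_def using r2 q by (intro simple_path_join_loop) auto
    show "pathfinish c = pathstart c" using r2 q by (simp add: c_def)
  qed
  have cim: "path_image c = kap \<union> F1 \<union> F0 \<union> UU' \<union> F0'" unfolding c_def using r2 q by (subst path_image_join) auto
  define W where "W = {x. - x \<in> T} \<union> {x. \<exists>p q. (p, q) \<noteq> (0, 0) \<and> inS x p q}"
  have cW: "closed W" unfolding W_def by (intro closed_Un closed_uminus_T closed_other_S)
  have Wi: "inS x p q \<Longrightarrow> (p, q) \<noteq> (0, 0) \<Longrightarrow> x \<in> W" for x p q unfolding W_def by blast
  have TW: "T \<inter> W = path_image c"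
  proof
    show "path_image c \<subseteq> T \<inter> W"
    proof -
      have "kap \<subseteq> T \<inter> W" by (auto simp: kap_def W_def)
      moreover have "F0 \<subseteq> T \<inter> W" unfolding F0_def using Wi[of _ 1 0] inT_inS[of _ 1 0] by auto
      moreover have "F1 \<subseteq> T \<inter> W" unfolding F1_def using Wi[of _ 1 0] inU_inS[of _ 1 0] by auto
      moreover have "UU' \<subseteq> T \<inter> W"
      proof
        fix x assume "x \<in> UU'"
        then obtain p q where "x \<in> T" "q \<noteq> 0" "inS x p q" unfolding UU'_def by blast
        then show "x \<in> T \<inter> W" using Wi[of x p q] by simp
      qed
      moreover have "F0' \<subseteq> T \<inter> W"
      proof
        fix x assume "x \<in> F0'"
        then have "x \<in> T" "inS x (-1) 0" using F0'_iff[of x] inT_inS[of x] by auto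
        then show "x \<in> T \<inter> W" using Wi[of x "-1" 0] by simp
      qed
      ultimately show ?thesis unfolding cim by blast
    qed
    show "T \<inter> W \<subseteq> path_image c"
    proof
      fix x assume x: "x \<in> T \<inter> W"
      then have xT: "x \<in> T" and xS: "x \<in> S" using S_T by auto
      from x consider "- x \<in> T" | p q where "(p,q) \<noteq> (0,0)" "inS x p q" unfolding W_def by blast
      then show "x \<in> path_image c"
      proof cases
        case 1 then show ?thesis using xT unfolding cim kap_def by blast
      next
        case (2 p q)
        show ?thesis
        proof (cases "q = 0")
          case False then show ?thesis using xT 2 unfolding cim UU'_def by blast
        next
          case True
          then have "p = 1 \<or> p = -1" using row_nb[OF xS, of p] 2 by auto
          then show ?thesis
          proof
            assume "p = 1"
            then have "inT x 1 0 \<or> inU x 1 0" using 2 True inS_iff by simp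
            then show ?thesis using xT unfolding cim F0_def F1_def by auto
          next
            assume p: "p = -1"
            then have "inT x (-1) 0 \<or> inU x (-1) 0" using 2 True inS_iff by simp
            moreover have "\<not> inU x (-1) 0" using nev[of x "-1"] xT by auto
            ultimately have "x \<in> F0'" using F0'_iff xT by simp
            then show ?thesis unfolding cim by blast
          qed
        qed
      qed
    qed
  qed
  have TmW: "T - path_image c = - W"
  proof -
    have "x \<in> T" if "x \<notin> W" for x
    proof -
      obtain p q where pq: "inS x p q" using covering by blast
      then have "p = 0 \<and> q = 0" using that unfolding W_def by blast
      then have "x \<in> S" using pq by simp
      then show "x \<in> T" using that S_T unfolding W_def by blast
    qed
    then show ?thesis using TW by blast
  qed
  show ?thesis
  proof (rule disk_like_of_Jordan_curve[OF T_compact c])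
    show "path_image c \<subseteq> T" using TW by blast
    show "open (T - path_image c)" unfolding TmW using cW by (simp add: open_Compl)
    \<comment> \<open>The preimage of 0 lies in one translate of S only, and not in both halves,
      because each alternative of \<open>krec\<close> would put 0 into some S + (l, 0) with l \<ge>
      1. So this point or its negative lies in T alone.\<close>
    have "\<exists>x. x \<notin> W"
    proof -
      define x where "x = gi 0"
      have zS: "0 \<in> S" using covering[of 0] zero_only by (metis inS_00)
      have only: "p = 0 \<and> q = 0" if xpq: "inS x p q" for p q
      proof -
        obtain k where k: "k \<in> {0..B-1}" "inS 0 (k - B * q) (p - A * q)" using inS_rec[of x p q] xpq unfolding x_def g_gi by blast
        have e: "k - B * q = 0" "p - A * q = 0" using zero_only[OF k(2)] by auto
        have "q = 0"
        proof (rule ccontr)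
          assume "q \<noteq> 0"
          have "B dvd k" using e(1) by (metis dvd_triv_left eq_iff_diff_eq_0)
          then have "k = 0" using k(1) zdvd_not_zless[of k B] by force
          then show False using e(1) \<open>q \<noteq> 0\<close> B2 by simp
        qed
        then show ?thesis using e by simp
      qed
      have nk: "\<not> (x \<in> T \<and> - x \<in> T)"
      proof
        assume "x \<in> T \<and> - x \<in> T"
        then have "(\<exists>k\<in>{0..B-2}. inT 0 k 0 \<and> inU 0 (k+1) 0) \<or>
          (\<exists>k\<in>{1..B-2}. inT 0 k 0 \<and> inU 0 k 0) \<or> (inU 0 0 0 \<and> inU 0 1 0) \<or> (inT 0 (B-2) 0 \<and> inT 0 (B-1) 0)"
          unfolding krec unfolding x_def g_gi .
        then have "\<exists>l\<ge>1. inS 0 l 0"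
        proof (elim disjE bexE conjE)
          fix k assume "k \<in> {0..B-2}" "inU 0 (k+1) 0"
          then show ?thesis using inU_inS[of 0 "k+1" 0] by (intro exI[of _ "k+1"]) auto
        next
          fix k assume "k \<in> {1..B-2}" "inU 0 k 0"
          then show ?thesis using inU_inS[of 0 k 0] by (intro exI[of _ k]) auto
        next
          assume "inU 0 1 0" then show ?thesis using inU_inS[of 0 1 0] by (intro exI[of _ 1]) auto
        next
          assume "inT 0 (B-1) 0" then show ?thesis using inT_inS[of 0 "B-1" 0] B2 by (intro exI[of _ "B-1"]) auto
        qed
        then obtain l where "l \<ge> 1" "inS 0 l 0" by blast
        then show False using zero_only[of l 0] by simp
      qed
      have "\<exists>k\<in>{0..B-1}. g x - lv k 0 \<in> S" using zS B2 unfolding x_def g_gi by (intro bexI[of _ 0]) auto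
      then have "x \<in> S" using S_rec[of x] by blast
      then consider "x \<in> T" "- x \<notin> T" | "- x \<in> T" "x \<notin> T" using S_T nk by blast
      then show ?thesis
      proof cases
        case 1 then have "x \<notin> W" using only unfolding W_def by blast
        then show ?thesis by blast
      next
        case 2
        have "-x \<notin> W"
        proof
          assume "- x \<in> W"
          then obtain p q where "(p, q) \<noteq> (0, 0)" "inS (- x) p q" using 2 unfolding W_def by auto
          then show False using only[of "- p" "- q"] by (simp add: inS_minus)
        qed
        then show ?thesis by blast
      qed
    qed
    then show "T - path_image c \<noteq> {}" unfolding TmW by blast
  qed
qed

end

section \<open>The lattice tile for A = 1\<close>

context half_tile
begin

text \<open>When the subdivisions of T and -T are multiplied out, contact within a row leaves only
  digits at most 1 apart, and \<open>nev\<close> removes the pairs with the rotated tile on the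
  left. What survives is the chain required by \<open>krec\<close>.\<close>

lemma kappa_recursion:
  assumes row: "\<And>x p p'. inS x p 0 \<Longrightarrow> inS x p' 0 \<Longrightarrow> \<bar>p' - p\<bar> \<le> 1"
    and nev: "\<And>x p. inU x p 0 \<Longrightarrow> inT x (p + 1) 0 \<Longrightarrow> False"
  shows "(inS y 0 0 \<or> (\<exists>k\<in>{1..B-2}. inT y k 0)) \<and> (inS y (B-1) 0 \<or> (\<exists>k\<in>{1..B-2}. inU y k 0)) \<longleftrightarrow>
    (\<exists>k\<in>{0..B-2}. inT y k 0 \<and> inU y (k+1) 0) \<or> (\<exists>k\<in>{1..B-2}. inT y k 0 \<and> inU y k 0) \<or> (inU y 0 0 \<and> inU y 1 0) \<or>
      (inT y (B-2) 0 \<and> inT y (B-1) 0)" (is "?l \<longleftrightarrow> ?r")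
proof
  assume ?l
  then consider "inS y 0 0" "inS y (B-1) 0" | k where "inS y 0 0" "k\<in>{1..B-2}" "inU y k 0"
    | k where "k\<in>{1..B-2}" "inT y k 0" "inS y (B-1) 0" | k j where "k\<in>{1..B-2}" "inT y k 0" "j\<in>{1..B-2}" "inU y j 0" by blast
  then show ?r
  proof cases
    case 1
    then have B: "B = 2" using row[OF 1] B2 by auto
    have "inT y 0 0 \<or> inU y 0 0" "inT y 1 0 \<or> inU y 1 0" using 1 B by (simp_all add: inS_iff)
    moreover have "\<not> (inU y 0 0 \<and> inT y 1 0)" using nev[of y 0] by auto
    ultimately show ?thesis using B by auto
  next
    case (2 k)
    then have "k = 1" using row[OF 2(1) inU_inS[OF 2(3)]] by auto
    moreover have "inT y 0 0 \<or> inU y 0 0" using 2 by (simp add: inS_iff)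
    ultimately consider "k = 1" "inT y 0 0" | "k = 1" "inU y 0 0" by blast
    then show ?thesis
    proof cases
      assume "k = 1" "inT y 0 0"
      then have "0 \<in> {0..B-2}" "inT y 0 0 \<and> inU y (0+1) 0" using 2 B2 by auto
      then show ?thesis by blast
    next
      assume "k = 1" "inU y 0 0"
      then have "inU y 0 0 \<and> inU y 1 0" using 2 by simp
      then show ?thesis by blast
    qed
  next
    case (3 k)
    then have k: "k = B - 2" using row[OF inT_inS[OF 3(2)] 3(3)] by auto
    have "inT y (B-1) 0 \<or> inU y (B-1) 0" using 3 by (simp add: inS_iff)
    then show ?thesis
    proof
      assume "inT y (B-1) 0" then show ?thesis using 3 k by blast
    next
      assume "inU y (B-1) 0"
      then have "inT y k 0 \<and> inU y (k+1) 0" "k \<in> {0..B-2}" using 3 k by auto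
      then show ?thesis by blast
    qed
  next
    case (4 k j)
    have "\<bar>j - k\<bar> \<le> 1" using row[OF inT_inS[OF 4(2)] inU_inS[OF 4(4)]] .
    then consider "j = k" | "j = k + 1" | "k = j + 1" by linarith
    then show ?thesis
    proof cases
      case 1 then show ?thesis using 4 by blast
    next
      case 2
      then have "k \<in> {0..B-2}" using 4 by auto
      then show ?thesis using 2 4 by blast
    next
      case 3 then show ?thesis using nev[of y j] 4 by blast
    qed
  qed
next
  assume ?r
  then consider k where "k\<in>{0..B-2}" "inT y k 0" "inU y (k+1) 0" | k where "k\<in>{1..B-2}" "inT y k 0" "inU y k 0"
    | "inU y 0 0" "inU y 1 0" | "inT y (B-2) 0" "inT y (B-1) 0" by blast
  then show ?l
  proof cases
    case (1 k)
    have "inS y 0 0 \<or> (\<exists>k\<in>{1..B-2}. inT y k 0)"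
    proof (cases "k = 0")
      case True then show ?thesis using 1 inT_inS by blast
    next
      case False
      then have "k \<in> {1..B-2}" using 1 by auto
      then show ?thesis using 1 by blast
    qed
    moreover have "inS y (B-1) 0 \<or> (\<exists>k\<in>{1..B-2}. inU y k 0)"
    proof (cases "k = B - 2")
      case True then show ?thesis using inU_inS[OF 1(3)] by simp
    next
      case False
      then have "k + 1 \<in> {1..B-2}" using 1 by auto
      then show ?thesis using 1 by blast
    qed
    ultimately show ?thesis by blast
  next
    case (2 k) then show ?thesis by blast
  next
    case 3
    have "inS y (B-1) 0 \<or> (\<exists>k\<in>{1..B-2}. inU y k 0)"
    proof (cases "B = 2")
      case True then show ?thesis using inU_inS[OF 3(2)] by simp
    next
      case False
      then have "1 \<in> {1..B-2}" using B2 by auto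
      then show ?thesis using 3 by blast
    qed
    then show ?thesis using inU_inS[OF 3(1)] by blast
  next
    case 4
    have "inS y 0 0 \<or> (\<exists>k\<in>{1..B-2}. inT y k 0)"
    proof (cases "B = 2")
      case True then show ?thesis using inT_inS[OF 4(1)] by simp
    next
      case False
      then have "B - 2 \<in> {1..B-2}" using B2 by auto
      then show ?thesis using 4 by blast
    qed
    then show ?thesis using inT_inS[OF 4(2)] by blast
  qed
qed

lemma low_digit: assumes "inS y 0 q \<or> (\<exists>k\<in>{1..B-2}. inT y k q)"
  obtains k where "0 \<le> k" "k \<le> B - 2" "inS y k q"
  using assms
proof
  assume "inS y 0 q" then show thesis using that[of 0] B2 by simp
next
  assume "\<exists>k\<in>{1..B-2}. inT y k q"
  then obtain k where "k \<in> {1..B-2}" "inT y k q" by blast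
  then show thesis using that[of k] inT_inS[of y k q] by simp
qed

lemma high_digit: assumes "inS y (B-1) q \<or> (\<exists>k\<in>{1..B-2}. inU y k q)"
  obtains k where "1 \<le> k" "k \<le> B - 1" "inS y k q"
  using assms
proof
  assume "inS y (B-1) q" then show thesis using that[of "B-1"] B2 by simp
next
  assume "\<exists>k\<in>{1..B-2}. inU y k q"
  then obtain k where "k \<in> {1..B-2}" "inU y k q" by blast
  then show thesis using that[of k] inU_inS[of y k q] by simp
qed

text \<open>An expanding map has no bounded forward invariant set besides its fixed point. Triple
  intersections are such sets for g followed by a translation, so they are single points.\<close>

lemma fix_unique:
  assumes "bounded X" "\<And>x. x \<in> X \<Longrightarrow> g x + v \<in> X" "g z + v = z" "x \<in> X"
  shows "x = z"
proof -
  obtain E where E: "\<And>x. x \<in> X \<Longrightarrow> N (x - z) \<le> E" using gauge_bounded[OF assms(1) bounded_insert[THEN iffD2, OF bounded_empty]] by (metis singletonI)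
  have "N (x - z) \<le> lam ^ n * E" if "x \<in> X" for n x using that
  proof (induction n arbitrary: x)
    case 0 then show ?case using E by simp
  next
    case (Suc n)
    have "N (x - z) \<le> lam * N (g x - g z)" using contr[of "g x" "g z"] by simp
    also have "g x - g z = (g x + v) - z" using assms(3) by (simp add: algebra_simps)
    also have "lam * N (g x + v - z) \<le> lam * (lam ^ n * E)" using Suc.IH[OF assms(2)[OF Suc.prems]] lam(1) by (rule mult_left_mono)
    finally show ?case by (simp add: mult.assoc)
  qed
  then have "x \<in> {z}" using closed_mem_if_gauge_small[of "{z}" x E] assms(4) by auto
  then show ?thesis by simp
qed

end

text \<open>The six neighbours are \<open>(\<plusminus>1, 0)\<close>, \<open>\<plusminus>(1, 1)\<close>, \<open>\<plusminus>(0, 1)\<close>, so \<open>S\<close> is a topological hexagon with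
  vertices \<open>\<plusminus>z1\<close>, \<open>\<plusminus>z2\<close>, \<open>\<plusminus>(z1 - (1, 0))\<close>; \<open>FF\<close>, \<open>al\<close>, \<open>be\<close> are three consecutive sides. Under \<open>g\<close> the side
  \<open>FF\<close> is an alternating chain of translates of \<open>be\<close> and \<open>al\<close>, themselves affine copies of \<open>FF\<close>.\<close>

locale lattice_A1 = half_tile N lam c0 c1 1 B S T for N lam c0 c1 B S T
begin

lemma nb: assumes "inS x p q" "inS x p' q'"
  shows "(q' - q = 0 \<and> (p' - p = 0 \<or> p' - p = 1 \<or> p' - p = -1)) \<or> (q' - q = 1 \<and> (p' - p = 1 \<or> p' - p = 0)) \<or>
    (q' - q = -1 \<and> (p' - p = -1 \<or> p' - p = 0))"
proof -
  have "neighbour_vec 1 (p' - p, q' - q)"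
    by (rule neighbour_set_bound[OF _ _ _ _ nbrs_finite nbrs_minus nbrs_step inS_nbrs[OF assms]]) (use B2 in auto)
  then show ?thesis unfolding neighbour_vec_def by auto
qed

lemma up_nb: "inS x k q \<Longrightarrow> inS x j (q + 1) \<Longrightarrow> j = k \<or> j = k + 1" using nb[of x k q j "q + 1"] by auto

lemma zero_only: assumes "inS 0 p q" shows "p = 0 \<and> q = 0"
proof -
  have "inS 0 (-p) (-q)" using assms inS_minus[of 0 p q] by simp
  from nb[OF this assms] show ?thesis by presburger
qed

text \<open>The fixed point of x \<mapsto> g x + (1, 0), that is, \<open>zp\<close> for A = 1;
  \<open>z2\<close> is its image under the half-turn exchanging S and S + (1, 1).\<close>

definition z1 :: "real \<times> real" where
  "z1 = (2 * (of_int (B + 1) / (2 * (of_int B + 2))), of_int (B + 1) / (2 * (of_int B + 2)))"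
definition z2 where "z2 = lv 1 1 - z1"

lemma g_z1: "g z1 = z1 - lv 1 0"
proof -
  define b where "b = real_of_int B"
  define y where "y = (b + 1) / (2 * (b + 2))"
  have "0 < b + 2" using B2 by (simp add: b_def)
  then have "y * (2 * (b + 2)) = b + 1" by (simp add: y_def)
  then have 1: "2 * (b * y) + 4 * y = b + 1" by (simp add: algebra_simps)
  have z: "z1 = (2 * y, y)" by (simp add: z1_def b_def y_def)
  have "- b * y + (b - 1) / 2 = 2 * y - 1"
  proof -
    have "2 * R + 4 * y = b + 1 \<Longrightarrow> - R + (b - 1) / 2 = 2 * y - 1" for R :: real by (simp add: field_simps)
    from this[OF 1] show ?thesis by simp
  qed
  then show ?thesis unfolding z by (simp add: gmap_def lv_def prod_eq_iff flip: b_def)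
qed

lemma g_z2: "g z2 = - z1"
proof -
  have "z2 = - (z1 - lv 1 1)" by (simp add: z2_def)
  then have "g z2 = lv (B-1) 0 - g (z1 - lv 1 1)" by (simp only: gmap_minus)
  also have "\<dots> = - z1" unfolding gmap_diff_lv g_z1 by (simp add: lv_def prod_eq_iff)
  finally show ?thesis .
qed

lemma z1_mem: "inS z1 0 0" "inS z1 1 0" "inS z1 1 1"
proof -
  have 1: "g z1 - lv 0 0 = z1 - lv 1 0" using g_z1 by simp
  have 2: "g (z1 - lv 1 0) - lv 0 0 = z1 - lv 1 1" unfolding gmap_diff_lv g_z1 by (simp add: lv_def prod_eq_iff)
  have 3: "g (z1 - lv 1 1) - lv (B-1) 0 = z1" unfolding gmap_diff_lv g_z1 by (simp add: lv_def prod_eq_iff)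
  show "inS z1 0 0" "inS z1 1 0" "inS z1 1 1" unfolding inS_00 unfolding inS_def
    by (rule cycle3_mem[OF 1 2 3]; use B2 in simp)+
qed

lemma z2_mem: "inS z2 0 0" "inS z2 0 1" "inS z2 1 1"
  unfolding z2_def inS_reflect using z1_mem by simp_all

lemma z1_unique: assumes "inS x 0 0" "inS x 1 0" "inS x 1 1" shows "x = z1"
proof (rule fix_unique[of "{x. inS x 0 0 \<and> inS x 1 0 \<and> inS x 1 1}" "lv 1 0" z1])
  show "bounded {x. inS x 0 0 \<and> inS x 1 0 \<and> inS x 1 1}"
    by (rule bounded_subset[OF compact_imp_bounded[OF S_compact]]) auto
  show "g z1 + lv 1 0 = z1" using g_z1 by simp
  show "x \<in> {x. inS x 0 0 \<and> inS x 1 0 \<and> inS x 1 1}" using assms by simp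
  fix y assume "y \<in> {x. inS x 0 0 \<and> inS x 1 0 \<and> inS x 1 1}"
  then have y: "inS y 0 0" "inS y 1 0" "inS y 1 1" by auto
  obtain k where k: "k \<in> {0..B-1}" "inS (g y) k 0" using inS_rec[of y 0 0] y(1) by auto
  obtain j where j: "j \<in> {0..B-1}" "inS (g y) j 1" using inS_rec[of y 1 0] y(2) by auto
  obtain n where n: "n \<in> {0..B-1}" "inS (g y) (n - B) 0" using inS_rec[of y 1 1] y(3) by auto
  have kn: "k = 0" "n - B = -1" using nb[OF n(2) k(2)] k(1) n(1) by auto
  have "j = 0" using nb[OF k(2) j(2)] nb[OF n(2) j(2)] kn by auto
  then show "g y + lv 1 0 \<in> {x. inS x 0 0 \<and> inS x 1 0 \<and> inS x 1 1}"
    unfolding mem_Collect_eq inS_plus using k(2) j(2) n(2) kn by simp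
qed

lemma z2_unique: assumes "inS x 0 0" "inS x 0 1" "inS x 1 1" shows "x = z2"
proof -
  have "lv 1 1 - x = z1" by (rule z1_unique) (unfold inS_reflect, use assms in simp_all)
  then show ?thesis unfolding z2_def by (simp add: algebra_simps)
qed

definition FF where "FF = {x. inS x 0 0 \<and> inS x 1 0}"
definition al where "al = {x. inS x 0 0 \<and> inS x 1 1}"
definition be where "be = {x. inS x 0 0 \<and> inS x 0 1}"
definition M where "M = nat (2 * B - 1)"
text \<open>The compatible digits k in the lower and j in the upper row satisfy j = k or j = k + 1.
  Listed in zigzag order by i = k + j they are the floor and the ceiling of i/2, which gives M = 2 B
  - 1 places.\<close>

definition PP :: "nat \<Rightarrow> (real \<times> real) set" where
  "PP i = {x. inS (g x) (int (i div 2)) 0 \<and> inS (g x) (int ((i + 1) div 2)) 1}"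
definition xp :: "nat \<Rightarrow> real \<times> real" where
  "xp i = gi (if even i then z1 + lv (int (i div 2) - 1) 0 else z2 + lv (int (i div 2)) 0)"
definition fal where "fal x = gi (- x)"
text \<open>This is \<open>fal\<close> after the half-turn x \<mapsto> (1, 0) - x of FF, followed by
  one more step back. The half-turn makes the copies of \<open>be\<close> and \<open>al\<close> fit
  head to tail along the chain.\<close>

definition fbe where "fbe x = gi (gi (x - lv 1 0) - lv 1 1)"
definition hf :: "nat \<Rightarrow> real \<times> real \<Rightarrow> real \<times> real" where
  "hf i x = gi ((if even i then fbe x else fal x) + lv (int (i div 2)) 0)"

lemma M: "3 \<le> M" "int M = 2 * B - 1" "odd M" using B2 by (auto simp: M_def even_nat_iff)

lemma FF_reflect: "lv 1 0 - x \<in> FF \<longleftrightarrow> x \<in> FF" unfolding FF_def mem_Collect_eq inS_reflect by auto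

lemma al_iff: "x \<in> al \<longleftrightarrow> - g x \<in> FF"
proof
  assume "x \<in> al"
  then have x: "inS x 0 0" "inS x 1 1" by (auto simp: al_def)
  obtain k where k: "k \<in> {0..B-1}" "inS (g x) k 0" using inS_rec[of x 0 0] x(1) by auto
  obtain n where n: "n \<in> {0..B-1}" "inS (g x) (n - B) 0" using inS_rec[of x 1 1] x(2) by auto
  have "k = 0" "n - B = -1" using nb[OF n(2) k(2)] k(1) n(1) by auto
  then show "- g x \<in> FF" using k n unfolding FF_def mem_Collect_eq inS_minus by simp
next
  assume "- g x \<in> FF"
  then have f: "inS (g x) 0 0" "inS (g x) (-1) 0" unfolding FF_def mem_Collect_eq inS_minus by auto
  have 0: "0 \<in> {0..B-1}" "B - 1 \<in> {0..B-1}" using B2 by auto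
  have "inS (g x) (0 - B * 0) (0 - 1 * 0)" using f(1) by simp
  then have "inS x 0 0" using inS_rec[of x 0 0] 0(1) by blast
  moreover have "inS (g x) (B - 1 - B * 1) (1 - 1 * 1)" using f(2) by simp
  then have "inS x 1 1" using inS_rec[of x 1 1] 0(2) by blast
  ultimately show "x \<in> al" by (simp add: al_def)
qed

lemma be_iff: "x \<in> be \<longleftrightarrow> g x + lv 1 1 \<in> al"
proof
  assume "x \<in> be"
  then have x: "inS x 0 0" "inS x 0 1" by (auto simp: be_def)
  obtain k where k: "k \<in> {0..B-1}" "inS (g x) k 0" using inS_rec[of x 0 0] x(1) by auto
  obtain n where n: "n \<in> {0..B-1}" "inS (g x) (n - B) (-1)" using inS_rec[of x 0 1] x(2) by auto
  have "k = 0" "n - B = -1" using nb[OF n(2) k(2)] k(1) n(1) by auto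
  then show "g x + lv 1 1 \<in> al" using k n unfolding al_def mem_Collect_eq inS_plus by simp
next
  assume "g x + lv 1 1 \<in> al"
  then have f: "inS (g x) (-1) (-1)" "inS (g x) 0 0" unfolding al_def mem_Collect_eq inS_plus by auto
  have 0: "0 \<in> {0..B-1}" "B - 1 \<in> {0..B-1}" using B2 by auto
  have "inS (g x) (0 - B * 0) (0 - 1 * 0)" using f(2) by simp
  then have "inS x 0 0" using inS_rec[of x 0 0] 0(1) by blast
  moreover have "inS (g x) (B - 1 - B * 1) (0 - 1 * 1)" using f(1) by simp
  then have "inS x 0 1" using inS_rec[of x 0 1] 0(2) by blast
  ultimately show "x \<in> be" by (simp add: be_def)
qed

lemma fal_image: "fal ` FF = al"
proof (intro equalityI subsetI)
  fix y assume "y \<in> fal ` FF"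
  then obtain x where x: "x \<in> FF" "y = fal x" by blast
  have "- g y = x" unfolding x(2) fal_def by simp
  then show "y \<in> al" using x(1) unfolding al_iff by simp
next
  fix y assume "y \<in> al"
  then have "- g y \<in> FF" "y = fal (- g y)" unfolding al_iff fal_def by simp_all
  then show "y \<in> fal ` FF" by blast
qed

lemma fbe_image: "fbe ` FF = be"
proof (intro equalityI subsetI)
  fix y assume "y \<in> fbe ` FF"
  then obtain x where x: "x \<in> FF" "y = fbe x" by blast
  have "- g (g y + lv 1 1) = lv 1 0 - x" unfolding x(2) fbe_def by simp
  then show "y \<in> be" using x(1) unfolding be_iff al_iff by (simp add: FF_reflect)
next
  fix y assume "y \<in> be"
  then have "- g (g y + lv 1 1) \<in> FF" unfolding be_iff al_iff .
  then have "lv 1 0 - (- g (g y + lv 1 1)) \<in> FF" unfolding FF_reflect .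
  moreover have "y = fbe (lv 1 0 - (- g (g y + lv 1 1)))" by (simp add: fbe_def)
  ultimately show "y \<in> fbe ` FF" by blast
qed

lemma vertex_maps: "fal z1 = z2" "fal (lv 1 0 - z1) = z1" "fbe z1 = z1 - lv 1 0" "fbe (lv 1 0 - z1) = z2"
proof -
  have a: "gi (- z1) = z2" by (metis g_z2 gi_g)
  have b: "gi (z1 - lv 1 0) = z1" by (metis g_z1 gi_g)
  have "g (z1 - lv 1 0) = z1 - lv 1 1" unfolding gmap_diff_lv g_z1 by (simp add: lv_def prod_eq_iff)
  then have c: "gi (z1 - lv 1 1) = z1 - lv 1 0" by (metis gi_g)
  show "fal z1 = z2" unfolding fal_def a ..
  show "fal (lv 1 0 - z1) = z1" using b by (simp add: fal_def)
  show "fbe z1 = z1 - lv 1 0" unfolding fbe_def b c ..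
  have "lv 1 0 - z1 - lv 1 0 = - z1" "z2 - lv 1 1 = - z1" by (simp_all add: z2_def)
  then show "fbe (lv 1 0 - z1) = z2" by (simp only: fbe_def a)
qed

lemma PP_eq: "PP i = hf i ` FF"
proof -
  define k where "k = int (i div 2)"
  define Y where "Y = (if even i then be else al)"
  have P: "x \<in> PP i \<longleftrightarrow> g x - lv k 0 \<in> Y" for x
  proof (cases "even i")
    case True
    then have "int ((i + 1) div 2) = k" unfolding k_def by presburger
    then show ?thesis using True unfolding PP_def Y_def be_def al_def mem_Collect_eq k_def[symmetric] by (simp add: inS_shift del: inS_00)
  next
    case False
    then have "int ((i + 1) div 2) = k + 1" unfolding k_def by presburger
    then show ?thesis using False unfolding PP_def Y_def be_def al_def mem_Collect_eq k_def[symmetric] by (simp add: inS_shift add.commute del: inS_00)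
  qed
  have Y: "Y = (\<lambda>x. if even i then fbe x else fal x) ` FF" unfolding Y_def using fal_image fbe_image by auto
  show ?thesis
  proof (intro equalityI subsetI)
    fix x assume "x \<in> PP i"
    then obtain y where y: "y \<in> FF" "g x - lv k 0 = (if even i then fbe y else fal y)" unfolding P Y by blast
    have "g x = (if even i then fbe y else fal y) + lv k 0" using y(2) by (metis diff_add_cancel)
    then have "x = gi ((if even i then fbe y else fal y) + lv k 0)" by (metis gi_g)
    then have "x = hf i y" unfolding hf_def k_def .
    then show "x \<in> hf i ` FF" using y(1) by blast
  next
    fix x assume "x \<in> hf i ` FF"
    then obtain y where y: "y \<in> FF" "x = hf i y" by blast
    have "g x - lv k 0 = (if even i then fbe y else fal y)" unfolding y(2) hf_def k_def by simp
    then show "x \<in> PP i" unfolding P Y using y(1) by blast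
  qed
qed

lemma FF_rec: "FF = (\<Union>i<M. PP i)"
proof (intro equalityI subsetI)
  fix x assume "x \<in> FF"
  then have x: "inS x 0 0" "inS x 1 0" by (auto simp: FF_def)
  obtain k where k: "k \<in> {0..B-1}" "inS (g x) k 0" using inS_rec[of x 0 0] x(1) by auto
  obtain j where j: "j \<in> {0..B-1}" "inS (g x) j 1" using inS_rec[of x 1 0] x(2) by auto
  have jk: "j = k \<or> j = k + 1" using nb[OF k(2) j(2)] by auto
  define i where "i = nat (k + j)"
  have i: "int (i div 2) = k" "int ((i + 1) div 2) = j" "i < M" using jk k(1) j(1) M(2) unfolding i_def by auto
  then have "x \<in> PP i" using k j unfolding PP_def by simp
  then show "x \<in> (\<Union>i<M. PP i)" using i by blast
next
  fix x assume "x \<in> (\<Union>i<M. PP i)"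
  then obtain i where i: "i < M" "x \<in> PP i" by blast
  have "int (i div 2) \<in> {0..B-1}" "int ((i+1) div 2) \<in> {0..B-1}" using i(1) M(2) by auto
  then have "inS x 0 0" "inS x 1 0" using i(2) inS_rec[of x 0 0] inS_rec[of x 1 0] unfolding PP_def by auto
  then show "x \<in> FF" by (simp add: FF_def)
qed

text \<open>The digits at place i add up to i, and contacts across the two rows bound each digit at
  place j by one at place i, with a loss of 1 in total; hence j \<le> i + 1.\<close>

lemma PP_disj: assumes "Suc i < j" "x \<in> PP i" "x \<in> PP j" shows False
proof -
  define k k' l l' where "k = int (i div 2)" and "k' = int ((i+1) div 2)" and "l = int (j div 2)" and "l' = int ((j+1) div 2)"
  have m: "inS (g x) k 0" "inS (g x) k' 1" "inS (g x) l 0" "inS (g x) l' 1"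
    using assms(2,3) unfolding PP_def k_def k'_def l_def l'_def by auto
  have "k + k' = int i" "l + l' = int j" unfolding k_def k'_def l_def l'_def by presburger+
  moreover have "l' \<le> k + 1" "l \<le> k'" using nb[OF m(1) m(4)] nb[OF m(3) m(2)] by auto
  ultimately show False using assms(1) by linarith
qed

lemma PP_adj: assumes "x \<in> PP i" "x \<in> PP (Suc i)" shows "x = xp (Suc i)"
proof (cases "even i")
  case True
  define k where "k = int (i div 2)"
  have "inS (g x) k 0" "inS (g x) k 1" "inS (g x) (k + 1) 1" using assms True unfolding PP_def k_def by (auto elim!: evenE simp: add.commute)
  then have "g x - lv k 0 = z2" by (intro z2_unique) (unfold inS_shift, simp_all add: add.commute)
  then have "g x = z2 + lv k 0" by (simp add: algebra_simps)
  then have "x = gi (z2 + lv k 0)" by (metis gi_g)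
  then show ?thesis using True by (simp add: xp_def k_def)
next
  case False
  define k where "k = int (i div 2)"
  have "inS (g x) k 0" "inS (g x) (k + 1) 1" "inS (g x) (k + 1) 0" using assms False unfolding PP_def k_def by (auto elim!: oddE simp: add.commute)
  then have "g x - lv k 0 = z1" by (intro z1_unique) (unfold inS_shift, simp_all add: add.commute)
  then have "g x = z1 + lv k 0" by (simp add: algebra_simps)
  then have "x = gi (z1 + lv k 0)" by (metis gi_g)
  then show ?thesis using False by (simp add: xp_def k_def)
qed

lemma xp_ends: "xp 0 = z1" "xp M = lv 1 0 - z1"
proof -
  have "gi (z1 + lv (-1) 0) = z1" by (metis g_z1 gi_g lv_minus minus_zero diff_conv_add_uminus)
  then show "xp 0 = z1" by (simp add: xp_def)
  have "g (lv 1 0 - z1) = z2 + lv (B - 1) 0"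
  proof -
    have "lv 1 0 - z1 = - (z1 - lv 1 0)" by simp
    then have "g (lv 1 0 - z1) = lv (B-1) 0 - g (z1 - lv 1 0)" by (simp only: gmap_minus)
    then show ?thesis unfolding gmap_diff_lv g_z1 z2_def by (simp add: lv_def prod_eq_iff)
  qed
  then have "gi (z2 + lv (B-1) 0) = lv 1 0 - z1" by (metis gi_g)
  moreover have "int (M div 2) = B - 1" using M by linarith
  ultimately show "xp M = lv 1 0 - z1" using M(3) by (simp add: xp_def)
qed

lemma F_arc: obtains p where "arc p" "path_image p = FF"
    "\<And>i. i < M \<Longrightarrow> p ` {real i / M .. (real i + 1) / M} = PP i" "\<And>i. i \<le> M \<Longrightarrow> p (real i / M) = xp i"
proof -
  interpret AC: arc_chain FF PP xp hf "\<lambda>_ _. 0" UNIV M N lam c0 c1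
  proof
    show "2 \<le> M" using M by simp
    have "FF = {x. inS x 0 0} \<inter> {x. inS x 1 0}" by (auto simp: FF_def)
    then show "compact FF" using compact_inS compact_Int by metis
    have "z1 \<in> FF" unfolding FF_def mem_Collect_eq using z1_mem by blast
    then show "FF \<noteq> {}" by blast
    show "FF = (\<Union>i<M. PP i)" by (rule FF_rec)
    show "PP i = hf i ` FF \<and> hf i (xp 0) = xp i \<and> hf i (xp M) = xp (Suc i) \<and> inj (hf i)" if "i < M" for i
    proof (intro conjI)
      show "PP i = hf i ` FF" by (rule PP_eq)
      show "hf i (xp 0) = xp i" 
      proof -
        have "(if even i then fbe z1 else fal z1) + lv (int (i div 2)) 0 = (if even i then z1 + lv (int (i div 2) - 1) 0 else z2 + lv (int (i div 2)) 0)"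
          unfolding vertex_maps by (simp add: lv_def prod_eq_iff)
        then show ?thesis unfolding xp_ends hf_def by (simp only: xp_def)
      qed
      show "hf i (xp M) = xp (Suc i)" 
      proof -
        have "(if even i then fbe (lv 1 0 - z1) else fal (lv 1 0 - z1)) + lv (int (i div 2)) 0
          = (if even (Suc i) then z1 + lv (int (Suc i div 2) - 1) 0 else z2 + lv (int (Suc i div 2)) 0)"
          unfolding vertex_maps by (cases "even i") (auto elim!: evenE oddE)
        then show ?thesis unfolding xp_ends hf_def by (simp only: xp_def)
      qed
      show "inj (hf i)"
      proof (rule injI)
        fix x y assume "hf i x = hf i y"
        then have "(if even i then fbe x else fal x) + lv (int (i div 2)) 0 = (if even i then fbe y else fal y) + lv (int (i div 2)) 0"
          unfolding hf_def by (rule inj_gi)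
        then have *: "(if even i then fbe x else fal x) = (if even i then fbe y else fal y)" unfolding add_right_cancel .
        show "x = y"
        proof (cases "even i")
          case True
          then have "gi (gi (x - lv 1 0) - lv 1 1) = gi (gi (y - lv 1 0) - lv 1 1)" using * by (simp add: fbe_def)
          from inj_gi[OF this] have "gi (x - lv 1 0) = gi (y - lv 1 0)" by simp
          from inj_gi[OF this] show ?thesis by simp
        next
          case False
          then have "gi (- x) = gi (- y)" using * by (simp add: fal_def)
          from inj_gi[OF this] show ?thesis by simp
        qed
      qed
    qed
    show "N (hf i p - hf i q) \<le> lam * N (p - q)" for i p q
    proof -
      have le: "lam * t \<le> t" if "0 \<le> t" for t using that lam by (simp add: mult_left_le_one_le)
      have 1: "N (fal p - fal q) \<le> N (p - q)"
      proof -
        have "N (fal p - fal q) \<le> lam * N (- p - - q)" unfolding fal_def by (rule contr)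
        also have "N (- p - - q) = N (p - q)" using N_minus[of "p - q"] by simp
        finally show ?thesis using le[OF N_nonneg[of "p - q"]] by simp
      qed
      have 2: "N (fbe p - fbe q) \<le> N (p - q)"
      proof -
        have "N (fbe p - fbe q) \<le> lam * N (gi (p - lv 1 0) - gi (q - lv 1 0))"
          unfolding fbe_def using contr[of "gi (p - lv 1 0) - lv 1 1" "gi (q - lv 1 0) - lv 1 1"] by simp
        also have "\<dots> \<le> N (gi (p - lv 1 0) - gi (q - lv 1 0))" by (rule le[OF N_nonneg])
        also have "\<dots> \<le> lam * N (p - q)" using contr[of "p - lv 1 0" "q - lv 1 0"] by simp
        also have "\<dots> \<le> N (p - q)" by (rule le[OF N_nonneg])
        finally show ?thesis .
      qed
      have "N (hf i p - hf i q) \<le> lam * N ((if even i then fbe p else fal p) - (if even i then fbe q else fal q))"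
        unfolding hf_def using contr[of "(if even i then fbe p else fal p) + lv (int (i div 2)) 0" "(if even i then fbe q else fal q) + lv (int (i div 2)) 0"] by simp
      also have "\<dots> \<le> lam * N (p - q)" using 1 2 lam by (intro mult_left_mono) auto
      finally show ?thesis .
    qed
    show "0 \<le> lam" "lam < 1" "0 < c0" "0 < c1" "c0 * norm v \<le> N v" "N v \<le> c1 * norm v" for v
      by (rule lam c01 N_lower N_upper)+
    show "PP i \<inter> PP j = {}" if "Suc i < j" for i j using PP_disj[OF that] by blast
    show "PP i \<inter> PP (Suc i) \<subseteq> {xp (Suc i)}" for i using PP_adj by blast
    show "xp 0 \<notin> PP i" if "0 < i" for i
    proof
      assume a: "xp 0 \<in> PP i"
      have "g (xp 0) = z1 - lv 1 0" unfolding xp_ends by (rule g_z1)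
      then have "inS (z1 - lv 1 0) (int (i div 2)) 0" "inS (z1 - lv 1 0) (int ((i+1) div 2)) 1" using a unfolding PP_def by auto
      then have b: "inS z1 (int (i div 2) + 1) 0" "inS z1 (int ((i+1) div 2) + 1) 1" unfolding inS_shift by auto
      have "int (i div 2) = 0" "int ((i+1) div 2) = 0" using nb[OF z1_mem(1) b(1)] nb[OF z1_mem(1) b(2)] by auto
      then show False using that by auto
    qed
    show "xp M \<notin> PP i" if "Suc i < M" for i
    proof
      assume a: "xp M \<in> PP i"
      have "g (xp M) = z2 + lv (B - 1) 0"
      proof -
        have "int (M div 2) = B - 1" using M by linarith
        then show ?thesis using M(3) by (simp add: xp_def)
      qed
      then have "inS (z2 + lv (B-1) 0) (int (i div 2)) 0" "inS (z2 + lv (B-1) 0) (int ((i+1) div 2)) 1" using a unfolding PP_def by auto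
      then have b: "inS z2 (int (i div 2) - (B-1)) 0" "inS z2 (int ((i+1) div 2) - (B-1)) 1" unfolding inS_plus by auto
      have "int (i div 2) - (B-1) \<ge> 0" using nb[OF z2_mem(2) b(1)] nb[OF z2_mem(3) b(1)] by auto
      then show False using that M by auto
    qed
  qed auto
  show thesis
  proof (rule AC.arc_exists)
    fix p assume "arc p" "path_image p = FF" "\<And>i. i < M \<Longrightarrow> p ` {real i / M .. (real i + 1) / M} = PP i" "\<And>i. i \<le> M \<Longrightarrow> p (real i / M) = xp i"
    then show thesis by (rule that)
  qed
qed

text \<open>The parametrization runs through place l during [l/M, (l+1)/M], so a block of
  consecutive places is a subarc. The parts of the side belonging to T, -T and their translates are
  such blocks.\<close>

lemma F_subarc: assumes "i < j" "j \<le> M"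
  shows "\<exists>q. arc q \<and> path_image q = (\<Union>l\<in>{i..<j}. PP l) \<and> q 0 = xp i \<and> q 1 = xp j"
proof -
  obtain p where p: "arc p" "path_image p = FF" "\<And>i. i < M \<Longrightarrow> p ` {real i / M .. (real i + 1) / M} = PP i"
    "\<And>i. i \<le> M \<Longrightarrow> p (real i / M) = xp i" by (rule F_arc) blast
  have M0: "0 < real M" using M by simp
  have un: "p ` {real i / M .. real k / M} = (\<Union>l\<in>{i..<k}. PP l)" if "i < k" "k \<le> M" for k using that
  proof (induction k)
    case (Suc k)
    show ?case
    proof (cases "i = k")
      case True
      have "{k..<Suc k} = {k}" by auto
      then show ?thesis using p(3)[of k] True Suc.prems by (simp add: add.commute)
    next
      case False
      have "{real i / M .. real (Suc k) / M} = {real i / M .. real k / M} \<union> {real k / M .. (real k + 1) / M}"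
        using False Suc.prems M0 by (subst ivl_disj_un_two_touch) (auto simp: divide_right_mono add.commute)
      moreover have "{i..<Suc k} = insert k {i..<k}" using Suc.prems by auto
      ultimately show ?thesis using Suc p(3)[of k] False by (simp add: image_Un Un_commute)
    qed
  qed simp
  have ij: "real i / M < real j / M" using assms(1) M0 by (simp add: divide_strict_right_mono)
  define q where "q = subpath (real i / M) (real j / M) p"
  have "arc q" unfolding q_def using ij assms M0 by (intro arc_subpath_arc p) (auto simp: field_simps)
  moreover have "path_image q = (\<Union>l\<in>{i..<j}. PP l)" unfolding q_def path_image_subpath using ij un[OF assms] by simp
  moreover have "q 0 = xp i" "q 1 = xp j" using p(4)[of i] p(4)[of j] assms by (simp_all add: q_def subpath_def)
  ultimately show ?thesis by blast
qed

lemma g_xp: "g (xp i) = (if even i then z1 + lv (int (i div 2) - 1) 0 else z2 + lv (int (i div 2)) 0)"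
  by (simp add: xp_def)

text \<open>The sides \<open>al\<close> and \<open>be\<close> meet only at z2, so their copies of FF
  join to the arc later used as \<gamma>U.\<close>

lemma upper_arc: "\<exists>q. arc q \<and> path_image q = al \<union> be \<and> q 0 = z1 \<and> q 1 = z1 - lv 1 0"
proof -
  obtain p where p: "arc p" "path_image p = FF" "\<And>i. i < M \<Longrightarrow> p ` {real i / M .. (real i + 1) / M} = PP i"
    "\<And>i. i \<le> M \<Longrightarrow> p (real i / M) = xp i" by (rule F_arc) blast
  have M0: "0 < real M" using M by simp
  have e: "p 0 = z1" "p 1 = lv 1 0 - z1" using p(4)[of 0] p(4)[of M] M0 xp_ends by auto
  have r: "arc (reversepath p)" "path_image (reversepath p) = FF" using p by (simp_all add: arc_reversepath)
  have cgi: "continuous_on X gi" for X by (rule contraction_continuous[OF contr])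
  have 1: "arc (fal \<circ> reversepath p)"
  proof (rule arc_continuous_inj_image[OF r(1)])
    show "continuous_on (path_image (reversepath p)) fal" unfolding fal_def[abs_def]
      by (intro continuous_on_compose2[OF cgi[of UNIV]] continuous_intros) auto
    show "inj_on fal (path_image (reversepath p))" by (rule inj_onI) (auto simp: fal_def dest: inj_gi)
  qed
  have 2: "arc (fbe \<circ> reversepath p)"
  proof (rule arc_continuous_inj_image[OF r(1)])
    show "continuous_on (path_image (reversepath p)) fbe" unfolding fbe_def[abs_def]
      by (intro continuous_on_compose2[OF cgi[of UNIV]] continuous_intros) auto
    show "inj_on fbe (path_image (reversepath p))"
    proof (rule inj_onI)
      fix x y assume "fbe x = fbe y"
      from inj_gi[OF this[unfolded fbe_def]] have "gi (x - lv 1 0) = gi (y - lv 1 0)" by simp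
      from inj_gi[OF this] show "x = y" by simp
    qed
  qed
  have i1: "path_image (fal \<circ> reversepath p) = al" unfolding path_image_compose r(2) by (rule fal_image)
  have i2: "path_image (fbe \<circ> reversepath p) = be" unfolding path_image_compose r(2) by (rule fbe_image)
  have e1: "pathstart (fal \<circ> reversepath p) = z1" "pathfinish (fal \<circ> reversepath p) = z2"
    "pathstart (fbe \<circ> reversepath p) = z2" "pathfinish (fbe \<circ> reversepath p) = z1 - lv 1 0"
    using e vertex_maps by (simp_all add: pathstart_def pathfinish_def reversepath_def)
  define q where "q = (fal \<circ> reversepath p) +++ (fbe \<circ> reversepath p)"
  have "al \<inter> be \<subseteq> {z2}" using z2_unique unfolding al_def be_def by blast
  then have "arc q" unfolding q_def by (intro arc_join 1 2) (simp_all add: e1 i1 i2)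
  moreover have "path_image q = al \<union> be" unfolding q_def by (subst path_image_join) (simp_all add: e1 i1 i2)
  moreover have "q 0 = z1" "q 1 = z1 - lv 1 0" using e1 unfolding q_def
    by (metis pathstart_join pathstart_def, metis pathfinish_join pathfinish_def)
  ultimately show ?thesis by blast
qed

end

section \<open>A = 1\<close>

locale tile_A1 = crystile N lam c0 c1 1 B S T for N lam c0 c1 B S T
begin

sublocale lattice_A1 N lam c0 c1 B S T by unfold_locales

text \<open>Contact with the row above would need the digit 0, but -T has only the digits 1, ..., B
  - 1. Hence the upper boundary of S belongs to T.\<close>

lemma noU_up: assumes "inU x p q" shows "\<not> inS x (p + 1) (q + 1)" "\<not> inS x p (q + 1)"
proof -
  define y where "y = x - lv p q"
  have "inU y 0 0" unfolding y_def inU_shift using assms by simp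
  then have "inS (g y) (B - 1) 0 \<or> (\<exists>k\<in>{1..B-2}. inU (g y) k 0)" using inU_rec[of y 0 0] by (simp del: inU_00)
  then obtain k where k: "1 \<le> k" "inS (g y) k 0" by (rule high_digit)
  have "\<not> inS y 1 1"
  proof
    assume "inS y 1 1"
    then obtain n where n: "n \<in> {0..B-1}" "inS (g y) (n - B) 0" using inS_rec[of y 1 1] by auto
    then show False using nb[OF n(2) k(2)] k(1) by auto
  qed
  then show "\<not> inS x (p + 1) (q + 1)" unfolding y_def inS_shift by (simp add: add.commute)
  have "\<not> inS y 0 1"
  proof
    assume "inS y 0 1"
    then obtain n where n: "n \<in> {0..B-1}" "inS (g y) (n - B) (-1)" using inS_rec[of y 0 1] by auto
    then show False using nb[OF n(2) k(2)] k(1) by auto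
  qed
  then show "\<not> inS x p (q + 1)" unfolding y_def inS_shift by (simp add: add.commute)
qed

lemma noT_down: assumes "inT x p q" shows "\<not> inS x (p - 1) (q - 1)" "\<not> inS x p (q - 1)"
  using noU_up[of "- x" "- p" "- q"] assms unfolding inU_minus inS_minus by simp_all

text \<open>One step later the contact pairs a subtile of -T with one in the row above. A rotated
  subtile admits none by \<open>noU_up\<close>, and the S-piece at B - 1 is too far to the
  right.\<close>

lemma never: "\<not> (inU x 0 0 \<and> inT x 1 0)"
proof
  assume a: "inU x 0 0 \<and> inT x 1 0"
  from a have u: "inS (g x) (B - 1) 0 \<or> (\<exists>k\<in>{1..B-2}. inU (g x) k 0)" using inU_rec[of x 0 0] by (simp del: inU_00)
  from a have t: "inS (g x) 0 1 \<or> (\<exists>k\<in>{1..B-2}. inT (g x) k 1)" using inT_rec[of x 1 0] by simp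
  obtain j where j: "0 \<le> j" "j \<le> B - 2" "inS (g x) j 1" using t by (rule low_digit)
  from u show False
  proof
    assume "inS (g x) (B - 1) 0"
    then show False using up_nb[of "g x" "B - 1" 0 j] j by simp
  next
    assume "\<exists>k\<in>{1..B-2}. inU (g x) k 0"
    then obtain l where l: "inU (g x) l 0" by blast
    then have "j = l \<or> j = l + 1" using up_nb[OF inU_inS[OF l]] j(3) by simp
    then show False using noU_up[OF l] j(3) by auto
  qed
qed

text \<open>Among all places only the first belongs to T and T + (1, 0): an unrotated subtile in the
  upper row never touches the row below, so T + (1, 0) must use its S-piece.\<close>

lemma F0_eq: "{x. inT x 0 0 \<and> inT x 1 0} = PP 0"
proof (intro equalityI subsetI)
  fix x assume "x \<in> {x. inT x 0 0 \<and> inT x 1 0}"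
  then have x: "inT x 0 0" "inT x 1 0" by blast+
  have "inS (g x) 0 0 \<or> (\<exists>k\<in>{1..B-2}. inT (g x) k 0)" using inT_rec[of x 0 0] x(1) by (simp del: inT_00 inS_00)
  then obtain k where k: "0 \<le> k" "inS (g x) k 0" by (rule low_digit)
  have t: "inS (g x) 0 1 \<or> (\<exists>k\<in>{1..B-2}. inT (g x) k 1)" using inT_rec[of x 1 0] x(2) by simp
  have s: "inS (g x) 0 1"
    using t
  proof
    assume "\<exists>k\<in>{1..B-2}. inT (g x) k 1"
    then obtain j where j: "inT (g x) j 1" by blast
    have "j = k \<or> j = k + 1" using up_nb[OF k(2)] inT_inS[OF j] by simp
    then show ?thesis using noT_down[OF j] k(2) by auto
  qed
  then have "k = 0" using nb[OF k(2) s] k(1) by auto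
  then show "x \<in> PP 0" using s k(2) unfolding PP_def by simp
next
  fix x assume "x \<in> PP 0"
  then have s: "inS (g x) 0 0" "inS (g x) 0 1" unfolding PP_def by auto
  have "inT x 0 0" using inT_rec[of x 0 0] s(1) by (simp del: inT_00 inS_00)
  moreover have "inT x 1 0" using inT_rec[of x 1 0] s(2) by simp
  ultimately show "x \<in> {x. inT x 0 0 \<and> inT x 1 0}" by blast
qed

lemma F1_eq: "{x. inT x 0 0 \<and> inU x 1 0} = (\<Union>i\<in>{1..<M-1}. PP i)"
proof (intro equalityI subsetI)
  fix x assume "x \<in> {x. inT x 0 0 \<and> inU x 1 0}"
  then have x: "inT x 0 0" "inU x 1 0" by blast+
  have "inS (g x) 0 0 \<or> (\<exists>k\<in>{1..B-2}. inT (g x) k 0)" using inT_rec[of x 0 0] x(1) by (simp del: inT_00 inS_00)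
  then obtain k where k: "0 \<le> k" "k \<le> B - 2" "inS (g x) k 0" by (rule low_digit)
  have "inS (g x) (B - 1) 1 \<or> (\<exists>k\<in>{1..B-2}. inU (g x) k 1)" using inU_rec[of x 1 0] x(2) by simp
  then obtain j where j: "1 \<le> j" "j \<le> B - 1" "inS (g x) j 1" by (rule high_digit)
  have jk: "j = k \<or> j = k + 1" using nb[OF k(3) j(3)] by auto
  define i where "i = nat (k + j)"
  have i: "int (i div 2) = k" "int ((i + 1) div 2) = j" "i \<in> {1..<M-1}" using jk k j M unfolding i_def by auto
  then have "x \<in> PP i" using k j unfolding PP_def by simp
  then show "x \<in> (\<Union>i\<in>{1..<M-1}. PP i)" using i by blast
next
  fix x assume "x \<in> (\<Union>i\<in>{1..<M-1}. PP i)"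
  then obtain i where i: "1 \<le> i" "i < M - 1" "x \<in> PP i" by auto
  define k j where "k = int (i div 2)" and "j = int ((i + 1) div 2)"
  have s: "inS (g x) k 0" "inS (g x) j 1" using i(3) unfolding PP_def k_def j_def by auto
  have kj: "0 \<le> k" "k \<le> B - 2" "1 \<le> j" "j \<le> B - 1" using i M(2) unfolding k_def j_def by linarith+
  have d: "j = k \<or> j = k + 1" unfolding k_def j_def by presburger
  have "inT (g x) k 0" using s noU_up[of "g x" k 0] d inS_iff[of "g x" k 0] by auto
  then have "inS (g x) 0 0 \<or> (\<exists>k\<in>{1..B-2}. inT (g x) k 0)" using kj inT_inS[of "g x" k 0] by (cases "k = 0") auto
  then have "inT x 0 0" using inT_rec[of x 0 0] by (simp del: inT_00 inS_00)
  moreover have "inU (g x) j 1" using s noT_down[of "g x" j 1] d inS_iff[of "g x" j 1] by auto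
  then have "inS (g x) (B - 1) 1 \<or> (\<exists>k\<in>{1..B-2}. inU (g x) k 1)" using kj inU_inS[of "g x" j 1] by (cases "j = B - 1") auto
  then have "inU x 1 0" using inU_rec[of x 1 0] by simp
  ultimately show "x \<in> {x. inT x 0 0 \<and> inU x 1 0}" by blast
qed

lemma top_nb: assumes "x \<in> T" "q \<noteq> 0" "inS x p q" shows "q = 1 \<and> (p = 0 \<or> p = 1)" "- x \<notin> T"
proof -
  have t: "inT x 0 0" using assms(1) by simp
  show q: "q = 1 \<and> (p = 0 \<or> p = 1)" using nb[OF inT_inS[OF t] assms(3)] noT_down[OF t] assms(2,3) by auto
  show "- x \<notin> T"
  proof
    assume "- x \<in> T"
    then have "inU x 0 0" by simp
    then show False using noU_up[of x 0 0] q assms(3) by auto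
  qed
qed

lemma top_eq: "al \<union> be = {x. x \<in> T \<and> (\<exists>p q. q \<noteq> 0 \<and> inS x p q)}"
proof (intro equalityI subsetI)
  fix x assume "x \<in> al \<union> be"
  then have x: "inS x 0 0" "inS x 1 1 \<or> inS x 0 1" unfolding al_def be_def by blast+
  have "inT x 0 0" using x noU_up[of x 0 0] inS_iff[of x 0 0] by auto
  moreover have "\<exists>p q. q \<noteq> 0 \<and> inS x p q" using x(2) zero_neq_one by metis
  ultimately show "x \<in> {x. x \<in> T \<and> (\<exists>p q. q \<noteq> 0 \<and> inS x p q)}" by simp
next
  fix x assume "x \<in> {x. x \<in> T \<and> (\<exists>p q. q \<noteq> 0 \<and> inS x p q)}"
  then obtain p q where x: "x \<in> T" "q \<noteq> 0" "inS x p q" by blast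
  have "inT x 0 0" using x(1) by simp
  then have "inS x 0 0" by (rule inT_inS)
  then show "x \<in> al \<union> be" unfolding al_def be_def using top_nb(1)[OF x] x(3) by auto
qed

lemma row: "inS x p 0 \<Longrightarrow> inS x p' 0 \<Longrightarrow> \<bar>p' - p\<bar> \<le> 1" using nb[of x p 0 p' 0] by auto

lemma nev: assumes "inU x p 0" "inT x (p + 1) 0" shows False
  using never[of "x - lv p 0"] assms unfolding inT_shift inU_shift by (simp add: add.commute)

lemma disk_like_T: "disk_like T"
proof -
  have M4: "0 < (1::nat)" "1 \<le> M" "1 < M - 1" "M - 1 \<le> M" using M by auto
  obtain \<gamma>0 where g0: "arc \<gamma>0" "path_image \<gamma>0 = (\<Union>l\<in>{0..<1}. PP l)" "\<gamma>0 0 = xp 0" "\<gamma>0 1 = xp 1"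
    using F_subarc[OF M4(1,2)] by blast
  obtain \<gamma>1 where g1: "arc \<gamma>1" "path_image \<gamma>1 = (\<Union>l\<in>{1..<M-1}. PP l)" "\<gamma>1 0 = xp 1" "\<gamma>1 1 = xp (M-1)"
    using F_subarc[OF M4(3,4)] by blast
  obtain \<gamma>U where gU: "arc \<gamma>U" "path_image \<gamma>U = al \<union> be" "\<gamma>U 0 = z1" "\<gamma>U 1 = z1 - lv 1 0"
    using upper_arc by blast
  have d: "int ((M - 1) div 2) = B - 1" "even (M - 1)" using M by auto
  have g1w: "g (xp 1) = z2" "g (xp (M-1)) = z1 + lv (B-2) 0" using d by (simp_all add: g_xp)
  interpret kappa_tile N lam c0 c1 1 B S T z1 "xp 1" "xp (M-1)" \<gamma>0 \<gamma>1 \<gamma>U 1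
  proof
    show "\<bar>p\<bar> \<le> 1" if "x \<in> S" "inS x p 0" for x p using row[of x 0 p] that by simp
    show "p = 0 \<and> q = 0" if "inS 0 p q" for p q using zero_only[OF that] .
    show "\<not> (inU x 0 0 \<and> inT x 1 0)" for x by (rule never)
    show "path_image \<gamma>0 = {x. inT x 0 0 \<and> inT x 1 0}" unfolding g0(2) F0_eq by simp
    show "\<gamma>0 0 = z1" unfolding g0(3) by (rule xp_ends)
    show "path_image \<gamma>1 = {x. inT x 0 0 \<and> inU x 1 0}" unfolding g1(2) F1_eq ..
    show "path_image \<gamma>U = {x. x \<in> T \<and> (\<exists>p q. q \<noteq> 0 \<and> inS x p q)}" unfolding gU(2) by (rule top_eq)
    show "x = xp 1" if "inT x 0 0" "inT x 1 0" "inU x 1 0" for x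
    proof -
      have F1: "x \<in> {x. inT x 0 0 \<and> inU x 1 0}" using that by blast
      have a: "x \<in> PP 0" using F0_eq that by blast
      obtain i where i: "1 \<le> i" "x \<in> PP i" using F1_eq F1 by fastforce
      have "i = 1" using PP_disj[of 0 i x] a i by fastforce
      then show ?thesis using PP_adj[of x 0] a i by simp
    qed
    show "xp 1 + xp (M-1) = lv 1 0"
    proof -
      have "g (lv 1 0 - xp 1) = g (- (xp 1 - lv 1 0))" by simp
      also have "\<dots> = lv (B-1) 0 - (z2 - lv 0 1)" unfolding gmap_minus gmap_diff_lv g1w by simp
      also have "\<dots> = g (xp (M-1))" unfolding g1w(2) z2_def by (simp add: lv_def prod_eq_iff)
      finally have "lv 1 0 - xp 1 = xp (M-1)" by (rule g_inj)
      then show ?thesis by (simp add: algebra_simps)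
    qed
    show "x = z1" if "x \<in> T" "q \<noteq> 0" "inS x p q" "inS x 1 0" for x p q
    proof -
      have "inT x 0 0" using that by simp
      have q: "q = 1" "p = 0 \<or> p = 1" using top_nb(1)[OF that(1-3)] by auto
      then have "p = 1" using nb[OF that(4,3)] by auto
      then show ?thesis using z1_unique[of x] inT_inS[OF \<open>inT x 0 0\<close>] that(3,4) q by blast
    qed
    show "x = z1 - lv 1 0" if "x \<in> T" "q \<noteq> 0" "inS x p q" "inS x (-1) 0" for x p q
    proof -
      have t: "inT x 0 0" using that by simp
      have q: "q = 1" "p = 0 \<or> p = 1" using top_nb(1)[OF that(1-3)] by auto
      then have "p = 0" using nb[OF that(4,3)] by auto
      then have "x + lv 1 0 = z1" using q(1) that(3,4) inT_inS[OF t] by (intro z1_unique) (unfold inS_plus, simp_all)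
      then show ?thesis by (simp add: algebra_simps)
    qed
    show "- x \<notin> T" if "x \<in> T" "q \<noteq> 0" "inS x p q" for x p q using top_nb(2)[OF that] .
    show "x \<in> T \<and> - x \<in> T \<longleftrightarrow> (\<exists>k\<in>{0..B-2}. inT (g x) k 0 \<and> inU (g x) (k+1) 0) \<or>
      (\<exists>k\<in>{1..B-2}. inT (g x) k 0 \<and> inU (g x) k 0) \<or> (inU (g x) 0 0 \<and> inU (g x) 1 0) \<or>
      (inT (g x) (B-2) 0 \<and> inT (g x) (B-1) 0)" for x
    proof -
      have "x \<in> T \<and> - x \<in> T \<longleftrightarrow> inT x 0 0 \<and> inU x 0 0" by simp
      also have "\<dots> \<longleftrightarrow> (inS (g x) 0 0 \<or> (\<exists>k\<in>{1..B-2}. inT (g x) k 0)) \<and> (inS (g x) (B-1) 0 \<or> (\<exists>k\<in>{1..B-2}. inU (g x) k 0))"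
        unfolding inT_rec[of x 0 0] inU_rec[of x 0 0] by simp
      also note kappa_recursion[OF row nev]
      finally show ?thesis .
    qed
    show "g (- 1 *\<^sub>R xp (M-1)) = lv 1 0 - z1"
    proof -
      have "- 1 *\<^sub>R xp (M-1) = - xp (M-1)" by simp
      then have "g (- 1 *\<^sub>R xp (M-1)) = lv (B-1) 0 - (z1 + lv (B-2) 0)" unfolding g1w(2)[symmetric] by (simp only: gmap_minus)
      then show ?thesis by (simp add: lv_def prod_eq_iff)
    qed
  qed (use g0 g1 gU in simp_all)
  show ?thesis by (rule disk_like_T)
qed

end

lemma disk_like_tile_1: assumes "2 \<le> B" shows "disk_like (tile 1 B)"
proof -
  obtain N lam c0 c1 where "tile_gauge N lam c0 c1 1 B" using tile_gauge_exists[of B 1] assms by auto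
  from tile_crystile(1)[OF this] interpret crystile N lam c0 c1 1 B "tile 1 B \<union> uminus ` tile 1 B" "tile 1 B" .
  interpret tile_A1 N lam c0 c1 B "tile 1 B \<union> uminus ` tile 1 B" "tile 1 B" by unfold_locales
  show ?thesis by (rule disk_like_T)
qed

section \<open>A = -1\<close>

text \<open>Reflecting the plane in the horizontal axis turns the lattice tile for \<open>A = -1\<close> into the one for \<open>A = 1\<close>, but
  reverses the order of the digits, which exchanges \<open>T\<close> and \<open>- T\<close> in the recursion.\<close>

locale mirror_tile_A1 = half_tile N lam c0 c1 1 B S T for N lam c0 c1 B S T +
  assumes B3: "3 \<le> B"
    and T_rec: "\<And>x. x \<in> T \<longleftrightarrow> gmap 1 B x - lv (B-1) 0 \<in> S \<or> (\<exists>k\<in>{1..B-2}. lv k 0 - gmap 1 B x \<in> T)"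
begin

sublocale lattice_A1 N lam c0 c1 B S T by unfold_locales

lemma inT_rec: "inT x p 0 \<longleftrightarrow> inS (g x) (B-1) p \<or> (\<exists>k\<in>{1..B-2}. inU (g x) k p)"
proof -
  have e: "g (x - lv p 0) - lv k 0 = g x - lv k p" for k
    unfolding gmap_diff_lv by (simp add: lv_def prod_eq_iff)
  have e': "lv k 0 - g (x - lv p 0) = lv k p - g x" for k
    unfolding gmap_diff_lv by (simp add: lv_def prod_eq_iff)
  show ?thesis unfolding inT_def inS_def inU_def T_rec[of "x - lv p 0"] e e' ..
qed

lemma inU_rec: "inU x p 0 \<longleftrightarrow> inS (g x) 0 p \<or> (\<exists>k\<in>{1..B-2}. inT (g x) k p)"
proof -
  have "inU x p 0 \<longleftrightarrow> inT (- x) (-p) 0" by (simp add: inT_minus)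
  also have "\<dots> \<longleftrightarrow> inS (g x) 0 p \<or> (\<exists>k\<in>{1..B-2}. inT (g x) (B - 1 - k) p)"
    unfolding inT_rec gmap_minus inS_reflect inU_reflect by simp
  also have "(\<exists>k\<in>{1..B-2}. inT (g x) (B - 1 - k) p) \<longleftrightarrow> (\<exists>k\<in>{1..B-2}. inT (g x) k p)" (is "?l \<longleftrightarrow> ?r")
  proof
    assume ?l then obtain k where "k \<in> {1..B-2}" "inT (g x) (B - 1 - k) p" by blast
    then show ?r by (intro bexI[of _ "B - 1 - k"]) auto
  next
    assume ?r then obtain k where "k \<in> {1..B-2}" "inT (g x) k p" by blast
    then show ?l by (intro bexI[of _ "B - 1 - k"]) auto
  qed
  finally show ?thesis .
qed

text \<open>The digits 1, ..., B - 1 now belong to T, so it is T that has no contact with the row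
  above, and its contact with other rows lies along the lower boundary of S.\<close>

lemma noT_up: assumes "inT x p q" shows "\<not> inS x (p + 1) (q + 1)" "\<not> inS x p (q + 1)"
proof -
  define y where "y = x - lv p q"
  have "inT y 0 0" unfolding y_def inT_shift using assms by simp
  then have "inS (g y) (B - 1) 0 \<or> (\<exists>k\<in>{1..B-2}. inU (g y) k 0)" using inT_rec[of y 0] by (simp del: inT_00)
  then obtain k where k: "1 \<le> k" "inS (g y) k 0" by (rule high_digit)
  have "\<not> inS y 1 1"
  proof
    assume "inS y 1 1"
    then obtain n where n: "n \<in> {0..B-1}" "inS (g y) (n - B) 0" using inS_rec[of y 1 1] by auto
    then show False using nb[OF n(2) k(2)] k(1) by auto
  qed
  then show "\<not> inS x (p + 1) (q + 1)" unfolding y_def inS_shift by (simp add: add.commute)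
  have "\<not> inS y 0 1"
  proof
    assume "inS y 0 1"
    then obtain n where n: "n \<in> {0..B-1}" "inS (g y) (n - B) (-1)" using inS_rec[of y 0 1] by auto
    then show False using nb[OF n(2) k(2)] k(1) by auto
  qed
  then show "\<not> inS x p (q + 1)" unfolding y_def inS_shift by (simp add: add.commute)
qed

lemma noU_down: assumes "inU x p q" shows "\<not> inS x (p - 1) (q - 1)" "\<not> inS x p (q - 1)"
  using noT_up[of "- x" "- p" "- q"] assms unfolding inT_minus inS_minus by simp_all

lemma never: "\<not> (inU x 0 0 \<and> inT x 1 0)"
proof
  assume a: "inU x 0 0 \<and> inT x 1 0"
  from a have u: "inS (g x) 0 0 \<or> (\<exists>k\<in>{1..B-2}. inT (g x) k 0)" using inU_rec[of x 0] by (simp del: inU_00 inS_00)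
  from a have t: "inS (g x) (B-1) 1 \<or> (\<exists>k\<in>{1..B-2}. inU (g x) k 1)" using inT_rec[of x 1] by simp
  obtain k where k: "0 \<le> k" "k \<le> B - 2" "inS (g x) k 0" using u by (rule low_digit)
  from t show False
  proof
    assume 1: "inS (g x) (B - 1) 1"
    from u show False
    proof
      assume "inS (g x) 0 0" then show False using up_nb[of "g x" 0 0 "B - 1"] 1 B3 by simp
    next
      assume "\<exists>k\<in>{1..B-2}. inT (g x) k 0"
      then obtain l where l: "inT (g x) l 0" by blast
      have "inS (g x) (B - 1) (0 + 1)" using 1 by simp
      then show False using up_nb[OF inT_inS[OF l]] noT_up[OF l] by metis
    qed
  next
    assume "\<exists>k\<in>{1..B-2}. inU (g x) k 1"
    then obtain j where j: "inU (g x) j 1" by blast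
    have "j = k \<or> j = k + 1" using up_nb[OF k(3)] inU_inS[OF j] by simp
    then show False using noU_down[OF j] k(3) by auto
  qed
qed

text \<open>In the mirrored situation T and T + (1, 0) share two places: the upper digit must be B -
  1, the lower one is B - 2 or B - 1.\<close>

lemma F0_eq: "{x. inT x 0 0 \<and> inT x 1 0} = (\<Union>i\<in>{M-2..<M}. PP i)"
proof (intro equalityI subsetI)
  fix x assume "x \<in> {x. inT x 0 0 \<and> inT x 1 0}"
  then have x: "inT x 0 0" "inT x 1 0" by blast+
  have "inS (g x) (B-1) 0 \<or> (\<exists>k\<in>{1..B-2}. inU (g x) k 0)" using inT_rec[of x 0] x(1) by (simp del: inT_00 inS_00)
  then obtain k where k: "k \<le> B - 1" "inS (g x) k 0" by (rule high_digit)
  have t: "inS (g x) (B-1) 1 \<or> (\<exists>k\<in>{1..B-2}. inU (g x) k 1)" using inT_rec[of x 1] x(2) by simp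
  have s: "inS (g x) (B-1) 1"
    using t
  proof
    assume "\<exists>k\<in>{1..B-2}. inU (g x) k 1"
    then obtain j where j: "inU (g x) j 1" by blast
    have "j = k \<or> j = k + 1" using up_nb[OF k(2)] inU_inS[OF j] by simp
    then show ?thesis using noU_down[OF j] k(2) by auto
  qed
  then have kd: "k = B - 1 \<or> k = B - 2" using nb[OF k(2) s] k(1) by auto
  define i where "i = nat (k + (B - 1))"
  have i: "int (i div 2) = k" "int ((i + 1) div 2) = B - 1" "i \<in> {M-2..<M}" using kd B3 M unfolding i_def by auto
  then have "x \<in> PP i" using k s unfolding PP_def by simp
  then show "x \<in> (\<Union>i\<in>{M-2..<M}. PP i)" using i by blast
next
  fix x assume "x \<in> (\<Union>i\<in>{M-2..<M}. PP i)"
  then obtain i where i: "M - 2 \<le> i" "i < M" "x \<in> PP i" by auto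
  define k where "k = int (i div 2)"
  have j: "int ((i + 1) div 2) = B - 1" "k = B - 1 \<or> k = B - 2" using i M unfolding k_def by linarith+
  have s: "inS (g x) k 0" "inS (g x) (B-1) 1" using i(3) unfolding PP_def k_def j by auto
  have "inS (g x) (B-1) 0 \<or> (\<exists>k\<in>{1..B-2}. inU (g x) k 0)"
    using j(2)
  proof
    assume "k = B - 1" then show ?thesis using s by simp
  next
    assume k: "k = B - 2"
    then have "inU (g x) k 0" using s noT_up[of "g x" k 0] inS_iff[of "g x" k 0] by auto
    then show ?thesis using k B3 by auto
  qed
  then have "inT x 0 0" using inT_rec[of x 0] by (simp del: inT_00 inS_00)
  moreover have "inT x 1 0" using inT_rec[of x 1] s(2) by simp
  ultimately show "x \<in> {x. inT x 0 0 \<and> inT x 1 0}" by blast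
qed

text \<open>For B = 2 this range of places would be empty, so here B is at least 3; the case B = 2
  is settled through S instead.\<close>

lemma F1_eq: "{x. inT x 0 0 \<and> inU x 1 0} = (\<Union>i\<in>{2..<M-2}. PP i)"
proof (intro equalityI subsetI)
  fix x assume "x \<in> {x. inT x 0 0 \<and> inU x 1 0}"
  then have x: "inT x 0 0" "inU x 1 0" by blast+
  have "inS (g x) (B-1) 0 \<or> (\<exists>k\<in>{1..B-2}. inU (g x) k 0)" using inT_rec[of x 0] x(1) by (simp del: inT_00 inS_00)
  then obtain k where k: "1 \<le> k" "k \<le> B - 1" "inS (g x) k 0" by (rule high_digit)
  have "inS (g x) 0 1 \<or> (\<exists>k\<in>{1..B-2}. inT (g x) k 1)" using inU_rec[of x 1] x(2) by simp
  then obtain j where j: "0 \<le> j" "j \<le> B - 2" "inS (g x) j 1" by (rule low_digit)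
  have jk: "j = k \<or> j = k + 1" using nb[OF k(3) j(3)] by auto
  define i where "i = nat (k + j)"
  have i: "int (i div 2) = k" "int ((i + 1) div 2) = j" "i \<in> {2..<M-2}" using jk k j M unfolding i_def by auto
  then have "x \<in> PP i" using k j unfolding PP_def by simp
  then show "x \<in> (\<Union>i\<in>{2..<M-2}. PP i)" using i by blast
next
  fix x assume "x \<in> (\<Union>i\<in>{2..<M-2}. PP i)"
  then obtain i where i: "2 \<le> i" "i < M - 2" "x \<in> PP i" by auto
  define k j where "k = int (i div 2)" and "j = int ((i + 1) div 2)"
  have s: "inS (g x) k 0" "inS (g x) j 1" using i(3) unfolding PP_def k_def j_def by auto
  have kj: "1 \<le> k" "k \<le> B - 2" "1 \<le> j" "j \<le> B - 2" using i M(2) unfolding k_def j_def by linarith+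
  have d: "j = k \<or> j = k + 1" unfolding k_def j_def by presburger
  have "inU (g x) k 0" using s noT_up[of "g x" k 0] d inS_iff[of "g x" k 0] by auto
  then have "inS (g x) (B-1) 0 \<or> (\<exists>k\<in>{1..B-2}. inU (g x) k 0)" using kj by auto
  then have "inT x 0 0" using inT_rec[of x 0] by (simp del: inT_00 inS_00)
  moreover have "inT (g x) j 1" using s noU_down[of "g x" j 1] d inS_iff[of "g x" j 1] by auto
  then have "inS (g x) 0 1 \<or> (\<exists>k\<in>{1..B-2}. inT (g x) k 1)" using kj by auto
  then have "inU x 1 0" using inU_rec[of x 1] by simp
  ultimately show "x \<in> {x. inT x 0 0 \<and> inU x 1 0}" by blast
qed

lemma bottom_nb: assumes "x \<in> T" "q \<noteq> 0" "inS x p q" shows "q = -1 \<and> (p = 0 \<or> p = -1)" "- x \<notin> T"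
proof -
  have t: "inT x 0 0" using assms(1) by simp
  show q: "q = -1 \<and> (p = 0 \<or> p = -1)" using nb[OF inT_inS[OF t] assms(3)] noT_up[OF t] assms(2,3) by auto
  show "- x \<notin> T"
  proof
    assume "- x \<in> T"
    then have "inU x 0 0" by simp
    then show False using noU_down[of x 0 0] q assms(3) by auto
  qed
qed

lemma bottom_eq: "{x. - x \<in> al \<union> be} = {x. x \<in> T \<and> (\<exists>p q. q \<noteq> 0 \<and> inS x p q)}"
proof (intro equalityI subsetI)
  fix x assume "x \<in> {x. - x \<in> al \<union> be}"
  then have x: "inS x 0 0" "inS x (-1) (-1) \<or> inS x 0 (-1)" unfolding al_def be_def mem_Collect_eq Un_iff inS_minus by auto
  have "inT x 0 0" using x noU_down[of x 0 0] inS_iff[of x 0 0] by auto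
  moreover have "\<exists>p q. q \<noteq> 0 \<and> inS x p q" using x(2) by (metis neg_equal_0_iff_equal zero_neq_one)
  ultimately show "x \<in> {x. x \<in> T \<and> (\<exists>p q. q \<noteq> 0 \<and> inS x p q)}" by simp
next
  fix x assume "x \<in> {x. x \<in> T \<and> (\<exists>p q. q \<noteq> 0 \<and> inS x p q)}"
  then obtain p q where x: "x \<in> T" "q \<noteq> 0" "inS x p q" by blast
  have "inT x 0 0" using x(1) by simp
  then have "inS x 0 0" by (rule inT_inS)
  moreover have "inS x (-1) (-1) \<or> inS x 0 (-1)" using bottom_nb(1)[OF x] x(3) by auto
  ultimately show "x \<in> {x. - x \<in> al \<union> be}" unfolding al_def be_def mem_Collect_eq Un_iff inS_minus by (simp del: inS_00)
qed

lemma row: "inS x p 0 \<Longrightarrow> inS x p' 0 \<Longrightarrow> \<bar>p' - p\<bar> \<le> 1" using nb[of x p 0 p' 0] by auto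

lemma nev: assumes "inU x p 0" "inT x (p + 1) 0" shows False
  using never[of "x - lv p 0"] assms unfolding inT_shift inU_shift by (simp add: add.commute)

lemma disk_like_T: "disk_like T"
proof -
  have M4: "M - 2 < M" "M \<le> M" "2 < M - 2" "M - 2 \<le> M" using M B3 by auto
  obtain q0 where q0: "arc q0" "path_image q0 = (\<Union>l\<in>{M-2..<M}. PP l)" "q0 0 = xp (M-2)" "q0 1 = xp M"
    using F_subarc[OF M4(1,2)] by blast
  obtain q1 where q1: "arc q1" "path_image q1 = (\<Union>l\<in>{2..<M-2}. PP l)" "q1 0 = xp 2" "q1 1 = xp (M-2)"
    using F_subarc[OF M4(3,4)] by blast
  obtain qU where qU: "arc qU" "path_image qU = al \<union> be" "qU 0 = z1" "qU 1 = z1 - lv 1 0"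
    using upper_arc by blast
  \<comment> \<open>All arcs are reversed, because the boundary of T now starts from (1, 0) - z1,
    the far end of the side.\<close>
  define \<gamma>0 \<gamma>1 \<gamma>U where "\<gamma>0 = reversepath q0" and "\<gamma>1 = reversepath q1" and "\<gamma>U = reversepath (uminus \<circ> qU)"
  have g0: "arc \<gamma>0" "path_image \<gamma>0 = (\<Union>l\<in>{M-2..<M}. PP l)" "\<gamma>0 0 = xp M" "\<gamma>0 1 = xp (M-2)"
    and g1: "arc \<gamma>1" "path_image \<gamma>1 = (\<Union>l\<in>{2..<M-2}. PP l)" "\<gamma>1 0 = xp (M-2)" "\<gamma>1 1 = xp 2"
    using q0 q1 unfolding \<gamma>0_def \<gamma>1_def 
    by (simp_all add: arc_reversepath) (simp_all add: reversepath_def)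
  have gU: "arc \<gamma>U" "path_image \<gamma>U = {x. - x \<in> al \<union> be}" "\<gamma>U 0 = lv 1 0 - z1" "\<gamma>U 1 = - z1"
  proof -
    have "arc (uminus \<circ> qU)" by (rule arc_continuous_inj_image[OF qU(1)]) (auto intro!: continuous_intros inj_onI)
    then show "arc \<gamma>U" unfolding \<gamma>U_def by (simp add: arc_reversepath)
    show "path_image \<gamma>U = {x. - x \<in> al \<union> be}" unfolding \<gamma>U_def path_image_reversepath path_image_compose qU(2)
      using mem_uminus_image by blast
    show "\<gamma>U 0 = lv 1 0 - z1" "\<gamma>U 1 = - z1" using qU(3,4) by (simp_all add: \<gamma>U_def reversepath_def)
  qed
  have d: "int ((M - 2) div 2) = B - 2" "odd (M - 2)" using M by auto
  have g1w: "g (xp (M-2)) = z2 + lv (B-2) 0" "g (xp 2) = z1" using d by (simp_all add: g_xp)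
  interpret kappa_tile N lam c0 c1 1 B S T "lv 1 0 - z1" "xp (M-2)" "xp 2" \<gamma>0 \<gamma>1 \<gamma>U "-1"
  proof
    show "\<bar>p\<bar> \<le> 1" if "x \<in> S" "inS x p 0" for x p using row[of x 0 p] that by simp
    show "p = 0 \<and> q = 0" if "inS 0 p q" for p q using zero_only[OF that] .
    show "\<not> (inU x 0 0 \<and> inT x 1 0)" for x by (rule never)
    show "path_image \<gamma>0 = {x. inT x 0 0 \<and> inT x 1 0}" unfolding g0(2) F0_eq by simp
    show "\<gamma>0 0 = lv 1 0 - z1" unfolding g0(3) by (rule xp_ends)
    show "path_image \<gamma>1 = {x. inT x 0 0 \<and> inU x 1 0}" unfolding g1(2) F1_eq ..
    show "path_image \<gamma>U = {x. x \<in> T \<and> (\<exists>p q. q \<noteq> 0 \<and> inS x p q)}" unfolding gU(2) by (rule bottom_eq)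
    show "\<gamma>U 1 = lv 1 0 - z1 - lv 1 0" using gU(4) by simp
    show "x = xp (M-2)" if "inT x 0 0" "inT x 1 0" "inU x 1 0" for x
    proof -
      have "x \<in> (\<Union>i\<in>{M-2..<M}. PP i)" using F0_eq that(1,2) by blast
      then obtain j where j: "M - 2 \<le> j" "x \<in> PP j" by auto
      have "x \<in> (\<Union>i\<in>{2..<M-2}. PP i)" using F1_eq that(1,3) by blast
      then obtain i where i: "i < M - 2" "x \<in> PP i" by auto
      have "\<not> Suc i < j" using PP_disj[of i j x] j i by blast
      then have "j = Suc i" "j = M - 2" using i j by auto
      then show ?thesis using PP_adj[of x i] i j by simp
    qed
    show "xp (M-2) + xp 2 = lv 1 0"
    proof -
      have "g (lv 1 0 - xp 2) = g (- (xp 2 - lv 1 0))" by simp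
      also have "\<dots> = lv (B-1) 0 - (z1 - lv 0 1)" unfolding gmap_minus gmap_diff_lv g1w by simp
      also have "\<dots> = g (xp (M-2))" unfolding g1w(1) z2_def by (simp add: lv_def prod_eq_iff)
      finally have "lv 1 0 - xp 2 = xp (M-2)" by (rule g_inj)
      then show ?thesis by (simp add: algebra_simps)
    qed
    show "x = lv 1 0 - z1" if "x \<in> T" "q \<noteq> 0" "inS x p q" "inS x 1 0" for x p q
    proof -
      have t: "inT x 0 0" using that by simp
      have q: "q = -1" "p = 0 \<or> p = -1" using bottom_nb(1)[OF that(1-3)] by auto
      then have "p = 0" using nb[OF that(4,3)] by auto
      then have "lv 1 0 - x = z1" using q(1) that(3,4) inT_inS[OF t] by (intro z1_unique) (unfold inS_reflect, simp_all)
      then show ?thesis by (simp add: algebra_simps)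
    qed
    show "x = lv 1 0 - z1 - lv 1 0" if "x \<in> T" "q \<noteq> 0" "inS x p q" "inS x (-1) 0" for x p q
    proof -
      have t: "inT x 0 0" using that by simp
      have q: "q = -1" "p = 0 \<or> p = -1" using bottom_nb(1)[OF that(1-3)] by auto
      then have "p = -1" using nb[OF that(4,3)] by auto
      then have "- x = z1" using q(1) that(3,4) inT_inS[OF t] by (intro z1_unique) (unfold inS_minus, simp_all)
      then have "x = - z1" by (metis minus_minus)
      then show ?thesis by simp
    qed
    show "- x \<notin> T" if "x \<in> T" "q \<noteq> 0" "inS x p q" for x p q using bottom_nb(2)[OF that] .
    show "x \<in> T \<and> - x \<in> T \<longleftrightarrow> (\<exists>k\<in>{0..B-2}. inT (g x) k 0 \<and> inU (g x) (k+1) 0) \<or>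
      (\<exists>k\<in>{1..B-2}. inT (g x) k 0 \<and> inU (g x) k 0) \<or> (inU (g x) 0 0 \<and> inU (g x) 1 0) \<or>
      (inT (g x) (B-2) 0 \<and> inT (g x) (B-1) 0)" for x
    proof -
      have "x \<in> T \<and> - x \<in> T \<longleftrightarrow> inU x 0 0 \<and> inT x 0 0" by auto
      also have "\<dots> \<longleftrightarrow> (inS (g x) 0 0 \<or> (\<exists>k\<in>{1..B-2}. inT (g x) k 0)) \<and> (inS (g x) (B-1) 0 \<or> (\<exists>k\<in>{1..B-2}. inU (g x) k 0))"
        unfolding inT_rec[of x 0] inU_rec[of x 0] by simp
      also note kappa_recursion[OF row nev]
      finally show ?thesis .
    qed
    show "g (- (- 1) *\<^sub>R xp 2) = lv 1 0 - (lv 1 0 - z1)" using g1w(2) by simp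
  qed (use g0 g1 gU in simp_all)
  show ?thesis by (rule disk_like_T)
qed

end

lemma disk_like_tile_minus1:
  assumes "3 \<le> B" shows "disk_like (tile (-1) B)"
proof -
  obtain N0 l0 d0 d1 where "tile_gauge N0 l0 d0 d1 (-1) B" using tile_gauge_exists[of B "-1"] assms by auto
  from tile_crystile(1)[OF this] interpret C: crystile N0 l0 d0 d1 "-1" B "tile (-1) B \<union> uminus ` tile (-1) B" "tile (-1) B" .
  define T0 where "T0 = tile (-1) B"
  define S0 where "S0 = T0 \<union> uminus ` T0"
  define D :: "real \<times> real \<Rightarrow> real \<times> real" where "D = (\<lambda>p. (fst p, - snd p))"
  have D[simp]: "D (D x) = x" "D (x - y) = D x - D y" "D (lv k 0) = lv k 0" "D (- x) = - D x" for x y k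
    by (simp_all add: D_def lv_def prod_eq_iff)
  have hom: "homeomorphism UNIV UNIV D D"
    by (rule homeomorphismI) (auto simp: D_def intro!: continuous_intros)
  have mem: "x \<in> D ` X \<longleftrightarrow> D x \<in> X" for x X
  proof
    assume "D x \<in> X" then show "x \<in> D ` X" by (intro image_eqI[of _ _ "D x"]) auto
  qed auto
  have gD: "gmap (-1) B (D x) = lv (B-1) 0 - D (gmap 1 B x)" for x by (simp add: gmap_def D_def lv_def prod_eq_iff field_simps)
  have cD: "continuous_on X D" for X using hom by (auto simp: homeomorphism_def intro: continuous_on_subset)
  have C: "compact S0" "S0 \<noteq> {}" "compact T0" unfolding S0_def T0_def by (rule C.S_compact C.S_ne C.T_compact)+
  have sym: "x \<in> S0 \<longleftrightarrow> - x \<in> S0" for x using C.S_sym[of x] C.S_sym[of "- x"] unfolding S0_def T0_def by auto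
  have CT: "x \<in> S0 \<longleftrightarrow> x \<in> T0 \<or> - x \<in> T0" for x unfolding S0_def T0_def by (rule C.S_T)
  have S_rec: "x \<in> S0 \<longleftrightarrow> (\<exists>k\<in>{0..B-1}. gmap (-1) B x - lv k 0 \<in> S0)" for x
    unfolding S0_def T0_def by (rule C.S_rec)
  have T_rec: "x \<in> T0 \<longleftrightarrow> gmap (-1) B x \<in> S0 \<or> (\<exists>k\<in>{1..B-2}. gmap (-1) B x - lv k 0 \<in> T0)" for x
    unfolding S0_def T0_def by (rule C.T_rec)
  \<comment> \<open>The mirrored sets obey the recursion of the matrix for A = 1, so contraction has
    to be measured in a gauge for that matrix.\<close>
  obtain N lam c0 c1 where "tile_gauge N lam c0 c1 1 B" using tile_gauge_exists[of B 1] assms by auto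
  then interpret tile_gauge N lam c0 c1 1 B .
  have eq: "gmap (-1) B (D x) - lv k 0 = - D (gmap 1 B x - lv (B-1-k) 0)" for x k
    unfolding gD by (simp add: lv_def prod_eq_iff D_def)
  interpret mirror_tile_A1 N lam c0 c1 B "D ` S0" "D ` T0"
  proof
    show "compact (D ` S0)" "compact (D ` T0)" using C(1,3) cD compact_continuous_image by blast+
    show "D ` S0 \<noteq> {}" using C(2) by simp
    show "- x \<in> D ` S0" if "x \<in> D ` S0" for x using that sym[of "D x"] unfolding mem by simp
    show "x \<in> D ` S0 \<longleftrightarrow> x \<in> D ` T0 \<or> - x \<in> D ` T0" for x unfolding mem using CT[of "D x"] by simp
    show "x \<in> D ` S0 \<longleftrightarrow> (\<exists>k\<in>{0..B-1}. gmap 1 B x - lv k 0 \<in> D ` S0)" for x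
    proof -
      have "x \<in> D ` S0 \<longleftrightarrow> (\<exists>k\<in>{0..B-1}. D (gmap 1 B x - lv (B-1-k) 0) \<in> S0)"
        unfolding mem S_rec[of "D x"] eq using sym by blast
      also have "\<dots> \<longleftrightarrow> (\<exists>k\<in>{0..B-1}. D (gmap 1 B x - lv k 0) \<in> S0)"  (is "?l \<longleftrightarrow> ?r")
      proof
        assume ?l then obtain k where "k \<in> {0..B-1}" "D (gmap 1 B x - lv (B-1-k) 0) \<in> S0" by blast
        then show ?r by (intro bexI[of _ "B-1-k"]) auto
      next
        assume ?r then obtain k where "k \<in> {0..B-1}" "D (gmap 1 B x - lv k 0) \<in> S0" by blast
        then show ?l by (intro bexI[of _ "B-1-k"]) auto
      qed
      finally show ?thesis unfolding mem .
    qed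
    show "3 \<le> B" by fact
    show "x \<in> D ` T0 \<longleftrightarrow> gmap 1 B x - lv (B-1) 0 \<in> D ` S0 \<or> (\<exists>k\<in>{1..B-2}. lv k 0 - gmap 1 B x \<in> D ` T0)" for x
    proof -
      have s: "gmap (-1) B (D x) \<in> S0 \<longleftrightarrow> D (gmap 1 B x - lv (B-1) 0) \<in> S0" using eq[of x 0] sym[of "gmap (-1) B (D x)"] by (simp add: minus_diff_eq)
      have e2: "gmap (-1) B (D x) - lv k 0 = D (lv (B-1-k) 0 - gmap 1 B x)" for k
        unfolding gD by (simp add: lv_def prod_eq_iff D_def)
      have "(\<exists>k\<in>{1..B-2}. D (lv (B-1-k) 0 - gmap 1 B x) \<in> T0) \<longleftrightarrow> (\<exists>k\<in>{1..B-2}. D (lv k 0 - gmap 1 B x) \<in> T0)" (is "?l \<longleftrightarrow> ?r")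
      proof
        assume ?l then obtain k where "k \<in> {1..B-2}" "D (lv (B-1-k) 0 - gmap 1 B x) \<in> T0" by blast
        then show ?r by (intro bexI[of _ "B-1-k"]) auto
      next
        assume ?r then obtain k where "k \<in> {1..B-2}" "D (lv k 0 - gmap 1 B x) \<in> T0" by blast
        then show ?l by (intro bexI[of _ "B-1-k"]) auto
      qed
      then show ?thesis unfolding mem T_rec[of "D x"] s e2 by blast
    qed
  qed
  have "T0 homeomorphic D ` T0" using homeomorphism_of_subsets[OF hom, of T0] unfolding homeomorphic_def by blast
  then show ?thesis using disk_like_homeomorphic disk_like_T unfolding T0_def by blast
qed

section \<open>A = 0\<close>

context lattice_tile
begin

text \<open>Allows S to be recognized from an explicit candidate, such as the square for A = 0 or a
  mirror image.\<close>

lemma S_unique: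
  assumes Q: "compact Q" "Q \<noteq> {}" "\<And>x. x \<in> Q \<longleftrightarrow> (\<exists>k\<in>{0..B-1}. gmap A B x - lv k 0 \<in> Q)"
  shows "Q = S"
proof -
  define fs where "fs = (\<lambda>k x. gi (x + lv k 0)) ` {0..B-1}"
  have c: "N (f p - f q) \<le> lam * N (p - q)" if "f \<in> fs" for f p q
  proof -
    obtain k where "f = (\<lambda>x. gi (x + lv k 0))" using \<open>f \<in> fs\<close> unfolding fs_def by blast
    then show ?thesis using contr[of "p + lv k 0" "q + lv k 0"] by simp
  qed
  have eq: "X = (\<Union>f\<in>fs. f ` X)" if X: "\<And>x. x \<in> X \<longleftrightarrow> (\<exists>k\<in>{0..B-1}. g x - lv k 0 \<in> X)" for X
  proof (intro equalityI subsetI)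
    fix x assume "x \<in> X"
    then obtain k where k: "k \<in> {0..B-1}" "g x - lv k 0 \<in> X" using X[of x] by blast
    have "x = gi (g x - lv k 0 + lv k 0)" by simp
    then have "x \<in> (\<lambda>x. gi (x + lv k 0)) ` X" using k(2) by blast
    then show "x \<in> (\<Union>f\<in>fs. f ` X)" using k(1) unfolding fs_def by blast
  next
    fix x assume "x \<in> (\<Union>f\<in>fs. f ` X)"
    then obtain k y where k: "k \<in> {0..B-1}" "y \<in> X" "x = gi (y + lv k 0)" unfolding fs_def by blast
    then have "g x - lv k 0 \<in> X" by simp
    then show "x \<in> X" using X[of x] k(1) by blast
  qed
  have "Q \<subseteq> S" by (rule attractor_subset[OF c, of fs])
    (use eq[OF Q(3)] eq[OF S_rec] Q S_compact S_ne compact_imp_bounded in blast)+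
  moreover have "S \<subseteq> Q" by (rule attractor_subset[OF c, of fs])
    (use eq[OF Q(3)] eq[OF S_rec] Q S_compact S_ne compact_imp_bounded in blast)+
  ultimately show ?thesis by blast
qed

end

text \<open>Here t is the first coordinate of g at height y. The heights \<plusminus>1/2 bound the
  whole range of digits, 1/2 - 1/b is where digit 0 ends and its negative where digit B - 2
  ends.\<close>

lemma strip_bounds:
  fixes b y t k :: real
  assumes "0 < b" "t = - (b * y) + (b - 1) / 2"
  shows "y \<le> 1/2 \<longleftrightarrow> -1/2 \<le> t" "-1/2 \<le> y \<longleftrightarrow> t \<le> b - 1/2" "1/2 - 1/b \<le> y \<longleftrightarrow> t \<le> 1/2" "- (1/2 - 1/b) \<le> y \<longleftrightarrow> t \<le> b - 3/2"
proof -
  have c: "u \<le> v \<longleftrightarrow> b * u \<le> b * v" for u v using assms(1) by simp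
  have e: "b * (1/2) = b/2" "b * (-1/2) = - b/2" "b * (1/2 - 1/b) = b/2 - 1" "b * - (1/2 - 1/b) = 1 - b/2"
    using assms(1) by (simp_all add: field_simps)
  define R where "R = b * y"
  show "y \<le> 1/2 \<longleftrightarrow> -1/2 \<le> t" "-1/2 \<le> y \<longleftrightarrow> t \<le> b - 1/2" "1/2 - 1/b \<le> y \<longleftrightarrow> t \<le> 1/2" "- (1/2 - 1/b) \<le> y \<longleftrightarrow> t \<le> b - 3/2"
    unfolding c[of y] c[of _ y] e assms(2) R_def[symmetric] by (auto simp: field_simps)
qed

locale tile_A0 = crystile N lam c0 c1 0 B S T for N lam c0 c1 B S T
begin

text \<open>For A = 0 the map g exchanges the axes and stretches one of them by B, so the digits cut
  the unit square into B strips.\<close>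

lemma S_square: "x \<in> S \<longleftrightarrow> \<bar>fst x\<bar> \<le> 1/2 \<and> \<bar>snd x\<bar> \<le> 1/2"
proof -
  define Q :: "(real \<times> real) set" where "Q = {-1/2..1/2} \<times> {-1/2..1/2}"
  have Q: "x \<in> Q \<longleftrightarrow> \<bar>fst x\<bar> \<le> 1/2 \<and> \<bar>snd x\<bar> \<le> 1/2" for x by (cases x) (auto simp: Q_def)
  have "Q = S"
  proof (rule S_unique)
    show "compact Q" unfolding Q_def by (intro compact_Times) auto
    show "Q \<noteq> {}" using Q[of 0] by auto
    fix x :: "real \<times> real"
    define b where "b = real_of_int B"
    have b: "2 \<le> b" using B2 by (simp add: b_def)
    define t where "t = - (b * snd x) + (b - 1) / 2"
    have gx: "gmap 0 B x = (t, fst x)" by (simp add: gmap_def t_def b_def)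
    show "x \<in> Q \<longleftrightarrow> (\<exists>k\<in>{0..B-1}. gmap 0 B x - lv k 0 \<in> Q)"
    proof
      assume "x \<in> Q"
      then have x: "\<bar>fst x\<bar> \<le> 1/2" "\<bar>snd x\<bar> \<le> 1/2" using Q by auto
      have t: "-1/2 \<le> t" "t \<le> b - 1/2" using x strip_bounds(1,2)[OF _ t_def] b by auto
      \<comment> \<open>Rounding would give B at the extreme value t = b - 1/2, hence the separate
        value B - 1 at that end.\<close>
      define k where "k = (if t \<ge> b - 1 then B - 1 else \<lfloor>t + 1/2\<rfloor>)"
      have "k \<in> {0..B-1} \<and> \<bar>t - of_int k\<bar> \<le> 1/2"
      proof (cases "t \<ge> b - 1")
        case True then show ?thesis using t B2 by (auto simp: k_def b_def)
      next
        case False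
        have "of_int \<lfloor>t + 1/2\<rfloor> < b" using False by linarith
        moreover have "0 \<le> \<lfloor>t + 1/2\<rfloor>" using t by simp
        moreover have "\<bar>t - of_int \<lfloor>t + 1/2\<rfloor>\<bar> \<le> 1/2" by linarith
        ultimately show ?thesis using False by (auto simp: k_def b_def)
      qed
      then show "\<exists>k\<in>{0..B-1}. gmap 0 B x - lv k 0 \<in> Q" using x unfolding gx Q by (intro bexI[of _ k]) auto
    next
      assume "\<exists>k\<in>{0..B-1}. gmap 0 B x - lv k 0 \<in> Q"
      then obtain k where k: "0 \<le> k" "k \<le> B - 1" "\<bar>t - of_int k\<bar> \<le> 1/2" "\<bar>fst x\<bar> \<le> 1/2" unfolding gx Q by auto
      have k': "0 \<le> real_of_int k" "real_of_int k \<le> b - 1" using k by (auto simp: b_def)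
      have "-1/2 \<le> t" "t \<le> b - 1/2" using k(3) k' by linarith+
      then have "snd x \<le> 1/2" "-1/2 \<le> snd x" using strip_bounds(1,2)[OF _ t_def] b by auto
      then show "x \<in> Q" using k(4) unfolding Q by auto
    qed
  qed
  then show ?thesis using Q by blast
qed

end

locale tile_A0_wide = tile_A0 + assumes B3: "3 \<le> B"
begin

definition b where "b = real_of_int B"
text \<open>The right edge of the square is cut at heights h and -h: above h it separates T from T +
  (1, 0), between them T from (1, 0) - T.\<close>

definition h where "h = 1/2 - 1/b"

lemma b: "3 \<le> b" using B3 by (simp add: b_def)
lemma bh: "b * h = b / 2 - 1" using b by (simp add: h_def field_simps)
lemma h: "0 < h" "h < 1/2" using b by (auto simp: h_def field_simps)

lemma inS_square: "inS x p q \<longleftrightarrow> \<bar>fst x - of_int p\<bar> \<le> 1/2 \<and> \<bar>snd x - of_int q\<bar> \<le> 1/2"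
  unfolding inS_def S_square by simp

lemma TS: "x \<in> T \<Longrightarrow> \<bar>fst x\<bar> \<le> 1/2 \<and> \<bar>snd x\<bar> \<le> 1/2" using S_T[of x] S_square[of x] by blast

lemma g_eq: "g x = (- (b * snd x) + (b - 1) / 2, fst x)" by (simp add: gmap_def b_def)

lemma top_in: assumes "\<bar>fst x\<bar> \<le> 1/2" "snd x = 1/2" shows "x \<in> T"
  using T_rec[of x] assms unfolding g_eq S_square by (simp add: field_simps)

lemma bottom_out: assumes "snd x = -1/2" shows "x \<notin> T"
proof
  assume "x \<in> T"
  then have "g x \<in> S \<or> (\<exists>k\<in>{1..B-2}. g x - lv k 0 \<in> T)" using T_rec[of x] by simp
  then show False
  proof
    assume "g x \<in> S" then show False unfolding g_eq S_square using assms b by (simp add: field_simps)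
  next
    assume "\<exists>k\<in>{1..B-2}. g x - lv k 0 \<in> T"
    then obtain k where k: "k \<le> B - 2" "g x - lv k 0 \<in> T" by auto
    have "real_of_int k \<le> b - 2" using k(1) by (simp add: b_def)
    then show False using TS[OF k(2)] unfolding g_eq using assms by (simp add: field_simps)
  qed
qed

text \<open>g carries the right edge to height 1/2, where the translates of T contribute at every
  digit. In \<open>left_T\<close> the edge goes to height -1/2, which T misses, so only the S-piece
  at digit 0 remains.\<close>

lemma right_T: assumes "fst x = 1/2" shows "x \<in> T \<longleftrightarrow> - h \<le> snd x \<and> snd x \<le> 1/2"
proof -
  define t where "t = - (b * snd x) + (b - 1) / 2"
  have gx: "g x = (t, 1/2)" unfolding g_eq t_def assms ..
  note sb = strip_bounds[OF _ t_def, folded h_def]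
  show ?thesis
  proof
    assume x: "x \<in> T"
    have "t \<le> b - 3/2"
      using x[unfolded T_rec[of x]]
    proof
      assume "g x \<in> S"
      then have "\<bar>t\<bar> \<le> 1/2" unfolding gx S_square by simp
      then show ?thesis using b by linarith
    next
      assume "\<exists>k\<in>{1..B-2}. g x - lv k 0 \<in> T"
      then obtain k where k: "k \<le> B - 2" "g x - lv k 0 \<in> T" by auto
      have "real_of_int k \<le> b - 2" using k(1) by (simp add: b_def)
      moreover have "\<bar>t - of_int k\<bar> \<le> 1/2" using TS[OF k(2)] unfolding gx by simp
      ultimately show ?thesis by linarith
    qed
    then show "- h \<le> snd x \<and> snd x \<le> 1/2" using TS[OF x] sb(4) b by auto
  next
    assume y: "- h \<le> snd x \<and> snd x \<le> 1/2"
    then have t': "- 1/2 \<le> t" "t \<le> b - 3/2" using sb b by auto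
    define k where "k = (if t \<ge> b - 2 then B - 2 else \<lfloor>t + 1/2\<rfloor>)"
    have k: "0 \<le> k \<and> k \<le> B - 2 \<and> \<bar>t - of_int k\<bar> \<le> 1/2"
    proof (cases "t \<ge> b - 2")
      case True then show ?thesis using t' B3 by (auto simp: k_def b_def)
    next
      case False
      have "of_int \<lfloor>t + 1/2\<rfloor> < b - 1" using False by linarith
      then have "\<lfloor>t + 1/2\<rfloor> < B - 1" unfolding b_def by linarith
      moreover have "0 \<le> \<lfloor>t + 1/2\<rfloor>" using t' by simp
      moreover have "\<bar>t - of_int \<lfloor>t + 1/2\<rfloor>\<bar> \<le> 1/2" by linarith
      ultimately show ?thesis using False by (auto simp: k_def)
    qed
    show "x \<in> T"
    proof (cases "k = 0")
      case True
      then have "g x \<in> S" unfolding gx S_square using k by simp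
      then show ?thesis using T_rec[of x] by blast
    next
      case False
      have "g x - lv k 0 \<in> T" by (rule top_in) (use k gx in simp_all)
      moreover have "k \<in> {1..B-2}" using False k by auto
      ultimately show ?thesis using T_rec[of x] by blast
    qed
  qed
qed

lemma left_T: assumes "fst x = -1/2" shows "x \<in> T \<longleftrightarrow> h \<le> snd x \<and> snd x \<le> 1/2"
proof -
  define t where "t = - (b * snd x) + (b - 1) / 2"
  have gx: "g x = (t, -1/2)" unfolding g_eq t_def assms ..
  have "g x - lv k 0 \<notin> T" for k by (rule bottom_out) (simp add: gx)
  then have "x \<in> T \<longleftrightarrow> g x \<in> S" using T_rec[of x] by blast
  also have "\<dots> \<longleftrightarrow> -1/2 \<le> t \<and> t \<le> 1/2" unfolding gx S_square by auto
  also have "\<dots> \<longleftrightarrow> h \<le> snd x \<and> snd x \<le> 1/2" using strip_bounds(1,3)[OF _ t_def, folded h_def] b by auto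
  finally show ?thesis .
qed

lemma vertical_segment: "closed_segment (c, s) (c, t) = {x. fst x = c \<and> min s t \<le> snd x \<and> snd x \<le> max s t}" for c s t :: real
proof -
  have "closed_segment (c, s) (c, t) = {c} \<times> closed_segment s t"
    using closed_segment_same_fst[of "(c,s)" "(c,t)"] by simp
  also have "closed_segment s t = {min s t..max s t}" by (simp add: closed_segment_eq_real_ivl)
  finally show ?thesis by (simp add: set_eq_iff mem_Times_iff)
qed

lemma horizontal_segment: "closed_segment (s, c) (t, c) = {x. snd x = c \<and> min s t \<le> fst x \<and> fst x \<le> max s t}" for c s t :: real
proof -
  have "closed_segment (s, c) (t, c) = closed_segment s t \<times> {c}"
    using closed_segment_same_snd[of "(s,c)" "(t,c)"] by simp
  also have "closed_segment s t = {min s t..max s t}" by (simp add: closed_segment_eq_real_ivl)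
  finally show ?thesis by (simp add: set_eq_iff mem_Times_iff conj_commute)
qed

lemma int_half: assumes "\<bar>x\<bar> \<le> 1/2" "\<bar>x - of_int p\<bar> \<le> (1/2::real)" "p \<noteq> 0" shows "p = 1 \<and> x = 1/2 \<or> p = -1 \<and> x = -1/2"
proof -
  have "\<bar>real_of_int p\<bar> \<le> 1" using assms(1,2) by linarith
  then have "\<bar>p\<bar> \<le> 1" by linarith
  then have "p = 1 \<or> p = -1" using assms(3) by auto
  then show ?thesis using assms(1,2) by auto
qed

lemma right_edge: assumes "inS x 0 0" "inS x 1 0" shows "fst x = 1/2" "\<bar>snd x\<bar> \<le> 1/2"
  using int_half[of "fst x" 1] assms unfolding inS_square by auto

lemma row: assumes "inS x p 0" "inS x p' 0" shows "\<bar>p' - p\<bar> \<le> 1"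
proof -
  have "\<bar>real_of_int p' - real_of_int p\<bar> \<le> 1" using assms unfolding inS_square by linarith
  then show ?thesis by linarith
qed

lemma T00_T10: "inT x 0 0 \<and> inT x 1 0 \<longleftrightarrow> fst x = 1/2 \<and> h \<le> snd x \<and> snd x \<le> 1/2"
proof
  assume a: "inT x 0 0 \<and> inT x 1 0"
  then have "fst x = 1/2" using right_edge[of x] inT_inS[of x 0 0] inT_inS[of x 1 0] by blast
  then show "fst x = 1/2 \<and> h \<le> snd x \<and> snd x \<le> 1/2" using left_T[of "x - lv 1 0"] a by (simp add: inT_def)
next
  assume "fst x = 1/2 \<and> h \<le> snd x \<and> snd x \<le> 1/2"
  then show "inT x 0 0 \<and> inT x 1 0" using left_T[of "x - lv 1 0"] right_T[of x] h by (simp add: inT_def)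
qed

lemma T00_U10: "inT x 0 0 \<and> inU x 1 0 \<longleftrightarrow> fst x = 1/2 \<and> - h \<le> snd x \<and> snd x \<le> h"
proof
  assume a: "inT x 0 0 \<and> inU x 1 0"
  then have "fst x = 1/2" using right_edge[of x] inT_inS[of x 0 0] inU_inS[of x 1 0] by blast
  then show "fst x = 1/2 \<and> - h \<le> snd x \<and> snd x \<le> h" using right_T[of "lv 1 0 - x"] right_T[of x] a by (simp add: inT_def inU_def)
next
  assume "fst x = 1/2 \<and> - h \<le> snd x \<and> snd x \<le> h"
  then show "inT x 0 0 \<and> inU x 1 0" using right_T[of "lv 1 0 - x"] right_T[of x] h by (simp add: inT_def inU_def)
qed

lemma never: "\<not> (inU x 0 0 \<and> inT x 1 0)"
proof
  assume a: "inU x 0 0 \<and> inT x 1 0"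
  then have "fst x = 1/2" using right_edge[of x] inU_inS[of x 0 0] inT_inS[of x 1 0] by blast
  then show False using left_T[of "x - lv 1 0"] left_T[of "- x"] a h by (simp add: inT_def)
qed

lemma nev: assumes "inU x p 0" "inT x (p + 1) 0" shows False
  using never[of "x - lv p 0"] assms unfolding inT_shift inU_shift by (simp add: add.commute)

lemma top_only: assumes "x \<in> T" "q \<noteq> 0" "inS x p q" shows "snd x = 1/2"
  using int_half[of "snd x" q] TS[OF assms(1)] assms(2,3) bottom_out[of x] assms(1) unfolding inS_square by auto

lemma disk_like_T: "disk_like T"
proof -
  have lin: "arc (linepath x y)" if "x \<noteq> y" for x y :: "real \<times> real" using that by simp
  interpret kappa_tile N lam c0 c1 0 B S T "(1/2,1/2)" "(1/2,h)" "(1/2,-h)" "linepath (1/2,1/2) (1/2,h)"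
    "linepath (1/2,h) (1/2,-h)" "linepath (1/2,1/2) (-1/2,1/2)" 1
  proof
    show "\<bar>p\<bar> \<le> 1" if "x \<in> S" "inS x p 0" for x p using row[of x 0 p] that by simp
    show "p = 0 \<and> q = 0" if "inS 0 p q" for p q
    proof -
      have "\<bar>real_of_int p\<bar> \<le> 1/2" "\<bar>real_of_int q\<bar> \<le> 1/2" using that unfolding inS_square by simp_all
      then show ?thesis by linarith
    qed
    show "\<not> (inU x 0 0 \<and> inT x 1 0)" for x by (rule never)
    show "arc (linepath (1/2::real,1/2::real) (1/2,h))" "arc (linepath (1/2::real,h) (1/2,-h))" "arc (linepath (1/2::real,1/2::real) (-1/2,1/2))"
      using h by (auto intro!: lin)
    show "path_image (linepath (1/2,1/2) (1/2,h)) = {x. inT x 0 0 \<and> inT x 1 0}"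
      unfolding path_image_linepath vertical_segment T00_T10 using h by auto
    show "path_image (linepath (1/2,h) (1/2,-h)) = {x. inT x 0 0 \<and> inU x 1 0}"
      unfolding path_image_linepath vertical_segment T00_U10 using h by auto
    show "path_image (linepath (1/2,1/2) (-1/2,1/2)) = {x. x \<in> T \<and> (\<exists>p q. q \<noteq> 0 \<and> inS x p q)}"
    proof (intro equalityI subsetI)
      fix x :: "real \<times> real" assume "x \<in> path_image (linepath (1/2,1/2) (-1/2,1/2))"
      then have x: "snd x = 1/2" "\<bar>fst x\<bar> \<le> 1/2" unfolding path_image_linepath horizontal_segment by auto
      have "inS x 0 1" unfolding inS_square using x by simp
      moreover have "x \<in> T" using top_in x by blast
      ultimately show "x \<in> {x. x \<in> T \<and> (\<exists>p q. q \<noteq> 0 \<and> inS x p q)}" by (metis (mono_tags, lifting) mem_Collect_eq zero_neq_one)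
    next
      fix x assume "x \<in> {x. x \<in> T \<and> (\<exists>p q. q \<noteq> 0 \<and> inS x p q)}"
      then obtain p q where "x \<in> T" "q \<noteq> 0" "inS x p q" by blast
      then have "snd x = 1/2" "\<bar>fst x\<bar> \<le> 1/2" using top_only TS by blast+
      then show "x \<in> path_image (linepath (1/2,1/2) (-1/2,1/2))" unfolding path_image_linepath horizontal_segment by auto
    qed
    show "x = (1/2, h)" if "inT x 0 0" "inT x 1 0" "inU x 1 0" for x
    proof -
      have "fst x = 1/2" "h \<le> snd x" "snd x \<le> h" using T00_T10[of x] T00_U10[of x] that by blast+
      then show ?thesis by (simp add: prod_eq_iff)
    qed
    show "x = (1/2,1/2)" if "x \<in> T" "q \<noteq> 0" "inS x p q" "inS x 1 0" for x p q
    proof -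
      have "inT x 0 0" using that(1) by simp
      then have "fst x = 1/2" using right_edge(1)[OF inT_inS that(4)] by blast
      then show ?thesis using top_only[OF that(1-3)] by (simp add: prod_eq_iff)
    qed
    show "x = (1/2,1/2) - lv 1 0" if "x \<in> T" "q \<noteq> 0" "inS x p q" "inS x (-1) 0" for x p q
    proof -
      have "fst x = -1/2" using int_half[of "fst x" "-1"] TS[OF that(1)] that(4) unfolding inS_square by auto
      then show ?thesis using top_only[OF that(1-3)] by (simp add: prod_eq_iff)
    qed
    show "- x \<notin> T" if "x \<in> T" "q \<noteq> 0" "inS x p q" for x p q using bottom_out[of "- x"] top_only[OF that] by simp
    show "x \<in> T \<and> - x \<in> T \<longleftrightarrow> (\<exists>k\<in>{0..B-2}. inT (g x) k 0 \<and> inU (g x) (k+1) 0) \<or>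
      (\<exists>k\<in>{1..B-2}. inT (g x) k 0 \<and> inU (g x) k 0) \<or> (inU (g x) 0 0 \<and> inU (g x) 1 0) \<or>
      (inT (g x) (B-2) 0 \<and> inT (g x) (B-1) 0)" for x
    proof -
      have "x \<in> T \<and> - x \<in> T \<longleftrightarrow> inT x 0 0 \<and> inU x 0 0" by simp
      also have "\<dots> \<longleftrightarrow> (inS (g x) 0 0 \<or> (\<exists>k\<in>{1..B-2}. inT (g x) k 0)) \<and> (inS (g x) (B-1) 0 \<or> (\<exists>k\<in>{1..B-2}. inU (g x) k 0))"
        unfolding inT_rec[of x 0 0] inU_rec[of x 0 0] by simp
      also note kappa_recursion[OF row nev]
      finally show ?thesis .
    qed
    show "g (- 1 *\<^sub>R (1/2, - h)) = lv 1 0 - (1/2, 1/2)" unfolding g_eq using bh by (simp add: lv_def field_simps)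
  qed (simp_all add: lv_def linepath_0' linepath_1')
  show ?thesis by (rule disk_like_T)
qed

end

lemma disk_like_tile_0: assumes "3 \<le> B" shows "disk_like (tile 0 B)"
proof -
  obtain N lam c0 c1 where "tile_gauge N lam c0 c1 0 B" using tile_gauge_exists[of B 0] assms by auto
  from tile_crystile(1)[OF this] interpret crystile N lam c0 c1 0 B "tile 0 B \<union> uminus ` tile 0 B" "tile 0 B" .
  interpret tile_A0_wide N lam c0 c1 B "tile 0 B \<union> uminus ` tile 0 B" "tile 0 B" by unfold_locales fact
  show ?thesis by (rule disk_like_T)
qed

section \<open>A = B = 2\<close>

text \<open>For B = 2 it suffices that S is disk-like. Its neighbours are at \<plusminus>(1, 0),
  \<plusminus>(1, 1) and \<plusminus>(2, 1), and its boundary is a hexagon with sides F, al, be and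
  their negatives.\<close>

locale lattice_A22 = half_tile N lam c0 c1 2 2 S T for N lam c0 c1 S T
begin

lemma nb: assumes "inS x p q" "inS x p' q'"
  shows "(q' - q = 0 \<and> (p' - p = 0 \<or> p' - p = 1 \<or> p' - p = -1)) \<or> (q' - q = 1 \<and> (p' - p = 1 \<or> p' - p = 2)) \<or>
    (q' - q = -1 \<and> (p' - p = -1 \<or> p' - p = -2))"
proof -
  have "neighbour_vec 2 (p' - p, q' - q)"
    by (rule neighbour_set_bound[OF _ _ _ _ nbrs_finite nbrs_minus nbrs_step inS_nbrs[OF assms]]) auto
  then show ?thesis unfolding neighbour_vec_def by auto
qed

lemma zero_only: assumes "inS 0 p q" shows "p = 0 \<and> q = 0"
proof -
  have "inS 0 (-p) (-q)" using assms inS_minus[of 0 p q] by simp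
  from nb[OF this assms] show ?thesis by presburger
qed

lemma inS_rec2: "inS x p q \<longleftrightarrow> inS (g x) (- 2 * q) (p - 2 * q) \<or> inS (g x) (1 - 2 * q) (p - 2 * q)"
proof -
  have "{0..2-1::int} = {0,1}" by auto
  then show ?thesis unfolding inS_rec[of x p q] by simp
qed

text \<open>The value of \<open>zp\<close> for A = B = 2; the vertices of the hexagon come from it
  by the half-turns of the arrangement and by translations.\<close>

definition z1 :: "real \<times> real" where "z1 = (9/10, 3/10)"
definition z2 where "z2 = lv 2 1 - z1"

lemma g_z1: "g z1 = z1 - lv 1 0" and g_z2: "g z2 = z2 - lv 2 1"
  by (simp_all add: z1_def z2_def gmap_def lv_def)

lemma z1_mem: "inS z1 0 0" "inS z1 1 0" "inS z1 2 1"
proof -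
  have 1: "g z1 - lv 0 0 = z1 - lv 1 0" using g_z1 by simp
  have 2: "g (z1 - lv 1 0) - lv 1 0 = z1 - lv 2 1" unfolding gmap_diff_lv g_z1 by (simp add: lv_def prod_eq_iff)
  have 3: "g (z1 - lv 2 1) - lv 1 0 = z1" unfolding gmap_diff_lv g_z1 by (simp add: lv_def prod_eq_iff)
  show "inS z1 0 0" "inS z1 1 0" "inS z1 2 1" unfolding inS_00 unfolding inS_def
    by (rule cycle3_mem[OF 1 2 3]; simp)+
qed

lemma z2_mem: "inS z2 0 0" "inS z2 1 1" "inS z2 2 1"
  unfolding z2_def inS_reflect using z1_mem by simp_all

definition F where "F = {x. inS x 0 0 \<and> inS x 1 0}"
definition al where "al = {x. inS x 0 0 \<and> inS x 2 1}"
definition be where "be = {x. inS x 0 0 \<and> inS x 1 1}"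

lemma F_iff: "x \<in> F \<longleftrightarrow> g x \<in> be"
proof -
  have "x \<in> F \<longleftrightarrow> (inS (g x) 0 0 \<or> inS (g x) 1 0) \<and> (inS (g x) 0 1 \<or> inS (g x) 1 1)"
    unfolding F_def mem_Collect_eq inS_rec2[of x 0 0] inS_rec2[of x 1 0] by simp
  also have "\<dots> \<longleftrightarrow> inS (g x) 0 0 \<and> inS (g x) 1 1" (is "?l \<longleftrightarrow> ?r")
  proof
    assume ?l then show ?r
      using nb[of "g x" 0 0 0 1] nb[of "g x" 1 0 0 1] nb[of "g x" 1 0 1 1] by auto
  qed blast
  finally show ?thesis unfolding be_def mem_Collect_eq .
qed

lemma al_iff: "x \<in> al \<longleftrightarrow> g x + lv 1 0 \<in> F"
proof -
  have "x \<in> al \<longleftrightarrow> (inS (g x) 0 0 \<or> inS (g x) 1 0) \<and> (inS (g x) (-2) 0 \<or> inS (g x) (-1) 0)"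
    unfolding al_def mem_Collect_eq inS_rec2[of x 0 0] inS_rec2[of x 2 1] by simp
  also have "\<dots> \<longleftrightarrow> inS (g x) 0 0 \<and> inS (g x) (-1) 0" (is "?l \<longleftrightarrow> ?r")
  proof
    assume ?l then show ?r
      using nb[of "g x" 0 0 "-2" 0] nb[of "g x" 1 0 "-2" 0] nb[of "g x" 1 0 "-1" 0] by auto
  qed blast
  finally show ?thesis unfolding F_def mem_Collect_eq inS_plus by auto
qed

text \<open>Here \<open>be\<close> is the side that reproduces itself: g maps F onto
  \<open>be\<close> and al onto a translate of F, while the image of \<open>be\<close> is a chain of
  a translate of al, the negative of \<open>be\<close> and another translate of al.\<close>

definition P :: "nat \<Rightarrow> (real \<times> real) set" where
  "P i = (if i = 0 then {x. inS (g x) 0 0 \<and> inS (g x) (-2) (-1)}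
    else if i = 1 then {x. inS (g x) 0 0 \<and> inS (g x) (-1) (-1)} else {x. inS (g x) 1 0 \<and> inS (g x) (-1) (-1)})"
definition xp :: "nat \<Rightarrow> real \<times> real" where
  "xp i = gi (if i = 0 then z2 - lv 2 1 else if i = 1 then z1 - lv 2 1 else if i = 2 then z2 - lv 1 1 else z1 - lv 1 1)"
definition psi where "psi x = gi (gi x - lv 1 0)"
definition hf :: "nat \<Rightarrow> real \<times> real \<Rightarrow> real \<times> real" where
  "hf i x = gi (if i = 0 then psi x - lv 2 1 else if i = 1 then - x else psi x - lv 1 1)"

lemma be_rec: "be = P 0 \<union> P 1 \<union> P 2"
proof -
  have "x \<in> be \<longleftrightarrow> x \<in> P 0 \<union> P 1 \<union> P 2" for x
  proof -
    have "x \<in> be \<longleftrightarrow> (inS (g x) 0 0 \<or> inS (g x) 1 0) \<and> (inS (g x) (-2) (-1) \<or> inS (g x) (-1) (-1))"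
      unfolding be_def mem_Collect_eq inS_rec2[of x 0 0] inS_rec2[of x 1 1] by simp
    also have "\<dots> \<longleftrightarrow> (inS (g x) 0 0 \<and> inS (g x) (-2) (-1)) \<or> (inS (g x) 0 0 \<and> inS (g x) (-1) (-1)) \<or> (inS (g x) 1 0 \<and> inS (g x) (-1) (-1))"
      using nb[of "g x" "-2" "-1" 1 0] by auto
    also have "\<dots> \<longleftrightarrow> x \<in> P 0 \<union> P 1 \<union> P 2" unfolding P_def Un_iff by simp
    finally show ?thesis .
  qed
  then show ?thesis by blast
qed

lemma psi_image: "psi ` be = al"
proof (intro equalityI subsetI)
  fix y assume "y \<in> psi ` be"
  then obtain x where x: "x \<in> be" "y = psi x" by blast
  have "g (g y + lv 1 0) = x" unfolding x(2) psi_def by simp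
  then show "y \<in> al" using x(1) unfolding al_iff F_iff by simp
next
  fix y assume "y \<in> al"
  then have "g (g y + lv 1 0) \<in> be" "y = psi (g (g y + lv 1 0))" unfolding al_iff F_iff psi_def by simp_all
  then show "y \<in> psi ` be" by blast
qed

lemma F_image: "gi ` be = F"
proof (intro equalityI subsetI)
  fix y assume "y \<in> gi ` be"
  then show "y \<in> F" unfolding F_iff by auto
next
  fix y assume "y \<in> F"
  then have "g y \<in> be" "y = gi (g y)" unfolding F_iff by simp_all
  then show "y \<in> gi ` be" by blast
qed

lemma gi_vertex: "gi (z1 - lv 1 0) = z1" "gi z2 = z2 - lv 1 1" "gi (z2 - lv 2 1) = z2" "gi (z1 - lv 1 1) = z1 - lv 1 0"
proof -
  show "gi (z1 - lv 1 0) = z1" "gi (z2 - lv 2 1) = z2" by (metis g_z1 gi_g, metis g_z2 gi_g)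
  have "g (z2 - lv 1 1) = z2" "g (z1 - lv 1 0) = z1 - lv 1 1" unfolding gmap_diff_lv g_z1 g_z2 by (simp_all add: lv_def prod_eq_iff)
  then show "gi z2 = z2 - lv 1 1" "gi (z1 - lv 1 1) = z1 - lv 1 0" by (metis gi_g)+
qed

lemma psi_vertex: "psi z2 = z2" "psi (z1 - lv 1 0) = z1"
proof -
  have "z2 - lv 1 1 - lv 1 0 = z2 - lv 2 1" by (simp add: lv_def prod_eq_iff)
  then show "psi z2 = z2" unfolding psi_def gi_vertex(2) by (simp only: gi_vertex)
  show "psi (z1 - lv 1 0) = z1" unfolding psi_def gi_vertex ..
qed

lemma xp_ends: "xp 0 = z2" "xp 3 = z1 - lv 1 0" by (simp_all add: xp_def gi_vertex)

lemma psi_inj: assumes "psi x = psi y" shows "x = y"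
proof -
  from inj_gi[OF assms[unfolded psi_def]] have "gi x = gi y" by simp
  then show ?thesis by (rule inj_gi)
qed

lemma P_eq: assumes "i < 3" shows "P i = hf i ` be"
proof -
  consider "i = 0" | "i = 1" | "i = 2" using assms by linarith
  then show ?thesis
  proof cases
    case 1
    have "x \<in> P 0 \<longleftrightarrow> g x + lv 2 1 \<in> al" for x unfolding P_def al_def mem_Collect_eq inS_plus by auto
    then have "x \<in> P 0 \<longleftrightarrow> (\<exists>y\<in>be. g x + lv 2 1 = psi y)" for x using psi_image by blast
    moreover have "g x + lv 2 1 = psi y \<longleftrightarrow> x = gi (psi y - lv 2 1)" for x y by (metis g_gi gi_g add_diff_cancel diff_add_cancel)
    ultimately show ?thesis using 1 by (auto simp: hf_def)
  next
    case 2
    have "x \<in> P 1 \<longleftrightarrow> - g x \<in> be" for x unfolding P_def be_def mem_Collect_eq inS_minus by auto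
    then have "x \<in> P 1 \<longleftrightarrow> (\<exists>y\<in>be. - g x = y)" for x by blast
    moreover have "- g x = y \<longleftrightarrow> x = gi (- y)" for x y by (metis g_gi gi_g minus_minus)
    ultimately show ?thesis using 2 by (auto simp: hf_def)
  next
    case 3
    have "x \<in> P 2 \<longleftrightarrow> g x + lv 1 1 \<in> al" for x unfolding P_def al_def mem_Collect_eq inS_plus by auto
    then have "x \<in> P 2 \<longleftrightarrow> (\<exists>y\<in>be. g x + lv 1 1 = psi y)" for x using psi_image by blast
    moreover have "g x + lv 1 1 = psi y \<longleftrightarrow> x = gi (psi y - lv 1 1)" for x y by (metis g_gi gi_g add_diff_cancel diff_add_cancel)
    ultimately show ?thesis using 3 by (auto simp: hf_def)
  qed
qed

lemma z1_unique: assumes "inS x 0 0" "inS x 1 0" "inS x 2 1" shows "x = z1"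
proof (rule fix_unique[of "{x. inS x 0 0 \<and> inS x 1 0 \<and> inS x 2 1}" "lv 1 0" z1])
  show "bounded {x. inS x 0 0 \<and> inS x 1 0 \<and> inS x 2 1}"
    by (rule bounded_subset[OF compact_imp_bounded[OF S_compact]]) auto
  show "g z1 + lv 1 0 = z1" using g_z1 by simp
  show "x \<in> {x. inS x 0 0 \<and> inS x 1 0 \<and> inS x 2 1}" using assms by simp
  fix y assume "y \<in> {x. inS x 0 0 \<and> inS x 1 0 \<and> inS x 2 1}"
  then have y: "y \<in> F" "y \<in> al" unfolding F_def al_def by blast+
  have 1: "inS (g y) 1 1" using y(1) unfolding F_iff be_def mem_Collect_eq by blast
  have 2: "inS (g y + lv 1 0) 0 0" "inS (g y + lv 1 0) 1 0" using y(2) unfolding al_iff F_def mem_Collect_eq by blast+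
  have "inS (g y + lv 1 0) 2 1" unfolding inS_plus using 1 by simp
  then show "g y + lv 1 0 \<in> {x. inS x 0 0 \<and> inS x 1 0 \<and> inS x 2 1}" using 2 by blast
qed

lemma z2_unique: assumes "inS x 0 0" "inS x 1 1" "inS x 2 1" shows "x = z2"
proof -
  have "lv 2 1 - x = z1" by (rule z1_unique) (unfold inS_reflect, use assms in simp_all)
  then show ?thesis unfolding z2_def by (simp add: algebra_simps)
qed

lemma be_arc: obtains p where "arc p" "path_image p = be" "p 0 = z2" "p 1 = z1 - lv 1 0"
proof -
  interpret AC: arc_chain be P xp hf "\<lambda>_ _. 0" UNIV 3 N lam c0 c1
  proof
    have "be = {x. inS x 0 0} \<inter> {x. inS x 1 1}" by (auto simp: be_def)
    then show "compact be" using compact_inS compact_Int by metis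
    have "z2 \<in> be" unfolding be_def mem_Collect_eq using z2_mem by blast
    then show "be \<noteq> {}" by blast
    have "{..<3::nat} = {0,1,2}" by auto
    then show "be = (\<Union>i<3. P i)" using be_rec by auto
    show "P i = hf i ` be \<and> hf i (xp 0) = xp i \<and> hf i (xp 3) = xp (Suc i) \<and> inj (hf i)" if "i < 3" for i
    proof (intro conjI)
      show "P i = hf i ` be" by (rule P_eq[OF that])
      have i: "i = 0 \<or> i = 1 \<or> i = 2" using that by linarith
      have v: "- z2 = z1 - lv 2 1" "- (z1 - lv 1 0) = z2 - lv 1 1" by (simp_all add: z2_def lv_def prod_eq_iff)
      show "hf i (xp 0) = xp i" unfolding xp_ends hf_def psi_vertex v using i by (auto simp: xp_def)
      show "hf i (xp 3) = xp (Suc i)" unfolding xp_ends hf_def psi_vertex v using i by (auto simp: xp_def)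
      show "inj (hf i)"
      proof (rule injI)
        fix x y assume "hf i x = hf i y"
        from inj_gi[OF this[unfolded hf_def]] show "x = y" by (auto split: if_splits dest: psi_inj)
      qed
    qed
    have le: "lam * t \<le> t" if "0 \<le> t" for t using that lam by (simp add: mult_left_le_one_le)
    show "N (hf i p - hf i q) \<le> lam * N (p - q)" for i p q
    proof -
      have "N (psi p - psi q) \<le> lam * N (gi p - gi q)"
        unfolding psi_def using contr[of "gi p - lv 1 0" "gi q - lv 1 0"] by simp
      also have "\<dots> \<le> N (gi p - gi q)" by (rule le[OF N_nonneg])
      also have "\<dots> \<le> lam * N (p - q)" by (rule contr)
      also have "\<dots> \<le> N (p - q)" by (rule le[OF N_nonneg])
      finally have 1: "N (psi p - psi q) \<le> N (p - q)" .
      have 2: "N (- p - - q) \<le> N (p - q)" using N_minus[of "p - q"] by simp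
      have "N (hf i p - hf i q) \<le> lam * N ((if i = 0 then psi p - lv 2 1 else if i = 1 then - p else psi p - lv 1 1)
          - (if i = 0 then psi q - lv 2 1 else if i = 1 then - q else psi q - lv 1 1))" unfolding hf_def by (rule contr)
      also have "\<dots> \<le> lam * N (p - q)" using 1 2 lam by (intro mult_left_mono) auto
      finally show ?thesis .
    qed
    show "0 \<le> lam" "lam < 1" "0 < c0" "0 < c1" "c0 * norm v \<le> N v" "N v \<le> c1 * norm v" for v
      by (rule lam c01 N_lower N_upper)+
    show "P i \<inter> P j = {}" if "i < 3" "j < 3" "Suc i < j" for i j
    proof -
      have "i = 0" "j = 2" using that by auto
      then have "inS (g x) (-2) (-1) \<and> inS (g x) 1 0" if "x \<in> P i \<inter> P j" for x using that unfolding P_def by auto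
      then show ?thesis using nb[of _ "-2" "-1" 1 0] by fastforce
    qed
    show "P i \<inter> P (Suc i) \<subseteq> {xp (Suc i)}" if "Suc i < 3" for i
    proof
      fix x assume x: "x \<in> P i \<inter> P (Suc i)"
      have "i = 0 \<or> i = 1" using that by linarith
      then consider "i = 0" | "i = 1" by blast
      then have "g x = (if i = 0 then z1 - lv 2 1 else z2 - lv 1 1)"
      proof cases
        case 1
        have "g x + lv 2 1 = z1" by (rule z1_unique) (use x 1 in \<open>unfold inS_plus, auto simp: P_def\<close>)
        then show ?thesis using 1 by (simp add: algebra_simps)
      next
        case 2
        have "g x + lv 1 1 = z2" by (rule z2_unique) (use x 2 in \<open>unfold inS_plus, auto simp: P_def\<close>)
        then show ?thesis using 2 by (simp add: algebra_simps)
      qed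
      then have "x = gi (if i = 0 then z1 - lv 2 1 else z2 - lv 1 1)" by (metis gi_g)
      then show "x \<in> {xp (Suc i)}" using that by (auto simp: xp_def)
    qed
    show "xp 0 \<notin> P i" if "0 < i" for i
    proof
      assume a: "xp 0 \<in> P i"
      have "g (xp 0) = z2 - lv 2 1" unfolding xp_ends by (rule g_z2)
      then have "inS (z2 - lv 2 1) (-1) (-1)" using a that unfolding P_def by (auto split: if_splits)
      then have "inS z2 1 0" unfolding inS_shift by simp
      then show False using nb[OF z2_mem(2) \<open>inS z2 1 0\<close>] by simp
    qed
    show "xp 3 \<notin> P i" if "Suc i < 3" for i
    proof
      assume a: "xp 3 \<in> P i"
      have "g (xp 3) = z1 - lv 1 1" by (simp add: xp_def)
      then have "inS (z1 - lv 1 1) 0 0" using a that unfolding P_def by (auto split: if_splits)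
      then have "inS z1 1 1" unfolding inS_shift by simp
      then show False using nb[OF z1_mem(2) \<open>inS z1 1 1\<close>] by simp
    qed
  qed auto
  show thesis
  proof (rule AC.arc_exists)
    fix p assume "arc p" "path_image p = be" "\<And>i. i \<le> 3 \<Longrightarrow> p (real i / real 3) = xp i"
    then show thesis using that[of p] xp_ends \<open>\<And>i. i \<le> 3 \<Longrightarrow> p (real i / real 3) = xp i\<close>[of 0] \<open>\<And>i. i \<le> 3 \<Longrightarrow> p (real i / real 3) = xp i\<close>[of 3] by simp
  qed
qed

lemma meet: "F \<inter> al \<subseteq> {z1}" "al \<inter> be \<subseteq> {z2}" "F \<inter> be = {}"
proof -
  show "F \<inter> al \<subseteq> {z1}" using z1_unique unfolding F_def al_def by blast
  show "al \<inter> be \<subseteq> {z2}" using z2_unique unfolding al_def be_def by blast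
  show "F \<inter> be = {}"
  proof (rule ccontr)
    assume "F \<inter> be \<noteq> {}"
    then obtain x where "inS x 1 0" "inS x 1 1" unfolding F_def be_def by blast
    from nb[OF this] show False by simp
  qed
qed

text \<open>A side and a negative of a side give nine pairs. The neighbour list leaves F with the
  negative of be, and be with the negative of F, each meeting in one vertex.\<close>

lemma opposite_meet: assumes "x \<in> F \<union> al \<union> be" "- x \<in> F \<union> al \<union> be" shows "x = lv 1 0 - z1 \<or> x = z1 - lv 1 0"
proof -
  have "inS x 0 0" using assms(1) unfolding F_def al_def be_def by blast
  have 1: "inS x 1 0 \<or> inS x 2 1 \<or> inS x 1 1" using assms(1) unfolding F_def al_def be_def by blast
  have 2: "inS x (-1) 0 \<or> inS x (-2) (-1) \<or> inS x (-1) (-1)"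
    using assms(2) unfolding F_def al_def be_def Un_iff mem_Collect_eq inS_minus by auto
  consider "inS x 1 0" "inS x (-1) (-1)" | "inS x 1 1" "inS x (-1) 0"
    using 1 2 nb[of x 1 0 "-1" 0] nb[of x 1 0 "-2" "-1"] nb[of x 2 1 "-1" 0] nb[of x 2 1 "-2" "-1"] nb[of x 2 1 "-1" "-1"]
      nb[of x 1 1 "-2" "-1"] nb[of x 1 1 "-1" "-1"] by auto
  then show ?thesis
  proof cases
    case 1
    have "x + lv 1 1 = z2" by (rule z2_unique) (unfold inS_plus, use 1 \<open>inS x 0 0\<close> in simp_all)
    then have "x = z2 - lv 1 1" by (simp add: algebra_simps)
    then show ?thesis by (simp add: z2_def lv_def prod_eq_iff)
  next
    case 2
    have "x + lv 1 0 = z1" by (rule z1_unique) (unfold inS_plus, use 2 \<open>inS x 0 0\<close> in simp_all)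
    then show ?thesis by (simp add: algebra_simps)
  qed
qed

text \<open>Three consecutive sides run from b to -b, so the arc and its negative close up to the
  hexagon. The resulting curve consists of the points of S lying in another translate, and
  \<open>covering\<close> makes the rest of S open.\<close>

lemma disk_like_S: "disk_like S"
proof -
  obtain p where p: "arc p" "path_image p = be" "p 0 = z2" "p 1 = z1 - lv 1 0" by (rule be_arc)
  have cgi: "continuous_on X gi" for X by (rule contraction_continuous[OF contr])
  have pf: "arc (gi \<circ> p)" by (rule arc_continuous_inj_image[OF p(1) cgi]) (auto intro: inj_onI inj_gi)
  have pa: "arc (psi \<circ> p)"
  proof (rule arc_continuous_inj_image[OF p(1)])
    show "continuous_on (path_image p) psi" unfolding psi_def[abs_def]
      by (intro continuous_on_compose2[OF cgi[of UNIV]] continuous_intros cgi) auto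
    show "inj_on psi (path_image p)" by (auto intro: inj_onI psi_inj)
  qed
  define W1 where "W1 = reversepath (psi \<circ> p) +++ p"
  define W where "W = (gi \<circ> p) +++ W1"
  define b where "b = lv 1 0 - z1"
  have b: "z2 - lv 1 1 = b" "z1 - lv 1 0 = - b" by (simp_all add: b_def z2_def lv_def prod_eq_iff)
  have im: "path_image (gi \<circ> p) = F" "path_image (reversepath (psi \<circ> p)) = al"
    unfolding path_image_reversepath path_image_compose p(2) by (rule F_image psi_image)+
  have e: "pathstart p = z2" "pathfinish p = - b" "pathstart (gi \<circ> p) = b" "pathfinish (gi \<circ> p) = z1"
    "pathstart (reversepath (psi \<circ> p)) = z1" "pathfinish (reversepath (psi \<circ> p)) = z2"
    using p(3,4) gi_vertex psi_vertex b by (simp_all add: pathstart_def pathfinish_def reversepath_def)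
  have W1: "arc W1" "path_image W1 = al \<union> be" "pathstart W1 = z1" "pathfinish W1 = - b"
  proof -
    show "arc W1" unfolding W1_def using meet(2) by (intro arc_join p(1)) (simp_all add: e im p(2) arc_reversepath pa del: path_image_reversepath pathstart_reversepath pathfinish_reversepath)
    show "path_image W1 = al \<union> be" unfolding W1_def by (subst path_image_join) (simp_all add: e im p(2) del: path_image_reversepath pathstart_reversepath pathfinish_reversepath)
    show "pathstart W1 = z1" "pathfinish W1 = - b" unfolding W1_def pathstart_join pathfinish_join by (rule e)+
  qed
  have W: "arc W" "path_image W = F \<union> al \<union> be" "pathstart W = b" "pathfinish W = - b"
  proof -
    show "arc W" unfolding W_def using meet by (intro arc_join pf W1) (auto simp: e im W1)
    show "path_image W = F \<union> al \<union> be" unfolding W_def by (subst path_image_join) (auto simp: e im W1)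
    show "pathstart W = b" "pathfinish W = - b" unfolding W_def by (simp_all add: e W1)
  qed
  define V where "V = uminus \<circ> W"
  have V: "arc V" "pathstart V = - b" "pathfinish V = b"
    using W(3,4) unfolding V_def pathstart_def pathfinish_def
    by (auto intro!: arc_continuous_inj_image[OF W(1)] continuous_intros inj_onI)
  have Vi: "x \<in> path_image V \<longleftrightarrow> - x \<in> F \<union> al \<union> be" for x unfolding V_def path_image_compose W(2) by (rule mem_uminus_image)
  define c where "c = W +++ V"
  have cs: "simple_path c" unfolding c_def
  proof (rule simple_path_join_loop[OF W(1) V(1)])
    show "pathfinish W = pathstart V" "pathfinish V = pathstart W" using W V by simp_all
    show "path_image W \<inter> path_image V \<subseteq> {pathstart W, pathstart V}"
    proof
      fix x assume "x \<in> path_image W \<inter> path_image V"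
      then have "x \<in> F \<union> al \<union> be" "- x \<in> F \<union> al \<union> be" unfolding W(2) Int_iff Vi by blast+
      from opposite_meet[OF this] show "x \<in> {pathstart W, pathstart V}" unfolding W(3) V(2) b(2) b_def by simp
    qed
  qed
  have ci: "x \<in> path_image c \<longleftrightarrow> x \<in> F \<union> al \<union> be \<or> - x \<in> F \<union> al \<union> be" for x
    unfolding c_def path_image_join[OF W(4)[folded V(2)]] Un_iff[of _ "path_image W" "path_image V"] Vi unfolding W(2) ..
  have ce: "x \<in> path_image c \<longleftrightarrow> x \<in> S \<and> (\<exists>p q. (p, q) \<noteq> (0, 0) \<and> inS x p q)" for x
  proof
    assume "x \<in> path_image c"
    then have "inS x 0 0 \<and> (inS x 1 0 \<or> inS x 2 1 \<or> inS x 1 1 \<or> inS x (-1) 0 \<or> inS x (-2) (-1) \<or> inS x (-1) (-1))"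
      unfolding ci F_def al_def be_def Un_iff mem_Collect_eq inS_minus by auto
    then show "x \<in> S \<and> (\<exists>p q. (p, q) \<noteq> (0, 0) \<and> inS x p q)" by (metis Pair_inject inS_00 neg_equal_0_iff_equal zero_neq_numeral zero_neq_one)
  next
    assume "x \<in> S \<and> (\<exists>p q. (p, q) \<noteq> (0, 0) \<and> inS x p q)"
    then obtain p q where x: "inS x 0 0" "(p, q) \<noteq> (0, 0)" "inS x p q" by auto
    have "inS x 1 0 \<or> inS x 2 1 \<or> inS x 1 1 \<or> inS x (-1) 0 \<or> inS x (-2) (-1) \<or> inS x (-1) (-1)" using nb[OF x(1,3)] x(2,3) by auto
    then show "x \<in> path_image c" using x(1) unfolding ci F_def al_def be_def Un_iff mem_Collect_eq inS_minus by auto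
  qed
  show ?thesis
  proof (rule disk_like_of_Jordan_curve[OF S_compact cs])
    show "pathfinish c = pathstart c" unfolding c_def using V(3) W(3) by simp
    show "path_image c \<subseteq> S" using ce by blast
    have "S - path_image c = - {x. \<exists>p q. (p, q) \<noteq> (0, 0) \<and> inS x p q}"
    proof (intro equalityI subsetI)
      fix x assume x: "x \<in> - {x. \<exists>p q. (p, q) \<noteq> (0, 0) \<and> inS x p q}"
      obtain p q where pq: "inS x p q" using covering by blast
      then have "(p, q) = (0, 0)" using x by blast
      then have "x \<in> S" using pq by simp
      then show "x \<in> S - path_image c" using x ce by blast
    qed (use ce in blast)
    then show "open (S - path_image c)" using closed_other_S by (simp add: open_Compl)
    obtain p q where pq: "inS 0 p q" using covering by blast
    then have "0 \<in> S" using zero_only[OF pq] by simp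
    moreover have "0 \<notin> path_image c" using ce[of 0] zero_only by auto
    ultimately show "S - path_image c \<noteq> {}" by blast
  qed
qed

end

section \<open>The classification\<close>

context crystile
begin

text \<open>The range {1..B-2} is empty for B = 2, so g itself carries T onto S.\<close>

lemma T_homeomorphic_S: assumes "B = 2" shows "T homeomorphic S"
proof -
  have T: "x \<in> T \<longleftrightarrow> g x \<in> S" for x using T_rec[of x] assms by simp
  have "continuous_on T g" unfolding gmap_def[abs_def] by (intro continuous_intros)
  moreover have "continuous_on S gi" by (rule contraction_continuous[OF contr])
  ultimately have "homeomorphism T S g gi" by (intro homeomorphismI) (auto simp: T simp del: split_paired_All)
  then show ?thesis unfolding homeomorphic_def by blast
qed

end

lemma disk_like_tile_0_2: "disk_like (tile 0 2)"
proof -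
  obtain N lam c0 c1 where "tile_gauge N lam c0 c1 0 2" using tile_gauge_exists[of 2 0] by auto
  from tile_crystile(1)[OF this] interpret crystile N lam c0 c1 0 2 "tile 0 2 \<union> uminus ` tile 0 2" "tile 0 2" .
  interpret tile_A0 N lam c0 c1 2 "tile 0 2 \<union> uminus ` tile 0 2" "tile 0 2" by unfold_locales
  define S where "S = tile 0 2 \<union> uminus ` tile 0 2"
  have S: "S = cbox (-1/2, -1/2) (1/2, 1/2)"
  proof -
    have "x \<in> S \<longleftrightarrow> x \<in> cbox (-1/2, -1/2) (1/2, 1/2)" for x
      unfolding S_def S_square by (cases x) (auto simp: cbox_Pair_eq abs_le_iff)
    then show ?thesis by blast
  qed
  have "(0, 0) \<in> box (-1/2, -1/2) (1/2::real, 1/2::real)" by (simp add: box_def Basis_prod_def)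
  then have "interior S \<noteq> {}" unfolding S interior_cbox by blast
  then have "S homeomorphic cball (0 :: real \<times> real) 1"
    unfolding S by (intro homeomorphic_convex_compact_cball) (auto simp: convex_box compact_cbox)
  then have "disk_like S" by (simp add: disk_like_def)
  then show ?thesis using T_homeomorphic_S disk_like_homeomorphic unfolding S_def by blast
qed

text \<open>The mirror image of the lattice tile for A = 1 solves the equation for A = -1, so
  \<open>S_unique\<close> identifies the two. The disk shape passes from \<open>tile 1 2\<close> to
  its S, to the mirrored S, and from there to \<open>tile (-1) 2\<close>.\<close>

lemma disk_like_tile_minus1_2: "disk_like (tile (-1) 2)"
proof -
  obtain N0 l0 d0 d1 where "tile_gauge N0 l0 d0 d1 (-1) 2" using tile_gauge_exists[of 2 "-1"] by auto
  from tile_crystile(1)[OF this] interpret C: crystile N0 l0 d0 d1 "-1" 2 "tile (-1) 2 \<union> uminus ` tile (-1) 2" "tile (-1) 2" .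
  obtain N lam c0 c1 where "tile_gauge N lam c0 c1 1 2" using tile_gauge_exists[of 2 1] by auto
  from tile_crystile(1)[OF this] interpret E: crystile N lam c0 c1 1 2 "tile 1 2 \<union> uminus ` tile 1 2" "tile 1 2" .
  define S where "S = tile 1 2 \<union> uminus ` tile 1 2"
  define D :: "real \<times> real \<Rightarrow> real \<times> real" where "D = (\<lambda>p. (fst p, - snd p))"
  have D[simp]: "D (D x) = x" for x by (simp add: D_def)
  have hom: "homeomorphism UNIV UNIV D D"
    by (rule homeomorphismI) (auto simp: D_def intro!: continuous_intros)
  have cD: "continuous_on X D" for X using hom by (auto simp: homeomorphism_def intro: continuous_on_subset)
  have mem: "x \<in> D ` X \<longleftrightarrow> D x \<in> X" for x X
  proof
    assume "D x \<in> X" then show "x \<in> D ` X" by (intro image_eqI[of _ _ "D x"]) auto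
  qed auto
  have "D ` S = tile (-1) 2 \<union> uminus ` tile (-1) 2"
  proof (rule C.S_unique)
    show "compact (D ` S)" using E.S_compact cD compact_continuous_image unfolding S_def by blast
    show "D ` S \<noteq> {}" using E.S_ne unfolding S_def by blast
    fix x
    have e: "gmap 1 2 (D x) - lv k 0 = - D (gmap (-1) 2 x - lv (1 - k) 0)" for k
      by (simp add: gmap_def D_def lv_def prod_eq_iff field_simps)
    have sym: "- y \<in> S \<longleftrightarrow> y \<in> S" for y using E.S_sym[of y] E.S_sym[of "- y"] unfolding S_def by auto
    have k: "{0..2-1::int} = {0,1}" by auto
    have "x \<in> D ` S \<longleftrightarrow> (\<exists>k\<in>{0..2-1}. gmap 1 2 (D x) - lv k 0 \<in> S)" unfolding mem S_def by (rule E.S_rec)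
    also have "\<dots> \<longleftrightarrow> (\<exists>k\<in>{0..2-1}. D (gmap (-1) 2 x - lv (1-k) 0) \<in> S)" unfolding e sym ..
    also have "\<dots> \<longleftrightarrow> (\<exists>k\<in>{0..2-1}. gmap (-1) 2 x - lv k 0 \<in> D ` S)" unfolding k mem by auto
    finally show "x \<in> D ` S \<longleftrightarrow> (\<exists>k\<in>{0..2-1}. gmap (-1) 2 x - lv k 0 \<in> D ` S)" .
  qed
  moreover have "S homeomorphic D ` S" using homeomorphism_of_subsets[OF hom, of S] unfolding homeomorphic_def by blast
  moreover have "disk_like S"
    using disk_like_homeomorphic[OF homeomorphic_sym[THEN iffD1, OF E.T_homeomorphic_S[OF refl]]] disk_like_tile_1[of 2] unfolding S_def by simp
  ultimately have "disk_like (tile (-1) 2 \<union> uminus ` tile (-1) 2)"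
    using disk_like_homeomorphic homeomorphic_sym by metis
  then show ?thesis using C.T_homeomorphic_S disk_like_homeomorphic by blast
qed

lemma disk_like_tile_2_2: "disk_like (tile 2 2)"
proof -
  obtain N lam c0 c1 where "tile_gauge N lam c0 c1 2 2" using tile_gauge_exists[of 2 2] by auto
  from tile_crystile(1)[OF this] interpret crystile N lam c0 c1 2 2 "tile 2 2 \<union> uminus ` tile 2 2" "tile 2 2" .
  interpret lattice_A22 N lam c0 c1 "tile 2 2 \<union> uminus ` tile 2 2" "tile 2 2" by unfold_locales
  show ?thesis using T_homeomorphic_S disk_like_homeomorphic disk_like_S by blast
qed

lemma not_disk_like_tile: assumes "2 \<le> A" "3 \<le> B" "2 * A < B + 3" shows "\<not> disk_like (tile A B)"
proof -
  \<comment> \<open>If A \<ge> B - 1, then 2A < B + 3 leaves A \<le> 3, and A^2 \<le> 9 < 12 \<le>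
    4B puts the matrix in the case of complex eigenvalues.\<close>
  have "\<bar>A\<bar> \<le> B - 2 \<or> A * A < 4 * B"
  proof (cases "A \<le> B - 2")
    case True then show ?thesis using assms by simp
  next
    case False
    then have "A \<le> 3" using assms by linarith
    then have "A * A \<le> 3 * 3" using assms by (intro mult_mono) auto
    then show ?thesis using assms by linarith
  qed
  then obtain N lam c0 c1 where "tile_gauge N lam c0 c1 A B" using tile_gauge_exists[of B A] assms by auto
  from tile_crystile(1)[OF this] interpret crystile N lam c0 c1 A B "tile A B \<union> uminus ` tile A B" "tile A B" .
  interpret nondisk_tile N lam c0 c1 A B "tile A B \<union> uminus ` tile A B" "tile A B" by unfold_locales fact+
  show ?thesis by (rule not_disk_like)
qed

theorem theorem5p3:
  fixes A B :: int
  assumes "-1 \<le> A" and "A \<le> B" and "B \<ge> 2" and "2 * A < B + 3"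
  shows "((A \<in> {-1, 0, 1} \<and> B \<ge> 2) \<or> (A = 2 \<and> B = 2) \<longrightarrow> disk_like (tile A B))
       \<and> (A \<ge> 2 \<and> B \<ge> 3 \<longrightarrow> \<not> disk_like (tile A B))"
proof (intro conjI impI)
  assume "(A \<in> {-1, 0, 1} \<and> B \<ge> 2) \<or> (A = 2 \<and> B = 2)"
  then consider "A = -1" "B = 2" | "A = -1" "3 \<le> B" | "A = 0" "B = 2" | "A = 0" "3 \<le> B" | "A = 1" | "A = 2" "B = 2"
    using assms(3) by force
  then show "disk_like (tile A B)"
    by cases (use assms(3) disk_like_tile_minus1_2 disk_like_tile_minus1 disk_like_tile_0_2 disk_like_tile_0
      disk_like_tile_1 disk_like_tile_2_2 in simp_all)
next
  assume "A \<ge> 2 \<and> B \<ge> 3"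
  then show "\<not> disk_like (tile A B)" using not_disk_like_tile assms(4) by blast
qed

end
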